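(* Let $n\ge 1$ and let $\vec u(t)=(u(t),\dot u(t))$ be a global solution in $\mathcal H$ of the Klein-Gordon equation $$(\partial_t^2-\Delta_x+1)u=N(u,x,t)\,u,\qquad \vec u(0)=(u_0,\dot u_0)\in\mathcal H,$$ on $\mathbb R^n$. Assume that $$E:=\sup_{t\ge 0}\|\vec u(t)\|_{\mathcal H}<\infty$$ and that, for some $\sigma>1$, $$E_u:=\sup_{t\ge 0}\|\langle x\rangle^{\sigma}N(u(t),x,t)u(t)\|_{L^2_x(\mathbb R^n)}<\infty .$$ Let $$\mathscr I_{\mathrm{loc}}:=\{(\alpha,\beta)\in(0,1)\times(0,1):\ \beta<\min\{1-\alpha,\tfrac{\sigma-1}{\sigma}\}\}.$$ Then for every $(\alpha,\beta)\in\mathscr I_{\mathrm{loc}}$ the limit $$\Omega_\alpha^*\vec u(0):=\lim_{t\to\infty}\mathcal F_\alpha(x,p,t)\,U_0(0,t)\,\vec u(t)$$ exists strongly in $\mathcal H$, and it is independent of $(\alpha,\beta)$: $\Omega_\alpha^*\vec u(0)=\Omega_{\alpha'}^*\vec u(0)$ for all $(\alpha,\beta),(\alpha',\beta')\in\mathscr I_{\mathrm{loc}}$.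
   Context: Notation. $\langle x\rangle=\sqrt{1+|x|^2}$; $p=-i\nabla_x$, and functions of $p$ are Fourier multipliers, in particular $\langle p\rangle=\sqrt{1-\Delta_x}$. $\mathcal H=H^1(\mathbb R^n)\times L^2(\mathbb R^n)$ with inner product $(\vec u,\vec v)_{\mathcal H}=(\langle p\rangle u_1,\langle p\rangle v_1)_{L^2}+(u_2,v_2)_{L^2}$. $u(t)=u(\cdot,t)$, $\dot u(t)=\partial_tu(\cdot,t)$. When $N$ depends on $u$, $N(u(t),x,t)$ is regarded as a time-dependent multiplication operator along the given orbit $\{u(t)\}_{t\ge0}$. Free evolution: $U_0(t,0)$ is the solution operator of $(\partial_t^2-\Delta+1)u_0=0$ on $\mathcal H$, i.e. $U_0(t,0)(f,g)=\big(\cos(t\langle p\rangle)f+\tfrac{\sin(t\langle p\rangle)}{\langle p\rangle}g,\ -\sin(t\langle p\rangle)\langle p\rangle f+\cos(t\langle p\rangle)g\big)$, and $U_0(0,t)=U_0(t,0)^{-1}=U_0(-t,0)$. Cut-offs: $F_c,F_1$ are smooth cut-off functions on $\mathbb R$ with $F_j(\lambda)=1$ for $\lambda\ge1$ and $F_j(\lambda)=0$ for $\lambda<1/2$ ($j=c,1$). $F_c(\frac{|x|}{t^\alpha}\le1)$ is multiplication by $1-F_c(|x|/t^\alpha)$; $F_1(t^\beta|p|>1)$ is the Fourier multiplier $F_1(t^\beta|\xi|)$; $F_1(|p|\le t^\beta)$ is the Fourier multiplier $1-F_1(|\xi|/t^\beta)$. For parameters $(\alpha,\beta)$ set $F_\alpha(x,p,t):=F_c(\frac{|x|}{t^\alpha}\le1)\,F_1(t^\beta|p|>1)\,F_1(|p|\le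 t^\beta)$ and $$\mathcal F_\alpha(x,p,t)=\begin{pmatrix}\langle p\rangle^{-1}F_\alpha(x,p,t)\langle p\rangle&0\\0&F_\alpha(x,p,t)\end{pmatrix}.$$ *)

theory Defs
  imports "HOL-Analysis.Analysis"
begin

section \<open>The space $L^2$\<close>

text \<open>Elements of $L^2$ are represented by complex-valued Borel functions. All notions below
  only depend on the almost-everywhere class of the function.\<close>

definition L2 :: "('a::euclidean_space \<Rightarrow> complex) set" where
  "L2 = {f \<in> borel_measurable lborel. integrable lborel (\<lambda>x. (cmod (f x))\<^sup>2)}"

definition L2_inner :: "('a::euclidean_space \<Rightarrow> complex) \<Rightarrow> ('a \<Rightarrow> complex) \<Rightarrow> complex" where
  "L2_inner f g = (LINT x|lborel. f x * cnj (g x))"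

definition L2_norm :: "('a::euclidean_space \<Rightarrow> complex) \<Rightarrow> real" where
  "L2_norm f = sqrt (LINT x|lborel. (cmod (f x))\<^sup>2)"

text \<open>Since the integral of a non-integrable function is 0 by convention, norm
  convergence is always accompanied by explicit membership.\<close>

definition L2_tendsto ::
    "('b \<Rightarrow> 'a::euclidean_space \<Rightarrow> complex) \<Rightarrow> ('a \<Rightarrow> complex) \<Rightarrow> 'b filter \<Rightarrow> bool" where
  "L2_tendsto X f F \<longleftrightarrow> f \<in> L2 \<and> (\<forall>\<^sub>F s in F. X s \<in> L2) \<and>
     ((\<lambda>s. L2_norm (\<lambda>x. X s x - f x)) \<longlongrightarrow> 0) F"

section \<open>Fourier transform and Fourier multipliers\<close>

definition fourier_trunc ::
    "real \<Rightarrow> ('a::euclidean_space \<Rightarrow> complex) \<Rightarrow> 'a \<Rightarrow> complex" where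
  "fourier_trunc R f \<xi> = complex_of_real ((2 * pi) powr (- real DIM('a) / 2)) *
     (LINT x:cball 0 R|lborel. exp (- (\<i> * complex_of_real (x \<bullet> \<xi>))) * f x)"

text \<open>The unitary (Plancherel) Fourier transform on $L^2$: the $L^2$-limit of the truncated
  Fourier integrals, determined up to a null set.\<close>

definition fourier :: "('a::euclidean_space \<Rightarrow> complex) \<Rightarrow> 'a \<Rightarrow> complex" where
  "fourier f = (SOME g. L2_tendsto (\<lambda>R. fourier_trunc R f) g at_top)"

definition inv_fourier :: "('a::euclidean_space \<Rightarrow> complex) \<Rightarrow> 'a \<Rightarrow> complex" where
  "inv_fourier g = (\<lambda>x. fourier g (- x))"

text \<open>\<open>multiplier m f\<close> is $m(p) f$ with $p = -i\nabla$, meaningful for $f \in L^2$ with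
  $m \hat f \in L^2$.\<close>

definition multiplier ::
    "('a::euclidean_space \<Rightarrow> real) \<Rightarrow> ('a \<Rightarrow> complex) \<Rightarrow> 'a \<Rightarrow> complex" where
  "multiplier m f = inv_fourier (\<lambda>\<xi>. complex_of_real (m \<xi>) * fourier f \<xi>)"

definition japanese :: "'a::euclidean_space \<Rightarrow> real" where
  "japanese x = sqrt (1 + (norm x)\<^sup>2)"

section \<open>The energy space\<close>

definition H1 :: "('a::euclidean_space \<Rightarrow> complex) set" where
  "H1 = {f \<in> L2. (\<lambda>\<xi>. complex_of_real (japanese \<xi>) * fourier f \<xi>) \<in> L2}"

type_synonym 'a state = "('a \<Rightarrow> complex) \<times> ('a \<Rightarrow> complex)"

definition energy_space :: "'a::euclidean_space state set" where
  "energy_space = H1 \<times> L2"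

definition energy_inner :: "'a::euclidean_space state \<Rightarrow> 'a state \<Rightarrow> complex" where
  "energy_inner u v =
     L2_inner (multiplier japanese (fst u)) (multiplier japanese (fst v)) +
     L2_inner (snd u) (snd v)"

definition energy_norm :: "'a::euclidean_space state \<Rightarrow> real" where
  "energy_norm u = sqrt (Re (energy_inner u u))"

definition energy_eq :: "'a::euclidean_space state \<Rightarrow> 'a state \<Rightarrow> bool" where
  "energy_eq u v \<longleftrightarrow> (AE x in lborel. fst u x = fst v x) \<and> (AE x in lborel. snd u x = snd v x)"

definition energy_tendsto ::
    "('b \<Rightarrow> 'a::euclidean_space state) \<Rightarrow> 'a state \<Rightarrow> 'b filter \<Rightarrow> bool" where
  "energy_tendsto X w F \<longleftrightarrow> w \<in> energy_space \<and> (\<forall>\<^sub>F s in F. X s \<in> energy_space) \<and>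
     ((\<lambda>s. energy_norm (\<lambda>x. fst (X s) x - fst w x, \<lambda>x. snd (X s) x - snd w x)) \<longlongrightarrow> 0) F"

section \<open>Global solutions of the Klein-Gordon equation\<close>

text \<open>\<open>N (u t) x t\<close> is the value at \<open>x\<close> of the multiplication operator along the orbit;
  passing the whole function \<open>u t\<close> covers local and nonlocal dependence on \<open>u\<close>.

  A global solution in the energy space is a continuous curve \<open>(u, v)\<close> in it with $v = \partial_t u$
  (derivative in $L^2$), for which the equation
  $\partial_t v + \langle p\rangle^2 u = N u$ holds in $H^{-1}$, integrated in time: no continuity
  in time of the right-hand side is imposed.\<close>

definition KG_global_solution ::
    "(('a::euclidean_space \<Rightarrow> complex) \<Rightarrow> 'a \<Rightarrow> real \<Rightarrow> complex) \<Rightarrow> 'a state \<Rightarrow>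
     (real \<Rightarrow> 'a \<Rightarrow> complex) \<Rightarrow> (real \<Rightarrow> 'a \<Rightarrow> complex) \<Rightarrow> bool" where
  "KG_global_solution N data u v \<longleftrightarrow>
     (\<forall>t\<ge>0. (u t, v t) \<in> energy_space) \<and>
     energy_eq (u 0, v 0) data \<and>
     (\<forall>t\<ge>0. energy_tendsto (\<lambda>s. (u s, v s)) (u t, v t) (at t within {0..})) \<and>
     (\<forall>t\<ge>0. L2_tendsto (\<lambda>s x. (u s x - u t x) / complex_of_real (s - t)) (v t)
        (at t within {0..})) \<and>
     (\<forall>t\<ge>0. (\<lambda>x. N (u t) x t * u t x) \<in> L2) \<and>
     (\<forall>\<phi>\<in>H1. \<forall>t\<ge>0.
        let rhs = (\<lambda>s. L2_inner (\<lambda>x. N (u s) x s * u s x) \<phi>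
                     - L2_inner (multiplier japanese (u s)) (multiplier japanese \<phi>))
        in set_integrable lborel {0..t} rhs \<and>
           L2_inner (v t) \<phi> - L2_inner (v 0) \<phi> = (LINT s:{0..t}|lborel. rhs s))"

section \<open>Free evolution and the localized wave operator\<close>

text \<open>\<open>free_evol t\<close> is $U_0(t,0)$; hence $U_0(0,t)$ is \<open>free_evol (- t)\<close>.\<close>

definition free_evol :: "real \<Rightarrow> 'a::euclidean_space state \<Rightarrow> 'a state" where
  "free_evol t w =
     (\<lambda>x. multiplier (\<lambda>\<xi>. cos (t * japanese \<xi>)) (fst w) x
        + multiplier (\<lambda>\<xi>. sin (t * japanese \<xi>) / japanese \<xi>) (snd w) x,
      \<lambda>x. multiplier (\<lambda>\<xi>. - (sin (t * japanese \<xi>) * japanese \<xi>)) (fst w) x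
        + multiplier (\<lambda>\<xi>. cos (t * japanese \<xi>)) (snd w) x)"

definition smooth_cutoff :: "(real \<Rightarrow> real) \<Rightarrow> bool" where
  "smooth_cutoff F \<longleftrightarrow> (\<forall>k. (deriv ^^ k) F differentiable_on UNIV) \<and>
     (\<forall>r\<ge>1. F r = 1) \<and> (\<forall>r<1/2. F r = 0)"

definition F_loc :: "(real \<Rightarrow> real) \<Rightarrow> (real \<Rightarrow> real) \<Rightarrow> real \<Rightarrow> real \<Rightarrow> real \<Rightarrow>
    ('a::euclidean_space \<Rightarrow> complex) \<Rightarrow> 'a \<Rightarrow> complex" where
  "F_loc Fc F1 \<alpha> \<beta> t f = (\<lambda>x. complex_of_real (1 - Fc (norm x / t powr \<alpha>)) *
     multiplier (\<lambda>\<xi>. F1 (t powr \<beta> * norm \<xi>))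
       (multiplier (\<lambda>\<xi>. 1 - F1 (norm \<xi> / t powr \<beta>)) f) x)"

definition F_loc_mat :: "(real \<Rightarrow> real) \<Rightarrow> (real \<Rightarrow> real) \<Rightarrow> real \<Rightarrow> real \<Rightarrow> real \<Rightarrow>
    'a::euclidean_space state \<Rightarrow> 'a state" where
  "F_loc_mat Fc F1 \<alpha> \<beta> t w =
     (multiplier (\<lambda>\<xi>. 1 / japanese \<xi>) (F_loc Fc F1 \<alpha> \<beta> t (multiplier japanese (fst w))),
      F_loc Fc F1 \<alpha> \<beta> t (snd w))"

definition I_loc :: "real \<Rightarrow> (real \<times> real) set" where
  "I_loc \<sigma> = {(\<alpha>, \<beta>). \<alpha> \<in> {0<..<1} \<and> \<beta> \<in> {0<..<1} \<and> \<beta> < min (1 - \<alpha>) ((\<sigma> - 1) / \<sigma>)}"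

text \<open>\<open>w\<close> is the strong limit $\Omega_\alpha^* \vec u(0)$ along the orbit \<open>(u, v)\<close>.\<close>

definition is_Omega_star :: "(real \<Rightarrow> real) \<Rightarrow> (real \<Rightarrow> real) \<Rightarrow> real \<Rightarrow> real \<Rightarrow>
    (real \<Rightarrow> 'a::euclidean_space \<Rightarrow> complex) \<Rightarrow> (real \<Rightarrow> 'a \<Rightarrow> complex) \<Rightarrow> 'a state \<Rightarrow> bool" where
  "is_Omega_star Fc F1 \<alpha> \<beta> u v w \<longleftrightarrow>
     energy_tendsto (\<lambda>t. F_loc_mat Fc F1 \<alpha> \<beta> t (free_evol (- t) (u t, v t))) w at_top"

end

(* On the Fourier side the half waves of the profile U_0(0,t) u(t) are
     e^{i omega t <xi>} (<xi> u^ + i omega v^),  omega = 1, -1,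
   and by Duhamel's formula their increments over [t,t'] are time integrals of
   e^{i omega s <xi>} (N u)^(s), t <= s <= t'.  Against the localization to |x| <= t^alpha and
   t^{-beta} <= |p| <= t^beta such an integrand is O(s^{-kappa}) with kappa > 1: the part of N u in
   |x| > s^{1 - epsilon - gamma} is small by the weight <x>^sigma with sigma > 1, the rest by a
   kernel estimate, since waves of frequency at least t^{-gamma} have left that region at time s.
   The kernel is estimated by rotating the frequency variable xi -> c xi into the complex domain.
   This needs cutoffs that are holomorphic in |xi|^2, and only uniform closeness to the given ones
   matters, so Weierstrass' theorem in the variable exp(-|xi|^2) supplies them.  If beta >= 1/2, the
   frequencies below t^{-gamma}, where alpha < gamma < 1/2, are removed first: composed with the
   restriction to |x| <= t^alpha, the projection onto them tends to 0 in operator norm.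

   Hence the localized increments tend to 0 uniformly in t' >= t.  Since the localizations tend
   strongly to the identity, the half waves converge weakly, and the localized half waves converge
   strongly to this weak limit, which does not depend on (alpha, beta). *)

theory Submission
  imports Defs "HOL-Probability.Probability" "HOL-Complex_Analysis.Complex_Analysis"
begin

section \<open>The Hilbert space $L^2$\<close>

text \<open>The exponents encode one picture. A wave of frequency t^{-\<gamma>} has speed about
  t^{-\<gamma>} and at time s has travelled about s t^{-\<gamma>}. This must exceed the observed
  radius t^\<alpha>, which asks for \<alpha> + \<gamma> < 1, and the uncertainty scale t^\<gamma>,
  which asks for \<gamma> < 1/2; and the part of N u beyond that distance, of size
  s^{-\<sigma>(1-\<gamma>)}, must be integrable in time. For \<gamma> = \<beta> the set
  \<open>I_loc\<close> gives the first and third conditions but not the second, hence the auxiliary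
  \<gamma>: if \<beta> >= 1/2, then \<alpha> < 1 - \<beta> <= 1/2 leaves room for it. Rotating all
  radii by one complex number takes the place of repeated integration by parts. Decay of any order
  comes from the order K to which the low-frequency cutoff vanishes at 0, and K is chosen large
  against crude losses that are powers of s. The equation holds only when tested against fixed
  functions, and N u need not be continuous in time. The increments are therefore estimated as
  pairings with adjoint localizations, uniformly over test functions of bounded norm.\<close>

lemma L2_measurable: "f \<in> L2 \<Longrightarrow> f \<in> borel_measurable borel"
  by (simp add: L2_def)

lemma borel_measurable_cnj [measurable (raw)]:
  "f \<in> borel_measurable M \<Longrightarrow> (\<lambda>x. cnj (f x)) \<in> borel_measurable M"
  by (rule borel_measurable_continuous_on[of cnj]) (auto intro!: continuous_intros)

lemma L2_integrable_sq: "f \<in> L2 \<Longrightarrow> integrable lborel (\<lambda>x. (cmod (f x))\<^sup>2)"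
  by (simp add: L2_def)

lemma L2I: "f \<in> borel_measurable borel \<Longrightarrow> integrable lborel (\<lambda>x. (cmod (f x))\<^sup>2) \<Longrightarrow> f \<in> L2"
  by (simp add: L2_def)

lemma L2_bound:
  assumes "f \<in> L2" "g \<in> borel_measurable borel" "\<And>x. cmod (g x) \<le> C * cmod (f x)"
  shows "g \<in> L2"
proof (rule L2I)
  note [measurable] = assms(2)
  show "integrable lborel (\<lambda>x. (cmod (g x))\<^sup>2)"
  proof (rule Bochner_Integration.integrable_bound)
    show "integrable lborel (\<lambda>x. C\<^sup>2 * (cmod (f x))\<^sup>2)"
      using L2_integrable_sq[OF assms(1)] by simp
    show "AE x in lborel. norm ((cmod (g x))\<^sup>2) \<le> norm (C\<^sup>2 * (cmod (f x))\<^sup>2)"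
      using power_mono[OF assms(3), of _ 2] by (auto simp: power_mult_distrib)
  qed measurable
qed fact

lemma L2_mult_bounded:
  assumes "f \<in> L2" "m \<in> borel_measurable borel" "\<And>x. cmod (m x) \<le> C"
  shows "(\<lambda>x. m x * f x) \<in> L2"
proof (rule L2_bound[OF assms(1)])
  show "(\<lambda>x. m x * f x) \<in> borel_measurable borel"
    using assms(2) L2_measurable[OF assms(1)] by measurable
qed (auto simp: norm_mult intro!: mult_right_mono assms)

lemma L2_scale: "f \<in> L2 \<Longrightarrow> (\<lambda>x. c * f x) \<in> L2"
  by (rule L2_mult_bounded[where C="cmod c"]) auto

lemma L2_uminus: "f \<in> L2 \<Longrightarrow> (\<lambda>x. - f x) \<in> L2"
  using L2_scale[of f "-1"] by simp

lemma L2_zero [simp]: "(\<lambda>x. 0) \<in> L2"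
  by (simp add: L2_def)

lemma L2_add:
  assumes "f \<in> L2" "g \<in> L2"
  shows "(\<lambda>x. f x + g x) \<in> L2"
proof (rule L2I)
  note [measurable] = L2_measurable[OF assms(1)] L2_measurable[OF assms(2)]
  show "(\<lambda>x. f x + g x) \<in> borel_measurable borel" by measurable
  show "integrable lborel (\<lambda>x. (cmod (f x + g x))\<^sup>2)"
  proof (rule Bochner_Integration.integrable_bound)
    show "integrable lborel (\<lambda>x. 2 * (cmod (f x))\<^sup>2 + 2 * (cmod (g x))\<^sup>2)"
      using assms by (auto dest!: L2_integrable_sq)
    have "(cmod (f x + g x))\<^sup>2 \<le> 2 * (cmod (f x))\<^sup>2 + 2 * (cmod (g x))\<^sup>2" for x
    proof -
      have "(cmod (f x + g x))\<^sup>2 \<le> (cmod (f x) + cmod (g x))\<^sup>2"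
        by (intro power_mono norm_triangle_ineq) auto
      also have "\<dots> \<le> 2 * (cmod (f x))\<^sup>2 + 2 * (cmod (g x))\<^sup>2"
        using sum_squares_bound[of "cmod (f x)" "cmod (g x)"] by (simp add: power2_sum)
      finally show ?thesis .
    qed
    then show "AE x in lborel. norm ((cmod (f x + g x))\<^sup>2)
        \<le> norm (2 * (cmod (f x))\<^sup>2 + 2 * (cmod (g x))\<^sup>2)" by auto
  qed measurable
qed

lemma L2_diff: "f \<in> L2 \<Longrightarrow> g \<in> L2 \<Longrightarrow> (\<lambda>x. f x - g x) \<in> L2"
  using L2_add[OF _ L2_uminus] by fastforce

lemma L2_cong_AE:
  assumes "f \<in> L2" "g \<in> borel_measurable borel" "AE x in lborel. f x = g x"
  shows "g \<in> L2"
proof (rule L2I)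
  note [measurable] = L2_measurable[OF assms(1)] assms(2)
  show "integrable lborel (\<lambda>x. (cmod (g x))\<^sup>2)"
    by (rule integrable_cong_AE_imp[OF L2_integrable_sq[OF assms(1)]]) (use assms(3) in auto)
qed fact

lemma L2_norm_nonneg [simp]: "0 \<le> L2_norm f"
  by (simp add: L2_norm_def)

lemma L2_norm_sq: "(L2_norm f)\<^sup>2 = (LINT x|lborel. (cmod (f x))\<^sup>2)"
  by (simp add: L2_norm_def)

lemma L2_norm_zero [simp]: "L2_norm (\<lambda>x. 0) = 0"
  by (simp add: L2_norm_def)

lemma L2_norm_cong_AE:
  assumes [measurable]: "f \<in> borel_measurable borel" "g \<in> borel_measurable borel"
    and "AE x in lborel. f x = g x"
  shows "L2_norm f = L2_norm g"
  unfolding L2_norm_def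
  by (intro arg_cong[where f=sqrt] integral_cong_AE) (use assms(3) in auto)

lemma L2_norm_eq_0:
  assumes "f \<in> L2" shows "L2_norm f = 0 \<longleftrightarrow> (AE x in lborel. f x = 0)"
  unfolding L2_norm_def using integral_nonneg_eq_0_iff_AE[OF L2_integrable_sq[OF assms]] by simp

lemma L2_norm_scale: "L2_norm (\<lambda>x. c * f x) = cmod c * L2_norm f"
  unfolding L2_norm_def by (simp add: norm_mult power_mult_distrib real_sqrt_mult)

lemma L2_norm_uminus: "L2_norm (\<lambda>x. - f x) = L2_norm f"
  unfolding L2_norm_def by simp

lemma L2_norm_minus_commute: "L2_norm (\<lambda>x. f x - g x) = L2_norm (\<lambda>x. g x - f x)"
  unfolding L2_norm_def by (simp add: norm_minus_commute)

lemma L2_norm_mono: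
  assumes "f \<in> L2" "g \<in> borel_measurable borel" "\<And>x. cmod (g x) \<le> C * cmod (f x)" "C \<ge> 0"
  shows "L2_norm g \<le> C * L2_norm f"
proof -
  have "(L2_norm g)\<^sup>2 \<le> (LINT x|lborel. C\<^sup>2 * (cmod (f x))\<^sup>2)"
    unfolding L2_norm_sq
  proof (rule integral_mono)
    show "integrable lborel (\<lambda>x. (cmod (g x))\<^sup>2)"
      by (rule L2_integrable_sq[OF L2_bound[OF assms(1-3)]])
    show "integrable lborel (\<lambda>x. C\<^sup>2 * (cmod (f x))\<^sup>2)"
      using L2_integrable_sq[OF assms(1)] by simp
    show "(cmod (g x))\<^sup>2 \<le> C\<^sup>2 * (cmod (f x))\<^sup>2" for x
      using power_mono[OF assms(3), of x 2] by (auto simp: power_mult_distrib)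
  qed
  also have "\<dots> = (C * L2_norm f)\<^sup>2"
    by (simp add: power_mult_distrib L2_norm_sq)
  finally show ?thesis
    by (rule power2_le_imp_le) (use assms(4) in simp)
qed

lemma L2_norm_mult_bounded:
  assumes "f \<in> L2" "m \<in> borel_measurable borel" "\<And>x. cmod (m x) \<le> C"
  shows "L2_norm (\<lambda>x. m x * f x) \<le> C * L2_norm f"
proof (rule L2_norm_mono[OF assms(1)])
  show "(\<lambda>x. m x * f x) \<in> borel_measurable borel"
    using assms(2) L2_measurable[OF assms(1)] by measurable
  show "0 \<le> C" using assms(3)[of undefined] norm_ge_zero[of "m undefined"] by linarith
qed (auto simp: norm_mult intro!: mult_right_mono assms)

section \<open>Cauchy-Schwarz, the inner product and duality\<close>

lemma L2_integrable_norm_mult: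
  assumes "f \<in> L2" "g \<in> L2"
  shows "integrable lborel (\<lambda>x. cmod (f x) * cmod (g x))"
proof (rule Bochner_Integration.integrable_bound)
  note [measurable] = L2_measurable[OF assms(1)] L2_measurable[OF assms(2)]
  show "integrable lborel (\<lambda>x. (cmod (f x))\<^sup>2 + (cmod (g x))\<^sup>2)"
    using assms by (auto dest!: L2_integrable_sq)
  have "\<bar>cmod (f x) * cmod (g x)\<bar> \<le> (cmod (f x))\<^sup>2 + (cmod (g x))\<^sup>2" for x
    using sum_squares_bound[of "cmod (f x)" "cmod (g x)"]
      mult_nonneg_nonneg[OF norm_ge_zero[of "f x"] norm_ge_zero[of "g x"]]
    unfolding abs_mult abs_norm_cancel by linarith
  then show "AE x in lborel. norm (cmod (f x) * cmod (g x)) \<le> norm ((cmod (f x))\<^sup>2 + (cmod (g x))\<^sup>2)"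
    by auto
qed (use assms[THEN L2_measurable] in measurable)

lemma L2_integrable_mult_cnj:
  assumes "f \<in> L2" "g \<in> L2"
  shows "integrable lborel (\<lambda>x. f x * cnj (g x))"
  by (rule Bochner_Integration.integrable_bound[OF L2_integrable_norm_mult[OF assms]])
    (use assms[THEN L2_measurable] in \<open>auto simp: norm_mult\<close>)

text \<open>Weighted arithmetic-geometric mean inequality: with A and B the two norms, |f||g| <=
  (B/2A)|f|^2 + (A/2B)|g|^2, and these weights make the integrated bound exactly A B. Vanishing
  norms are split off because the weights divide by them.\<close>

lemma L2_Cauchy_Schwarz_norm:
  assumes "f \<in> L2" "g \<in> L2"
  shows "(LINT x|lborel. cmod (f x) * cmod (g x)) \<le> L2_norm f * L2_norm g"
proof (cases "L2_norm f = 0 \<or> L2_norm g = 0")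
  case True
  then have "AE x in lborel. cmod (f x) * cmod (g x) = 0"
    using assms by (auto simp: L2_norm_eq_0)
  then show ?thesis using True by (simp add: integral_eq_zero_AE)
next
  case False
  define A where "A = L2_norm f"
  define B where "B = L2_norm g"
  have pos: "A > 0" "B > 0" using False unfolding A_def B_def by (auto simp: less_le)
  have "(LINT x|lborel. cmod (f x) * cmod (g x)) \<le>
      (LINT x|lborel. (B / (2 * A)) * (cmod (f x))\<^sup>2 + (A / (2 * B)) * (cmod (g x))\<^sup>2)"
  proof (rule integral_mono)
    show "integrable lborel (\<lambda>x. cmod (f x) * cmod (g x))"
      by (rule L2_integrable_norm_mult[OF assms])
    show "integrable lborel (\<lambda>x. (B / (2 * A)) * (cmod (f x))\<^sup>2 + (A / (2 * B)) * (cmod (g x))\<^sup>2)"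
      using assms[THEN L2_integrable_sq] by simp
    show "cmod (f x) * cmod (g x) \<le> (B / (2 * A)) * (cmod (f x))\<^sup>2 + (A / (2 * B)) * (cmod (g x))\<^sup>2" for x
      using sum_squares_bound[of "B * cmod (f x)" "A * cmod (g x)"] pos
      by (simp add: field_simps power2_eq_square)
  qed
  also have "\<dots> = (B / (2 * A)) * A\<^sup>2 + (A / (2 * B)) * B\<^sup>2"
    using assms[THEN L2_integrable_sq] by (simp add: A_def B_def L2_norm_sq)
  also have "\<dots> = A * B" using pos by (simp add: field_simps power2_eq_square)
  finally show ?thesis by (simp add: A_def B_def)
qed

lemma L2_Cauchy_Schwarz:
  assumes "f \<in> L2" "g \<in> L2"
  shows "cmod (L2_inner f g) \<le> L2_norm f * L2_norm g"
proof -
  have "cmod (L2_inner f g) \<le> (LINT x|lborel. cmod (f x * cnj (g x)))"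
    unfolding L2_inner_def by (rule integral_norm_bound)
  also have "\<dots> = (LINT x|lborel. cmod (f x) * cmod (g x))"
    by (simp add: norm_mult)
  finally show ?thesis using L2_Cauchy_Schwarz_norm[OF assms] by simp
qed

lemma L2_inner_self: "L2_inner f f = complex_of_real ((L2_norm f)\<^sup>2)"
  unfolding L2_inner_def L2_norm_sq complex_norm_square[symmetric] by (rule integral_complex_of_real)

lemma L2_inner_cnj: "L2_inner g f = cnj (L2_inner f g)"
proof -
  have "cnj (L2_inner f g) = (LINT x|lborel. cnj (f x * cnj (g x)))"
    unfolding L2_inner_def by (rule Bochner_Integration.integral_cnj [symmetric])
  then show ?thesis unfolding L2_inner_def by (simp add: mult.commute)
qed

lemma L2_inner_add_left: "f \<in> L2 \<Longrightarrow> g \<in> L2 \<Longrightarrow> h \<in> L2 \<Longrightarrow>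
    L2_inner (\<lambda>x. f x + g x) h = L2_inner f h + L2_inner g h"
  unfolding L2_inner_def by (simp add: distrib_right L2_integrable_mult_cnj)

lemma L2_inner_diff_left: "f \<in> L2 \<Longrightarrow> g \<in> L2 \<Longrightarrow> h \<in> L2 \<Longrightarrow>
    L2_inner (\<lambda>x. f x - g x) h = L2_inner f h - L2_inner g h"
  unfolding L2_inner_def by (simp add: left_diff_distrib L2_integrable_mult_cnj)

lemma L2_inner_add_right: "f \<in> L2 \<Longrightarrow> g \<in> L2 \<Longrightarrow> h \<in> L2 \<Longrightarrow>
    L2_inner h (\<lambda>x. f x + g x) = L2_inner h f + L2_inner h g"
  unfolding L2_inner_def by (simp add: distrib_left L2_integrable_mult_cnj)

lemma L2_inner_diff_right: "f \<in> L2 \<Longrightarrow> g \<in> L2 \<Longrightarrow> h \<in> L2 \<Longrightarrow>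
    L2_inner h (\<lambda>x. f x - g x) = L2_inner h f - L2_inner h g"
  unfolding L2_inner_def by (simp add: right_diff_distrib L2_integrable_mult_cnj)

lemma L2_inner_scale_left: "L2_inner (\<lambda>x. c * f x) h = c * L2_inner f h"
  unfolding L2_inner_def by (simp add: mult.assoc)

lemma L2_inner_scale_right: "L2_inner f (\<lambda>x. c * h x) = cnj c * L2_inner f h"
  unfolding L2_inner_def by (simp add: mult.assoc mult.left_commute)

lemma L2_inner_move: "L2_inner (\<lambda>x. m x * f x) g = L2_inner f (\<lambda>x. cnj (m x) * g x)"
  unfolding L2_inner_def by (simp add: mult_ac)

lemma L2_inner_cong_AE:
  assumes [measurable]: "f \<in> borel_measurable borel" "g \<in> borel_measurable borel"
      "f' \<in> borel_measurable borel" "g' \<in> borel_measurable borel"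
    and "AE x in lborel. f x = f' x" "AE x in lborel. g x = g' x"
  shows "L2_inner f g = L2_inner f' g'"
  unfolding L2_inner_def by (intro integral_cong_AE) (use assms(5,6) in auto)

lemma L2_norm_add_sq:
  assumes "f \<in> L2" "g \<in> L2"
  shows "(L2_norm (\<lambda>x. f x + g x))\<^sup>2 = (L2_norm f)\<^sup>2 + (L2_norm g)\<^sup>2 + 2 * Re (L2_inner f g)"
proof -
  have "complex_of_real ((L2_norm (\<lambda>x. f x + g x))\<^sup>2) =
      of_real ((L2_norm f)\<^sup>2) + of_real ((L2_norm g)\<^sup>2) + (L2_inner f g + cnj (L2_inner f g))"
    unfolding L2_inner_self[symmetric] L2_inner_cnj[of g f, symmetric]
    using assms by (simp add: L2_inner_add_left L2_inner_add_right L2_add)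
  from arg_cong[OF this, of Re] show ?thesis by simp
qed

lemma L2_norm_diff_sq:
  assumes "f \<in> L2" "g \<in> L2"
  shows "(L2_norm (\<lambda>x. f x - g x))\<^sup>2 = (L2_norm f)\<^sup>2 + (L2_norm g)\<^sup>2 - 2 * Re (L2_inner f g)"
  using L2_norm_add_sq[OF assms(1) L2_uminus[OF assms(2)]] L2_inner_scale_right[of f "-1" g]
  by (simp add: L2_norm_uminus)

lemma L2_norm_triangle:
  assumes "f \<in> L2" "g \<in> L2"
  shows "L2_norm (\<lambda>x. f x + g x) \<le> L2_norm f + L2_norm g"
proof (rule power2_le_imp_le)
  have "Re (L2_inner f g) \<le> L2_norm f * L2_norm g"
    using complex_Re_le_cmod L2_Cauchy_Schwarz[OF assms] order_trans by blast
  then show "(L2_norm (\<lambda>x. f x + g x))\<^sup>2 \<le> (L2_norm f + L2_norm g)\<^sup>2"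
    unfolding L2_norm_add_sq[OF assms] by (simp add: power2_sum)
qed simp

lemma L2_norm_triangle_diff:
  assumes "f \<in> L2" "g \<in> L2"
  shows "L2_norm (\<lambda>x. f x - g x) \<le> L2_norm f + L2_norm g"
  using L2_norm_triangle[OF assms(1) L2_uminus[OF assms(2)]] by (simp add: L2_norm_uminus)

lemma L2_norm_triangle3:
  assumes "f \<in> L2" "g \<in> L2" "h \<in> L2"
  shows "L2_norm (\<lambda>x. f x - h x) \<le> L2_norm (\<lambda>x. f x - g x) + L2_norm (\<lambda>x. g x - h x)"
  using L2_norm_triangle[OF L2_diff[OF assms(1,2)] L2_diff[OF assms(2,3)]] by simp

text \<open>Testing with h = f suffices. Through this lemma estimates of pairings, the only kind the
  weak equation offers, become norm estimates.\<close>

lemma L2_norm_le_dual: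
  assumes "f \<in> L2" "\<And>h. h \<in> L2 \<Longrightarrow> cmod (L2_inner f h) \<le> C * L2_norm h" "C \<ge> 0"
  shows "L2_norm f \<le> C"
proof (cases "L2_norm f = 0")
  case False
  have "(L2_norm f)\<^sup>2 \<le> C * L2_norm f"
    using assms(2)[OF assms(1)] unfolding L2_inner_self norm_of_real by simp
  then show ?thesis using False by (simp add: power2_eq_square less_le)
qed (use assms(3) in simp)

lemma L2_eq_AE_dual:
  assumes "f \<in> L2" "g \<in> L2" "\<And>h. h \<in> L2 \<Longrightarrow> L2_inner f h = L2_inner g h"
  shows "AE x in lborel. f x = g x"
proof -
  have "L2_norm (\<lambda>x. f x - g x) \<le> 0"
    by (rule L2_norm_le_dual) (use assms in \<open>auto simp: L2_diff L2_inner_diff_left\<close>)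
  then have "L2_norm (\<lambda>x. f x - g x) = 0" using L2_norm_nonneg antisym by blast
  then show ?thesis using L2_norm_eq_0[OF L2_diff[OF assms(1,2)]] by simp
qed

section \<open>Completeness\<close>

text \<open>Riesz-Fischer on representatives: a subsequence with increments at most 2^{-k} in norm
  converges almost everywhere, and Fatou's lemma compares its pointwise limit with the whole
  sequence.\<close>

lemma L2_complete:
  fixes f :: "nat \<Rightarrow> 'a::euclidean_space \<Rightarrow> complex"
  assumes L2: "\<And>n. f n \<in> L2"
    and cau: "\<And>e. e > 0 \<Longrightarrow> \<exists>N. \<forall>m\<ge>N. \<forall>n\<ge>N. L2_norm (\<lambda>x. f m x - f n x) < e"
  shows "\<exists>g\<in>L2. (\<lambda>n. L2_norm (\<lambda>x. f n x - g x)) \<longlonglongrightarrow> 0"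
proof -
  note [measurable] = L2_measurable[OF L2]
  have "\<forall>k. \<exists>N. \<forall>m\<ge>N. \<forall>n\<ge>N. L2_norm (\<lambda>x. f m x - f n x) < (1/2)^k"
    using cau by simp
  then obtain N where N: "\<And>k m n. m \<ge> N k \<Longrightarrow> n \<ge> N k \<Longrightarrow> L2_norm (\<lambda>x. f m x - f n x) < (1/2)^k"
    by metis
  \<comment> \<open>Partial sums of the thresholds are monotone and dominate each
    \<open>N k\<close>; the summand \<open>k\<close> gives \<open>r k \<ge> k\<close>, so the
    subsequence runs through arbitrarily late terms.\<close>
  define r where "r k = (\<Sum>j\<le>k. N j) + k" for k
  have rN: "r k \<ge> N k" for k unfolding r_def using member_le_sum[of k "{..k}" N] by simp
  have rmono: "r k \<le> r (Suc k)" for k unfolding r_def by simp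
  have rk: "r k \<ge> k" for k by (simp add: r_def)
  define d where "d k x = f (r (Suc k)) x - f (r k) x" for k x
  have dm [measurable]: "d k \<in> borel_measurable borel" for k unfolding d_def by measurable
  have dL2: "d k \<in> L2" for k unfolding d_def by (intro L2_diff L2)
  have dn: "L2_norm (d k) \<le> (1/2)^k" for k
    unfolding d_def by (intro less_imp_le N rN order_trans[OF rN rmono])
  have nn: "(\<integral>\<^sup>+x. ennreal ((cmod (h x))\<^sup>2) \<partial>lborel) = ennreal ((L2_norm h)\<^sup>2)" if "h \<in> L2" for h :: "'a \<Rightarrow> complex"
    unfolding L2_norm_sq by (rule nn_integral_eq_integral) (use L2_integrable_sq[OF that] in auto)
  have "(\<integral>\<^sup>+x. (\<Sum>k. ennreal (2^k * (cmod (d k x))\<^sup>2)) \<partial>lborel) =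
      (\<Sum>k. (\<integral>\<^sup>+x. ennreal (2^k * (cmod (d k x))\<^sup>2) \<partial>lborel))"
    by (rule nn_integral_suminf) measurable
  also have "\<dots> = (\<Sum>k. ennreal (2^k * (L2_norm (d k))\<^sup>2))"
    by (simp add: ennreal_mult nn_integral_cmult nn dL2)
  also have "\<dots> \<le> (\<Sum>k. ennreal ((1/2)^k))"
  proof (intro suminf_le ennreal_leI)
    fix k
    have "(2::real)^k * (L2_norm (d k))\<^sup>2 \<le> 2^k * ((1/2)^k)\<^sup>2"
      using dn by (intro mult_left_mono power_mono) auto
    also have "\<dots> = (1/2)^k" by (simp add: power2_eq_square power_mult_distrib[symmetric] flip: power_add)
    finally show "(2::real)^k * (L2_norm (d k))\<^sup>2 \<le> (1/2)^k" .
  qed auto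
  also have "\<dots> = ennreal (\<Sum>k. (1/2)^k)"
    by (rule suminf_ennreal2) (auto intro!: summable_geometric)
  also have "\<dots> < \<infinity>" by simp
  finally have fin: "(\<integral>\<^sup>+x. (\<Sum>k. ennreal (2^k * (cmod (d k x))\<^sup>2)) \<partial>lborel) < \<infinity>" .
  \<comment> \<open>The weight 2^k is affordable because the squared norms decay like 4^{-k}, and
    finiteness of the weighted sum at a point forces |d_k(x)| <= sqrt S 2^{-k/2}, which is
    summable.\<close>
  have "AE x in lborel. (\<Sum>k. ennreal (2^k * (cmod (d k x))\<^sup>2)) \<noteq> \<infinity>"
    by (rule nn_integral_PInf_AE) (use fin in auto)
  then have conv: "AE x in lborel. convergent (\<lambda>k. f (r k) x)"
  proof (rule AE_mp, intro AE_I2 impI)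
    fix x assume elim: "(\<Sum>k. ennreal (2^k * (cmod (d k x))\<^sup>2)) \<noteq> \<infinity>"
    define a where "a k = 2^k * (cmod (d k x))\<^sup>2" for k
    obtain S where S0: "S \<ge> 0" "(\<Sum>k. ennreal (a k)) = ennreal S"
      using elim unfolding a_def[symmetric]
      by (cases "\<Sum>k. ennreal (a k)") auto
    have S: "2^k * (cmod (d k x))\<^sup>2 \<le> S" for k
    proof -
      have "sum (\<lambda>k. ennreal (a k)) {k} \<le> (\<Sum>k. ennreal (a k))"
        by (rule sum_le_suminf) auto
      then have "ennreal (a k) \<le> ennreal S" unfolding S0(2) by simp
      then show ?thesis using S0(1) by (simp add: a_def)
    qed
    have le: "cmod (d k x) \<le> sqrt S * (sqrt (1/2))^k" for k
    proof -
      have "(cmod (d k x))\<^sup>2 \<le> S * (1/2)^k"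
        using S[of k] by (simp add: field_simps power_one_over)
      then have "cmod (d k x) \<le> sqrt (S * (1/2)^k)" by (rule real_le_rsqrt)
      then show ?thesis by (simp add: real_sqrt_mult real_sqrt_power)
    qed
    have "summable (\<lambda>k. sqrt S * (sqrt (1/2))^k)"
      by (rule summable_mult, rule summable_geometric) simp
    then have "summable (\<lambda>k. d k x)"
      by (rule summable_comparison_test'[where N=0]) (rule le)
    then have "convergent (\<lambda>n. \<Sum>k<n. d k x)" by (simp add: summable_iff_convergent)
    moreover have "(\<Sum>k<n. d k x) = f (r n) x - f (r 0) x" for n
      unfolding d_def by (rule sum_lessThan_telescope)
    ultimately have "convergent (\<lambda>n. f (r n) x - f (r 0) x)" by simp
    from convergent_add[OF this convergent_const[of "f (r 0) x"]]
    show "convergent (\<lambda>k. f (r k) x)" by simp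
  qed
  define g where "g x = lim (\<lambda>k. f (r k) x)" for x
  have gm [measurable]: "g \<in> borel_measurable borel"
    unfolding g_def by (rule borel_measurable_lim_metric) measurable
  have lim: "AE x in lborel. (\<lambda>k. f (r k) x) \<longlonglongrightarrow> g x"
    using conv by eventually_elim (simp add: g_def convergent_LIMSEQ_iff)
  \<comment> \<open>Fatou along the subsequence with n held fixed. The bound carries over to g
    although no integrability of g - f_n is known yet; the next step reads off that integrability
    from it.\<close>
  have fatou: "(\<integral>\<^sup>+x. ennreal ((cmod (g x - f n x))\<^sup>2) \<partial>lborel) \<le> ennreal (e\<^sup>2)"
    if e: "e > 0" and n: "\<And>m. m \<ge> n \<Longrightarrow> L2_norm (\<lambda>x. f m x - f n x) < e" for n e
  proof -
    have "(\<integral>\<^sup>+x. ennreal ((cmod (g x - f n x))\<^sup>2) \<partial>lborel) =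
        (\<integral>\<^sup>+x. liminf (\<lambda>k. ennreal ((cmod (f (r k) x - f n x))\<^sup>2)) \<partial>lborel)"
    proof (rule nn_integral_cong_AE)
      show "AE x in lborel. ennreal ((cmod (g x - f n x))\<^sup>2) = liminf (\<lambda>k. ennreal ((cmod (f (r k) x - f n x))\<^sup>2))"
        using lim
      proof eventually_elim
        case (elim x)
        have "(\<lambda>k. ennreal ((cmod (f (r k) x - f n x))\<^sup>2)) \<longlonglongrightarrow> ennreal ((cmod (g x - f n x))\<^sup>2)"
          by (intro tendsto_intros elim)
        then show ?case using lim_imp_Liminf[OF sequentially_bot] by metis
      qed
    qed
    also have "\<dots> \<le> liminf (\<lambda>k. (\<integral>\<^sup>+x. ennreal ((cmod (f (r k) x - f n x))\<^sup>2) \<partial>lborel))"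
      by (rule nn_integral_liminf) measurable
    also have "\<dots> \<le> limsup (\<lambda>k. (\<integral>\<^sup>+x. ennreal ((cmod (f (r k) x - f n x))\<^sup>2) \<partial>lborel))"
      by (rule Liminf_le_Limsup) simp
    also have "\<dots> \<le> ennreal (e\<^sup>2)"
    proof (rule Limsup_bounded)
      show "\<forall>\<^sub>F k in sequentially. (\<integral>\<^sup>+x. ennreal ((cmod (f (r k) x - f n x))\<^sup>2) \<partial>lborel) \<le> ennreal (e\<^sup>2)"
        using eventually_ge_at_top[of n]
      proof eventually_elim
        case (elim k)
        have "L2_norm (\<lambda>x. f (r k) x - f n x) \<le> e"
          by (rule less_imp_le[OF n]) (use elim rk[of k] in linarith)
        then have "(L2_norm (\<lambda>x. f (r k) x - f n x))\<^sup>2 \<le> e\<^sup>2" by (rule power_mono) simp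
        then show ?case by (subst nn[OF L2_diff[OF L2 L2]]) (rule ennreal_leI)
      qed
    qed
    finally show ?thesis .
  qed
  have diffL2: "(\<lambda>x. g x - f n x) \<in> L2 \<and> L2_norm (\<lambda>x. g x - f n x) \<le> e"
    if e: "e > 0" and n: "\<And>m. m \<ge> n \<Longrightarrow> L2_norm (\<lambda>x. f m x - f n x) < e" for n e
  proof -
    have *: "(\<lambda>x. g x - f n x) \<in> L2"
    proof (rule L2I)
      show "integrable lborel (\<lambda>x. (cmod (g x - f n x))\<^sup>2)"
        by (rule integrableI_nonneg) (use le_less_trans[OF fatou[OF that] ennreal_less_top] in simp_all)
    qed measurable
    have "ennreal ((L2_norm (\<lambda>x. g x - f n x))\<^sup>2) \<le> ennreal (e\<^sup>2)"
      using fatou[OF that] nn[OF *] by simp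
    then have "(L2_norm (\<lambda>x. g x - f n x))\<^sup>2 \<le> e\<^sup>2" by simp
    then have "L2_norm (\<lambda>x. g x - f n x) \<le> e" by (rule power2_le_imp_le) (use e in simp)
    with * show ?thesis ..
  qed
  have gL2: "g \<in> L2"
  proof -
    obtain M where "\<forall>m\<ge>M. \<forall>n\<ge>M. L2_norm (\<lambda>x. f m x - f n x) < 1" using cau[of 1] by auto
    then have "(\<lambda>x. g x - f M x) \<in> L2" using diffL2[of 1 M] by simp
    from L2_add[OF this L2[of M]] show ?thesis by simp
  qed
  have "(\<lambda>n. L2_norm (\<lambda>x. f n x - g x)) \<longlonglongrightarrow> 0"
  proof (rule LIMSEQ_I)
    fix e :: real assume e: "e > 0"
    then obtain M where M: "\<forall>m\<ge>M. \<forall>n\<ge>M. L2_norm (\<lambda>x. f m x - f n x) < e/2" using cau[of "e/2"] by auto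
    have "norm (L2_norm (\<lambda>x. f n x - g x) - 0) < e" if "n \<ge> M" for n
      using diffL2[of "e/2" n] M that e L2_norm_minus_commute[of g "f n"] by simp
    then show "\<exists>M. \<forall>n\<ge>M. norm (L2_norm (\<lambda>x. f n x - g x) - 0) < e" by blast
  qed
  with gL2 show ?thesis by blast
qed

section \<open>Gaussian integrals and density in $L^1$\<close>

lemma lborel_integrable_affine:
  fixes f :: "'a::euclidean_space \<Rightarrow> 'b::{banach, second_countable_topology}"
  assumes "integrable lborel f" "c \<noteq> 0"
  shows "integrable lborel (\<lambda>x. f (t + c *\<^sub>R x))"
proof -
  have [measurable]: "f \<in> borel_measurable borel" using assms(1) by (simp add: integrable_iff_bounded)
  have "integrable (density (distr lborel borel (\<lambda>x. t + c *\<^sub>R x)) (\<lambda>_. ennreal (\<bar>c\<bar>^DIM('a)))) f"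
    using assms lborel_affine[OF assms(2), of t] by (simp add: ennreal_power)
  then have "integrable lborel (\<lambda>x. \<bar>c\<bar>^DIM('a) *\<^sub>R f (t + c *\<^sub>R x))"
    by (subst (asm) integrable_density) (auto simp: integrable_distr_eq)
  from integrable_scaleR_right[OF this, of "inverse (\<bar>c\<bar>^DIM('a))"]
  show ?thesis using assms(2) by simp
qed

lemma lborel_integral_affine:
  fixes f :: "'a::euclidean_space \<Rightarrow> 'b::{banach, second_countable_topology}"
  assumes "c \<noteq> 0" and [measurable]: "f \<in> borel_measurable borel"
  shows "(LINT x|lborel. f x) = \<bar>c\<bar>^DIM('a) *\<^sub>R (LINT x|lborel. f (t + c *\<^sub>R x))"
proof -
  have "(LINT x|lborel. f x) = (LINT x|density (distr lborel borel (\<lambda>x. t + c *\<^sub>R x)) (\<lambda>_. ennreal (\<bar>c\<bar>^DIM('a))). f x)"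
    using lborel_affine[OF assms(1), of t] by (simp add: ennreal_power)
  also have "\<dots> = \<bar>c\<bar>^DIM('a) *\<^sub>R (LINT x|lborel. f (t + c *\<^sub>R x))"
    by (subst integral_density) (auto simp: integral_distr)
  finally show ?thesis .
qed

section \<open>Fourier transforms of Gaussians\<close>

text \<open>Lebesgue measure is the image of a product of one-dimensional measures under the
  coordinate map, so Fubini for finite products applies. It reduces the Gaussian integrals to
  dimension one.\<close>

lemma lborel_integral_prod_Basis:
  fixes f :: "'a::euclidean_space \<Rightarrow> real \<Rightarrow> complex"
  assumes "\<And>b. b \<in> Basis \<Longrightarrow> integrable lborel (f b)"
  shows "(LINT x|lborel. (\<Prod>b\<in>Basis. f b (x \<bullet> b))) = (\<Prod>b\<in>Basis. (LINT x|lborel. f b x))"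
    and "integrable lborel (\<lambda>x. (\<Prod>b\<in>Basis. f b (x \<bullet> b)))"
proof -
  interpret product_sigma_finite "\<lambda>_::'a. lborel :: real measure" ..
  have [measurable]: "f b \<in> borel_measurable borel" if "b \<in> Basis" for b
    using assms[OF that] by (simp add: integrable_iff_bounded)
  have m: "(\<lambda>x. (\<Prod>b\<in>Basis. f b (x \<bullet> b))) \<in> borel_measurable borel"
    by (intro borel_measurable_prod) measurable
  have T: "(\<lambda>f. \<Sum>b\<in>Basis. f b *\<^sub>R b) \<in> (\<Pi>\<^sub>M b\<in>(Basis::'a set). lborel) \<rightarrow>\<^sub>M borel"
    by measurable
  have eq: "(\<Prod>b\<in>Basis. f b ((\<Sum>b\<in>Basis. w b *\<^sub>R b) \<bullet> b)) = (\<Prod>b\<in>Basis. f b (w b))" for w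
    by (intro prod.cong refl) simp
  show "(LINT x|lborel. (\<Prod>b\<in>Basis. f b (x \<bullet> b))) = (\<Prod>b\<in>Basis. (LINT x|lborel. f b x))"
    by (subst lborel_eq, subst integral_distr[OF T m])
      (use product_integral_prod[OF finite_Basis assms] eq in simp)
  show "integrable lborel (\<lambda>x. (\<Prod>b\<in>Basis. f b (x \<bullet> b)))"
    by (subst lborel_eq, subst integrable_distr_eq[OF T m])
      (use product_integrable_prod[OF finite_Basis assms] eq in simp)
qed

text \<open>Read off from the characteristic function of the standard normal distribution once the
  factor sqrt(2 pi) of its density is split off.\<close>

lemma std_gaussian_fourier_real:
  shows "integrable lborel (\<lambda>x::real. exp (\<i> * complex_of_real (t * x)) * complex_of_real (exp (- x\<^sup>2 / 2)))"
    and "(LINT x|lborel. exp (\<i> * complex_of_real (t * x)) * complex_of_real (exp (- x\<^sup>2 / 2)))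
        = complex_of_real (sqrt (2 * pi) * exp (- t\<^sup>2 / 2))"
proof -
  have eq: "exp (\<i> * complex_of_real (t * x)) * complex_of_real (exp (- x\<^sup>2 / 2)) =
      complex_of_real (sqrt (2 * pi)) * (std_normal_density x *\<^sub>R iexp (t * x))" for x :: real
    by (simp add: std_normal_density_def scaleR_conv_of_real)
  have int: "integrable lborel (\<lambda>x. std_normal_density x *\<^sub>R iexp (t * x))"
    by (rule Bochner_Integration.integrable_bound[OF integrable_normal_density[where \<mu>=0 and \<sigma>=1]]) auto
  then show "integrable lborel (\<lambda>x::real. exp (\<i> * complex_of_real (t * x)) * complex_of_real (exp (- x\<^sup>2 / 2)))"
    unfolding eq by (rule integrable_mult_right)
  have ch: "(LINT x|lborel. std_normal_density x *\<^sub>R iexp (t * x)) = char std_normal_distribution t"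
    unfolding char_def by (subst integral_density) auto
  then show "(LINT x|lborel. exp (\<i> * complex_of_real (t * x)) * complex_of_real (exp (- x\<^sup>2 / 2)))
        = complex_of_real (sqrt (2 * pi) * exp (- t\<^sup>2 / 2))"
    unfolding eq integral_mult_right_zero ch char_std_normal_distribution by simp
qed

lemma std_gaussian_fourier:
  fixes z :: "'a::euclidean_space"
  shows "integrable lborel (\<lambda>x::'a. exp (\<i> * complex_of_real (z \<bullet> x)) * complex_of_real (exp (- (norm x)\<^sup>2 / 2)))"
    and "(LINT x|lborel. exp (\<i> * complex_of_real (z \<bullet> x)) * complex_of_real (exp (- (norm x)\<^sup>2 / 2)))
        = complex_of_real (sqrt (2 * pi) ^ DIM('a) * exp (- (norm z)\<^sup>2 / 2))"
proof -
  have n2: "(norm x)\<^sup>2 = (\<Sum>b\<in>Basis. (x \<bullet> b)\<^sup>2)" for x :: 'a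
    by (subst power2_norm_eq_inner, subst euclidean_inner) (simp add: power2_eq_square)
  have eq: "exp (\<i> * complex_of_real (z \<bullet> x)) * complex_of_real (exp (- (norm x)\<^sup>2 / 2)) =
      (\<Prod>b\<in>Basis. exp (\<i> * complex_of_real ((z \<bullet> b) * (x \<bullet> b))) * complex_of_real (exp (- (x \<bullet> b)\<^sup>2 / 2)))" for x :: 'a
  proof -
    have "exp (\<i> * complex_of_real (z \<bullet> x)) = (\<Prod>b\<in>Basis. exp (\<i> * complex_of_real ((z \<bullet> b) * (x \<bullet> b))))"
      by (simp add: euclidean_inner[of z x] sum_distrib_left exp_sum)
    moreover have "exp (- (norm x)\<^sup>2 / 2) = (\<Prod>b\<in>Basis. exp (- (x \<bullet> b)\<^sup>2 / 2))"
      by (simp add: n2 exp_sum[symmetric] sum_negf sum_divide_distrib)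
    ultimately show ?thesis by (simp add: prod.distrib)
  qed
  note * = lborel_integral_prod_Basis[where f="\<lambda>b x. exp (\<i> * complex_of_real ((z \<bullet> b) * x)) * complex_of_real (exp (- x\<^sup>2 / 2))",
      OF std_gaussian_fourier_real(1)]
  show "integrable lborel (\<lambda>x::'a. exp (\<i> * complex_of_real (z \<bullet> x)) * complex_of_real (exp (- (norm x)\<^sup>2 / 2)))"
    unfolding eq by (rule *(2))
  show "(LINT x|lborel. exp (\<i> * complex_of_real (z \<bullet> x)) * complex_of_real (exp (- (norm x)\<^sup>2 / 2)))
        = complex_of_real (sqrt (2 * pi) ^ DIM('a) * exp (- (norm z)\<^sup>2 / 2))"
    unfolding eq *(1) std_gaussian_fourier_real(2)
    by (simp add: n2 prod.distrib exp_sum sum_negf sum_divide_distrib flip: of_real_prod)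
      (simp add: sum_negf[symmetric] sum_divide_distrib exp_sum)
qed

lemma gaussian_fourier:
  fixes z :: "'a::euclidean_space"
  assumes a: "a > 0"
  shows "integrable lborel (\<lambda>x::'a. exp (\<i> * complex_of_real (z \<bullet> x)) * complex_of_real (exp (- (a * norm x)\<^sup>2 / 2)))"
    and "(LINT x|lborel. exp (\<i> * complex_of_real (z \<bullet> x)) * complex_of_real (exp (- (a * norm x)\<^sup>2 / 2)))
        = complex_of_real ((sqrt (2 * pi) / a) ^ DIM('a) * exp (- (norm z / a)\<^sup>2 / 2))"
proof -
  let ?f = "\<lambda>x::'a. exp (\<i> * complex_of_real ((z /\<^sub>R a) \<bullet> x)) * complex_of_real (exp (- (norm x)\<^sup>2 / 2))"
  have eq: "?f (0 + a *\<^sub>R x) = exp (\<i> * complex_of_real (z \<bullet> x)) * complex_of_real (exp (- (a * norm x)\<^sup>2 / 2))" for x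
    using a by (simp add: field_simps)
  show "integrable lborel (\<lambda>x::'a. exp (\<i> * complex_of_real (z \<bullet> x)) * complex_of_real (exp (- (a * norm x)\<^sup>2 / 2)))"
    using lborel_integrable_affine[OF std_gaussian_fourier(1)[of "z /\<^sub>R a"], of a 0] a unfolding eq by simp
  have "(LINT x|lborel. ?f x) = \<bar>a\<bar>^DIM('a) *\<^sub>R (LINT x|lborel. ?f (0 + a *\<^sub>R x))"
    by (rule lborel_integral_affine) (use a in auto)
  then show "(LINT x|lborel. exp (\<i> * complex_of_real (z \<bullet> x)) * complex_of_real (exp (- (a * norm x)\<^sup>2 / 2)))
        = complex_of_real ((sqrt (2 * pi) / a) ^ DIM('a) * exp (- (norm z / a)\<^sup>2 / 2))"
    unfolding eq std_gaussian_fourier(2) using a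
    by (simp add: scaleR_conv_of_real field_simps power_divide)
qed

lemma gaussian_integral:
  assumes a: "a > 0"
  shows "integrable lborel (\<lambda>x::'a::euclidean_space. exp (- (a * norm x)\<^sup>2 / 2))"
    and "(LINT x::'a|lborel. exp (- (a * norm x)\<^sup>2 / 2)) = (sqrt (2 * pi) / a) ^ DIM('a)"
proof -
  have "integrable lborel (\<lambda>x::'a. complex_of_real (exp (- (a * norm x)\<^sup>2 / 2)))"
    using gaussian_fourier(1)[OF a, of 0] by simp
  then show "integrable lborel (\<lambda>x::'a. exp (- (a * norm x)\<^sup>2 / 2))"
    unfolding complex_of_real_integrable_eq .
  have "complex_of_real (LINT x::'a|lborel. exp (- (a * norm x)\<^sup>2 / 2)) = complex_of_real ((sqrt (2 * pi) / a) ^ DIM('a))"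
    using gaussian_fourier(2)[OF a, of "0::'a"] by (simp flip: integral_complex_of_real)
  then show "(LINT x::'a|lborel. exp (- (a * norm x)\<^sup>2 / 2)) = (sqrt (2 * pi) / a) ^ DIM('a)"
    unfolding of_real_eq_iff .
qed

lemma integral_norm_diff_triangle:
  fixes f g h :: "'a::euclidean_space \<Rightarrow> complex"
  assumes "integrable lborel f" "integrable lborel g" "integrable lborel h"
  shows "(LINT x|lborel. cmod (f x - h x)) \<le> (LINT x|lborel. cmod (f x - g x)) + (LINT x|lborel. cmod (g x - h x))"
proof -
  have "(LINT x|lborel. cmod (f x - h x)) \<le> (LINT x|lborel. cmod (f x - g x) + cmod (g x - h x))"
  proof (rule integral_mono)
    show "cmod (f x - h x) \<le> cmod (f x - g x) + cmod (g x - h x)" for x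
      using norm_triangle_ineq[of "f x - g x" "g x - h x"] by simp
  qed (use assms in auto)
  also have "\<dots> = (LINT x|lborel. cmod (f x - g x)) + (LINT x|lborel. cmod (g x - h x))"
    using assms by simp
  finally show ?thesis .
qed

lemma integrable_continuous_bounded_support:
  fixes g :: "'a::euclidean_space \<Rightarrow> complex"
  assumes "continuous_on UNIV g" "\<And>x. norm x > R \<Longrightarrow> g x = 0"
  shows "integrable lborel g"
proof -
  have "integrable lborel (\<lambda>x. indicator (cball 0 R) x *\<^sub>R g x)"
    by (rule borel_integrable_compact) (auto intro: continuous_on_subset[OF assms(1)])
  moreover have "indicator (cball 0 R) x *\<^sub>R g x = g x" for x
    using assms(2)[of x] by (auto simp: indicator_def not_le)
  ultimately show ?thesis by simp
qed

section \<open>Approximation by continuous functions of bounded support\<close>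

text \<open>Induction over integrable functions. An indicator of a set A of finite measure is
  reached in three moves, each of L^1 size below e': cut A to a ball, enlarge the result to an open
  set by outer regularity, and replace the indicator of the open set by a continuous function below
  it.\<close>

lemma L1_dense_Cc:
  fixes f :: "'a::euclidean_space \<Rightarrow> complex"
  assumes "integrable lborel f" "e > 0"
  shows "\<exists>g R. continuous_on UNIV g \<and> (\<forall>x. norm x > R \<longrightarrow> g x = 0) \<and> (LINT x|lborel. cmod (f x - g x)) < e"
  using assms
proof (induction f arbitrary: e rule: integrable_induct)
  case (base A c)
  have [measurable]: "A \<in> sets borel" using base by simp
  define C where "C = cmod c + 1"
  have C: "C > 0" "cmod c \<le> C" by (auto simp: C_def add_nonneg_pos)
  define e' where "e' = e / (3 * C)"
  have e': "e' > 0" using base C by (simp add: e'_def)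
  have intA: "integrable lborel (\<lambda>x. indicator A x :: real)" using base by simp
  have "(\<lambda>m::nat. LINT x|lborel. \<bar>indicator A x - indicator (A \<inter> ball 0 (real m)) x\<bar>) \<longlonglongrightarrow> (LINT x::'a|lborel. (0::real))"
  proof (rule integral_dominated_convergence[where w="\<lambda>x. indicator A x :: real"])
    show "AE x in lborel. (\<lambda>m. \<bar>indicator A x - indicator (A \<inter> ball 0 (real m)) x\<bar>) \<longlonglongrightarrow> (0::real)"
    proof (intro AE_I2 tendsto_eventually)
      fix x :: 'a
      obtain m0 :: nat where "norm x < real m0" using reals_Archimedean2 by blast
      then show "\<forall>\<^sub>F m in sequentially. \<bar>indicator A x - indicator (A \<inter> ball 0 (real m)) x\<bar> = (0::real)"
        by (intro eventually_mono[OF eventually_ge_at_top[of m0]]) (auto simp: indicator_def)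
    qed
  qed (use intA in \<open>auto simp: indicator_def\<close>)
  then have "\<forall>\<^sub>F m in sequentially. (LINT x|lborel. \<bar>indicator A x - indicator (A \<inter> ball 0 (real m)) x\<bar>) < e'"
    using e' order_tendstoD(2)[of _ 0 _ e'] by simp
  then obtain m :: nat where m: "(LINT x|lborel. \<bar>indicator A x - indicator (A \<inter> ball 0 (real m)) x\<bar>) < e'"
    by (auto simp: eventually_sequentially)
  define B where "B = A \<inter> ball 0 (real m)"
  have [measurable]: "B \<in> sets borel" by (simp add: B_def)
  obtain U where U: "open U" "B \<subseteq> U" "emeasure lborel (U - B) < e'"
    using outer_regular_lborel[of B e'] e' by auto
  define V where "V = U \<inter> ball 0 (real m)"
  have V: "open V" "B \<subseteq> V" "V \<subseteq> ball 0 (real m)" using U by (auto simp: V_def B_def)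
  have [measurable]: "V \<in> sets borel" using V by simp
  have "emeasure lborel (ball (0::'a) (real m)) < \<infinity>"
    using emeasure_bounded_finite[of "ball (0::'a) (real m)"] by simp
  then have finV: "emeasure lborel V < \<infinity>" "emeasure lborel B < \<infinity>" "emeasure lborel (V - B) < \<infinity>"
    using V emeasure_mono[of V "ball 0 (real m)" lborel] emeasure_mono[of B "ball 0 (real m)" lborel]
      emeasure_mono[of "V - B" "ball 0 (real m)" lborel] by (auto intro: le_less_trans)
  have "(LINT x|lborel. \<bar>indicator B x - indicator V x\<bar>) = (LINT x|lborel. (indicator (V - B) x :: real))"
    by (intro Bochner_Integration.integral_cong refl) (use V in \<open>auto simp: indicator_def\<close>)
  also have "\<dots> = measure lborel (V - B)" by simp
  also have "\<dots> < e'"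
  proof -
    have "emeasure lborel (V - B) \<le> emeasure lborel (U - B)"
      by (rule emeasure_mono) (use U in \<open>auto simp: V_def\<close>)
    then have "emeasure lborel (V - B) < ennreal e'" using U(3) by simp
    then show ?thesis using finV(3) e' by (simp add: emeasure_eq_ennreal_measure ennreal_less_iff)
  qed
  finally have BV: "(LINT x|lborel. \<bar>indicator B x - indicator V x\<bar>) < e'" .
  \<comment> \<open>Multiples of the distance to the complement, capped at 1: continuous, zero off
    the open set V, and equal to 1 from some k on at each point of V.\<close>
  define h where "h k x = min 1 (real k * infdist x (- V))" for k and x :: 'a
  have hc: "continuous_on UNIV (h k)" for k unfolding h_def by (intro continuous_intros)
  have [measurable]: "h k \<in> borel_measurable borel" for k by (rule borel_measurable_continuous_onI[OF hc])
  have h0: "0 \<le> h k x" "h k x \<le> 1" for k x by (auto simp: h_def infdist_nonneg)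
  have hV: "h k x = 0" if "x \<notin> V" for k x using that by (simp add: h_def)
  have hI: "h k x \<le> indicator V x" for k x using h0[where k=k and x=x] hV[where k=k and x=x] by (auto simp: indicator_def)
  have "(\<lambda>k. LINT x|lborel. \<bar>indicator V x - h k x\<bar>) \<longlonglongrightarrow> (LINT x::'a|lborel. (0::real))"
  proof (rule integral_dominated_convergence[where w="\<lambda>x. indicator V x :: real"])
    show "AE x in lborel. (\<lambda>k. \<bar>indicator V x - h k x\<bar>) \<longlonglongrightarrow> (0::real)"
    proof (intro AE_I2 tendsto_eventually)
      fix x :: 'a
      show "\<forall>\<^sub>F k in sequentially. \<bar>indicator V x - h k x\<bar> = (0::real)"
      proof (cases "x \<in> V")
        case True
        \<comment> \<open>By convention \<open>infdist\<close> to the empty set is 0, so positivity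
          of the distance needs a nonempty complement; boundedness of V supplies it.\<close>
        have ne: "- V \<noteq> {}"
          using bounded_subset[OF bounded_ball V(3)] not_bounded_UNIV by (metis Compl_UNIV_eq double_complement)
        have "infdist x (- V) > 0"
          using True V(1) ne in_closed_iff_infdist_zero[of "- V" x] infdist_nonneg[of x "- V"]
          by (auto simp: less_le)
        then obtain k0 :: nat where "1 < real k0 * infdist x (- V)"
          using ex_less_of_nat_mult by (metis of_nat_1 )
        then have "1 \<le> real k * infdist x (- V)" if "k \<ge> k0" for k
          using that mult_right_mono[of "real k0" "real k" "infdist x (- V)"] infdist_nonneg[of x "- V"] by simp
        then show ?thesis
          using True by (intro eventually_mono[OF eventually_ge_at_top[of k0]]) (simp add: h_def min_absorb1)
      qed (simp add: hV)
    qed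
    show "AE x in lborel. norm \<bar>indicator V x - h i x\<bar> \<le> indicator V x" for i
      using h0[of i] hI[of i] by (auto intro!: AE_I2 simp: abs_le_iff)
  qed (use finV in auto)
  then have "\<forall>\<^sub>F k in sequentially. (LINT x|lborel. \<bar>indicator V x - h k x\<bar>) < e'"
    using e' order_tendstoD(2)[of _ 0 _ e'] by simp
  then obtain k where k: "(LINT x|lborel. \<bar>indicator V x - h k x\<bar>) < e'"
    by (auto simp: eventually_sequentially)
  have hint: "integrable lborel (h k)"
    by (rule Bochner_Integration.integrable_bound[of _ "\<lambda>x. indicator V x :: real"])
      (use finV hI h0 in auto)
  define g where "g x = of_real (h k x) * c" for x
  have "(LINT x|lborel. cmod (indicator A x *\<^sub>R c - g x)) =
      cmod c * (LINT x|lborel. \<bar>indicator A x - h k x\<bar>)"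
  proof -
    have "cmod (indicator A x *\<^sub>R c - g x) = cmod c * \<bar>indicator A x - h k x\<bar>" for x
      unfolding g_def scaleR_conv_of_real left_diff_distrib[symmetric] norm_mult of_real_diff[symmetric] norm_of_real
      by simp
    then show ?thesis by simp
  qed
  also have "\<dots> \<le> C * (LINT x|lborel. \<bar>indicator A x - h k x\<bar>)"
    by (rule mult_right_mono) (use C in auto)
  also have "(LINT x|lborel. \<bar>indicator A x - h k x\<bar>) \<le>
      (LINT x|lborel. \<bar>indicator A x - indicator B x\<bar> + \<bar>indicator B x - indicator V x\<bar> + \<bar>indicator V x - h k x\<bar>)"
    by (rule integral_mono) (use intA hint finV in auto)
  also have "\<dots> = (LINT x|lborel. \<bar>indicator A x - indicator B x\<bar>) +
      (LINT x|lborel. \<bar>indicator B x - indicator V x\<bar>) + (LINT x|lborel. \<bar>indicator V x - h k x\<bar>)"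
    using intA hint finV by simp
  also have "C * \<dots> < C * (e' + e' + e')"
    using m BV k C unfolding B_def[symmetric] by simp
  also have "\<dots> = e" using C by (simp add: e'_def)
  finally have "(LINT x|lborel. cmod (indicator A x *\<^sub>R c - g x)) < e" using C by (simp add: mult_left_mono)
  moreover have "continuous_on UNIV g" unfolding g_def by (intro continuous_intros hc)
  moreover have "g x = 0" if "norm x > real m" for x
  proof -
    have "x \<notin> V" using V(3) that by auto
    then show ?thesis using hV[of x k] by (simp add: g_def)
  qed
  ultimately show ?case by blast
next
  case (add f1 f2)
  obtain g1 R1 where g1: "continuous_on UNIV g1" "\<And>x. norm x > R1 \<Longrightarrow> g1 x = 0" "(LINT x|lborel. cmod (f1 x - g1 x)) < e/2"
    using add.IH(1)[of "e/2"] add.prems by auto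
  obtain g2 R2 where g2: "continuous_on UNIV g2" "\<And>x. norm x > R2 \<Longrightarrow> g2 x = 0" "(LINT x|lborel. cmod (f2 x - g2 x)) < e/2"
    using add.IH(2)[of "e/2"] add.prems by auto
  have i: "integrable lborel g1" "integrable lborel g2"
    using integrable_continuous_bounded_support g1 g2 by blast+
  have "(LINT x|lborel. cmod (f1 x + f2 x - (g1 x + g2 x))) \<le> (LINT x|lborel. cmod (f1 x - g1 x) + cmod (f2 x - g2 x))"
  proof (rule integral_mono)
    show "cmod (f1 x + f2 x - (g1 x + g2 x)) \<le> cmod (f1 x - g1 x) + cmod (f2 x - g2 x)" for x
      using norm_triangle_ineq[of "f1 x - g1 x" "f2 x - g2 x"] by (simp add: algebra_simps)
  qed (use i add.hyps in auto)
  also have "\<dots> < e" using i add.hyps g1(3) g2(3) by simp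
  finally have "(LINT x|lborel. cmod (f1 x + f2 x - (g1 x + g2 x))) < e" .
  moreover have "continuous_on UNIV (\<lambda>x. g1 x + g2 x)" by (intro continuous_intros g1 g2)
  moreover have "\<forall>x. norm x > max R1 R2 \<longrightarrow> g1 x + g2 x = 0" using g1(2) g2(2) by simp
  ultimately show ?case by blast
next
  case (lim f s)
  have [measurable]: "f \<in> borel_measurable lborel" "\<And>i. s i \<in> borel_measurable lborel"
    using lim.hyps(1,4) by auto
  have "(\<lambda>i. LINT x|lborel. cmod (f x - s i x)) \<longlonglongrightarrow> (LINT x::'a|lborel. (0::real))"
  proof (rule integral_dominated_convergence[where w="\<lambda>x. 3 * cmod (f x)"])
    show "AE x in lborel. (\<lambda>i. cmod (f x - s i x)) \<longlonglongrightarrow> 0"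
    proof (rule AE_I2)
      fix x :: 'a
      have "(\<lambda>i. cmod (f x - s i x)) \<longlonglongrightarrow> cmod (f x - f x)"
        by (intro tendsto_intros lim.hyps(2)) simp
      then show "(\<lambda>i. cmod (f x - s i x)) \<longlonglongrightarrow> 0" by simp
    qed
    show "AE x in lborel. norm (cmod (f x - s i x)) \<le> 3 * cmod (f x)" for i
    proof (rule AE_I2)
      fix x :: 'a
      have "cmod (s i x) \<le> 2 * cmod (f x)" using lim.hyps(3)[of x i] by simp
      then show "norm (cmod (f x - s i x)) \<le> 3 * cmod (f x)"
        using norm_triangle_ineq4[of "f x" "s i x"] by simp
    qed
  qed (use lim.hyps in auto)
  then have "\<forall>\<^sub>F i in sequentially. (LINT x|lborel. cmod (f x - s i x)) < e/2"
    using lim.prems order_tendstoD(2)[of _ 0 _ "e/2"] by simp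
  then obtain i where i: "(LINT x|lborel. cmod (f x - s i x)) < e/2"
    by (auto simp: eventually_sequentially)
  obtain g R where g: "continuous_on UNIV g" "\<forall>x. norm x > R \<longrightarrow> g x = 0" "(LINT x|lborel. cmod (s i x - g x)) < e/2"
    using lim.IH[of "e/2" i] lim.prems by auto
  have "integrable lborel g" using integrable_continuous_bounded_support g by blast
  then have "(LINT x|lborel. cmod (f x - g x)) \<le> (LINT x|lborel. cmod (f x - s i x)) + (LINT x|lborel. cmod (s i x - g x))"
    by (intro integral_norm_diff_triangle lim.hyps)
  with i g(3) have "(LINT x|lborel. cmod (f x - g x)) < e" by simp
  with g show ?case by blast
qed

section \<open>Translation, reflection and dominated convergence in L^2\<close>

lemma L2_translate:
  fixes f :: "'a::euclidean_space \<Rightarrow> complex"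
  assumes "f \<in> L2"
  shows "(\<lambda>x. f (y + x)) \<in> L2" "L2_norm (\<lambda>x. f (y + x)) = L2_norm f"
proof -
  have [measurable]: "f \<in> borel_measurable borel" by (rule L2_measurable[OF assms])
  show "(\<lambda>x. f (y + x)) \<in> L2"
    using lborel_integrable_affine[OF L2_integrable_sq[OF assms], of 1 y] by (intro L2I) auto
  show "L2_norm (\<lambda>x. f (y + x)) = L2_norm f"
    unfolding L2_norm_def using lborel_integral_affine[of 1 "\<lambda>x. (cmod (f x))\<^sup>2" y] by simp
qed

lemma L2_reflect:
  fixes f :: "'a::euclidean_space \<Rightarrow> complex"
  assumes "f \<in> L2"
  shows "(\<lambda>x. f (- x)) \<in> L2" "L2_norm (\<lambda>x. f (- x)) = L2_norm f"
proof -
  have [measurable]: "f \<in> borel_measurable borel" by (rule L2_measurable[OF assms])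
  show "(\<lambda>x. f (- x)) \<in> L2"
    using lborel_integrable_affine[OF L2_integrable_sq[OF assms], of "-1" 0] by (intro L2I) auto
  show "L2_norm (\<lambda>x. f (- x)) = L2_norm f"
    unfolding L2_norm_def using lborel_integral_affine[of "-1" "\<lambda>x. (cmod (f x))\<^sup>2" 0] by simp
qed

lemma L2_tendsto_dominated:
  fixes f :: "'a::euclidean_space \<Rightarrow> complex" and m :: "nat \<Rightarrow> 'a \<Rightarrow> complex"
  assumes "f \<in> L2" and [measurable]: "\<And>k. m k \<in> borel_measurable borel"
    and "\<And>k x. cmod (m k x) \<le> C" "AE x in lborel. (\<lambda>k. m k x) \<longlonglongrightarrow> 0"
  shows "(\<lambda>k. L2_norm (\<lambda>x. m k x * f x)) \<longlonglongrightarrow> 0"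
proof -
  have [measurable]: "f \<in> borel_measurable borel" by (rule L2_measurable[OF assms(1)])
  have "(\<lambda>k. LINT x|lborel. (cmod (m k x * f x))\<^sup>2) \<longlonglongrightarrow> (LINT x::'a|lborel. (0::real))"
  proof (rule integral_dominated_convergence[where w="\<lambda>x. C\<^sup>2 * (cmod (f x))\<^sup>2"])
    show "integrable lborel (\<lambda>x. C\<^sup>2 * (cmod (f x))\<^sup>2)" using L2_integrable_sq[OF assms(1)] by simp
    show "AE x in lborel. (\<lambda>k. (cmod (m k x * f x))\<^sup>2) \<longlonglongrightarrow> 0"
      using assms(4)
    proof eventually_elim
      case (elim x)
      then have "(\<lambda>k. (cmod (m k x * f x))\<^sup>2) \<longlonglongrightarrow> (cmod (0 * f x))\<^sup>2" by (intro tendsto_intros)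
      then show ?case by simp
    qed
    show "AE x in lborel. norm ((cmod (m k x * f x))\<^sup>2) \<le> C\<^sup>2 * (cmod (f x))\<^sup>2" for k
      using assms(3) by (intro AE_I2) (auto simp: norm_mult power_mult_distrib intro!: mult_right_mono power_mono)
  qed auto
  then have "(\<lambda>k. sqrt (LINT x|lborel. (cmod (m k x * f x))\<^sup>2)) \<longlonglongrightarrow> sqrt 0"
    by (intro tendsto_real_sqrt) simp
  then show ?thesis by (simp add: L2_norm_def)
qed

lemma L2_tendsto_dominated_at_top:
  fixes f :: "'a::euclidean_space \<Rightarrow> complex" and m :: "real \<Rightarrow> 'a \<Rightarrow> complex"
  assumes "f \<in> L2" "\<And>k. m k \<in> borel_measurable borel"
    and "\<And>k x. k \<ge> k0 \<Longrightarrow> cmod (m k x) \<le> C" "AE x in lborel. ((\<lambda>k. m k x) \<longlongrightarrow> 0) at_top"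
  shows "((\<lambda>k. L2_norm (\<lambda>x. m k x * f x)) \<longlongrightarrow> 0) at_top"
proof (rule tendsto_at_topI_sequentially)
  fix X :: "nat \<Rightarrow> real" assume X: "filterlim X at_top sequentially"
  define Y where "Y n = max k0 (X n)" for n
  have Y: "filterlim Y at_top sequentially"
    unfolding Y_def by (rule filterlim_at_top_mono[OF X]) auto
  have "(\<lambda>n. L2_norm (\<lambda>x. m (Y n) x * f x)) \<longlonglongrightarrow> 0"
  proof (rule L2_tendsto_dominated[OF assms(1), where C=C])
    show "AE x in lborel. (\<lambda>n. m (Y n) x) \<longlonglongrightarrow> 0"
      using assms(4) by eventually_elim (rule filterlim_compose[OF _ Y])
    show "cmod (m (Y n) x) \<le> C" for n x by (rule assms(3)) (simp add: Y_def)
  qed (rule assms(2))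
  moreover have "\<forall>\<^sub>F n in sequentially. k0 \<le> X n"
    using X unfolding filterlim_at_top by blast
  then have "\<forall>\<^sub>F n in sequentially. L2_norm (\<lambda>x. m (Y n) x * f x) = L2_norm (\<lambda>x. m (X n) x * f x)"
    by eventually_elim (simp add: Y_def max_absorb2)
  ultimately show "(\<lambda>n. L2_norm (\<lambda>x. m (X n) x * f x)) \<longlonglongrightarrow> 0"
    by (rule Lim_transform_eventually)
qed

lemma L2_truncate_tendsto:
  fixes f :: "'a::euclidean_space \<Rightarrow> complex"
  assumes "f \<in> L2"
  shows "((\<lambda>R. L2_norm (\<lambda>x. indicator (cball 0 R) x * f x - f x)) \<longlongrightarrow> 0) at_top"
proof -
  have "((\<lambda>R. L2_norm (\<lambda>x. (indicator (cball 0 R) x - 1) * f x)) \<longlongrightarrow> 0) at_top"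
  proof (rule L2_tendsto_dominated_at_top[OF assms, where C=1 and ?k0.0=0])
    show "AE x in (lborel :: 'a measure). ((\<lambda>R. indicator (cball 0 R) x - 1 :: complex) \<longlongrightarrow> 0) at_top"
    proof (intro AE_I2 tendsto_eventually)
      fix x :: 'a
      show "\<forall>\<^sub>F R in at_top. indicator (cball 0 R) x - 1 = (0::complex)"
        by (intro eventually_mono[OF eventually_ge_at_top[of "norm x"]]) (auto simp: indicator_def)
    qed
  qed (auto simp: indicator_def)
  then show ?thesis by (simp add: left_diff_distrib)
qed

lemma L2_truncate:
  assumes "f \<in> L2" shows "(\<lambda>x. indicator (cball 0 R) x * f x) \<in> L2"
  by (rule L2_mult_bounded[OF assms, where C=1]) (auto simp: indicator_def)

lemma L2_bounded_support_integrable: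
  fixes f :: "'a::euclidean_space \<Rightarrow> complex"
  assumes f: "f \<in> L2" and R: "\<And>x. norm x > R \<Longrightarrow> f x = 0"
  shows "integrable lborel f"
    and "(LINT x|lborel. cmod (f x)) \<le> sqrt (measure lborel (cball (0::'a) R)) * L2_norm f"
proof -
  have [measurable]: "f \<in> borel_measurable borel" by (rule L2_measurable[OF f])
  let ?i = "\<lambda>x::'a. indicator (cball 0 R) x :: complex"
  have sq: "(cmod (?i x))\<^sup>2 = indicator (cball 0 R) x" for x by (simp add: indicator_def)
  have fin: "emeasure lborel (cball (0::'a) R) < \<infinity>"
    using emeasure_bounded_finite[OF bounded_cball] by simp
  have "?i \<in> borel_measurable borel" by (intro borel_measurable_indicator) simp
  then have i: "?i \<in> L2"
    by (rule L2I) (use fin in \<open>simp add: sq\<close>)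
  have eq: "cmod (?i x) * cmod (f x) = cmod (f x)" for x
    using R[of x] by (auto simp: indicator_def not_le)
  have "integrable lborel (\<lambda>x. cmod (f x))"
    using L2_integrable_norm_mult[OF i f] unfolding eq .
  then show "integrable lborel f" by (simp add: integrable_norm_iff)
  have "L2_norm ?i = sqrt (measure lborel (cball (0::'a) R))"
    unfolding L2_norm_def sq by simp
  then show "(LINT x|lborel. cmod (f x)) \<le> sqrt (measure lborel (cball (0::'a) R)) * L2_norm f"
    using L2_Cauchy_Schwarz_norm[OF i f] unfolding eq by simp
qed

text \<open>Uniform continuity settles the case of a continuous function of bounded support; density
  and translation invariance of the integral transfer it, each of the three comparisons costing
  e/3.\<close>

lemma L1_translation_continuous:
  fixes f :: "'a::euclidean_space \<Rightarrow> complex"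
  assumes f: "integrable lborel f" and e: "e > 0"
  shows "\<exists>d>0. \<forall>y. norm y < d \<longrightarrow> (LINT x|lborel. cmod (f (y + x) - f x)) < e"
proof -
  obtain g R where g: "continuous_on UNIV g" "\<And>x. norm x > R \<Longrightarrow> g x = 0" "(LINT x|lborel. cmod (f x - g x)) < e/3"
    using L1_dense_Cc[OF f, of "e/3"] e by auto
  have ig: "integrable lborel g" by (rule integrable_continuous_bounded_support[OF g(1,2)])
  have [measurable]: "f \<in> borel_measurable borel" "g \<in> borel_measurable borel"
    using f ig by (auto simp: integrable_iff_bounded)
  \<comment> \<open>Shifts have length below 1. If x has norm at most |R| + 1, both x and y + x lie
    in this ball; otherwise g vanishes at both points.\<close>
  define C where "C = cball (0::'a) (\<bar>R\<bar> + 2)"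
  define K where "K = measure lborel C + 1"
  have K: "K > 0" by (simp add: K_def add_nonneg_pos)
  have finC: "emeasure lborel C < \<infinity>" unfolding C_def
    using emeasure_bounded_finite[OF bounded_cball] by simp
  have "uniformly_continuous_on C g" unfolding C_def
    by (intro compact_uniformly_continuous continuous_on_subset[OF g(1)]) auto
  moreover have "e / (3 * K) > 0" using e K by simp
  ultimately obtain d where d: "d > 0"
      "\<And>x x'. x \<in> C \<Longrightarrow> x' \<in> C \<Longrightarrow> dist x' x < d \<Longrightarrow> dist (g x') (g x) < e / (3 * K)"
    unfolding uniformly_continuous_on_def by metis
  have "(LINT x|lborel. cmod (f (y + x) - f x)) < e" if y: "norm y < min d 1" for y
  proof -
    have iy: "integrable lborel (\<lambda>x. f (y + x))" "integrable lborel (\<lambda>x. g (y + x))"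
      using lborel_integrable_affine[OF f, of 1 y] lborel_integrable_affine[OF ig, of 1 y] by auto
    have bd: "cmod (g (y + x) - g x) \<le> indicator C x * (e / (3 * K))" for x
    proof (cases "norm x \<le> \<bar>R\<bar> + 1")
      case True
      then have "x \<in> C" "y + x \<in> C" using y norm_triangle_ineq[of y x] by (auto simp: C_def)
      then show ?thesis using d(2)[of x "y + x"] y by (simp add: dist_norm)
    next
      case False
      then have "norm x > R" "norm (y + x) > R" using y norm_triangle_ineq4[of "y + x" y] by auto
      then have "g (y + x) - g x = 0" using g(2) by simp
      then show ?thesis using \<open>e / (3 * K) > 0\<close> by (simp add: indicator_def)
    qed
    have "(LINT x|lborel. cmod (g (y + x) - g x)) \<le> (LINT x|lborel. indicator C x * (e / (3 * K)))"
      by (rule integral_mono) (use iy ig finC bd in \<open>auto simp: C_def\<close>)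
    also have "\<dots> = measure lborel C * (e / (3 * K))" by (simp add: C_def)
    also have "\<dots> < K * (e / (3 * K))"
      using \<open>e / (3 * K) > 0\<close> by (rule mult_strict_right_mono[rotated]) (simp add: K_def)
    also have "\<dots> = e / 3" using K by simp
    finally have 1: "(LINT x|lborel. cmod (g (y + x) - g x)) < e / 3" .
    have 2: "(LINT x|lborel. cmod (f (y + x) - g (y + x))) < e / 3"
      using lborel_integral_affine[of 1 "\<lambda>x. cmod (f x - g x)" y] g(3) by simp
    have "(LINT x|lborel. cmod (f (y + x) - f x)) \<le>
        (LINT x|lborel. cmod (f (y + x) - g (y + x))) + (LINT x|lborel. cmod (g (y + x) - f x))"
      by (rule integral_norm_diff_triangle) (use iy f in auto)
    also have "(LINT x|lborel. cmod (g (y + x) - f x)) \<le>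
        (LINT x|lborel. cmod (g (y + x) - g x)) + (LINT x|lborel. cmod (g x - f x))"
      by (rule integral_norm_diff_triangle) (use iy f ig in auto)
    finally show ?thesis using 1 2 g(3) by (simp add: norm_minus_commute)
  qed
  then show ?thesis using d(1) by (intro exI[of _ "min d 1"]) auto
qed

text \<open>Truncating to the set where |f| and |x| are at most k leaves a bounded integrable h, and
  |h(y+x) - h(x)|^2 <= 2c |h(y+x) - h(x)| reduces the claim to the L^1 case.\<close>

lemma L2_translation_continuous:
  fixes f :: "'a::euclidean_space \<Rightarrow> complex"
  assumes f: "f \<in> L2" and e: "e > 0"
  shows "\<exists>d>0. \<forall>y. norm y < d \<longrightarrow> L2_norm (\<lambda>x. f (y + x) - f x) < e"
proof -
  have [measurable]: "f \<in> borel_measurable borel" by (rule L2_measurable[OF f])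
  define S where "S k = {x. cmod (f x) \<le> real k} \<inter> cball 0 (real k)" for k
  have [measurable]: "S k \<in> sets borel" for k unfolding S_def by measurable
  have "(\<lambda>k. L2_norm (\<lambda>x. (1 - indicator (S k) x) * f x)) \<longlonglongrightarrow> 0"
  proof (rule L2_tendsto_dominated[OF f, where C=1])
    show "AE x in lborel. (\<lambda>k. 1 - indicator (S k) x :: complex) \<longlonglongrightarrow> 0"
    proof (intro AE_I2 tendsto_eventually)
      fix x :: 'a
      obtain k0 :: nat where "max (cmod (f x)) (norm x) < real k0" using reals_Archimedean2 by blast
      then show "\<forall>\<^sub>F k in sequentially. 1 - indicator (S k) x = (0::complex)"
        by (intro eventually_mono[OF eventually_ge_at_top[of k0]]) (auto simp: indicator_def S_def)
    qed
  qed (auto simp: indicator_def)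
  then have "\<forall>\<^sub>F k in sequentially. L2_norm (\<lambda>x. (1 - indicator (S k) x) * f x) < e/3"
    using e order_tendstoD(2)[of _ 0 _ "e/3"] by simp
  then obtain k0 where k0: "\<And>k. k \<ge> k0 \<Longrightarrow> L2_norm (\<lambda>x. (1 - indicator (S k) x) * f x) < e/3"
    by (auto simp: eventually_sequentially)
  define c where "c = real (Suc k0)"
  have c: "c > 0" by (simp add: c_def)
  define h where "h x = indicator (S (Suc k0)) x * f x" for x
  have [measurable]: "h \<in> borel_measurable borel" unfolding h_def by measurable
  have hL2: "h \<in> L2" unfolding h_def by (rule L2_mult_bounded[OF f, where C=1]) (auto simp: indicator_def)
  have hb: "cmod (h x) \<le> c" for x by (auto simp: h_def S_def indicator_def c_def)
  have hs: "h x = 0" if "norm x > c" for x using that by (auto simp: h_def S_def indicator_def c_def)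
  have hint: "integrable lborel h" by (rule L2_bounded_support_integrable[OF hL2 hs])
  have fh: "L2_norm (\<lambda>x. f x - h x) < e/3"
    using k0[of "Suc k0"] by (simp add: h_def left_diff_distrib)
  obtain d where d: "d > 0" "\<And>y. norm y < d \<Longrightarrow> (LINT x|lborel. cmod (h (y + x) - h x)) < (e/3)\<^sup>2 / (2*c)"
    using L1_translation_continuous[OF hint, of "(e/3)\<^sup>2 / (2*c)"] e c by auto
  have "L2_norm (\<lambda>x. f (y + x) - f x) < e" if y: "norm y < d" for y
  proof -
    note hy = L2_translate(1)[OF hL2, of y] and fy = L2_translate(1)[OF f, of y]
    have iy: "integrable lborel (\<lambda>x. h (y + x))"
      using lborel_integrable_affine[OF hint, of 1 y] by simp
    have "(L2_norm (\<lambda>x. h (y + x) - h x))\<^sup>2 \<le> (LINT x|lborel. 2 * c * cmod (h (y + x) - h x))"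
      unfolding L2_norm_sq
    proof (rule integral_mono)
      show "integrable lborel (\<lambda>x. (cmod (h (y + x) - h x))\<^sup>2)"
        by (rule L2_integrable_sq[OF L2_diff[OF hy hL2]])
      show "(cmod (h (y + x) - h x))\<^sup>2 \<le> 2 * c * cmod (h (y + x) - h x)" for x
        unfolding power2_eq_square
        using hb[of x] hb[of "y + x"] norm_triangle_ineq4[of "h (y + x)" "h x"]
        by (intro mult_right_mono) auto
    qed (use iy hint in auto)
    also have "\<dots> < (e/3)\<^sup>2" using d(2)[OF y] c by (simp add: field_simps)
    finally have 1: "L2_norm (\<lambda>x. h (y + x) - h x) < e/3"
      by (rule power_less_imp_less_base) (use e in simp)
    have 2: "L2_norm (\<lambda>x. f (y + x) - h (y + x)) < e/3"
      using L2_translate(2)[OF L2_diff[OF f hL2], of y] fh by simp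
    show ?thesis
      using L2_norm_triangle3[OF fy hy f] L2_norm_triangle3[OF hy hL2 f] 1 2 fh
      by (simp add: L2_norm_minus_commute[of h f])
  qed
  then show ?thesis using d(1) by blast
qed

section \<open>Plancherel's theorem\<close>

text \<open>The Fourier integral as an honest pointwise function, meaningful for integrable f.
  Truncation links it to \<open>fourier\<close>, which is only an L^2 limit of such
  integrals.\<close>

definition ft :: "('a::euclidean_space \<Rightarrow> complex) \<Rightarrow> 'a \<Rightarrow> complex" where
  "ft f \<xi> = complex_of_real ((2 * pi) powr (- real DIM('a) / 2)) *
     (LINT x|lborel. exp (- (\<i> * complex_of_real (x \<bullet> \<xi>))) * f x)"

lemma fourier_trunc_eq_ft: "fourier_trunc R f = ft (\<lambda>x. indicator (cball 0 R) x * f x)"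
  unfolding fourier_trunc_def ft_def set_lebesgue_integral_def
  by (intro ext arg_cong2[where f="(*)"] refl Bochner_Integration.integral_cong)
    (auto simp: indicator_def)

lemma integrable_product_kernel:
  fixes f h :: "'a::euclidean_space \<Rightarrow> complex"
  assumes f: "integrable lborel f" and h: "integrable lborel h"
    and k [measurable]: "(\<lambda>p. k (fst p) (snd p)) \<in> borel_measurable (borel \<Otimes>\<^sub>M borel)"
    and C: "\<And>x y. cmod (k x y) \<le> C"
  shows "integrable (lborel \<Otimes>\<^sub>M lborel) (\<lambda>(x, y). k x y * f x * h y)"
proof -
  have [measurable]: "f \<in> borel_measurable borel" "h \<in> borel_measurable borel"
    using f h by (auto simp: integrable_iff_bounded)
  have m: "(\<lambda>(x, y). f x * h y) \<in> borel_measurable (lborel \<Otimes>\<^sub>M lborel)" by measurable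
  have "integrable (lborel \<Otimes>\<^sub>M lborel) (\<lambda>(x, y). f x * h y)"
    by (rule lborel_pair.Fubini_integrable[OF m]) (use f h in \<open>auto simp: norm_mult\<close>)
  then have "integrable (lborel \<Otimes>\<^sub>M lborel) (\<lambda>p. of_real C * (case p of (x, y) \<Rightarrow> f x * h y) :: complex)"
    by (rule integrable_mult_right)
  moreover have "(\<lambda>(x, y). k x y * f x * h y) \<in> borel_measurable (lborel \<Otimes>\<^sub>M lborel)"
    using k by (simp add: case_prod_beta') measurable
  moreover have "C \<ge> 0" using order_trans[OF norm_ge_zero C] .
  then have "AE p in lborel \<Otimes>\<^sub>M lborel. cmod (case p of (x, y) \<Rightarrow> k x y * f x * h y)
      \<le> cmod (of_real C * (case p of (x, y) \<Rightarrow> f x * h y))"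
    using C by (intro AE_I2) (auto simp: norm_mult mult.assoc intro!: mult_right_mono)
  ultimately show ?thesis by (rule Bochner_Integration.integrable_bound)
qed

lemma fubini_kernel:
  fixes f h :: "'a::euclidean_space \<Rightarrow> complex"
  assumes f: "integrable lborel f" and h: "integrable lborel h"
    and k: "(\<lambda>p. k (fst p) (snd p)) \<in> borel_measurable (borel \<Otimes>\<^sub>M borel)"
    and C: "\<And>x y. cmod (k x y) \<le> C"
  shows "(LINT y|lborel. h y * (LINT x|lborel. k x y * f x)) = (LINT x|lborel. f x * (LINT y|lborel. k x y * h y))"
proof -
  have "(LINT y|lborel. LINT x|lborel. k x y * f x * h y) = (LINT x|lborel. LINT y|lborel. k x y * f x * h y)"
    by (rule lborel_pair.Fubini_integral) (rule integrable_product_kernel[OF assms])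
  also have "(LINT y|lborel. LINT x|lborel. k x y * f x * h y) = (LINT y|lborel. h y * (LINT x|lborel. k x y * f x))"
    by (simp add: mult.commute)
  also have "(LINT x|lborel. LINT y|lborel. k x y * f x * h y) = (LINT x|lborel. f x * (LINT y|lborel. k x y * h y))"
    unfolding integral_mult_right_zero[symmetric]
    by (intro Bochner_Integration.integral_cong refl) (simp add: mult_ac)
  finally show ?thesis .
qed

lemma exp_kernel_measurable:
  "(\<lambda>p::'a::euclidean_space \<times> 'a. exp (- (\<i> * complex_of_real (fst p \<bullet> snd p)))) \<in> borel_measurable (borel \<Otimes>\<^sub>M borel)"
  unfolding borel_prod by (intro borel_measurable_continuous_onI continuous_intros)

lemma ft_measurable [measurable]:
  assumes [measurable]: "f \<in> borel_measurable borel"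
  shows "ft f \<in> borel_measurable borel"
proof -
  have "(\<lambda>p::'a \<times> 'a. exp (- (\<i> * complex_of_real (snd p \<bullet> fst p)))) \<in> borel_measurable (borel \<Otimes>\<^sub>M borel)"
    unfolding borel_prod by (intro borel_measurable_continuous_onI continuous_intros)
  then have "(\<lambda>p. exp (- (\<i> * complex_of_real (snd p \<bullet> fst p))) * f (snd p)) \<in> borel_measurable (borel \<Otimes>\<^sub>M lborel)"
    by measurable
  then have "(\<lambda>\<xi>. LINT x|lborel. exp (- (\<i> * complex_of_real (x \<bullet> \<xi>))) * f x) \<in> borel_measurable borel"
    by (intro lborel.borel_measurable_lebesgue_integral) (simp add: case_prod_beta')
  then show ?thesis unfolding ft_def by measurable
qed

lemma ft_bound:
  "cmod (ft f \<xi>) \<le> (2 * pi) powr (- real DIM('a) / 2) * (LINT x|lborel. cmod (f (x::'a::euclidean_space)))"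
proof -
  have "cmod (LINT x|lborel. exp (- (\<i> * complex_of_real (x \<bullet> \<xi>))) * f x) \<le> (LINT x|lborel. cmod (exp (- (\<i> * complex_of_real (x \<bullet> \<xi>))) * f x))"
    by (rule integral_norm_bound)
  then show ?thesis unfolding ft_def by (simp add: norm_mult mult_left_mono)
qed

lemma ft_integrable_exp:
  assumes "integrable lborel f"
  shows "integrable lborel (\<lambda>x. exp (- (\<i> * complex_of_real (x \<bullet> \<xi>))) * f x)"
proof (rule Bochner_Integration.integrable_bound[OF assms])
  have [measurable]: "f \<in> borel_measurable borel" using assms by (simp add: integrable_iff_bounded)
  have [measurable]: "(\<lambda>x. exp (- (\<i> * complex_of_real (x \<bullet> \<xi>)))) \<in> borel_measurable borel"
    by (intro borel_measurable_continuous_onI continuous_intros)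
  show "(\<lambda>x. exp (- (\<i> * complex_of_real (x \<bullet> \<xi>))) * f x) \<in> borel_measurable lborel" by measurable
qed (simp add: norm_mult)

lemma ft_add: "integrable lborel f \<Longrightarrow> integrable lborel g \<Longrightarrow> ft (\<lambda>x. f x + g x) \<xi> = ft f \<xi> + ft g \<xi>"
  unfolding ft_def by (simp add: distrib_left ft_integrable_exp)

lemma ft_diff: "integrable lborel f \<Longrightarrow> integrable lborel g \<Longrightarrow> ft (\<lambda>x. f x - g x) \<xi> = ft f \<xi> - ft g \<xi>"
  unfolding ft_def by (simp add: right_diff_distrib ft_integrable_exp)

lemma ft_scale: "ft (\<lambda>x. c * f x) \<xi> = c * ft f \<xi>"
  unfolding ft_def by (simp add: mult.left_commute)

text \<open>Fubini, since the kernel is bounded and symmetric in its two variables. The regularized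
  Plancherel identity, the adjoint of \<open>fourier\<close> and the kernel representation of
  pairings all rest on this formula.\<close>

lemma ft_mult:
  assumes f: "integrable lborel f" and h: "integrable lborel h"
  shows "(LINT \<xi>|lborel. h \<xi> * ft f \<xi>) = (LINT x|lborel. f x * ft h (x::'a::euclidean_space))"
proof -
  define c where "c = complex_of_real ((2 * pi) powr (- real DIM('a) / 2))"
  have "(LINT \<xi>|lborel. h \<xi> * (LINT x|lborel. exp (- (\<i> * complex_of_real (x \<bullet> \<xi>))) * f x)) =
      (LINT x|lborel. f x * (LINT \<xi>|lborel. exp (- (\<i> * complex_of_real (x \<bullet> \<xi>))) * h \<xi>))"
    by (rule fubini_kernel[OF f h exp_kernel_measurable, of 1]) simp
  moreover have "h \<xi> * ft f \<xi> = c * (h \<xi> * (LINT x|lborel. exp (- (\<i> * complex_of_real (x \<bullet> \<xi>))) * f x))" for \<xi>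
    by (simp add: ft_def c_def)
  moreover have "f x * ft h x = c * (f x * (LINT \<xi>|lborel. exp (- (\<i> * complex_of_real (x \<bullet> \<xi>))) * h \<xi>))" for x
    by (simp add: ft_def c_def inner_commute)
  ultimately show ?thesis by (simp only: integral_mult_right_zero)
qed

lemma ft_cnj: "cnj (ft f \<xi>) = ft (\<lambda>x. cnj (f x)) (- \<xi>)"
  unfolding ft_def
  by (simp add: Bochner_Integration.integral_cnj[symmetric] exp_cnj)

lemma ft_reflect:
  assumes [measurable]: "h \<in> borel_measurable borel"
  shows "ft (\<lambda>x. h (- x)) \<xi> = ft h (- (\<xi>::'a::euclidean_space))"
proof -
  have [measurable]: "(\<lambda>x. exp (- (\<i> * complex_of_real (x \<bullet> (-\<xi>)))) * h x) \<in> borel_measurable borel"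
    by (intro borel_measurable_times borel_measurable_continuous_onI continuous_intros assms)
  show ?thesis
    unfolding ft_def
    using lborel_integral_affine[of "-1" "\<lambda>x. exp (- (\<i> * complex_of_real (x \<bullet> (-\<xi>)))) * h x" 0] by simp
qed

section \<open>The isometry on integrable functions, by Gaussian damping\<close>

text \<open>The left side is the integral of h times \<open>ft f\<close> with h the damped conjugate
  of \<open>ft f\<close>. Moving the transform onto h produces a Gaussian average of conj f of width
  e, and the substitution y = x + e z leaves e only in a translation of f, where e -> 0 is
  harmless.\<close>

lemma ft_gaussian_regularised:
  fixes f :: "'a::euclidean_space \<Rightarrow> complex"
  assumes f: "integrable lborel f" and e: "e > 0"
  shows "(LINT \<xi>|lborel. complex_of_real ((cmod (ft f \<xi>))\<^sup>2 * exp (- (e * norm \<xi>)\<^sup>2 / 2))) =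
     (LINT x|lborel. f x * (LINT z|lborel. cnj (f (x + e *\<^sub>R z)) *
        complex_of_real ((2 * pi) powr (- real DIM('a) / 2) * exp (- (norm z)\<^sup>2 / 2))))"
proof -
  have [measurable]: "f \<in> borel_measurable borel" using f by (auto simp: integrable_iff_bounded)
  define c where "c = (2 * pi) powr (- real DIM('a) / 2)"
  have c2: "c * sqrt (2 * pi) ^ DIM('a) = 1"
    unfolding c_def by (simp add: powr_half_sqrt[symmetric] powr_realpow[symmetric] powr_powr powr_minus powr_add[symmetric])
  define g where "g \<xi> = complex_of_real (exp (- (e * norm \<xi>)\<^sup>2 / 2))" for \<xi> :: 'a
  have [measurable]: "g \<in> borel_measurable borel" unfolding g_def by measurable
  have gint: "integrable lborel g" unfolding g_def
    using gaussian_integral(1)[OF e] by (subst complex_of_real_integrable_eq)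
  define h where "h \<xi> = g \<xi> * cnj (ft f \<xi>)" for \<xi>
  have [measurable]: "h \<in> borel_measurable borel" unfolding h_def by measurable
  define B where "B = c * (LINT x|lborel. cmod (f x))"
  have fB: "cmod (ft f \<xi>) \<le> B" for \<xi> unfolding B_def c_def by (rule ft_bound)
  have hint: "integrable lborel h"
  proof (rule Bochner_Integration.integrable_bound)
    show "integrable lborel (\<lambda>\<xi>. of_real B * g \<xi>)" using gint by simp
    show "AE \<xi> in lborel. norm (h \<xi>) \<le> norm (of_real B * g \<xi>)"
    proof (rule AE_I2)
      fix \<xi>
      have "0 \<le> B" using order_trans[OF norm_ge_zero fB] .
      then show "norm (h \<xi>) \<le> norm (of_real B * g \<xi>)"
        using mult_right_mono[OF fB[of \<xi>] norm_ge_zero[of "g \<xi>"]]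
        by (simp add: h_def norm_mult mult.commute)
    qed
  qed measurable
  have "(LINT \<xi>|lborel. complex_of_real ((cmod (ft f \<xi>))\<^sup>2 * exp (- (e * norm \<xi>)\<^sup>2 / 2))) = (LINT \<xi>|lborel. h \<xi> * ft f \<xi>)"
    by (intro Bochner_Integration.integral_cong refl) (simp only: h_def g_def of_real_mult complex_norm_square mult_ac)
  also have "\<dots> = (LINT x|lborel. f x * ft h x)" by (rule ft_mult[OF f hint])
  also have "\<dots> = (LINT x|lborel. f x * (LINT z|lborel. cnj (f (x + e *\<^sub>R z)) *
        complex_of_real (c * exp (- (norm z)\<^sup>2 / 2))))"
  proof (rule Bochner_Integration.integral_cong[OF refl], rule arg_cong2[where f="(*)", OF refl])
    fix x :: 'a
    define k where "k \<xi> = exp (- (\<i> * complex_of_real (\<xi> \<bullet> x))) * g \<xi>" for \<xi>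
    have kint: "integrable lborel k" unfolding k_def by (rule ft_integrable_exp[OF gint])
    then have [measurable]: "k \<in> borel_measurable borel" by (auto simp: integrable_iff_bounded)
    have kint': "integrable lborel (\<lambda>\<xi>. k (- \<xi>))" using lborel_integrable_affine[OF kint, of "-1" 0] by simp
    have fc: "integrable lborel (\<lambda>x. cnj (f x))" using f by simp
    have "ft h x = of_real c * (LINT \<xi>|lborel. k \<xi> * cnj (ft f \<xi>))"
      unfolding ft_def[of h] h_def k_def c_def by (simp add: mult.assoc)
    also have "(LINT \<xi>|lborel. k \<xi> * cnj (ft f \<xi>)) = (LINT \<xi>|lborel. k (- \<xi>) * ft (\<lambda>x. cnj (f x)) \<xi>)"
      unfolding ft_cnj using lborel_integral_affine[of "-1" "\<lambda>\<xi>. k (- \<xi>) * ft (\<lambda>x. cnj (f x)) \<xi>" 0] by simp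
    also have "\<dots> = (LINT y|lborel. cnj (f y) * ft (\<lambda>\<xi>. k (- \<xi>)) y)" by (rule ft_mult[OF fc kint'])
    also have "\<dots> = (LINT y|lborel. cnj (f y) * of_real (c * (sqrt (2 * pi) / e) ^ DIM('a) * exp (- (norm (y - x) / e)\<^sup>2 / 2)))"
    proof (rule Bochner_Integration.integral_cong[OF refl], rule arg_cong2[where f="(*)", OF refl])
      fix y
      have "ft (\<lambda>\<xi>. k (- \<xi>)) y = ft k (- y)" by (rule ft_reflect) measurable
      also have "\<dots> = of_real c * (LINT \<xi>|lborel. exp (\<i> * complex_of_real ((y - x) \<bullet> \<xi>)) * complex_of_real (exp (- (e * norm \<xi>)\<^sup>2 / 2)))"
        unfolding ft_def k_def g_def c_def
        by (simp add: mult.assoc[symmetric] exp_add[symmetric] inner_diff_left inner_commute algebra_simps)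
      also have "\<dots> = of_real (c * (sqrt (2 * pi) / e) ^ DIM('a) * exp (- (norm (y - x) / e)\<^sup>2 / 2))"
        unfolding gaussian_fourier(2)[OF e] by simp
      finally show "ft (\<lambda>\<xi>. k (- \<xi>)) y = of_real (c * (sqrt (2 * pi) / e) ^ DIM('a) * exp (- (norm (y - x) / e)\<^sup>2 / 2))" .
    qed
    also have "\<dots> = \<bar>e\<bar>^DIM('a) *\<^sub>R (LINT z|lborel. cnj (f (x + e *\<^sub>R z)) * of_real (c * (sqrt (2 * pi) / e) ^ DIM('a) * exp (- (norm (x + e *\<^sub>R z - x) / e)\<^sup>2 / 2)))"
      by (rule lborel_integral_affine) (use e in auto)
    also have "of_real c * \<dots> = (LINT z|lborel. of_real c * (\<bar>e\<bar>^DIM('a) *\<^sub>R (cnj (f (x + e *\<^sub>R z)) * of_real (c * (sqrt (2 * pi) / e) ^ DIM('a) * exp (- (norm (x + e *\<^sub>R z - x) / e)\<^sup>2 / 2)))))"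
      by simp
    also have "\<dots> = (LINT z|lborel. cnj (f (x + e *\<^sub>R z)) * complex_of_real (c * exp (- (norm z)\<^sup>2 / 2)))"
    proof (rule Bochner_Integration.integral_cong[OF refl])
      fix z :: 'a
      have "c * (e ^ DIM('a) * (c * (sqrt (2 * pi) / e) ^ DIM('a))) = c * (c * sqrt (2 * pi) ^ DIM('a))"
        using e by (simp add: power_divide)
      then have 1: "c * (e ^ DIM('a) * (c * (sqrt (2 * pi) / e) ^ DIM('a))) = c" using c2 by simp
      have "of_real c * (\<bar>e\<bar>^DIM('a) *\<^sub>R (cnj (f (x + e *\<^sub>R z)) * of_real (c * (sqrt (2 * pi) / e) ^ DIM('a) * exp (- (norm (x + e *\<^sub>R z - x) / e)\<^sup>2 / 2))))
        = cnj (f (x + e *\<^sub>R z)) * of_real ((c * (e ^ DIM('a) * (c * (sqrt (2 * pi) / e) ^ DIM('a)))) * exp (- (norm z)\<^sup>2 / 2))"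
        using e by (simp add: scaleR_conv_of_real mult_ac)
      then show "of_real c * (\<bar>e\<bar>^DIM('a) *\<^sub>R (cnj (f (x + e *\<^sub>R z)) * of_real (c * (sqrt (2 * pi) / e) ^ DIM('a) * exp (- (norm (x + e *\<^sub>R z - x) / e)\<^sup>2 / 2))))
        = cnj (f (x + e *\<^sub>R z)) * complex_of_real (c * exp (- (norm z)\<^sup>2 / 2))" unfolding 1 .
    qed
    finally show "ft h x = (LINT z|lborel. cnj (f (x + e *\<^sub>R z)) * complex_of_real (c * exp (- (norm z)\<^sup>2 / 2)))" .
  qed
  finally show ?thesis unfolding c_def .
qed

text \<open>Let e -> 0 in the damped identity. On the right translation continuity and dominated
  convergence give the squared norm of f; on the left the damping factors increase to 1, so monotone
  convergence gives square integrability of the transform together with the value of its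
  norm.\<close>

lemma ft_isometry:
  fixes f :: "'a::euclidean_space \<Rightarrow> complex"
  assumes f: "integrable lborel f" and f2: "f \<in> L2"
  shows "ft f \<in> L2" "L2_norm (ft f) = L2_norm f"
proof -
  have [measurable]: "f \<in> borel_measurable borel" using f by (auto simp: integrable_iff_bounded)
  define \<gamma> where "\<gamma> z = (2 * pi) powr (- real DIM('a) / 2) * exp (- (norm z)\<^sup>2 / 2)" for z :: 'a
  have \<gamma>0: "\<gamma> z \<ge> 0" for z by (simp add: \<gamma>_def)
  have \<gamma>int: "integrable lborel \<gamma>"
    unfolding \<gamma>_def using gaussian_integral(1)[where a=1 and 'a='a] by simp
  have [measurable]: "\<gamma> \<in> borel_measurable borel" using \<gamma>int by auto
  have "(2 * pi) powr (- real DIM('a) / 2) * sqrt (2 * pi) ^ DIM('a) = 1"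
    by (simp add: powr_half_sqrt[symmetric] powr_realpow[symmetric] powr_powr powr_minus powr_add[symmetric])
  then have \<gamma>1: "(LINT z|lborel. \<gamma> z) = 1"
    unfolding \<gamma>_def using gaussian_integral(2)[where a=1 and 'a='a] by simp
  define N where "N = L2_norm f"
  \<comment> \<open>The autocorrelation of f at the shift e z: bounded by the squared norm N^2 and,
    by continuity of translations, tending to N^2 as e -> 0.\<close>
  define \<phi> where "\<phi> e z = L2_inner f (\<lambda>x. f (e *\<^sub>R z + x))" for e :: real and z :: 'a
  define e where "e k = 1 / real (Suc k)" for k
  have e: "e k > 0" for k by (simp add: e_def)
  note tr = L2_translate[OF f2]
  have \<phi>b: "cmod (\<phi> r z) \<le> N * N" for r z
    unfolding \<phi>_def N_def using L2_Cauchy_Schwarz[OF f2 tr(1)] by (simp add: tr(2))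
  have \<phi>m [measurable]: "\<phi> r \<in> borel_measurable borel" for r
    unfolding \<phi>_def L2_inner_def by measurable
  have reg: "(LINT \<xi>|lborel. complex_of_real ((cmod (ft f \<xi>))\<^sup>2 * exp (- (r * norm \<xi>)\<^sup>2 / 2))) =
      (LINT z|lborel. of_real (\<gamma> z) * \<phi> r z)" if "r > 0" for r
  proof -
    have m: "(\<lambda>(z, x). f x * (cnj (f (r *\<^sub>R z + x)) * of_real (\<gamma> z))) \<in> borel_measurable (lborel \<Otimes>\<^sub>M lborel)"
      by measurable
    have n: "(LINT x|lborel. norm (case (z, x) of (z, x) \<Rightarrow> f x * (cnj (f (r *\<^sub>R z + x)) * of_real (\<gamma> z)))) =
        \<gamma> z * (LINT x|lborel. cmod (f x) * cmod (f (r *\<^sub>R z + x)))" for z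
      unfolding integral_mult_right_zero[symmetric]
      by (intro Bochner_Integration.integral_cong refl) (use \<gamma>0 in \<open>simp add: norm_mult mult_ac\<close>)
    have "integrable (lborel \<Otimes>\<^sub>M lborel) (\<lambda>(z, x). f x * (cnj (f (r *\<^sub>R z + x)) * of_real (\<gamma> z)))"
    proof (rule lborel_pair.Fubini_integrable[OF m])
      show "integrable lborel (\<lambda>z. LINT x|lborel. norm (case (z, x) of (z, x) \<Rightarrow> f x * (cnj (f (r *\<^sub>R z + x)) * of_real (\<gamma> z))))"
        unfolding n
      proof (rule Bochner_Integration.integrable_bound)
        show "integrable lborel (\<lambda>z. (N * N) * \<gamma> z)" using \<gamma>int by simp
        show "AE z in lborel. norm (\<gamma> z * (LINT x|lborel. cmod (f x) * cmod (f (r *\<^sub>R z + x)))) \<le> norm (N * N * \<gamma> z)"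
        proof (rule AE_I2)
          fix z
          have "(LINT x|lborel. cmod (f x) * cmod (f (r *\<^sub>R z + x))) \<le> N * N"
            using L2_Cauchy_Schwarz_norm[OF f2 tr(1)] by (simp add: tr(2) N_def)
          then show "norm (\<gamma> z * (LINT x|lborel. cmod (f x) * cmod (f (r *\<^sub>R z + x)))) \<le> norm (N * N * \<gamma> z)"
            using \<gamma>0[of z] by (simp add: abs_mult mult.commute[of _ "\<gamma> z"] mult_left_mono)
        qed
      qed measurable
      show "AE z in lborel. integrable lborel (\<lambda>x. case (z, x) of (z, x) \<Rightarrow> f x * (cnj (f (r *\<^sub>R z + x)) * of_real (\<gamma> z)))"
        using L2_integrable_mult_cnj[OF f2 tr(1)] by (auto simp: mult.assoc[symmetric])
    qed
    from lborel_pair.Fubini_integral[OF this]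
    have "(LINT x|lborel. LINT z|lborel. f x * (cnj (f (r *\<^sub>R z + x)) * of_real (\<gamma> z))) =
        (LINT z|lborel. LINT x|lborel. f x * (cnj (f (r *\<^sub>R z + x)) * of_real (\<gamma> z)))" .
    also have "\<dots> = (LINT z|lborel. of_real (\<gamma> z) * \<phi> r z)"
      unfolding \<phi>_def L2_inner_def integral_mult_right_zero[symmetric] by (simp only: mult_ac)
    finally show ?thesis
      unfolding ft_gaussian_regularised[OF f that] by (simp add: \<gamma>_def add.commute)
  qed
  have e0: "e \<longlonglongrightarrow> 0" unfolding e_def using LIMSEQ_inverse_real_of_nat by (simp add: inverse_eq_divide)
  have "(\<lambda>k. LINT z|lborel. of_real (\<gamma> z) * \<phi> (e k) z) \<longlonglongrightarrow> (LINT z|lborel. of_real (\<gamma> z) * of_real (N\<^sup>2))"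
  proof (rule integral_dominated_convergence[where w="\<lambda>z. (N * N) * \<gamma> z"])
    show "integrable lborel (\<lambda>z. (N * N) * \<gamma> z)" using \<gamma>int by simp
    show "AE z in lborel. norm (of_real (\<gamma> z) * \<phi> (e k) z) \<le> (N * N) * \<gamma> z" for k
      using \<phi>b \<gamma>0 by (intro AE_I2) (simp add: norm_mult mult.commute[of _ "\<gamma> _"] mult_left_mono)
    show "AE z in lborel. (\<lambda>k. of_real (\<gamma> z) * \<phi> (e k) z) \<longlonglongrightarrow> of_real (\<gamma> z) * of_real (N\<^sup>2)"
    proof (intro AE_I2 tendsto_mult tendsto_const)
      fix z :: 'a
      have d: "cmod (\<phi> (e k) z - of_real (N\<^sup>2)) \<le> N * L2_norm (\<lambda>x. f (e k *\<^sub>R z + x) - f x)" for k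
      proof -
        have "\<phi> (e k) z - of_real (N\<^sup>2) = L2_inner f (\<lambda>x. f (e k *\<^sub>R z + x) - f x)"
          unfolding \<phi>_def N_def L2_inner_self[symmetric] by (rule L2_inner_diff_right[symmetric, OF tr(1) f2 f2])
        then show ?thesis unfolding N_def using L2_Cauchy_Schwarz[OF f2 L2_diff[OF tr(1) f2]] by simp
      qed
      have ez: "(\<lambda>k. norm (e k *\<^sub>R z)) \<longlonglongrightarrow> 0"
        using tendsto_scaleR[OF e0 tendsto_const[of z]] tendsto_norm_zero by fastforce
      have "(\<lambda>k. L2_norm (\<lambda>x. f (e k *\<^sub>R z + x) - f x)) \<longlonglongrightarrow> 0"
      proof (rule LIMSEQ_I)
        fix r :: real assume "r > 0"
        then obtain \<delta> where \<delta>: "\<delta> > 0" "\<forall>y. norm y < \<delta> \<longrightarrow> L2_norm (\<lambda>x. f (y + x) - f x) < r"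
          using L2_translation_continuous[OF f2] by blast
        obtain k0 where "\<And>k. k \<ge> k0 \<Longrightarrow> norm (e k *\<^sub>R z) < \<delta>"
          using order_tendstoD(2)[OF ez \<delta>(1)] by (auto simp: eventually_sequentially)
        then show "\<exists>k0. \<forall>k\<ge>k0. norm (L2_norm (\<lambda>x. f (e k *\<^sub>R z + x) - f x) - 0) < r"
          using \<delta>(2) by (intro exI[of _ k0]) simp
      qed
      from tendsto_mult_right_zero[OF this, of N]
      have "(\<lambda>k. \<phi> (e k) z - of_real (N\<^sup>2)) \<longlonglongrightarrow> 0"
        by (rule Lim_null_comparison[rotated]) (intro always_eventually allI d)
      then show "(\<lambda>k. \<phi> (e k) z) \<longlonglongrightarrow> of_real (N\<^sup>2)"
        by (rule LIM_zero_cancel)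
    qed
  qed measurable
  then have "(\<lambda>k. LINT z|lborel. of_real (\<gamma> z) * \<phi> (e k) z) \<longlonglongrightarrow> complex_of_real (N\<^sup>2)"
    by (simp add: integral_complex_of_real \<gamma>1 del: of_real_power)
  then have "(\<lambda>k. complex_of_real (LINT \<xi>|lborel. (cmod (ft f \<xi>))\<^sup>2 * exp (- (e k * norm \<xi>)\<^sup>2 / 2))) \<longlonglongrightarrow> complex_of_real (N\<^sup>2)"
    unfolding reg[OF e, symmetric] integral_complex_of_real .
  then have lim: "(\<lambda>k. LINT \<xi>|lborel. (cmod (ft f \<xi>))\<^sup>2 * exp (- (e k * norm \<xi>)\<^sup>2 / 2)) \<longlonglongrightarrow> N\<^sup>2"
    unfolding tendsto_of_real_iff .
  define B where "B = (2 * pi) powr (- real DIM('a) / 2) * (LINT x|lborel. cmod (f x))"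
  have fB: "cmod (ft f \<xi>) \<le> B" for \<xi> unfolding B_def by (rule ft_bound)
  have i: "integrable lborel (\<lambda>\<xi>. (cmod (ft f \<xi>))\<^sup>2 * exp (- (e k * norm \<xi>)\<^sup>2 / 2))" for k
  proof (rule Bochner_Integration.integrable_bound)
    show "integrable lborel (\<lambda>\<xi>::'a. B\<^sup>2 * exp (- (e k * norm \<xi>)\<^sup>2 / 2))"
      using gaussian_integral(1)[OF e[of k], where 'a='a] by simp
    show "AE \<xi> in lborel. norm ((cmod (ft f \<xi>))\<^sup>2 * exp (- (e k * norm \<xi>)\<^sup>2 / 2)) \<le> norm (B\<^sup>2 * exp (- (e k * norm \<xi>)\<^sup>2 / 2))"
      using power_mono[OF fB, of _ 2] by (intro AE_I2) (simp add: abs_mult)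
  qed measurable
  have mono: "AE \<xi> in lborel. mono (\<lambda>k. (cmod (ft f \<xi>))\<^sup>2 * exp (- (e k * norm \<xi>)\<^sup>2 / 2))"
  proof (intro AE_I2 monoI mult_left_mono)
    fix \<xi> :: 'a and k l :: nat assume "k \<le> l"
    then have "e l \<le> e k" by (simp add: e_def frac_le)
    then have "(e l * norm \<xi>)\<^sup>2 \<le> (e k * norm \<xi>)\<^sup>2" using e[of l] by (intro power_mono mult_right_mono) (auto intro: less_imp_le)
    then show "exp (- (e k * norm \<xi>)\<^sup>2 / 2) \<le> exp (- (e l * norm \<xi>)\<^sup>2 / 2)" by simp
  qed auto
  have lim2: "AE \<xi> in lborel. (\<lambda>k. (cmod (ft f \<xi>))\<^sup>2 * exp (- (e k * norm \<xi>)\<^sup>2 / 2)) \<longlonglongrightarrow> (cmod (ft f \<xi>))\<^sup>2"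
  proof (rule AE_I2)
    fix \<xi> :: 'a
    have "(\<lambda>k. (cmod (ft f \<xi>))\<^sup>2 * exp (- (e k * norm \<xi>)\<^sup>2 / 2)) \<longlonglongrightarrow> (cmod (ft f \<xi>))\<^sup>2 * exp (- (0 * norm \<xi>)\<^sup>2 / 2)"
      by (intro tendsto_intros e0) simp
    then show "(\<lambda>k. (cmod (ft f \<xi>))\<^sup>2 * exp (- (e k * norm \<xi>)\<^sup>2 / 2)) \<longlonglongrightarrow> (cmod (ft f \<xi>))\<^sup>2" by simp
  qed
  have mm: "(\<lambda>\<xi>. (cmod (ft f \<xi>))\<^sup>2) \<in> borel_measurable lborel" by measurable
  show "ft f \<in> L2"
    using integrable_monotone_convergence[OF i mono lim2 lim mm] by (intro L2I) measurable
  have "(L2_norm (ft f))\<^sup>2 = N\<^sup>2"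
    unfolding L2_norm_sq using integral_monotone_convergence[OF i mono lim2 lim mm] .
  then show "L2_norm (ft f) = L2_norm f" unfolding N_def by (simp add: power2_eq_iff_nonneg)
qed

section \<open>Extension of the transform to L^2\<close>

text \<open>The truncations of f are Cauchy in L^2 and \<open>ft\<close> is isometric on their
  differences. Integer radii give the limit by completeness.\<close>

lemma fourier_exists:
  fixes f :: "'a::euclidean_space \<Rightarrow> complex"
  assumes f: "f \<in> L2"
  shows "\<exists>g. L2_tendsto (\<lambda>R. fourier_trunc R f) g at_top"
proof -
  let ?t = "\<lambda>R x. indicator (cball 0 R) x * f x"
  have tL: "?t R \<in> L2" for R by (rule L2_truncate[OF f])
  have ti: "integrable lborel (?t R)" for R
    by (rule L2_bounded_support_integrable[OF tL, of R R]) (simp add: indicator_def)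
  have fL: "ft (?t R) \<in> L2" for R by (rule ft_isometry[OF ti tL])
  have iso: "L2_norm (\<lambda>\<xi>. ft (?t R) \<xi> - ft (?t S) \<xi>) = L2_norm (\<lambda>x. ?t R x - ?t S x)" for R S
  proof -
    have "(\<lambda>\<xi>. ft (?t R) \<xi> - ft (?t S) \<xi>) = ft (\<lambda>x. ?t R x - ?t S x)"
      by (intro ext ft_diff[symmetric] ti)
    then show ?thesis using ft_isometry(2)[of "\<lambda>x. ?t R x - ?t S x"] ti tL by (simp add: L2_diff)
  qed
  define \<epsilon> where "\<epsilon> R = L2_norm (\<lambda>x. ?t R x - f x)" for R
  have \<epsilon>: "(\<epsilon> \<longlongrightarrow> 0) at_top" unfolding \<epsilon>_def by (rule L2_truncate_tendsto[OF f])
  have le: "L2_norm (\<lambda>\<xi>. ft (?t R) \<xi> - ft (?t S) \<xi>) \<le> \<epsilon> R + \<epsilon> S" for R S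
    unfolding iso \<epsilon>_def using L2_norm_triangle3[OF tL f tL] by (simp add: L2_norm_minus_commute[of f])
  have \<epsilon>n: "(\<lambda>n. \<epsilon> (real n)) \<longlonglongrightarrow> 0"
    by (rule filterlim_compose[OF \<epsilon> filterlim_real_sequentially])
  have "\<exists>g\<in>L2. (\<lambda>n. L2_norm (\<lambda>x. ft (?t (real n)) x - g x)) \<longlonglongrightarrow> 0"
  proof (rule L2_complete[OF fL])
    fix r :: real assume "r > 0"
    then obtain n0 where n0: "\<And>n. n \<ge> n0 \<Longrightarrow> \<epsilon> (real n) < r/2"
      using order_tendstoD(2)[OF \<epsilon>n, of "r/2"] by (auto simp: eventually_sequentially)
    show "\<exists>n0. \<forall>m\<ge>n0. \<forall>n\<ge>n0. L2_norm (\<lambda>x. ft (?t (real m)) x - ft (?t (real n)) x) < r"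
    proof (intro exI allI impI)
      fix m n assume "m \<ge> n0" "n \<ge> n0"
      then show "L2_norm (\<lambda>x. ft (?t (real m)) x - ft (?t (real n)) x) < r"
        using n0[of m] n0[of n] le[of "real m" "real n"] by linarith
    qed
  qed
  then obtain g where g: "g \<in> L2" "(\<lambda>n. L2_norm (\<lambda>x. ft (?t (real n)) x - g x)) \<longlonglongrightarrow> 0" by blast
  \<comment> \<open>The truncation error of f at radius R bounds the distance to the limit, which
    extends the convergence from integer to real radii.\<close>
  have bd: "L2_norm (\<lambda>x. ft (?t R) x - g x) \<le> \<epsilon> R" for R
  proof (rule LIMSEQ_le_const)
    have "(\<lambda>n. \<epsilon> R + \<epsilon> (real n) + L2_norm (\<lambda>x. ft (?t (real n)) x - g x)) \<longlonglongrightarrow> \<epsilon> R + 0 + 0"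
      by (intro tendsto_intros \<epsilon>n g)
    then show "(\<lambda>n. \<epsilon> R + \<epsilon> (real n) + L2_norm (\<lambda>x. ft (?t (real n)) x - g x)) \<longlonglongrightarrow> \<epsilon> R" by simp
    show "\<exists>N. \<forall>n\<ge>N. L2_norm (\<lambda>x. ft (?t R) x - g x) \<le> \<epsilon> R + \<epsilon> (real n) + L2_norm (\<lambda>x. ft (?t (real n)) x - g x)"
    proof (intro exI allI impI)
      fix n :: nat
      show "L2_norm (\<lambda>x. ft (?t R) x - g x) \<le> \<epsilon> R + \<epsilon> (real n) + L2_norm (\<lambda>x. ft (?t (real n)) x - g x)"
        using L2_norm_triangle3[OF fL fL g(1), of R "real n"] le[of R "real n"] by linarith
    qed
  qed
  have "((\<lambda>R. L2_norm (\<lambda>x. ft (?t R) x - g x)) \<longlongrightarrow> 0) at_top"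
    by (rule tendsto_sandwich[OF _ _ tendsto_const \<epsilon>]) (auto intro!: always_eventually bd)
  then have "L2_tendsto (\<lambda>R. fourier_trunc R f) g at_top"
    unfolding L2_tendsto_def fourier_trunc_eq_ft using g(1) fL by auto
  then show ?thesis by blast
qed

lemma L2_tendstoD:
  assumes "L2_tendsto X f F"
  shows "f \<in> L2" "\<forall>\<^sub>F s in F. X s \<in> L2" "((\<lambda>s. L2_norm (\<lambda>x. X s x - f x)) \<longlongrightarrow> 0) F"
  using assms by (auto simp: L2_tendsto_def)

lemma L2_tendsto_unique:
  assumes "L2_tendsto X f F" "L2_tendsto X g F" "F \<noteq> bot"
  shows "AE x in lborel. f x = g x"
proof -
  note f = L2_tendstoD[OF assms(1)] and g = L2_tendstoD[OF assms(2)]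
  have "((\<lambda>s. L2_norm (\<lambda>x. X s x - f x) + L2_norm (\<lambda>x. X s x - g x)) \<longlongrightarrow> 0 + 0) F"
    by (intro tendsto_add f g)
  moreover have "\<forall>\<^sub>F s in F. L2_norm (\<lambda>x. f x - g x) \<le> L2_norm (\<lambda>x. X s x - f x) + L2_norm (\<lambda>x. X s x - g x)"
    using f(2)
  proof eventually_elim
    case (elim s)
    then show ?case using L2_norm_triangle3[OF f(1) elim g(1)] by (simp add: L2_norm_minus_commute[of f])
  qed
  ultimately have "L2_norm (\<lambda>x. f x - g x) \<le> 0 + 0"
    by (intro tendsto_lowerbound[OF _ _ assms(3)])
  then have "L2_norm (\<lambda>x. f x - g x) = 0" using L2_norm_nonneg[of "\<lambda>x. f x - g x"] by linarith
  then show ?thesis using L2_norm_eq_0[OF L2_diff[OF f(1) g(1)]] by simp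
qed

lemma L2_tendsto_add:
  assumes "L2_tendsto X f F" "L2_tendsto Y g F"
  shows "L2_tendsto (\<lambda>s x. X s x + Y s x) (\<lambda>x. f x + g x) F"
proof -
  note f = L2_tendstoD[OF assms(1)] and g = L2_tendstoD[OF assms(2)]
  have lim: "((\<lambda>s. L2_norm (\<lambda>x. X s x - f x) + L2_norm (\<lambda>x. Y s x - g x)) \<longlongrightarrow> 0) F"
    using tendsto_add[OF f(3) g(3)] by simp
  have ev: "\<forall>\<^sub>F s in F. norm (L2_norm (\<lambda>x. (X s x + Y s x) - (f x + g x))) \<le> L2_norm (\<lambda>x. X s x - f x) + L2_norm (\<lambda>x. Y s x - g x)"
    using f(2) g(2)
  proof eventually_elim
    case (elim s)
    then show ?case using L2_norm_triangle[OF L2_diff[OF elim(1) f(1)] L2_diff[OF elim(2) g(1)]] by (simp add: algebra_simps)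
  qed
  have "((\<lambda>s. L2_norm (\<lambda>x. (X s x + Y s x) - (f x + g x))) \<longlongrightarrow> 0) F"
    by (rule Lim_null_comparison[OF ev lim])
  moreover have "\<forall>\<^sub>F s in F. (\<lambda>x. X s x + Y s x) \<in> L2"
    using f(2) g(2) by eventually_elim (rule L2_add)
  ultimately show ?thesis using L2_add[OF f(1) g(1)] by (simp add: L2_tendsto_def)
qed

lemma L2_tendsto_scale:
  assumes "L2_tendsto X f F"
  shows "L2_tendsto (\<lambda>s x. c * X s x) (\<lambda>x. c * f x) F"
proof -
  note f = L2_tendstoD[OF assms]
  have "((\<lambda>s. cmod c * L2_norm (\<lambda>x. X s x - f x)) \<longlongrightarrow> cmod c * 0) F"
    by (intro tendsto_intros f)
  then have "((\<lambda>s. L2_norm (\<lambda>x. c * X s x - c * f x)) \<longlongrightarrow> 0) F"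
    unfolding L2_norm_scale[symmetric] by (simp add: right_diff_distrib)
  moreover have "\<forall>\<^sub>F s in F. (\<lambda>x. c * X s x) \<in> L2"
    using f(2) by eventually_elim (rule L2_scale)
  ultimately show ?thesis using L2_scale[OF f(1)] by (simp add: L2_tendsto_def)
qed

lemma L2_inner_tendsto:
  assumes "L2_tendsto X f F" "L2_tendsto Y g F"
  shows "((\<lambda>s. L2_inner (X s) (Y s)) \<longlongrightarrow> L2_inner f g) F"
proof -
  note f = L2_tendstoD[OF assms(1)] and g = L2_tendstoD[OF assms(2)]
  let ?a = "\<lambda>s. L2_norm (\<lambda>x. X s x - f x)" and ?b = "\<lambda>s. L2_norm (\<lambda>x. Y s x - g x)"
  have "((\<lambda>s. ?a s * ?b s + ?a s * L2_norm g + L2_norm f * ?b s) \<longlongrightarrow> 0 * 0 + 0 * L2_norm g + L2_norm f * 0) F"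
    by (intro tendsto_intros f g)
  then have lim: "((\<lambda>s. ?a s * ?b s + ?a s * L2_norm g + L2_norm f * ?b s) \<longlongrightarrow> 0) F" by simp
  have "((\<lambda>s. L2_inner (X s) (Y s) - L2_inner f g) \<longlongrightarrow> 0) F"
  proof (rule Lim_null_comparison[OF _ lim])
    show "\<forall>\<^sub>F s in F. norm (L2_inner (X s) (Y s) - L2_inner f g) \<le> ?a s * ?b s + ?a s * L2_norm g + L2_norm f * ?b s"
      using f(2) g(2)
    proof eventually_elim
      case (elim s)
      note d = L2_diff[OF elim(1) f(1)] L2_diff[OF elim(2) g(1)]
      have "L2_inner (X s) (Y s) - L2_inner f g = L2_inner (\<lambda>x. X s x - f x) (\<lambda>x. Y s x - g x)
          + L2_inner (\<lambda>x. X s x - f x) g + L2_inner f (\<lambda>x. Y s x - g x)"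
        using elim f(1) g(1) d by (simp add: L2_inner_diff_left L2_inner_diff_right)
      moreover have "cmod (L2_inner (\<lambda>x. X s x - f x) (\<lambda>x. Y s x - g x)
          + L2_inner (\<lambda>x. X s x - f x) g + L2_inner f (\<lambda>x. Y s x - g x)) \<le> ?a s * ?b s + ?a s * L2_norm g + L2_norm f * ?b s"
        by (intro norm_triangle_le add_mono L2_Cauchy_Schwarz d f(1) g(1))
      ultimately show ?case by simp
    qed
  qed
  then show ?thesis by (rule LIM_zero_cancel)
qed

lemma L2_tendsto_truncate:
  assumes "f \<in> L2" shows "L2_tendsto (\<lambda>R x. indicator (cball 0 R) x * f x) f at_top"
  unfolding L2_tendsto_def using assms L2_truncate[OF assms] L2_truncate_tendsto[OF assms] by simp

lemma fourier_tendsto: "f \<in> L2 \<Longrightarrow> L2_tendsto (\<lambda>R. fourier_trunc R f) (fourier f) at_top"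
  unfolding fourier_def by (rule someI_ex[OF fourier_exists])

lemma fourier_L2: "f \<in> L2 \<Longrightarrow> fourier f \<in> L2"
  by (rule L2_tendstoD(1)[OF fourier_tendsto])

lemma fourier_AE_unique:
  assumes "f \<in> L2" "L2_tendsto (\<lambda>R. fourier_trunc R f) g at_top"
  shows "AE \<xi> in lborel. fourier f \<xi> = g \<xi>"
  by (rule L2_tendsto_unique[OF fourier_tendsto[OF assms(1)] assms(2)]) simp

text \<open>A true equality of functions: the truncated integrals ignore null sets, so the choice
  operator is applied to the same predicate on both sides.\<close>

lemma fourier_cong_AE:
  assumes [measurable]: "f \<in> borel_measurable borel" "g \<in> borel_measurable borel"
    and "AE x in lborel. f x = g x"
  shows "fourier f = fourier g"
proof -
  have [measurable]: "cball (0::'a) R \<in> sets borel" for R by simp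
  have [measurable]: "(\<lambda>x. exp (- (\<i> * complex_of_real (x \<bullet> \<xi>)))) \<in> borel_measurable borel" for \<xi> :: 'a
    by (intro borel_measurable_continuous_onI continuous_intros)
  have "fourier_trunc R f = fourier_trunc R g" for R
    unfolding fourier_trunc_eq_ft ft_def
  proof (intro ext arg_cong2[where f="(*)"] refl integral_cong_AE)
    fix \<xi> :: 'a
    show "AE x in lborel. exp (- (\<i> * complex_of_real (x \<bullet> \<xi>))) * (indicator (cball 0 R) x * f x) =
        exp (- (\<i> * complex_of_real (x \<bullet> \<xi>))) * (indicator (cball 0 R) x * g x)"
      using assms(3) by eventually_elim simp
  qed measurable
  then show ?thesis unfolding fourier_def by simp
qed

lemma fourier_trunc_integrable:
  assumes "f \<in> L2"
  shows "integrable lborel (\<lambda>x. indicator (cball 0 R) x * f x)"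
  by (rule L2_bounded_support_integrable(1)[OF L2_truncate[OF assms], of R R]) (simp add: indicator_def)

lemma fourier_add:
  assumes "f \<in> L2" "g \<in> L2"
  shows "AE \<xi> in lborel. fourier (\<lambda>x. f x + g x) \<xi> = fourier f \<xi> + fourier g \<xi>"
proof (rule fourier_AE_unique[OF L2_add[OF assms]])
  have "fourier_trunc R (\<lambda>x. f x + g x) = (\<lambda>\<xi>. fourier_trunc R f \<xi> + fourier_trunc R g \<xi>)" for R
    unfolding fourier_trunc_eq_ft distrib_left
    by (intro ext ft_add fourier_trunc_integrable assms)
  then show "L2_tendsto (\<lambda>R. fourier_trunc R (\<lambda>x. f x + g x)) (\<lambda>\<xi>. fourier f \<xi> + fourier g \<xi>) at_top"
    using L2_tendsto_add[OF fourier_tendsto[OF assms(1)] fourier_tendsto[OF assms(2)]] by simp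
qed

lemma fourier_scale:
  assumes "f \<in> L2"
  shows "AE \<xi> in lborel. fourier (\<lambda>x. c * f x) \<xi> = c * fourier f \<xi>"
proof (rule fourier_AE_unique[OF L2_scale[OF assms]])
  have "fourier_trunc R (\<lambda>x. c * f x) = (\<lambda>\<xi>. c * fourier_trunc R f \<xi>)" for R
    unfolding fourier_trunc_eq_ft mult.left_commute[of _ c] by (intro ext ft_scale)
  then show "L2_tendsto (\<lambda>R. fourier_trunc R (\<lambda>x. c * f x)) (\<lambda>\<xi>. c * fourier f \<xi>) at_top"
    using L2_tendsto_scale[OF fourier_tendsto[OF assms]] by simp
qed

lemma fourier_diff:
  assumes "f \<in> L2" "g \<in> L2"
  shows "AE \<xi> in lborel. fourier (\<lambda>x. f x - g x) \<xi> = fourier f \<xi> - fourier g \<xi>"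
  using fourier_add[OF assms(1) L2_scale[OF assms(2), of "-1"]] fourier_scale[OF assms(2), of "-1"]
  by eventually_elim simp

lemma fourier_bounded_support:
  assumes f: "f \<in> L2" and R: "\<And>x. norm x > R \<Longrightarrow> f x = 0"
  shows "AE \<xi> in lborel. fourier f \<xi> = ft f \<xi>"
proof (rule fourier_AE_unique[OF f])
  have eq: "fourier_trunc S f = ft f" if "S \<ge> R" for S
  proof -
    have "(\<lambda>x. indicator (cball 0 S) x * f x) = f"
      using R that by (intro ext) (auto simp: indicator_def)
    then show ?thesis unfolding fourier_trunc_eq_ft by simp
  qed
  have fL: "ft f \<in> L2" by (rule ft_isometry(1)[OF L2_bounded_support_integrable(1)[OF f R] f])
  have ev: "\<forall>\<^sub>F S in at_top. fourier_trunc S f = ft f"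
    using eventually_ge_at_top[of R] by eventually_elim (rule eq)
  have "((\<lambda>S. L2_norm (\<lambda>x. fourier_trunc S f x - ft f x)) \<longlongrightarrow> 0) at_top"
    by (intro tendsto_eventually) (use ev in eventually_elim, simp)
  moreover have "\<forall>\<^sub>F S in at_top. fourier_trunc S f \<in> L2"
    using ev by eventually_elim (simp add: fL)
  ultimately show "L2_tendsto (\<lambda>S. fourier_trunc S f) (ft f) at_top"
    using fL by (simp add: L2_tendsto_def)
qed

lemma fourier_norm:
  assumes f: "f \<in> L2"
  shows "L2_norm (fourier f) = L2_norm f"
proof -
  have eq: "L2_inner (fourier_trunc R f) (fourier_trunc R f) =
      L2_inner (\<lambda>x. indicator (cball 0 R) x * f x) (\<lambda>x. indicator (cball 0 R) x * f x)" for R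
    unfolding L2_inner_self fourier_trunc_eq_ft
    using ft_isometry(2)[OF fourier_trunc_integrable[OF f] L2_truncate[OF f]] by simp
  have "L2_inner (fourier f) (fourier f) = L2_inner f f"
    using L2_inner_tendsto[OF fourier_tendsto[OF f] fourier_tendsto[OF f]]
      L2_inner_tendsto[OF L2_tendsto_truncate[OF f] L2_tendsto_truncate[OF f]]
    unfolding eq by (rule tendsto_unique[rotated]) simp
  then show ?thesis unfolding L2_inner_self of_real_eq_iff by (simp add: power2_eq_iff_nonneg)
qed

text \<open>Polarization: additivity yields the real part, homogeneity for the scalar i the
  imaginary part. Linearity is asked for only almost everywhere because \<open>fourier\<close>
  selects a representative by choice.\<close>

lemma L2_norm_isometry_inner:
  assumes T: "\<And>f. f \<in> L2 \<Longrightarrow> T f \<in> L2" "\<And>f. f \<in> L2 \<Longrightarrow> L2_norm (T f) = L2_norm f"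
    and add: "\<And>f g. f \<in> L2 \<Longrightarrow> g \<in> L2 \<Longrightarrow> AE x in lborel. T (\<lambda>x. f x + g x) x = T f x + T g x"
    and scale: "\<And>f c. f \<in> L2 \<Longrightarrow> AE x in lborel. T (\<lambda>x. c * f x) x = c * T f x"
    and f: "f \<in> L2" and g: "g \<in> L2"
  shows "L2_inner (T f) (T g) = L2_inner f g"
proof -
  have Re: "Re (L2_inner (T f) (T h)) = Re (L2_inner f h)" if h: "h \<in> L2" for h
  proof -
    have "L2_norm (\<lambda>x. T f x + T h x) = L2_norm (T (\<lambda>x. f x + h x))"
      by (rule L2_norm_cong_AE[symmetric]) (use add[OF f h] T(1) f h in \<open>auto intro!: L2_measurable L2_add\<close>)
    also have "\<dots> = L2_norm (\<lambda>x. f x + h x)" by (rule T(2)[OF L2_add[OF f h]])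
    finally show ?thesis
      using L2_norm_add_sq[OF f h] L2_norm_add_sq[OF T(1)[OF f] T(1)[OF h]] T(2)[OF f] T(2)[OF h] by simp
  qed
  have "L2_inner (T f) (T (\<lambda>x. \<i> * g x)) = L2_inner (T f) (\<lambda>x. \<i> * T g x)"
    by (rule L2_inner_cong_AE) (use scale[OF g, of \<i>] T(1) f g in \<open>auto intro!: L2_measurable L2_scale\<close>)
  then have "Re (L2_inner (T f) (\<lambda>x. \<i> * T g x)) = Re (L2_inner f (\<lambda>x. \<i> * g x))"
    using Re[OF L2_scale[OF g, of \<i>]] by simp
  then have "Im (L2_inner (T f) (T g)) = Im (L2_inner f g)"
    unfolding L2_inner_scale_right by simp
  with Re[OF g] show ?thesis by (simp add: complex_eq_iff)
qed

section \<open>Unitarity and inversion\<close>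

lemma fourier_inner:
  "f \<in> L2 \<Longrightarrow> g \<in> L2 \<Longrightarrow> L2_inner (fourier f) (fourier g) = L2_inner f g"
  by (rule L2_norm_isometry_inner[where T=fourier, OF fourier_L2 fourier_norm fourier_add fourier_scale])

lemma inv_fourier_L2: "f \<in> L2 \<Longrightarrow> inv_fourier f \<in> L2"
  unfolding inv_fourier_def by (intro L2_reflect fourier_L2)

lemma inv_fourier_norm: "f \<in> L2 \<Longrightarrow> L2_norm (inv_fourier f) = L2_norm f"
  unfolding inv_fourier_def by (simp add: L2_reflect(2) fourier_L2 fourier_norm)

lemma inv_fourier_inner:
  assumes "f \<in> L2" "g \<in> L2" shows "L2_inner (inv_fourier f) (inv_fourier g) = L2_inner f g"
proof -
  note [measurable] = L2_measurable[OF fourier_L2[OF assms(1)]] L2_measurable[OF fourier_L2[OF assms(2)]]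
  have "L2_inner (inv_fourier f) (inv_fourier g) = L2_inner (fourier f) (fourier g)"
    unfolding L2_inner_def inv_fourier_def
    using lborel_integral_affine[of "-1" "\<lambda>x. fourier f x * cnj (fourier g x)" 0] by simp
  then show ?thesis using fourier_inner[OF assms] by simp
qed

text \<open>For truncations this is the multiplication formula, conjugation turning the kernel into
  that of the inverse transform; both sides then converge as the radius grows.\<close>

lemma fourier_adjoint:
  assumes f: "f \<in> L2" and g: "g \<in> L2"
  shows "L2_inner (fourier f) g = L2_inner f (inv_fourier g)"
proof -
  let ?f = "\<lambda>R x. indicator (cball 0 R) x * f x" and ?g = "\<lambda>R x. indicator (cball 0 R) x * g x"
  note fi = fourier_trunc_integrable[OF f] and gi = fourier_trunc_integrable[OF g]
  have eq: "L2_inner (fourier_trunc R f) (?g R) = L2_inner (?f R) (\<lambda>x. fourier_trunc R g (- x))" for R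
  proof -
    have gi': "integrable lborel (\<lambda>x. cnj (?g R x))"
      using gi[of R] by (simp del: complex_cnj_mult)
    have "L2_inner (fourier_trunc R f) (?g R) = (LINT x|lborel. cnj (?g R x) * ft (?f R) x)"
      unfolding L2_inner_def fourier_trunc_eq_ft by (simp add: mult.commute)
    also have "\<dots> = (LINT x|lborel. ?f R x * ft (\<lambda>x. cnj (?g R x)) x)"
      by (rule ft_mult[OF fi gi'])
    also have "\<dots> = L2_inner (?f R) (\<lambda>x. fourier_trunc R g (- x))"
      unfolding L2_inner_def fourier_trunc_eq_ft ft_cnj by simp
    finally show ?thesis .
  qed
  have "L2_tendsto (\<lambda>R x. fourier_trunc R g (- x)) (inv_fourier g) at_top"
  proof -
    note t = L2_tendstoD[OF fourier_tendsto[OF g]]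
    have tL: "fourier_trunc R g \<in> L2" for R
      unfolding fourier_trunc_eq_ft by (rule ft_isometry(1)[OF gi L2_truncate[OF g]])
    have "L2_norm (\<lambda>x. fourier_trunc R g (- x) - inv_fourier g x) = L2_norm (\<lambda>x. fourier_trunc R g x - fourier g x)" for R
      unfolding inv_fourier_def using L2_reflect(2)[OF L2_diff[OF tL t(1)]] by simp
    then show ?thesis
      unfolding L2_tendsto_def using t(3) inv_fourier_L2[OF g] L2_reflect(1)[OF tL] by simp
  qed
  then have "((\<lambda>R. L2_inner (fourier_trunc R f) (?g R)) \<longlongrightarrow> L2_inner f (inv_fourier g)) at_top"
    unfolding eq by (intro L2_inner_tendsto L2_tendsto_truncate f)
  moreover have "((\<lambda>R. L2_inner (fourier_trunc R f) (?g R)) \<longlongrightarrow> L2_inner (fourier f) g) at_top"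
    by (intro L2_inner_tendsto L2_tendsto_truncate fourier_tendsto f g)
  ultimately show ?thesis by (intro tendsto_unique[rotated]) auto
qed

text \<open>Tested against h, the adjoint relation turns the left side into the inner product of two
  inverse transforms, and these preserve inner products. No pointwise inversion formula
  enters.\<close>

lemma fourier_inv_fourier:
  assumes f: "f \<in> L2" shows "AE x in lborel. fourier (inv_fourier f) x = f x"
proof (rule L2_eq_AE_dual[OF fourier_L2[OF inv_fourier_L2[OF f]] f])
  fix h :: "'a \<Rightarrow> complex" assume h: "h \<in> L2"
  show "L2_inner (fourier (inv_fourier f)) h = L2_inner f h"
    unfolding fourier_adjoint[OF inv_fourier_L2[OF f] h] by (rule inv_fourier_inner[OF f h])
qed

lemma inv_fourier_cong_AE:
  assumes "f \<in> borel_measurable borel" "g \<in> borel_measurable borel" "AE x in lborel. f x = g x"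
  shows "inv_fourier f = inv_fourier g"
  unfolding inv_fourier_def fourier_cong_AE[OF assms] ..

section \<open>Fourier multipliers\<close>

lemma multiplier_L2: "(\<lambda>\<xi>. of_real (m \<xi>) * fourier f \<xi>) \<in> L2 \<Longrightarrow> multiplier m f \<in> L2"
  unfolding multiplier_def by (rule inv_fourier_L2)

lemma fourier_multiplier:
  "(\<lambda>\<xi>. of_real (m \<xi>) * fourier f \<xi>) \<in> L2 \<Longrightarrow> AE \<xi> in lborel. fourier (multiplier m f) \<xi> = of_real (m \<xi>) * fourier f \<xi>"
  unfolding multiplier_def by (rule fourier_inv_fourier)

lemma multiplier_norm:
  "(\<lambda>\<xi>. of_real (m \<xi>) * fourier f \<xi>) \<in> L2 \<Longrightarrow> L2_norm (multiplier m f) = L2_norm (\<lambda>\<xi>. of_real (m \<xi>) * fourier f \<xi>)"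
  unfolding multiplier_def by (rule inv_fourier_norm)

lemma bounded_multiplier_fourier_L2:
  fixes m :: "'a::euclidean_space \<Rightarrow> real"
  assumes "f \<in> L2" "m \<in> borel_measurable borel" "\<And>\<xi>. \<bar>m \<xi>\<bar> \<le> C"
  shows "(\<lambda>\<xi>. of_real (m \<xi>) * fourier f \<xi>) \<in> L2"
  by (rule L2_mult_bounded[OF fourier_L2[OF assms(1)], where C=C]) (use assms in auto)

section \<open>Oscillatory integrals and complex dilation\<close>

text \<open>Cauchy's inequality converts the local majorant g of the integrand into a majorant of
  its c-derivative, hence of the difference quotients, and dominated convergence differentiates
  under the integral.\<close>

lemma holomorphic_parametric_integral:
  fixes f :: "complex \<Rightarrow> 'a::euclidean_space \<Rightarrow> complex"
  assumes D: "open D"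
    and hol: "\<And>x. (\<lambda>c. f c x) holomorphic_on D"
    and meas: "\<And>c. c \<in> D \<Longrightarrow> f c \<in> borel_measurable lborel"
    and dom: "\<And>c0. c0 \<in> D \<Longrightarrow> \<exists>r>0. \<exists>g. cball c0 r \<subseteq> D \<and> integrable lborel g \<and>
        (\<forall>c\<in>cball c0 r. \<forall>x. cmod (f c x) \<le> g x)"
  shows "(\<lambda>c. LINT x|lborel. f c x) holomorphic_on D"
proof -
  have "\<exists>L. ((\<lambda>c. LINT x|lborel. f c x) has_field_derivative L) (at c0)" if c0: "c0 \<in> D" for c0
  proof -
    obtain r g where r: "r > 0" "cball c0 r \<subseteq> D" and g: "integrable lborel g"
      and fg: "\<And>c x. c \<in> cball c0 r \<Longrightarrow> cmod (f c x) \<le> g x"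
      using dom[OF c0] by blast
    have int: "integrable lborel (f c)" if "c \<in> cball c0 r" for c
    proof (rule Bochner_Integration.integrable_bound[OF g])
      show "AE x in lborel. norm (f c x) \<le> norm (g x)"
        unfolding real_norm_def by (intro AE_I2 order_trans[OF fg[OF that] abs_ge_self])
      show "f c \<in> borel_measurable lborel" using that r by (intro meas) auto
    qed
    define L where "L = (LINT x|lborel. deriv (\<lambda>c. f c x) c0)"
    \<comment> \<open>Halving the radius leaves a disc of radius r/2 around each such c inside the
      domain of the majorant, which is what Cauchy's inequality consumes.\<close>
    have dbound: "cmod (deriv (\<lambda>c. f c x) c) \<le> g x / (r/2)" if c: "c \<in> cball c0 (r/2)" for c x
    proof -
      have sub: "cball c (r/2) \<subseteq> cball c0 r"
      proof
        fix w assume "w \<in> cball c (r/2)"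
        then show "w \<in> cball c0 r" using c dist_triangle[of c0 w c] by simp
      qed
      have "cmod ((deriv ^^ 1) (\<lambda>c. f c x) c) \<le> fact 1 * g x / (r/2)^1"
      proof (rule Cauchy_inequality)
        show "(\<lambda>c. f c x) holomorphic_on ball c (r/2)"
          by (rule holomorphic_on_subset[OF hol]) (use sub r ball_subset_cball in blast)
        show "continuous_on (cball c (r/2)) (\<lambda>c. f c x)"
          by (rule continuous_on_subset[OF holomorphic_on_imp_continuous_on[OF hol]]) (use sub r in blast)
        show "cmod (f w x) \<le> g x" if "cmod (c - w) = r/2" for w
          by (rule fg) (use sub that in \<open>auto simp: dist_norm\<close>)
      qed (use r in simp)
      then show ?thesis by simp
    qed
    have der: "((\<lambda>c. f c x) has_field_derivative deriv (\<lambda>c. f c x) c) (at c)" if "c \<in> D" for c x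
      by (rule holomorphic_derivI[OF hol D that])
    have lip: "cmod (f c x - f c0 x) \<le> g x / (r/2) * cmod (c - c0)" if c: "c \<in> cball c0 (r/2)" for c x
    proof (rule field_differentiable_bound[where S="cball c0 (r/2)"])
      show "((\<lambda>c. f c x) has_field_derivative deriv (\<lambda>c. f c x) z) (at z within cball c0 (r/2))"
        if "z \<in> cball c0 (r/2)" for z
        by (rule has_field_derivative_at_within[OF der]) (use that r subset_cball[of "r/2" r c0] in auto)
    qed (use dbound c r in auto)
    have "((\<lambda>h. ((LINT x|lborel. f (c0 + h) x) - (LINT x|lborel. f c0 x)) / h) \<longlongrightarrow> L) (at 0)"
      unfolding tendsto_at_iff_sequentially comp_def
    proof (intro allI impI)
      fix X :: "nat \<Rightarrow> complex" assume X: "\<forall>i. X i \<in> UNIV - {0}" "X \<longlonglongrightarrow> 0"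
      have "\<forall>\<^sub>F i in sequentially. cmod (X i) < r/2"
        by (rule order_tendstoD(2)[OF tendsto_norm_zero[OF X(2)]]) (use r in simp)
      then obtain k where k: "\<And>i. i \<ge> k \<Longrightarrow> cmod (X i) < r/2" by (auto simp: eventually_sequentially)
      define Y where "Y i = X (i + k)" for i
      have Y: "Y i \<noteq> 0" "cmod (Y i) < r/2" for i using X k[of "i + k"] by (auto simp: Y_def)
      have Y0: "Y \<longlonglongrightarrow> 0" unfolding Y_def by (rule LIMSEQ_ignore_initial_segment[OF X(2)])
      have Yc: "c0 + Y i \<in> cball c0 (r/2)" "c0 + Y i \<in> cball c0 r" "c0 \<in> cball c0 r" for i
        using Y(2)[of i] r by (auto simp: dist_norm)
      have "(\<lambda>i. LINT x|lborel. (f (c0 + Y i) x - f c0 x) / Y i) \<longlonglongrightarrow> L"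
        unfolding L_def
      proof (rule integral_dominated_convergence[where w="\<lambda>x. g x / (r/2)"])
        show m: "(\<lambda>x. (f (c0 + Y i) x - f c0 x) / Y i) \<in> borel_measurable lborel" for i
          by (intro borel_measurable_divide borel_measurable_diff borel_measurable_const meas[OF c0] meas[OF subsetD[OF r(2) Yc(2)]])
        have lim: "(\<lambda>i. (f (c0 + Y i) x - f c0 x) / Y i) \<longlonglongrightarrow> deriv (\<lambda>c. f c x) c0" for x
        proof -
          have "((\<lambda>h. (f (c0 + h) x - f c0 x) / h) \<longlongrightarrow> deriv (\<lambda>c. f c x) c0) (at 0)"
            using der[OF c0, of x] by (simp add: DERIV_def)
          then show ?thesis
            by (rule filterlim_compose) (use Y Y0 in \<open>auto simp: filterlim_at\<close>)
        qed
        then show "AE x in lborel. (\<lambda>i. (f (c0 + Y i) x - f c0 x) / Y i) \<longlonglongrightarrow> deriv (\<lambda>c. f c x) c0" by simp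
        show "(\<lambda>x. deriv (\<lambda>c. f c x) c0) \<in> borel_measurable lborel"
          by (rule borel_measurable_LIMSEQ_metric[OF m lim])
        show "integrable lborel (\<lambda>x. g x / (r/2))" using g by simp
        show "AE x in lborel. norm ((f (c0 + Y i) x - f c0 x) / Y i) \<le> g x / (r/2)" for i
          using lip[OF Yc(1)] Y(1)[of i] by (intro AE_I2) (simp add: norm_divide field_simps)
      qed
      moreover have "(LINT x|lborel. (f (c0 + Y i) x - f c0 x) / Y i) =
          ((LINT x|lborel. f (c0 + Y i) x) - (LINT x|lborel. f c0 x)) / Y i" for i
        using int[OF Yc(2)] int[OF Yc(3)] by simp
      ultimately have "(\<lambda>i. ((LINT x|lborel. f (c0 + Y i) x) - (LINT x|lborel. f c0 x)) / Y i) \<longlonglongrightarrow> L" by (simp only:)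
      then show "(\<lambda>i. ((LINT x|lborel. f (c0 + X i) x) - (LINT x|lborel. f c0 x)) / X i) \<longlonglongrightarrow> L"
        unfolding Y_def by (rule LIMSEQ_offset)
    qed
    then show ?thesis by (auto simp: DERIV_def)
  qed
  then show ?thesis
    unfolding holomorphic_on_open[OF D] by blast
qed

text \<open>The sector |arg c| < pi/4 is exactly the part of the right half plane where Re (c^2) >
  0, so decay in c^2 |xi|^2 survives the rotation there. Convexity supplies the connectedness for
  analytic continuation.\<close>

lemma sector_properties:
  defines "D \<equiv> {c. \<bar>Im c\<bar> < Re c}"
  shows "open D" "connected D" "\<And>c. c \<in> D \<Longrightarrow> Re (c\<^sup>2) > 0" "\<And>c. c \<in> D \<Longrightarrow> c \<noteq> 0"
proof -
  show "open D" unfolding D_def by (intro open_Collect_less continuous_intros)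
  have "convex D"
    unfolding D_def convex_def
  proof (intro ballI allI impI)
    fix x y :: complex and u v :: real
    assume x: "x \<in> {c. \<bar>Im c\<bar> < Re c}" and y: "y \<in> {c. \<bar>Im c\<bar> < Re c}" and uv: "0 \<le> u" "0 \<le> v" "u + v = 1"
    have "\<bar>u * Im x + v * Im y\<bar> \<le> u * \<bar>Im x\<bar> + v * \<bar>Im y\<bar>"
      using uv by (intro order_trans[OF abs_triangle_ineq]) (simp add: abs_mult)
    also have "\<dots> < u * Re x + v * Re y"
    proof (cases "u = 0")
      case True
      then show ?thesis using uv y by simp
    next
      case False
      then show ?thesis using uv x y by (intro add_less_le_mono mult_strict_left_mono mult_left_mono) auto
    qed
    finally show "u *\<^sub>R x + v *\<^sub>R y \<in> {c. \<bar>Im c\<bar> < Re c}" by simp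
  qed
  then show "connected D" by (rule convex_connected)
  show "Re (c\<^sup>2) > 0" if "c \<in> D" for c
  proof -
    have "\<bar>Im c\<bar>\<^sup>2 < (Re c)\<^sup>2" using that by (intro power_strict_mono) (auto simp: D_def)
    then show ?thesis by (simp add: power2_eq_square)
  qed
  show "c \<noteq> 0" if "c \<in> D" for c using that by (auto simp: D_def)
qed

text \<open>For positive real c this is the substitution x -> c x. Both sides are holomorphic on the
  sector and the positive reals accumulate at 1, so the identity theorem extends it. In effect all
  radii are moved to a complex ray at once, in every dimension.\<close>

lemma dilation_analytic_continuation:
  fixes f :: "complex \<Rightarrow> 'a::euclidean_space \<Rightarrow> complex"
  defines "D \<equiv> {c. \<bar>Im c\<bar> < Re c}"
  assumes hol: "(\<lambda>c. LINT x|lborel. f c x) holomorphic_on D"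
    and real: "\<And>r x. r > 0 \<Longrightarrow> f (of_real r) x = f 1 (r *\<^sub>R x)"
    and meas: "f 1 \<in> borel_measurable borel"
    and c: "c \<in> D"
  shows "(LINT x|lborel. f 1 x) = c ^ DIM('a) * (LINT x|lborel. f c x)"
proof -
  define J where "J c = c ^ DIM('a) * (LINT x|lborel. f c x) - (LINT x|lborel. f 1 x)" for c
  have "J holomorphic_on D" unfolding J_def by (intro holomorphic_intros hol)
  moreover have "J z = 0" if z: "z \<in> complex_of_real ` {0<..}" for z
  proof -
    obtain r where r: "r > 0" "z = of_real r" using z by auto
    have "(LINT x|lborel. f 1 x) = \<bar>r\<bar>^DIM('a) *\<^sub>R (LINT x|lborel. f 1 (0 + r *\<^sub>R x))"
      by (rule lborel_integral_affine) (use r meas in auto)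
    then show ?thesis unfolding J_def r(2) real[OF r(1)] using r(1) by (simp add: scaleR_conv_of_real)
  qed
  moreover have "(1::complex) islimpt complex_of_real ` {0<..}"
    unfolding islimpt_approachable
  proof (intro allI impI)
    fix e :: real assume e: "e > 0"
    have "complex_of_real (1 + e/2) - 1 = of_real (e/2)" by simp
    then have "dist (complex_of_real (1 + e/2)) 1 < e" using e by (simp only: dist_norm norm_of_real)
    moreover have "complex_of_real (1 + e/2) \<noteq> 1" using e by (simp only: of_real_eq_1_iff)
    ultimately show "\<exists>x'\<in>complex_of_real ` {0<..}. x' \<noteq> 1 \<and> dist x' 1 < e"
      using e by (intro bexI[of _ "complex_of_real (1 + e/2)"] conjI imageI) auto
  qed
  moreover have "complex_of_real ` {0<..} \<subseteq> D" "1 \<in> D" by (auto simp: D_def)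
  ultimately have "J c = 0"
    using analytic_continuation[of J D "complex_of_real ` {0<..}" 1 c] sector_properties(1,2) c
    unfolding D_def by blast
  then show ?thesis by (simp add: J_def)
qed

lemma exp_linear_gaussian_integrable:
  fixes a b k :: real
  assumes k: "k > 0"
  shows "integrable lborel (\<lambda>x::'a::euclidean_space. exp (b + a * norm x - k * (norm x)\<^sup>2))"
proof (rule Bochner_Integration.integrable_bound)
  let ?g = "\<lambda>x::'a. exp (b + a\<^sup>2 / (2 * k)) * exp (- (sqrt k * norm x)\<^sup>2 / 2)"
  show "integrable lborel ?g"
    using gaussian_integral(1)[of "sqrt k", where 'a='a] k by simp
  show "AE x in lborel. norm (exp (b + a * norm x - k * (norm x)\<^sup>2)) \<le> norm (?g x)"
  proof (rule AE_I2)
    fix x :: 'a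
    have "0 \<le> (a / k - norm x)\<^sup>2 * (k / 2)" using k by simp
    also have "\<dots> = a\<^sup>2 / (2 * k) - a * norm x + k * (norm x)\<^sup>2 / 2"
      using k by (simp add: power2_eq_square field_simps)
    finally have "b + a * norm x - k * (norm x)\<^sup>2 \<le> (b + a\<^sup>2 / (2 * k)) + (- (sqrt k * norm x)\<^sup>2 / 2)"
      using k by (simp add: power_mult_distrib)
    then show "norm (exp (b + a * norm x - k * (norm x)\<^sup>2)) \<le> norm (?g x)"
      by (simp add: exp_add[symmetric] del: exp_add)
  qed
qed measurable

lemma power_exp_minus_le_fact:
  assumes "X \<ge> (0::real)"
  shows "X ^ n * exp (- X) \<le> fact n"
proof -
  have "X ^ n / fact n \<le> exp X"
    using sum_le_suminf[OF summable_exp_generic[of X], of "{n}"] assms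
    by (simp add: exp_def divide_inverse mult.commute)
  then show ?thesis by (simp add: exp_minus field_simps)
qed

text \<open>\<open>G\<close> stands for the cutoff \<open>F\<^sub>1(r)\<close> and \<open>H\<close> for \<open>1 - F\<^sub>1(r)\<close>, as functions of \<open>r\<^sup>2\<close>; the order
  \<open>K\<close> of vanishing of \<open>G\<close> at \<open>0\<close> determines the decay of the kernel.\<close>

locale analytic_cutoffs =
  fixes G H :: "complex \<Rightarrow> complex" and K :: nat and CG CH :: real
  assumes G_hol: "G holomorphic_on UNIV" and H_hol: "H holomorphic_on UNIV"
    and G_bound: "\<And>w. Re w \<ge> 0 \<Longrightarrow> cmod (G w) \<le> CG"
    and G_vanish: "\<And>w. Re w \<ge> 0 \<Longrightarrow> cmod (G w) \<le> CG * cmod w ^ K"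
    and H_bound: "\<And>w. Re w \<ge> 0 \<Longrightarrow> cmod (H w) \<le> CH * exp (- Re w)"
begin

lemma C_nonneg: "CG \<ge> 0" "CH \<ge> 0"
  using order_trans[OF norm_ge_zero G_bound[of 0]] order_trans[OF norm_ge_zero H_bound[of 0]] by auto

text \<open>The dilated integrand of the propagator kernel: z is the spatial displacement, s the
  time, and c = 1 the undilated kernel. A and B rescale the squared frequency and will be
  t^{2\<gamma>} and t^{-2\<beta>}.\<close>

definition osc :: "real \<Rightarrow> real \<Rightarrow> real \<Rightarrow> 'a::euclidean_space \<Rightarrow> complex \<Rightarrow> 'a \<Rightarrow> complex" where
  "osc A B s z c \<xi> = exp (\<i> * c * of_real (z \<bullet> \<xi>) + \<i> * of_real s * csqrt (1 + c\<^sup>2 * of_real ((norm \<xi>)\<^sup>2))) *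
     G (of_real A * c\<^sup>2 * of_real ((norm \<xi>)\<^sup>2)) * H (of_real B * c\<^sup>2 * of_real ((norm \<xi>)\<^sup>2))"

context
  fixes A B s :: real and z :: "'a::euclidean_space"
  assumes A: "A > 0" and B: "B > 0" and s: "s \<ge> 0"
begin

text \<open>Positive real part keeps the argument of \<open>csqrt\<close> off its branch cut, so the
  dispersion relation stays holomorphic in c throughout the sector.\<close>

lemma one_plus_sq_nonpos:
  assumes "Re (c\<^sup>2) > 0" "q \<ge> 0" shows "1 + c\<^sup>2 * of_real q \<notin> \<real>\<^sub>\<le>\<^sub>0"
proof -
  have "Re (1 + c\<^sup>2 * of_real q) > 0" using assms by (simp add: add_pos_nonneg)
  then show ?thesis by (auto simp: complex_nonpos_Reals_iff)
qed

lemma one_plus_norm_sq_nonpos: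
  assumes "Re (c\<^sup>2) > 0" shows "1 + c\<^sup>2 * (of_real (norm x))\<^sup>2 \<notin> \<real>\<^sub>\<le>\<^sub>0"
  using one_plus_sq_nonpos[OF assms, of "(norm x)\<^sup>2"] by simp

lemma osc_holomorphic: "(\<lambda>c. osc A B s z c \<xi>) holomorphic_on {c. \<bar>Im c\<bar> < Re c}"
  unfolding osc_def
  by (intro holomorphic_intros holomorphic_on_compose[OF _ holomorphic_on_subset[OF G_hol], unfolded o_def]
      holomorphic_on_compose[OF _ holomorphic_on_subset[OF H_hol], unfolded o_def])
    (use one_plus_norm_sq_nonpos[OF sector_properties(3)] in auto)

lemma osc_measurable:
  assumes "c \<in> {c. \<bar>Im c\<bar> < Re c}"
  shows "osc A B s z c \<in> borel_measurable borel"
proof -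
  have c: "Re (c\<^sup>2) > 0" by (rule sector_properties(3)[OF assms])
  have "continuous_on UNIV (osc A B s z c)"
    unfolding osc_def
    by (intro continuous_intros continuous_on_compose2[OF holomorphic_on_imp_continuous_on[OF G_hol]]
        continuous_on_compose2[OF holomorphic_on_imp_continuous_on[OF H_hol]]
        continuous_on_compose2[where g=csqrt and t="- \<real>\<^sub>\<le>\<^sub>0"] continuous_on_csqrt)
      (use one_plus_norm_sq_nonpos[OF c] in auto)
  then show ?thesis by (rule borel_measurable_continuous_onI)
qed

text \<open>A qualitative majorant that justifies holomorphy. The phase may grow exponentially in
  |xi| under rotation, but the Gaussian decay of \<open>H\<close> absorbs this locally uniformly in
  c.\<close>

lemma osc_crude_bound:
  assumes "Re (c\<^sup>2) \<ge> m" "m > 0" "cmod c \<le> M"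
  shows "cmod (osc A B s z c \<xi>) \<le> CG * CH * exp (s + (M * norm z + s * M) * norm \<xi> - B * m * (norm \<xi>)\<^sup>2)"
proof -
  let ?q = "(norm \<xi>)\<^sup>2" and ?w = "csqrt (1 + c\<^sup>2 * of_real ((norm \<xi>)\<^sup>2))"
  have M: "M \<ge> 0" using assms(3) norm_ge_zero order_trans by blast
  have re: "Re (of_real X * c\<^sup>2 * of_real ?q) = X * Re (c\<^sup>2) * ?q" for X
    by (simp add: algebra_simps)
  have "(cmod ?w)\<^sup>2 = cmod (1 + c\<^sup>2 * of_real ?q)" by (simp flip: norm_power)
  also have "\<dots> \<le> 1 + (cmod c * norm \<xi>)\<^sup>2"
    by (rule order_trans[OF norm_triangle_ineq]) (simp add: norm_mult norm_power power_mult_distrib)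
  also have "\<dots> \<le> 1 + (M * norm \<xi>)\<^sup>2" using assms(3) by (intro add_left_mono power_mono mult_right_mono) auto
  also have "\<dots> \<le> (1 + M * norm \<xi>)\<^sup>2" using M by (simp add: power2_sum)
  finally have w: "cmod ?w \<le> 1 + M * norm \<xi>" by (rule power2_le_imp_le) (use M in simp)
  have "cmod (exp (\<i> * c * of_real (z \<bullet> \<xi>) + \<i> * of_real s * ?w)) \<le> exp (M * (norm z * norm \<xi>) + s * (1 + M * norm \<xi>))"
  proof -
    have "Re (\<i> * c * of_real (z \<bullet> \<xi>) + \<i> * of_real s * ?w) \<le> cmod (\<i> * c * of_real (z \<bullet> \<xi>)) + cmod (\<i> * of_real s * ?w)"
      by (rule order_trans[OF complex_Re_le_cmod norm_triangle_ineq])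
    also have "\<dots> = cmod c * \<bar>z \<bullet> \<xi>\<bar> + s * cmod ?w" using s by (simp add: norm_mult)
    also have "\<dots> \<le> M * (norm z * norm \<xi>) + s * (1 + M * norm \<xi>)"
      using assms(3) M s w Cauchy_Schwarz_ineq2[of z \<xi>] by (intro add_mono mult_mono mult_left_mono) auto
    finally show ?thesis unfolding norm_exp_eq_Re by simp
  qed
  moreover have "cmod (G (of_real A * c\<^sup>2 * of_real ?q)) \<le> CG"
    by (rule G_bound) (unfold re, use A assms in simp)
  moreover have "cmod (H (of_real B * c\<^sup>2 * of_real ?q)) \<le> CH * exp (- (B * m * ?q))"
  proof -
    have "cmod (H (of_real B * c\<^sup>2 * of_real ?q)) \<le> CH * exp (- (B * Re (c\<^sup>2) * ?q))"
      using H_bound[of "of_real B * c\<^sup>2 * of_real ?q"] B assms unfolding re by simp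
    also have "\<dots> \<le> CH * exp (- (B * m * ?q))"
      using C_nonneg B assms by (intro mult_left_mono) (auto intro!: mult_right_mono mult_left_mono)
    finally show ?thesis .
  qed
  ultimately have "cmod (osc A B s z c \<xi>) \<le> exp (M * (norm z * norm \<xi>) + s * (1 + M * norm \<xi>)) * CG * (CH * exp (- (B * m * ?q)))"
    unfolding osc_def norm_mult using C_nonneg by (intro mult_mono) auto
  also have "\<dots> = CG * CH * (exp (M * (norm z * norm \<xi>) + s * (1 + M * norm \<xi>)) * exp (- (B * m * ?q)))" by simp
  also have "exp (M * (norm z * norm \<xi>) + s * (1 + M * norm \<xi>)) * exp (- (B * m * ?q)) =
      exp (s + (M * norm z + s * M) * norm \<xi> - B * m * ?q)"
    unfolding exp_add[symmetric] by (simp add: algebra_simps)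
  finally show ?thesis .
qed

lemma osc_integral_holomorphic: "(\<lambda>c. LINT \<xi>|lborel. osc A B s z c \<xi>) holomorphic_on {c. \<bar>Im c\<bar> < Re c}"
proof (rule holomorphic_parametric_integral[OF sector_properties(1) osc_holomorphic])
  show "osc A B s z c \<in> borel_measurable lborel" if "c \<in> {c. \<bar>Im c\<bar> < Re c}" for c
    using osc_measurable[OF that] by simp
  fix c0 :: complex assume c0: "c0 \<in> {c. \<bar>Im c\<bar> < Re c}"
  obtain r where r: "r > 0" "cball c0 r \<subseteq> {c. \<bar>Im c\<bar> < Re c}"
    using open_contains_cball sector_properties(1) c0 by meson
  \<comment> \<open>On the compact disc Re (c^2) attains a positive minimum, so a single Gaussian
    dominates for all c in the disc.\<close>
  have "\<exists>x\<in>cball c0 r. \<forall>y\<in>cball c0 r. Re (x\<^sup>2) \<le> Re (y\<^sup>2)"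
    by (rule continuous_attains_inf) (use r in \<open>auto intro!: continuous_intros\<close>)
  then obtain x where x: "x \<in> cball c0 r" "\<And>y. y \<in> cball c0 r \<Longrightarrow> Re (x\<^sup>2) \<le> Re (y\<^sup>2)" by blast
  define m where "m = Re (x\<^sup>2)"
  have m: "m > 0" unfolding m_def by (rule sector_properties(3)) (use x r in blast)
  define M where "M = cmod c0 + r"
  have M: "cmod c \<le> M" if "c \<in> cball c0 r" for c
    using that norm_triangle_ineq2[of c c0] by (simp add: M_def dist_norm norm_minus_commute)
  show "\<exists>r>0. \<exists>g. cball c0 r \<subseteq> {c. \<bar>Im c\<bar> < Re c} \<and> integrable lborel g \<and>
      (\<forall>c\<in>cball c0 r. \<forall>\<xi>. cmod (osc A B s z c \<xi>) \<le> g \<xi>)"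
  proof (intro exI[of _ r] conjI exI ballI allI)
    show "integrable lborel (\<lambda>\<xi>. CG * CH * exp (s + (M * norm z + s * M) * norm \<xi> - B * m * (norm \<xi>)\<^sup>2))"
      using B m by (intro integrable_mult_right exp_linear_gaussian_integrable) simp
    show "cmod (osc A B s z c \<xi>) \<le> CG * CH * exp (s + (M * norm z + s * M) * norm \<xi> - B * m * (norm \<xi>)\<^sup>2)"
      if "c \<in> cball c0 r" for c \<xi>
      using x(2)[OF that] m M[OF that] by (intro osc_crude_bound) (auto simp: m_def)
  qed (use r in auto)
qed

lemma osc_dilate:
  assumes "c \<in> {c. \<bar>Im c\<bar> < Re c}"
  shows "(LINT \<xi>|lborel. osc A B s z 1 \<xi>) = c ^ DIM('a) * (LINT \<xi>|lborel. osc A B s z c \<xi>)"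
proof (rule dilation_analytic_continuation[OF osc_integral_holomorphic _ osc_measurable assms])
  show "osc A B s z (complex_of_real r) x = osc A B s z 1 (r *\<^sub>R x)" if "r > 0" for r x
    using that by (simp add: osc_def power_mult_distrib mult.assoc)
qed auto

end

end

context analytic_cutoffs
begin

text \<open>With \<open>Im c = \<mu>\<^sup>2 / (2 s)\<close> the phase \<open>s \<langle>c \<xi>\<rangle>\<close> gains \<open>(\<mu> r)\<^sup>2 / (4 \<langle>r\<rangle>)\<close>, \<open>r = norm \<xi>\<close>, while \<open>z \<bullet> c \<xi>\<close>
  loses at most \<open>\<mu> r\<close>.\<close>

lemma osc_phase_decay:
  fixes z \<xi> :: "'a::euclidean_space"
  assumes c: "cmod c = 1" "Im c = \<mu>\<^sup>2 / (2 * s)" "Re c \<ge> 1/2"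
    and \<mu>: "\<mu> \<ge> 16" and s: "s > 0" and z: "norm z \<le> 2 * s / \<mu>"
  shows "Re (\<i> * c * of_real (z \<bullet> \<xi>) + \<i> * of_real s * csqrt (1 + c\<^sup>2 * of_real ((norm \<xi>)\<^sup>2)))
      \<le> 10 - \<mu> * norm \<xi>"
proof -
  define r where "r = norm \<xi>"
  define S where "S = Im c"
  define w where "w = csqrt (1 + c\<^sup>2 * of_real (r\<^sup>2))"
  define J where "J = sqrt (1 + r\<^sup>2)"
  have S: "S > 0" "S = \<mu>\<^sup>2 / (2 * s)" using c(2) \<mu> s by (auto simp: S_def)
  have r: "r \<ge> 0" by (simp add: r_def)
  have J: "J \<ge> 1" "J > 0" by (auto simp: J_def add_pos_nonneg)
  have w2: "w\<^sup>2 = 1 + c\<^sup>2 * of_real (r\<^sup>2)" by (simp add: w_def)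
  have "(cmod w)\<^sup>2 = cmod (1 + c\<^sup>2 * of_real (r\<^sup>2))" unfolding w2[symmetric] by (rule norm_power[symmetric])
  also have "\<dots> \<le> 1 + r\<^sup>2"
    by (rule order_trans[OF norm_triangle_ineq]) (use c(1) in \<open>simp add: norm_mult norm_power\<close>)
  finally have "cmod w \<le> J" unfolding J_def by (rule real_le_rsqrt)
  then have ReJ: "Re w \<le> J" using complex_Re_le_cmod order_trans by blast
  have Re0: "Re w \<ge> 0" unfolding w_def using csqrt_principal[of "1 + c\<^sup>2 * of_real (r\<^sup>2)"] by linarith
  \<comment> \<open>The imaginary part of w^2. Together with Re w <= J and Re c >= 1/2 it forces Im
    w >= r^2 S / (2 J), the decay produced by the phase.\<close>
  have Im2: "Re w * Im w = r\<^sup>2 * (Re c * S)"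
    using arg_cong[OF w2, of Im] by (simp add: Im_power2 S_def algebra_simps)
  have Im0: "Im w \<ge> 0"
  proof (cases "r = 0")
    case True
    then show ?thesis by (simp add: w_def)
  next
    case False
    then have "Re w * Im w > 0" unfolding Im2 using c(3) S(1) r by simp
    then show ?thesis using Re0 by (simp add: zero_less_mult_iff)
  qed
  have "r\<^sup>2 * (1/2 * S) \<le> r\<^sup>2 * (Re c * S)" using c(3) S(1) by (intro mult_left_mono mult_right_mono) auto
  also have "\<dots> \<le> J * Im w" unfolding Im2[symmetric] using ReJ Im0 by (rule mult_right_mono)
  finally have "r\<^sup>2 * S / (2 * J) \<le> Im w" using J by (simp add: field_simps)
  then have "s * (r\<^sup>2 * S / (2 * J)) \<le> s * Im w" by (rule mult_left_mono) (use s in simp)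
  moreover have "s * (r\<^sup>2 * S / (2 * J)) = (\<mu> * r)\<^sup>2 / (4 * J)"
    using s J by (simp add: S(2) power_mult_distrib field_simps)
  moreover have "- (S * (z \<bullet> \<xi>)) \<le> \<mu> * r"
  proof -
    have "- (z \<bullet> \<xi>) \<le> norm z * r" using Cauchy_Schwarz_ineq2[of z \<xi>] unfolding r_def by linarith
    also have "\<dots> \<le> 2 * s / \<mu> * r" using z r by (rule mult_right_mono)
    finally have "S * (- (z \<bullet> \<xi>)) \<le> S * (2 * s / \<mu> * r)" by (rule mult_left_mono) (use S(1) in simp)
    then have "- (S * (z \<bullet> \<xi>)) \<le> S * (2 * s / \<mu> * r)" by simp
    also have "\<dots> = \<mu> * r" using S(2) s \<mu> by (simp add: field_simps power2_eq_square)
    finally show ?thesis .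
  qed
  \<comment> \<open>The gain must pay for the loss \<mu> r and still leave decay exp(-\<mu> r). For
    r <= 1 one has J <= 2, and the square of \<mu> r - 8 gives 2 \<mu> r - 8, with slack up to 10.
    For r > 1 one has J <= 2 r, so the gain is at least \<mu> r * \<mu>/8, and \<mu> >= 16
    suffices.\<close>
  moreover have "2 * (\<mu> * r) - 10 \<le> (\<mu> * r)\<^sup>2 / (4 * J)"
  proof (cases "r \<le> 1")
    case True
    have "J \<le> sqrt 4" unfolding J_def by (rule real_sqrt_le_mono) (use True r power_mono[of r 1 2] in simp)
    then have "(\<mu> * r)\<^sup>2 / 8 \<le> (\<mu> * r)\<^sup>2 / (4 * J)" using J by (intro divide_left_mono) auto
    moreover have "0 \<le> (\<mu> * r - 8)\<^sup>2" by simp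
    then have "2 * (\<mu> * r) - 10 \<le> (\<mu> * r)\<^sup>2 / 8" by (simp add: power2_diff)
    ultimately show ?thesis by linarith
  next
    case False
    have "J \<le> sqrt ((2 * r)\<^sup>2)" unfolding J_def
    proof (rule real_sqrt_le_mono)
      have "1 \<le> r\<^sup>2" using False by (simp add: one_le_power)
      then show "1 + r\<^sup>2 \<le> (2 * r)\<^sup>2" by (simp add: power_mult_distrib)
    qed
    then have "J \<le> 2 * r" unfolding real_sqrt_abs using r by simp
    then have "(\<mu> * r)\<^sup>2 / (4 * (2 * r)) \<le> (\<mu> * r)\<^sup>2 / (4 * J)" using J False by (intro divide_left_mono) auto
    moreover have "(\<mu> * r)\<^sup>2 / (4 * (2 * r)) = (\<mu> * r) * (\<mu> / 8)" using False by (simp add: power2_eq_square)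
    moreover have "(\<mu> * r) * 2 \<le> (\<mu> * r) * (\<mu> / 8)" using \<mu> r by (intro mult_left_mono) auto
    ultimately show ?thesis by linarith
  qed
  moreover have "Re (\<i> * c * of_real (z \<bullet> \<xi>) + \<i> * of_real s * w) = - (S * (z \<bullet> \<xi>)) - s * Im w"
    by (simp add: S_def)
  ultimately have "Re (\<i> * c * of_real (z \<bullet> \<xi>) + \<i> * of_real s * w) \<le> 10 - \<mu> * r" by linarith
  then show ?thesis unfolding w_def r_def .
qed

text \<open>\<open>exp 10\<close> comes from the phase estimate, and (2K)! bounds x^{2K}
  exp(-x).\<close>

definition kernel_const :: real where
  "kernel_const = CG * CH * exp 10 * fact (2 * K)"

lemma kernel_const_nonneg: "kernel_const \<ge> 0"
  unfolding kernel_const_def using C_nonneg by simp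

text \<open>Vanishing of \<open>G\<close> gives (A r^2)^K = (A/\<mu>^2)^K (\<mu> r)^{2K}; the phase
  decay exp(-\<mu> r) absorbs the power of \<mu> r, and the Gaussian of \<open>H\<close> is left
  over for integration. Thus the gain is (A/\<mu>^2)^K, with no loss but the Gaussian
  volume.\<close>

lemma osc_sharp_bound:
  fixes z \<xi> :: "'a::euclidean_space"
  assumes A: "A > 0" and B: "B > 0" and s: "s > 0" and \<mu>: "\<mu> \<ge> 16" and z: "norm z \<le> 2 * s / \<mu>"
    and c: "cmod c = 1" "Im c = \<mu>\<^sup>2 / (2 * s)" "Re c \<ge> 1/2" "Re (c\<^sup>2) \<ge> 1/2"
  shows "cmod (osc A B s z c \<xi>) \<le> kernel_const * (A / \<mu>\<^sup>2) ^ K * exp (- (sqrt B * norm \<xi>)\<^sup>2 / 2)"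
proof -
  let ?q = "(norm \<xi>)\<^sup>2"
  have re: "Re (of_real X * c\<^sup>2 * of_real ?q) = X * Re (c\<^sup>2) * ?q" for X by (simp add: algebra_simps)
  have "cmod (G (of_real A * c\<^sup>2 * of_real ?q)) \<le> CG * cmod (of_real A * c\<^sup>2 * of_real ?q) ^ K"
    by (rule G_vanish) (unfold re, use A c in simp)
  then have g: "cmod (G (of_real A * c\<^sup>2 * of_real ?q)) \<le> CG * (A * ?q) ^ K"
    using A c(1) by (simp add: norm_mult norm_power)
  have "cmod (H (of_real B * c\<^sup>2 * of_real ?q)) \<le> CH * exp (- (B * Re (c\<^sup>2) * ?q))"
    using H_bound[of "of_real B * c\<^sup>2 * of_real ?q"] B c unfolding re by simp
  also have "\<dots> \<le> CH * exp (- (sqrt B * norm \<xi>)\<^sup>2 / 2)"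
  proof (rule mult_left_mono)
    have "B * (1/2) * ?q \<le> B * Re (c\<^sup>2) * ?q" using B c(4) by (intro mult_right_mono mult_left_mono) auto
    then show "exp (- (B * Re (c\<^sup>2) * ?q)) \<le> exp (- (sqrt B * norm \<xi>)\<^sup>2 / 2)"
      using B by (simp add: power_mult_distrib)
  qed (rule C_nonneg)
  finally have h: "cmod (H (of_real B * c\<^sup>2 * of_real ?q)) \<le> CH * exp (- (sqrt B * norm \<xi>)\<^sup>2 / 2)" .
  have e: "cmod (exp (\<i> * c * of_real (z \<bullet> \<xi>) + \<i> * of_real s * csqrt (1 + c\<^sup>2 * of_real ?q))) \<le> exp (10 - \<mu> * norm \<xi>)"
    unfolding norm_exp_eq_Re exp_le_cancel_iff by (rule osc_phase_decay) fact+
  have "cmod (osc A B s z c \<xi>) \<le> exp (10 - \<mu> * norm \<xi>) * (CG * (A * ?q) ^ K) * (CH * exp (- (sqrt B * norm \<xi>)\<^sup>2 / 2))"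
    unfolding osc_def norm_mult using C_nonneg A by (intro mult_mono e g h) auto
  also have "\<dots> = CG * CH * exp 10 * ((A / \<mu>\<^sup>2) ^ K * ((\<mu> * norm \<xi>) ^ (2 * K) * exp (- (\<mu> * norm \<xi>)))) * exp (- (sqrt B * norm \<xi>)\<^sup>2 / 2)"
  proof -
    have "A * ?q = (A / \<mu>\<^sup>2) * (\<mu> * norm \<xi>)\<^sup>2" using \<mu> by (simp add: power_mult_distrib)
    then have "(A * ?q) ^ K = (A / \<mu>\<^sup>2) ^ K * (\<mu> * norm \<xi>) ^ (2 * K)"
      by (simp only: power_mult_distrib power_mult)
    then show ?thesis by (simp add: exp_diff exp_minus field_simps)
  qed
  also have "\<dots> \<le> CG * CH * exp 10 * ((A / \<mu>\<^sup>2) ^ K * fact (2 * K)) * exp (- (sqrt B * norm \<xi>)\<^sup>2 / 2)"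
    using C_nonneg A \<mu> by (intro mult_right_mono mult_left_mono power_exp_minus_le_fact) auto
  finally show ?thesis by (simp add: kernel_const_def mult_ac)
qed

text \<open>The dilation factor c^n has modulus 1 for c on the unit circle, so the rotated integrand
  can be bounded pointwise without further cost.\<close>

lemma kernel_bound:
  fixes z :: "'a::euclidean_space"
  assumes A: "A > 0" and B: "B > 0" and s: "s > 0" and \<mu>: "\<mu> \<ge> 16" "\<mu>\<^sup>2 \<le> s" and z: "norm z \<le> 2 * s / \<mu>"
  shows "cmod (LINT \<xi>|lborel. osc A B s z 1 \<xi>) \<le> kernel_const * (A / \<mu>\<^sup>2) ^ K * (sqrt (2 * pi) / sqrt B) ^ DIM('a)"
proof -
  define S where "S = \<mu>\<^sup>2 / (2 * s)"
  have S: "0 < S" "S \<le> 1/2" using s \<mu> by (auto simp: S_def field_simps)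
  \<comment> \<open>The point of the unit circle with the imaginary part wanted by the phase
    estimate. The hypothesis \<mu>^2 <= s gives S <= 1/2, whence Re c > 1/2 and Re (c^2) = 1 - 2 S^2
    >= 1/2, well inside the sector.\<close>
  define c where "c = Complex (sqrt (1 - S\<^sup>2)) S"
  have S2: "S\<^sup>2 \<le> 1/4" using power_mono[OF S(2), of 2] S(1) by (simp add: power_divide)
  have sq: "sqrt (1 - S\<^sup>2) \<ge> 1/2 * sqrt 3"
  proof -
    have "sqrt (3/4) \<le> sqrt (1 - S\<^sup>2)" by (rule real_sqrt_le_mono) (use S2 in simp)
    then show ?thesis by (simp add: real_sqrt_divide)
  qed
  have s3: "sqrt 3 > (1::real)" by simp
  have c1: "cmod c = 1" using S2 by (simp add: c_def cmod_def)
  have sq2: "sqrt (1 - S\<^sup>2) > 1/2" using sq s3 by linarith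
  have cD: "c \<in> {c. \<bar>Im c\<bar> < Re c}" using S sq2 by (simp add: c_def)
  have cRe: "Re c \<ge> 1/2" using sq2 by (simp add: c_def)
  have c2: "Re (c\<^sup>2) \<ge> 1/2" using S2 by (simp add: c_def power2_eq_square)
  have "cmod (LINT \<xi>|lborel. osc A B s z 1 \<xi>) = cmod (LINT \<xi>|lborel. osc A B s z c \<xi>)"
    using osc_dilate[OF A B less_imp_le[OF s] cD, of z] c1 by (simp add: norm_mult norm_power)
  also have "\<dots> \<le> (LINT \<xi>|lborel. cmod (osc A B s z c \<xi>))" by (rule integral_norm_bound)
  also have "\<dots> \<le> (LINT \<xi>::'a|lborel. kernel_const * (A / \<mu>\<^sup>2) ^ K * exp (- (sqrt B * norm \<xi>)\<^sup>2 / 2))"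
  proof (rule integral_mono')
    show "integrable lborel (\<lambda>\<xi>::'a. kernel_const * (A / \<mu>\<^sup>2) ^ K * exp (- (sqrt B * norm \<xi>)\<^sup>2 / 2))"
      using gaussian_integral(1)[of "sqrt B", where 'a='a] B by simp
    show "cmod (osc A B s z c \<xi>) \<le> kernel_const * (A / \<mu>\<^sup>2) ^ K * exp (- (sqrt B * norm \<xi>)\<^sup>2 / 2)" for \<xi>
      by (rule osc_sharp_bound[OF A B s \<mu>(1) z c1 _ cRe c2]) (simp add: c_def S_def)
    show "0 \<le> kernel_const * (A / \<mu>\<^sup>2) ^ K * exp (- (sqrt B * norm \<xi>)\<^sup>2 / 2)" for \<xi> :: 'a
      using kernel_const_nonneg A by simp
  qed
  also have "\<dots> = kernel_const * (A / \<mu>\<^sup>2) ^ K * (sqrt (2 * pi) / sqrt B) ^ DIM('a)"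
    using gaussian_integral(2)[of "sqrt B", where 'a='a] B by simp
  finally show ?thesis .
qed

end

section \<open>From kernel bounds to bounds of pairings\<close>

text \<open>Two uses of the multiplication formula express the pairing as a double integral of the
  kernel at x - y against g(y) and the conjugate of h(x). The supports confine |x - y| to at most
  \<rho> + R, the only region where the kernel bound is assumed.\<close>

lemma fourier_kernel_pairing:
  fixes g h W :: "'a::euclidean_space \<Rightarrow> complex"
  assumes g: "g \<in> L2" "\<And>x. norm x > \<rho> \<Longrightarrow> g x = 0" and h: "h \<in> L2" "\<And>x. norm x > R \<Longrightarrow> h x = 0"
    and W: "integrable lborel W"
    and \<kappa>: "\<And>z. norm z \<le> \<rho> + R \<Longrightarrow> cmod (LINT \<xi>|lborel. exp (\<i> * of_real (z \<bullet> \<xi>)) * W \<xi>) \<le> \<kappa>"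
    and \<kappa>0: "\<kappa> \<ge> 0"
  shows "cmod (L2_inner (\<lambda>\<xi>. W \<xi> * fourier g \<xi>) (fourier h)) \<le>
      (2 * pi) powr (- real DIM('a)) * \<kappa> * (LINT x|lborel. cmod (g x)) * (LINT x|lborel. cmod (h x))"
proof -
  define c where "c = complex_of_real ((2 * pi) powr (- real DIM('a) / 2))"
  have gi: "integrable lborel g" by (rule L2_bounded_support_integrable(1)[OF g])
  have hi: "integrable lborel h" by (rule L2_bounded_support_integrable(1)[OF h])
  have hi': "integrable lborel (\<lambda>x. cnj (h x))" using hi by simp
  have [measurable]: "g \<in> borel_measurable borel" "h \<in> borel_measurable borel" "W \<in> borel_measurable borel"
    using gi hi W by (auto simp: integrable_iff_bounded)
  define N where "N = (LINT x|lborel. cmod (g x))"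
  have N0: "N \<ge> 0" by (simp add: N_def)
  have Wg: "integrable lborel (\<lambda>\<xi>. W \<xi> * ft g \<xi>)"
  proof (rule Bochner_Integration.integrable_bound)
    let ?C = "(2 * pi) powr (- real DIM('a) / 2) * N"
    show "integrable lborel (\<lambda>\<xi>. of_real ?C * W \<xi>)" using W by simp
    show "AE \<xi> in lborel. norm (W \<xi> * ft g \<xi>) \<le> norm (of_real ?C * W \<xi>)"
    proof (rule AE_I2)
      fix \<xi> :: 'a
      show "norm (W \<xi> * ft g \<xi>) \<le> norm (of_real ?C * W \<xi>)"
        using mult_left_mono[OF ft_bound[of g \<xi>] norm_ge_zero[of "W \<xi>"]] N0
        by (simp add: norm_mult N_def abs_mult mult.commute)
    qed
  qed measurable
  have "L2_inner (\<lambda>\<xi>. W \<xi> * fourier g \<xi>) (fourier h) = L2_inner (\<lambda>\<xi>. W \<xi> * ft g \<xi>) (ft h)"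
  proof (rule L2_inner_cong_AE)
    show "AE \<xi> in lborel. W \<xi> * fourier g \<xi> = W \<xi> * ft g \<xi>"
    proof -
      have "AE \<xi> in lborel. fourier g \<xi> = ft g \<xi>"
        by (rule fourier_bounded_support[OF g(1)]) (rule g(2))
      then show ?thesis by eventually_elim simp
    qed
    show "AE \<xi> in lborel. fourier h \<xi> = ft h \<xi>"
      by (rule fourier_bounded_support[OF h(1)]) (rule h(2))
  qed (use L2_measurable[OF fourier_L2[OF g(1)]] L2_measurable[OF fourier_L2[OF h(1)]] in measurable)
  also have "\<dots> = (LINT \<xi>|lborel. (W (- \<xi>) * ft g (- \<xi>)) * ft (\<lambda>x. cnj (h x)) \<xi>)"
    unfolding L2_inner_def ft_cnj
    using lborel_integral_affine[of "-1" "\<lambda>\<xi>. (W (- \<xi>) * ft g (- \<xi>)) * ft (\<lambda>x. cnj (h x)) \<xi>" 0] by simp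
  also have "\<dots> = (LINT x|lborel. cnj (h x) * ft (\<lambda>\<xi>. W (- \<xi>) * ft g (- \<xi>)) x)"
    by (rule ft_mult[OF hi']) (use lborel_integrable_affine[OF Wg, of "-1" 0] in simp)
  also have "cmod \<dots> \<le> (LINT x|lborel. cmod (cnj (h x) * ft (\<lambda>\<xi>. W (- \<xi>) * ft g (- \<xi>)) x))"
    by (rule integral_norm_bound)
  also have "\<dots> \<le> (LINT x|lborel. ((2 * pi) powr (- real DIM('a)) * \<kappa> * N) * cmod (h x))"
  proof (rule integral_mono')
    fix x :: 'a
    show "cmod (cnj (h x) * ft (\<lambda>\<xi>. W (- \<xi>) * ft g (- \<xi>)) x) \<le> (2 * pi) powr (- real DIM('a)) * \<kappa> * N * cmod (h x)"
    proof (cases "norm x \<le> R")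
      case True
      define k where "k \<xi> = exp (\<i> * of_real (x \<bullet> \<xi>)) * W \<xi>" for \<xi>
      have ki: "integrable lborel k"
        unfolding k_def using ft_integrable_exp[OF W, of "- x"] by (simp add: inner_commute)
      have "ft (\<lambda>\<xi>. W (- \<xi>) * ft g (- \<xi>)) x = ft (\<lambda>\<xi>. W \<xi> * ft g \<xi>) (- x)"
        by (rule ft_reflect) measurable
      also have "\<dots> = c * (LINT \<xi>|lborel. k \<xi> * ft g \<xi>)"
        unfolding ft_def[of "\<lambda>\<xi>. W \<xi> * ft g \<xi>"] k_def c_def by (simp add: inner_commute mult.assoc)
      also have "(LINT \<xi>|lborel. k \<xi> * ft g \<xi>) = (LINT y|lborel. g y * ft k y)" by (rule ft_mult[OF gi ki])
      also have "\<dots> = (LINT y|lborel. g y * (c * (LINT \<xi>|lborel. exp (\<i> * of_real ((x - y) \<bullet> \<xi>)) * W \<xi>)))"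
      proof -
        have "exp (- (\<i> * complex_of_real (\<xi> \<bullet> y))) * k \<xi> = exp (\<i> * of_real ((x - y) \<bullet> \<xi>)) * W \<xi>" for \<xi> y
        proof -
          have "exp (\<i> * complex_of_real ((x - y) \<bullet> \<xi>)) = exp (- (\<i> * complex_of_real (\<xi> \<bullet> y))) * exp (\<i> * of_real (x \<bullet> \<xi>))"
            unfolding exp_add[symmetric] by (simp add: inner_diff_left inner_commute[of y] right_diff_distrib)
          then show ?thesis by (simp add: k_def mult.assoc)
        qed
        then show ?thesis unfolding ft_def c_def by simp
      qed
      finally have "cmod (ft (\<lambda>\<xi>. W (- \<xi>) * ft g (- \<xi>)) x) =
          cmod c * cmod (LINT y|lborel. g y * (c * (LINT \<xi>|lborel. exp (\<i> * of_real ((x - y) \<bullet> \<xi>)) * W \<xi>)))"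
        by (simp add: norm_mult)
      also have "\<dots> \<le> cmod c * (LINT y|lborel. cmod (g y * (c * (LINT \<xi>|lborel. exp (\<i> * of_real ((x - y) \<bullet> \<xi>)) * W \<xi>))))"
        by (intro mult_left_mono integral_norm_bound) simp
      also have "\<dots> \<le> cmod c * (LINT y|lborel. (cmod c * \<kappa>) * cmod (g y))"
      proof (intro mult_left_mono integral_mono')
        fix y
        show "cmod (g y * (c * (LINT \<xi>|lborel. exp (\<i> * of_real ((x - y) \<bullet> \<xi>)) * W \<xi>))) \<le> cmod c * \<kappa> * cmod (g y)"
        proof (cases "norm y \<le> \<rho>")
          case y: True
          have "norm (x - y) \<le> \<rho> + R" using True y norm_triangle_ineq4[of x y] by linarith
          from mult_left_mono[OF \<kappa>[OF this], of "cmod (g y) * cmod c"]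
          show ?thesis by (simp add: norm_mult mult_ac)
        qed (use g(2) in simp)
      qed (use gi \<kappa>0 in auto)
      also have "\<dots> = cmod c * cmod c * \<kappa> * N" unfolding N_def by simp
      also have "cmod c * cmod c = (2 * pi) powr (- real DIM('a))"
        unfolding c_def by (simp add: powr_add[symmetric])
      finally have "cmod (ft (\<lambda>\<xi>. W (- \<xi>) * ft g (- \<xi>)) x) \<le> (2 * pi) powr (- real DIM('a)) * \<kappa> * N" .
      then show ?thesis by (simp add: norm_mult mult.commute[of _ "cmod (h x)"] mult_left_mono)
    qed (use h(2) in simp)
  qed (use hi \<kappa>0 N0 in auto)
  also have "\<dots> = (2 * pi) powr (- real DIM('a)) * \<kappa> * N * (LINT x|lborel. cmod (h x))" by simp
  finally show ?thesis unfolding N_def .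
qed

lemma japanese_measurable [measurable]: "japanese \<in> borel_measurable borel"
  unfolding japanese_def by measurable

lemma japanese_ge_1: "japanese x \<ge> 1" and japanese_ge_norm: "japanese x \<ge> norm x"
  unfolding japanese_def by (auto intro!: real_le_rsqrt)

lemma japanese_pos [simp]: "japanese x > 0"
  using japanese_ge_1[of x] by linarith

context analytic_cutoffs
begin

lemma near_pairing:
  fixes g h :: "'a::euclidean_space \<Rightarrow> complex" and m :: "'a \<Rightarrow> real"
  assumes A: "A > 0" and B: "B > 0" and s: "s > 0" and \<mu>: "\<mu> \<ge> 16" "\<mu>\<^sup>2 \<le> s"
    and g: "g \<in> L2" "\<And>x. norm x > \<rho> \<Longrightarrow> g x = 0" and h: "h \<in> L2" "\<And>x. norm x > R \<Longrightarrow> h x = 0"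
    and \<rho>R: "\<rho> + R \<le> 2 * s / \<mu>"
    and m: "\<And>\<xi>. complex_of_real (m \<xi>) = G (of_real (A * (norm \<xi>)\<^sup>2)) * H (of_real (B * (norm \<xi>)\<^sup>2))"
    and mm [measurable]: "m \<in> borel_measurable borel"
    and \<sigma>: "\<sigma> = 1 \<or> \<sigma> = - 1"
  shows "cmod (L2_inner (\<lambda>\<xi>. (exp (\<i> * of_real (\<sigma> * s * japanese \<xi>)) * of_real (m \<xi>)) * fourier g \<xi>) (fourier h)) \<le>
      (2 * pi) powr (- real DIM('a)) * (kernel_const * (A / \<mu>\<^sup>2) ^ K * (sqrt (2 * pi) / sqrt B) ^ DIM('a)) *
      (LINT x|lborel. cmod (g x)) * (LINT x|lborel. cmod (h x))"
proof (rule fourier_kernel_pairing[OF g h])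
  have e [measurable]: "(\<lambda>\<xi>::'a. exp (\<i> * of_real (\<sigma> * s * japanese \<xi>))) \<in> borel_measurable borel"
    unfolding japanese_def by (intro borel_measurable_continuous_onI continuous_intros)
  show "integrable lborel (\<lambda>\<xi>. exp (\<i> * of_real (\<sigma> * s * japanese \<xi>)) * of_real (m \<xi>))"
  proof (rule Bochner_Integration.integrable_bound)
    show "integrable lborel (\<lambda>\<xi>::'a. CG * CH * exp (0 + 0 * norm \<xi> - B * (norm \<xi>)\<^sup>2))"
      using B by (intro integrable_mult_right exp_linear_gaussian_integrable)
    show "AE \<xi> in lborel. norm (exp (\<i> * of_real (\<sigma> * s * japanese \<xi>)) * of_real (m \<xi>)) \<le> norm (CG * CH * exp (0 + 0 * norm \<xi> - B * (norm \<xi>)\<^sup>2))"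
    proof (rule AE_I2)
      fix \<xi> :: 'a
      have "cmod (of_real (m \<xi>)) \<le> CG * (CH * exp (- (B * (norm \<xi>)\<^sup>2)))"
        unfolding m norm_mult using G_bound[of "of_real (A * (norm \<xi>)\<^sup>2)"] H_bound[of "of_real (B * (norm \<xi>)\<^sup>2)"] A B C_nonneg
        by (intro mult_mono) auto
      then show "norm (exp (\<i> * of_real (\<sigma> * s * japanese \<xi>)) * of_real (m \<xi>)) \<le> norm (CG * CH * exp (0 + 0 * norm \<xi> - B * (norm \<xi>)\<^sup>2))"
        using C_nonneg by (simp add: norm_mult abs_mult norm_exp_i_times[of "\<sigma> * s * japanese \<xi>", simplified])
    qed
  qed measurable
  show "0 \<le> kernel_const * (A / \<mu>\<^sup>2) ^ K * (sqrt (2 * pi) / sqrt B) ^ DIM('a)"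
    using kernel_const_nonneg A B by simp
  fix z :: 'a assume "norm z \<le> \<rho> + R"
  then have z: "norm z \<le> 2 * s / \<mu>" using \<rho>R by linarith
  have osc1: "osc A B s z 1 \<xi> = exp (\<i> * of_real (z \<bullet> \<xi>)) * (exp (\<i> * of_real (s * japanese \<xi>)) * of_real (m \<xi>))" for z \<xi> :: 'a
  proof -
    have "csqrt (1 + 1\<^sup>2 * complex_of_real ((norm \<xi>)\<^sup>2)) = of_real (japanese \<xi>)"
      unfolding japanese_def using of_real_sqrt[of "1 + (norm \<xi>)\<^sup>2"] by simp
    then show ?thesis unfolding osc_def m by (simp add: exp_add mult.assoc)
  qed
  show "cmod (LINT \<xi>|lborel. exp (\<i> * of_real (z \<bullet> \<xi>)) * (exp (\<i> * of_real (\<sigma> * s * japanese \<xi>)) * of_real (m \<xi>)))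
      \<le> kernel_const * (A / \<mu>\<^sup>2) ^ K * (sqrt (2 * pi) / sqrt B) ^ DIM('a)"
    using \<sigma>
  proof
    assume "\<sigma> = 1"
    then show ?thesis using kernel_bound[OF A B s \<mu> z] unfolding osc1 by simp
  next
    assume "\<sigma> = - 1"
    \<comment> \<open>The symbol m is real, so conjugation reverses the sign of the time phase and
      sends z to -z; the kernel estimate sees only the norm of z.\<close>
    then have "exp (\<i> * of_real (z \<bullet> \<xi>)) * (exp (\<i> * of_real (\<sigma> * s * japanese \<xi>)) * of_real (m \<xi>)) = cnj (osc A B s (- z) 1 \<xi>)" for \<xi> :: 'a
      unfolding osc1 by (simp add: exp_cnj)
    then have "(LINT \<xi>|lborel. exp (\<i> * of_real (z \<bullet> \<xi>)) * (exp (\<i> * of_real (\<sigma> * s * japanese \<xi>)) * of_real (m \<xi>))) =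
        cnj (LINT \<xi>|lborel. osc A B s (- z) 1 \<xi>)"
      by (simp only: Bochner_Integration.integral_cnj)
    then show ?thesis using kernel_bound[OF A B s \<mu>, of "- z"] z by simp
  qed
qed

end

lemma L2_ball_L1_bound:
  fixes f :: "'a::euclidean_space \<Rightarrow> complex"
  assumes f: "f \<in> L2" and R: "\<And>x. norm x > R \<Longrightarrow> f x = 0" and R0: "R \<ge> 0" "R \<le> s"
  shows "(LINT x|lborel. cmod (f x)) \<le> sqrt (unit_ball_vol (real DIM('a)) * s ^ DIM('a)) * L2_norm f"
proof -
  have "(LINT x|lborel. cmod (f x)) \<le> sqrt (measure lborel (cball (0::'a) R)) * L2_norm f"
    by (rule L2_bounded_support_integrable(2)[OF f R])
  also have "measure lborel (cball (0::'a) R) = unit_ball_vol (real DIM('a)) * R ^ DIM('a)"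
    by (rule content_cball[OF R0(1)])
  also have "sqrt (unit_ball_vol (real DIM('a)) * R ^ DIM('a)) * L2_norm f \<le> sqrt (unit_ball_vol (real DIM('a)) * s ^ DIM('a)) * L2_norm f"
    using R0 by (intro mult_right_mono real_sqrt_le_mono mult_left_mono power_mono) auto
  finally show ?thesis .
qed

context analytic_cutoffs
begin

section \<open>The propagation estimate\<close>

text \<open>The first summand pays for the part of the source far from the origin, the second for
  the near part treated by the kernel.\<close>

definition propagation_const :: "nat \<Rightarrow> real" where
  "propagation_const n = CG * CH + (2 * pi) powr (- real n) * (kernel_const * sqrt (2 * pi) ^ n) * unit_ball_vol (real n)"

lemma propagation_const_nonneg: "propagation_const n \<ge> 0"
  unfolding propagation_const_def using C_nonneg kernel_const_nonneg by simp

text \<open>The source g is cut at radius \<rho> = s/\<mu>. Outside, the weight yields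
  \<rho>^{-\<sigma>}. Inside, points of g and of h are at most 2 s/\<mu> apart, where the kernel
  bound applies with gain s^{-2 \<epsilon> K}. The volume factors cost at most s^{2n}: s^n from
  passing to L^1 norms on balls and s^n from the high-frequency scale. The condition on K leaves
  s^{-2}.\<close>

lemma propagation_estimate:
  fixes g h :: "'a::euclidean_space \<Rightarrow> complex" and m :: "'a \<Rightarrow> real"
  assumes \<epsilon>: "\<epsilon> > 0" "\<alpha> + \<gamma> + \<epsilon> \<le> 1" "2 * \<gamma> + 2 * \<epsilon> \<le> 1" and \<gamma>: "\<gamma> \<ge> 0" and \<beta>: "\<beta> \<le> 1" and \<alpha>: "\<alpha> \<ge> 0"
    and K: "2 * real DIM('a) + 2 \<le> 2 * \<epsilon> * real K"
    and \<sigma>: "\<sigma> \<ge> 0"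
    and t: "t \<ge> 1" and s: "s \<ge> t" "s powr \<epsilon> \<ge> 16"
    and g: "g \<in> borel_measurable borel" "(\<lambda>x. complex_of_real (japanese x powr \<sigma>) * g x) \<in> L2"
      "L2_norm (\<lambda>x. complex_of_real (japanese x powr \<sigma>) * g x) \<le> E"
    and h: "h \<in> L2" "\<And>x. norm x > t powr \<alpha> \<Longrightarrow> h x = 0"
    and m: "\<And>\<xi>. complex_of_real (m \<xi>) = G (of_real (t powr (2 * \<gamma>) * (norm \<xi>)\<^sup>2)) * H (of_real (t powr (- 2 * \<beta>) * (norm \<xi>)\<^sup>2))"
    and mm [measurable]: "m \<in> borel_measurable borel"
    and \<omega>: "\<omega> = 1 \<or> \<omega> = - 1"
  shows "cmod (L2_inner (\<lambda>\<xi>. (exp (\<i> * of_real (\<omega> * s * japanese \<xi>)) * of_real (m \<xi>)) * fourier g \<xi>) (fourier h)) \<le>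
      propagation_const DIM('a) * s powr (- min 2 (\<sigma> * (1 - \<epsilon> - \<gamma>))) * E * L2_norm h"
proof -
  note [measurable] = g(1)
  \<comment> \<open>The excess s^\<epsilon> over the inverse threshold t^\<gamma> is the source of
    all decay, since t^{2\<gamma>}/\<mu>^2 = s^{-2\<epsilon>}. The hypotheses on exponents say that
    \<mu>^2 <= s and that t^\<alpha> <= s/\<mu>.\<close>
  define \<mu> where "\<mu> = s powr \<epsilon> * t powr \<gamma>"
  define \<rho> where "\<rho> = s / \<mu>"
  have pos: "s > 0" "t > 0" "s \<ge> 1" using t s by auto
  have t\<gamma>: "t powr \<gamma> \<ge> 1" using t \<gamma> by (rule ge_one_powr_ge_zero)
  have \<mu>16: "\<mu> \<ge> 16" using mult_mono[OF s(2) t\<gamma>] by (simp add: \<mu>_def)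
  have ts: "t powr p \<le> s powr p" if "p \<ge> 0" for p using that pos s(1) by (intro powr_mono2) auto
  have \<mu>2: "\<mu>\<^sup>2 = s powr (2 * \<epsilon>) * t powr (2 * \<gamma>)"
    by (simp add: \<mu>_def power2_eq_square powr_add[symmetric] mult_ac)
  have \<mu>s: "\<mu>\<^sup>2 \<le> s"
  proof -
    have "\<mu>\<^sup>2 \<le> s powr (2 * \<epsilon>) * s powr (2 * \<gamma>)" unfolding \<mu>2 using ts[of "2 * \<gamma>"] \<gamma> by (intro mult_left_mono) auto
    also have "\<dots> \<le> s powr 1" unfolding powr_add[symmetric] using \<epsilon>(3) pos by (intro powr_mono) auto
    finally show ?thesis using pos by simp
  qed
  have \<rho>0: "\<rho> > 0" using pos \<mu>16 by (simp add: \<rho>_def)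
  have R\<rho>: "t powr \<alpha> \<le> \<rho>"
  proof -
    have "t powr \<alpha> * \<mu> = s powr \<epsilon> * t powr (\<alpha> + \<gamma>)" by (simp add: \<mu>_def powr_add mult_ac)
    also have "\<dots> \<le> s powr \<epsilon> * s powr (\<alpha> + \<gamma>)" using ts[of "\<alpha> + \<gamma>"] \<alpha> \<gamma> by (intro mult_left_mono) auto
    also have "\<dots> \<le> s powr 1" unfolding powr_add[symmetric] using \<epsilon>(2) pos by (intro powr_mono) auto
    finally show ?thesis using \<mu>16 pos by (simp add: \<rho>_def field_simps)
  qed
  have \<rho>s: "\<rho> \<le> s" using \<mu>16 pos by (simp add: \<rho>_def field_simps)
  have E0: "E \<ge> 0" using order_trans[OF L2_norm_nonneg g(3)] .
  have j1: "japanese x powr \<sigma> \<ge> 1" for x :: 'a using japanese_ge_1[of x] \<sigma> by (rule ge_one_powr_ge_zero)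
  have le1: "cmod (g x) \<le> 1 * cmod (complex_of_real (japanese x powr \<sigma>) * g x)" for x
    using mult_right_mono[OF j1[of x] norm_ge_zero[of "g x"]] by (simp add: norm_mult)
  have gL2: "g \<in> L2" by (rule L2_bound[OF g(2,1) le1])
  have gE: "L2_norm g \<le> E" using L2_norm_mono[OF g(2,1) le1] g(3) by simp
  let ?i = "\<lambda>x::'a. indicator (cball 0 \<rho>) x :: complex"
  define g1 where "g1 x = ?i x * g x" for x
  define g2 where "g2 x = g x - g1 x" for x
  have [measurable]: "?i \<in> borel_measurable borel" by (intro borel_measurable_indicator) simp
  have g1L: "g1 \<in> L2" unfolding g1_def by (rule L2_truncate[OF gL2])
  have g2L: "g2 \<in> L2" unfolding g2_def by (rule L2_diff[OF gL2 g1L])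
  have g1E: "L2_norm g1 \<le> E"
  proof -
    have "L2_norm g1 \<le> 1 * L2_norm g"
      unfolding g1_def by (rule L2_norm_mult_bounded[OF gL2]) (auto simp: indicator_def)
    then show ?thesis using gE by simp
  qed
  have g1s: "g1 x = 0" if "norm x > \<rho>" for x using that by (simp add: g1_def indicator_def)
  have g2E: "L2_norm g2 \<le> \<rho> powr (- \<sigma>) * E"
  proof -
    have "L2_norm g2 \<le> \<rho> powr (- \<sigma>) * L2_norm (\<lambda>x. complex_of_real (japanese x powr \<sigma>) * g x)"
    proof (rule L2_norm_mono[OF g(2)])
      show "g2 \<in> borel_measurable borel" by (rule L2_measurable[OF g2L])
      fix x :: 'a
      show "cmod (g2 x) \<le> \<rho> powr (- \<sigma>) * cmod (complex_of_real (japanese x powr \<sigma>) * g x)"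
      proof (cases "norm x \<le> \<rho>")
        case True
        then show ?thesis by (simp add: g2_def g1_def indicator_def)
      next
        case False
        have "\<rho> powr \<sigma> \<le> japanese x powr \<sigma>"
          using False \<rho>0 \<sigma> japanese_ge_norm[of x] by (intro powr_mono2) auto
        then have "1 \<le> \<rho> powr (- \<sigma>) * japanese x powr \<sigma>" using \<rho>0 by (simp add: powr_minus field_simps)
        from mult_right_mono[OF this norm_ge_zero[of "g x"]] False show ?thesis
          by (simp add: g2_def g1_def indicator_def norm_mult mult.assoc)
      qed
    qed simp
    also have "\<dots> \<le> \<rho> powr (- \<sigma>) * E" by (intro mult_left_mono g) simp
    finally show ?thesis .
  qed
  \<comment> \<open>The second entry is the rate of the far part; the cap 2 is the rate that the
    choice of K secures for the near part.\<close>
  define \<kappa> where "\<kappa> = min 2 (\<sigma> * (1 - \<epsilon> - \<gamma>))"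
  have \<rho>\<kappa>: "\<rho> powr (- \<sigma>) \<le> s powr (- \<kappa>)"
  proof -
    have "s powr (1 - \<epsilon> - \<gamma>) \<le> \<rho>"
    proof -
      have "s powr (1 - \<epsilon> - \<gamma>) * \<mu> \<le> s powr (1 - \<epsilon> - \<gamma>) * (s powr \<epsilon> * s powr \<gamma>)"
        unfolding \<mu>_def using ts[OF \<gamma>] by (intro mult_left_mono) auto
      also have "\<dots> = s" using pos by (simp add: powr_add[symmetric])
      finally show ?thesis using \<mu>16 by (simp add: \<rho>_def field_simps)
    qed
    then have "\<rho> powr (- \<sigma>) \<le> (s powr (1 - \<epsilon> - \<gamma>)) powr (- \<sigma>)"
      using \<sigma> pos by (intro powr_mono2') auto
    also have "\<dots> = s powr (- (\<sigma> * (1 - \<epsilon> - \<gamma>)))" by (simp add: powr_powr mult.commute)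
    also have "\<dots> \<le> s powr (- \<kappa>)" using pos by (intro powr_mono) (auto simp: \<kappa>_def)
    finally show ?thesis .
  qed
  define W where "W \<xi> = exp (\<i> * of_real (\<omega> * s * japanese \<xi>)) * complex_of_real (m \<xi>)" for \<xi> :: 'a
  have [measurable]: "(\<lambda>\<xi>::'a. exp (\<i> * of_real (\<omega> * s * japanese \<xi>))) \<in> borel_measurable borel"
    unfolding japanese_def by (intro borel_measurable_continuous_onI continuous_intros)
  have Wm [measurable]: "W \<in> borel_measurable borel" unfolding W_def by measurable
  have Wb: "cmod (W \<xi>) \<le> CG * CH" for \<xi>
  proof -
    have "cmod (H (of_real (t powr (- 2 * \<beta>) * (norm \<xi>)\<^sup>2))) \<le> CH * exp (- (t powr (- 2 * \<beta>) * (norm \<xi>)\<^sup>2))"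
      using H_bound[of "of_real (t powr (- 2 * \<beta>) * (norm \<xi>)\<^sup>2)"] by simp
    also have "\<dots> \<le> CH * 1" using C_nonneg by (intro mult_left_mono) auto
    finally have "cmod (complex_of_real (m \<xi>)) \<le> CG * (CH * 1)"
      unfolding m norm_mult using C_nonneg by (intro mult_mono G_bound) auto
    then show ?thesis by (simp add: W_def norm_mult)
  qed
  have WL: "(\<lambda>\<xi>. W \<xi> * fourier f \<xi>) \<in> L2" if "f \<in> L2" for f
    by (rule L2_mult_bounded[OF fourier_L2[OF that] Wm Wb])
  have far: "cmod (L2_inner (\<lambda>\<xi>. W \<xi> * fourier g2 \<xi>) (fourier h)) \<le> CG * CH * s powr (- \<kappa>) * E * L2_norm h"
  proof -
    have "cmod (L2_inner (\<lambda>\<xi>. W \<xi> * fourier g2 \<xi>) (fourier h)) \<le> L2_norm (\<lambda>\<xi>. W \<xi> * fourier g2 \<xi>) * L2_norm (fourier h)"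
      by (rule L2_Cauchy_Schwarz[OF WL[OF g2L] fourier_L2[OF h(1)]])
    also have "\<dots> \<le> (CG * CH * (s powr (- \<kappa>) * E)) * L2_norm h"
      unfolding fourier_norm[OF h(1)]
    proof (intro mult_right_mono)
      have "L2_norm (\<lambda>\<xi>. W \<xi> * fourier g2 \<xi>) \<le> CG * CH * L2_norm g2"
        using L2_norm_mult_bounded[OF fourier_L2[OF g2L] Wm Wb] unfolding fourier_norm[OF g2L] .
      also have "\<dots> \<le> CG * CH * (s powr (- \<kappa>) * E)"
        using C_nonneg E0 by (intro mult_left_mono order_trans[OF g2E] mult_right_mono \<rho>\<kappa>) auto
      finally show "L2_norm (\<lambda>\<xi>. W \<xi> * fourier g2 \<xi>) \<le> CG * CH * (s powr (- \<kappa>) * E)" .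
    qed simp
    finally show ?thesis by (simp add: mult_ac)
  qed
  let ?n = "DIM('a)" and ?V = "unit_ball_vol (real DIM('a))"
  have near: "cmod (L2_inner (\<lambda>\<xi>. W \<xi> * fourier g1 \<xi>) (fourier h)) \<le>
      (2 * pi) powr (- real ?n) * (kernel_const * sqrt (2 * pi) ^ ?n) * ?V * s powr (- \<kappa>) * E * L2_norm h"
  proof -
    have "cmod (L2_inner (\<lambda>\<xi>. W \<xi> * fourier g1 \<xi>) (fourier h)) \<le>
        (2 * pi) powr (- real ?n) * (kernel_const * (t powr (2 * \<gamma>) / \<mu>\<^sup>2) ^ K * (sqrt (2 * pi) / sqrt (t powr (- 2 * \<beta>))) ^ ?n) *
        (LINT x|lborel. cmod (g1 x)) * (LINT x|lborel. cmod (h x))"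
      unfolding W_def
      by (rule near_pairing[where \<rho>=\<rho> and R="t powr \<alpha>", OF _ _ pos(1) \<mu>16 \<mu>s g1L g1s h _ m mm \<omega>])
        (use pos R\<rho> in \<open>auto simp: \<rho>_def\<close>)
    also have "\<dots> \<le> (2 * pi) powr (- real ?n) * (kernel_const * s powr (- (2 * \<epsilon> * real K)) * (sqrt (2 * pi) ^ ?n * s ^ ?n)) *
        (sqrt (?V * s ^ ?n) * E) * (sqrt (?V * s ^ ?n) * L2_norm h)"
    proof (intro mult_mono mult_left_mono)
      show "(LINT x|lborel. cmod (g1 x)) \<le> sqrt (?V * s ^ ?n) * E"
        by (rule order_trans[OF L2_ball_L1_bound[OF g1L g1s _ \<rho>s]]) (use \<rho>0 g1E pos in \<open>auto intro!: mult_left_mono\<close>)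
      show "(LINT x|lborel. cmod (h x)) \<le> sqrt (?V * s ^ ?n) * L2_norm h"
        by (rule L2_ball_L1_bound[where R="t powr \<alpha>", OF h(1)]) (use h(2) R\<rho> \<rho>s in auto)
      have "t powr (2 * \<gamma>) / \<mu>\<^sup>2 = s powr (- (2 * \<epsilon>))"
        unfolding \<mu>2 using pos by (simp add: powr_minus field_simps)
      then show "(t powr (2 * \<gamma>) / \<mu>\<^sup>2) ^ K \<le> s powr (- (2 * \<epsilon> * real K))"
        using pos by (simp add: powr_realpow[symmetric] powr_powr)
      have "sqrt (t powr (- 2 * \<beta>)) = t powr (- \<beta>)"
        using pos by (simp add: powr_half_sqrt[symmetric] powr_powr)
      then have "sqrt (2 * pi) / sqrt (t powr (- 2 * \<beta>)) = sqrt (2 * pi) * t powr \<beta>"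
        by (simp add: powr_minus divide_inverse)
      moreover have "t powr \<beta> \<le> s"
      proof -
        have "t powr \<beta> \<le> t powr 1" using t \<beta> by (intro powr_mono) auto
        then show ?thesis using pos s by simp
      qed
      ultimately show "(sqrt (2 * pi) / sqrt (t powr (- 2 * \<beta>))) ^ ?n \<le> sqrt (2 * pi) ^ ?n * s ^ ?n"
        unfolding power_mult_distrib[symmetric] by (intro power_mono) auto
    qed (use kernel_const_nonneg pos E0 in auto)
    also have "\<dots> = (2 * pi) powr (- real ?n) * (kernel_const * sqrt (2 * pi) ^ ?n) * ?V * (s ^ ?n * s ^ ?n * s powr (- (2 * \<epsilon> * real K))) * E * L2_norm h"
    proof -
      have "sqrt (?V * s ^ ?n) * sqrt (?V * s ^ ?n) = ?V * s ^ ?n" using pos by simp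
      moreover have "a * (k * b * (c * d)) * (v * E) * (v * l) = a * (k * c) * (v * v) * (d * b) * E * l" for a k b c d v l :: real by simp
      ultimately show ?thesis by (simp add: mult_ac)
    qed
    also have "\<dots> \<le> (2 * pi) powr (- real ?n) * (kernel_const * sqrt (2 * pi) ^ ?n) * ?V * s powr (- \<kappa>) * E * L2_norm h"
    proof (intro mult_right_mono mult_left_mono)
      have "s ^ ?n * s ^ ?n * s powr (- (2 * \<epsilon> * real K)) = s powr (real ?n + real ?n - 2 * \<epsilon> * real K)"
        using pos by (simp add: powr_realpow[symmetric] powr_add[symmetric])
      also have "\<dots> \<le> s powr (- \<kappa>)" using pos K by (intro powr_mono) (auto simp: \<kappa>_def)
      finally show "s ^ ?n * s ^ ?n * s powr (- (2 * \<epsilon> * real K)) \<le> s powr (- \<kappa>)" .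
    qed (use kernel_const_nonneg E0 in auto)
    finally show ?thesis .
  qed
  have "L2_inner (\<lambda>\<xi>. W \<xi> * fourier g \<xi>) (fourier h) = L2_inner (\<lambda>\<xi>. W \<xi> * fourier g1 \<xi> + W \<xi> * fourier g2 \<xi>) (fourier h)"
  proof (rule L2_inner_cong_AE)
    show "AE \<xi> in lborel. W \<xi> * fourier g \<xi> = W \<xi> * fourier g1 \<xi> + W \<xi> * fourier g2 \<xi>"
      using fourier_diff[OF gL2 g1L] unfolding g2_def[symmetric] by eventually_elim (simp add: distrib_left[symmetric])
  qed (auto intro!: L2_measurable L2_add WL fourier_L2 gL2 g1L g2L h)
  also have "\<dots> = L2_inner (\<lambda>\<xi>. W \<xi> * fourier g1 \<xi>) (fourier h) + L2_inner (\<lambda>\<xi>. W \<xi> * fourier g2 \<xi>) (fourier h)"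
    by (intro L2_inner_add_left WL fourier_L2 g1L g2L h)
  also have "cmod \<dots> \<le> (2 * pi) powr (- real ?n) * (kernel_const * sqrt (2 * pi) ^ ?n) * ?V * s powr (- \<kappa>) * E * L2_norm h
      + CG * CH * s powr (- \<kappa>) * E * L2_norm h"
    by (rule norm_triangle_le[OF add_mono[OF near far]])
  also have "\<dots> = propagation_const ?n * s powr (- \<kappa>) * E * L2_norm h"
    by (simp add: propagation_const_def algebra_simps)
  finally show ?thesis unfolding W_def \<kappa>_def .
qed

end

section \<open>Duhamel's formula for the half waves\<close>

lemma japanese_nonzero [simp]: "japanese x \<noteq> 0"
  using japanese_pos[of x] by linarith

lemma L2_tendsto_dominated_within:
  fixes f :: "'a::euclidean_space \<Rightarrow> complex" and m :: "real \<Rightarrow> 'a \<Rightarrow> complex"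
  assumes "f \<in> L2" "\<And>s. m s \<in> borel_measurable borel"
    and "\<And>s x. cmod (m s x) \<le> C" "\<And>x. ((\<lambda>s. m s x) \<longlongrightarrow> 0) (at t within S)"
  shows "((\<lambda>s. L2_norm (\<lambda>x. m s x * f x)) \<longlongrightarrow> 0) (at t within S)"
  unfolding tendsto_at_iff_sequentially comp_def
proof (intro allI impI)
  fix X assume X: "\<forall>i. X i \<in> S - {t}" "X \<longlonglongrightarrow> t"
  show "(\<lambda>n. L2_norm (\<lambda>x. m (X n) x * f x)) \<longlonglongrightarrow> 0"
  proof (rule L2_tendsto_dominated[OF assms(1,2,3)])
    show "AE x in lborel. (\<lambda>n. m (X n) x) \<longlonglongrightarrow> 0"
      using assms(4) X unfolding tendsto_at_iff_sequentially comp_def by blast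
  qed
qed

lemma has_vector_derivative_quotient:
  fixes f :: "real \<Rightarrow> complex"
  assumes "((\<lambda>y. (f y - f x) / of_real (y - x)) \<longlongrightarrow> D) (at x within S)"
  shows "(f has_vector_derivative D) (at x within S)"
proof -
  have "((\<lambda>y. norm ((f y - f x) / of_real (y - x) - D)) \<longlongrightarrow> 0) (at x within S)"
    using assms by (intro tendsto_norm_zero LIM_zero)
  moreover have "\<forall>\<^sub>F y in at x within S. norm ((f y - f x) / of_real (y - x) - D) = norm ((1 / norm (y - x)) *\<^sub>R (f y - (f x + (y - x) *\<^sub>R D)))"
    unfolding eventually_at_filter
  proof (intro always_eventually allI impI)
    fix y assume "y \<noteq> x"
    then have d: "complex_of_real (y - x) \<noteq> 0" by simp
    have "a / d - D = (a - d * D) / d" if "d \<noteq> 0" for a d :: complex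
      using that by (simp add: diff_divide_distrib)
    from this[OF d, of "f y - f x"]
    have "(f y - f x) / of_real (y - x) - D = (f y - (f x + (y - x) *\<^sub>R D)) / of_real (y - x)"
      unfolding scaleR_conv_of_real diff_diff_add .
    then show "norm ((f y - f x) / of_real (y - x) - D) = norm ((1 / norm (y - x)) *\<^sub>R (f y - (f x + (y - x) *\<^sub>R D)))"
      by (simp only: norm_divide norm_of_real norm_scaleR) simp
  qed
  ultimately have "((\<lambda>y. norm ((1 / norm (y - x)) *\<^sub>R (f y - (f x + (y - x) *\<^sub>R D)))) \<longlongrightarrow> 0) (at x within S)"
    by (rule Lim_transform_eventually)
  then show ?thesis
    unfolding has_vector_derivative_def has_derivative_within
    by (intro conjI bounded_linear_scaleR_left) (rule tendsto_norm_zero_cancel)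
qed

lemma cmod_exp_i_diff_le: "cmod (exp (- (\<i> * complex_of_real a)) - exp (- (\<i> * complex_of_real b))) \<le> \<bar>a - b\<bar>"
proof -
  have "exp (- (\<i> * complex_of_real a)) - exp (- (\<i> * complex_of_real b)) = exp (- (\<i> * complex_of_real b)) * (iexp (b - a) - 1)"
    by (simp add: right_diff_distrib exp_add[symmetric])
  then have "cmod (exp (- (\<i> * complex_of_real a)) - exp (- (\<i> * complex_of_real b))) = cmod (iexp (b - a) - 1)"
    by (simp add: norm_mult)
  also have "\<dots> \<le> \<bar>b - a\<bar>" using iexp_approx1[of "b - a" 0] by simp
  finally show ?thesis by simp
qed

section \<open>Rotated test functions\<close>

text \<open>The adjoint of multiplication by exp(i \<omega> t <xi>). The oscillation is put on the
  test function, where it can be differentiated in time.\<close>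

definition rot :: "real \<Rightarrow> real \<Rightarrow> ('a::euclidean_space \<Rightarrow> complex) \<Rightarrow> 'a \<Rightarrow> complex" where
  "rot \<omega> t \<psi> \<xi> = exp (- (\<i> * complex_of_real (\<omega> * t * japanese \<xi>))) * \<psi> \<xi>"

lemma exp_japanese_measurable [measurable]:
  "(\<lambda>\<xi>::'a::euclidean_space. exp (- (\<i> * complex_of_real (c * japanese \<xi>)))) \<in> borel_measurable borel"
  unfolding japanese_def by (intro borel_measurable_continuous_onI continuous_intros)

lemma rot_L2: "\<psi> \<in> L2 \<Longrightarrow> rot \<omega> t \<psi> \<in> L2"
  unfolding rot_def by (rule L2_mult_bounded[where C=1]) auto

lemma rot_japanese: "(\<lambda>\<xi>. complex_of_real (japanese \<xi>) * rot \<omega> t \<psi> \<xi>) = rot \<omega> t (\<lambda>\<xi>. complex_of_real (japanese \<xi>) * \<psi> \<xi>)"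
  unfolding rot_def by (intro ext mult.left_commute)

lemma rot_tendsto:
  assumes "\<psi> \<in> L2"
  shows "L2_tendsto (\<lambda>s. rot \<omega> s \<psi>) (rot \<omega> t \<psi>) (at t within S)"
proof -
  let ?e = "\<lambda>s \<xi>. exp (- (\<i> * complex_of_real (\<omega> * s * japanese \<xi>)))"
  have "((\<lambda>s. L2_norm (\<lambda>\<xi>. (?e s \<xi> - ?e t \<xi>) * \<psi> \<xi>)) \<longlongrightarrow> 0) (at t within S)"
  proof (rule L2_tendsto_dominated_within[OF assms, where C=2])
    show "cmod (?e s \<xi> - ?e t \<xi>) \<le> 2" for s \<xi>
      using norm_triangle_ineq4[of "?e s \<xi>" "?e t \<xi>"] by simp
    fix \<xi> :: 'a
    have "((\<lambda>s. ?e s \<xi> - ?e t \<xi>) \<longlongrightarrow> ?e t \<xi> - ?e t \<xi>) (at t within S)"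
      by (intro tendsto_intros)
    then show "((\<lambda>s. ?e s \<xi> - ?e t \<xi>) \<longlongrightarrow> 0) (at t within S)" by simp
  qed measurable
  then show ?thesis unfolding L2_tendsto_def using rot_L2[OF assms] by (simp add: rot_def left_diff_distrib)
qed

text \<open>The difference quotient of the phase, divided by <xi>, is bounded by |\<omega>|
  uniformly in s and xi. One weight <xi> on the test function is thus the price of dominated
  convergence.\<close>

lemma rot_derivative:
  assumes \<psi>: "\<psi> \<in> L2" and J: "(\<lambda>\<xi>. complex_of_real (japanese \<xi>) * \<psi> \<xi>) \<in> L2"
  shows "L2_tendsto (\<lambda>s \<xi>. (rot \<omega> s \<psi> \<xi> - rot \<omega> t \<psi> \<xi>) / of_real (s - t))
    (\<lambda>\<xi>. - (\<i> * of_real \<omega>) * rot \<omega> t (\<lambda>\<xi>. complex_of_real (japanese \<xi>) * \<psi> \<xi>) \<xi>) (at t within S)"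
proof -
  let ?e = "\<lambda>s \<xi>. exp (- (\<i> * complex_of_real (\<omega> * s * japanese \<xi>)))"
  let ?m = "\<lambda>s \<xi>. (?e s \<xi> - ?e t \<xi>) / (of_real (s - t) * of_real (japanese \<xi>)) + \<i> * of_real \<omega> * ?e t \<xi>"
  have "((\<lambda>s. L2_norm (\<lambda>\<xi>. ?m s \<xi> * (complex_of_real (japanese \<xi>) * \<psi> \<xi>))) \<longlongrightarrow> 0) (at t within S)"
  proof (rule L2_tendsto_dominated_within[OF J, where C="2 * \<bar>\<omega>\<bar>"])
    show "?m s \<in> borel_measurable borel" for s by measurable
    show "cmod (?m s \<xi>) \<le> 2 * \<bar>\<omega>\<bar>" for s and \<xi> :: 'a
    proof -
      have "cmod ((?e s \<xi> - ?e t \<xi>) / (of_real (s - t) * of_real (japanese \<xi>))) \<le> \<bar>\<omega>\<bar>"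
      proof (cases "s = t")
        case False
        have "cmod (?e s \<xi> - ?e t \<xi>) \<le> \<bar>\<omega> * s * japanese \<xi> - \<omega> * t * japanese \<xi>\<bar>" by (rule cmod_exp_i_diff_le)
        also have "\<dots> = \<bar>\<omega>\<bar> * (\<bar>s - t\<bar> * japanese \<xi>)"
        proof -
          have "\<omega> * s * japanese \<xi> - \<omega> * t * japanese \<xi> = \<omega> * ((s - t) * japanese \<xi>)" by (simp add: algebra_simps)
          then show ?thesis by (simp add: abs_mult less_imp_le)
        qed
        finally have "cmod (?e s \<xi> - ?e t \<xi>) / (\<bar>s - t\<bar> * japanese \<xi>) \<le> \<bar>\<omega>\<bar>"
          using False by (intro divide_le_eq[THEN iffD2]) (auto simp: less_imp_le)
        then show ?thesis
          unfolding norm_divide norm_mult norm_of_real using less_imp_le[OF japanese_pos[of \<xi>]] by simp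
      qed simp
      then show ?thesis by (intro norm_triangle_le) (simp add: norm_mult)
    qed
    fix \<xi> :: 'a
    have "((\<lambda>w. exp (- (\<i> * of_real (\<omega> * japanese \<xi>) * w))) has_field_derivative
        - (\<i> * of_real (\<omega> * japanese \<xi>)) * exp (- (\<i> * of_real (\<omega> * japanese \<xi>) * of_real t))) (at (complex_of_real t))"
      by (auto intro!: derivative_eq_intros)
    moreover have "filterlim complex_of_real (at (complex_of_real t)) (at t within S)"
      unfolding filterlim_at by (auto intro!: tendsto_intros simp: eventually_at_filter)
    ultimately have "((\<lambda>s. (exp (- (\<i> * of_real (\<omega> * japanese \<xi>) * of_real s)) - exp (- (\<i> * of_real (\<omega> * japanese \<xi>) * of_real t))) / (of_real s - of_real t)) \<longlongrightarrow>
        - (\<i> * of_real (\<omega> * japanese \<xi>)) * exp (- (\<i> * of_real (\<omega> * japanese \<xi>) * of_real t))) (at t within S)"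
      unfolding has_field_derivative_iff by (rule filterlim_compose)
    then have "((\<lambda>s. (?e s \<xi> - ?e t \<xi>) / of_real (s - t)) \<longlongrightarrow> - (\<i> * of_real (\<omega> * japanese \<xi>)) * ?e t \<xi>) (at t within S)"
      by (simp add: mult_ac)
    then have "((\<lambda>s. (?e s \<xi> - ?e t \<xi>) / of_real (s - t) / of_real (japanese \<xi>) + \<i> * of_real \<omega> * ?e t \<xi>) \<longlongrightarrow>
        (- (\<i> * of_real (\<omega> * japanese \<xi>)) * ?e t \<xi>) / of_real (japanese \<xi>) + \<i> * of_real \<omega> * ?e t \<xi>) (at t within S)"
      by (intro tendsto_intros) (auto simp: less_imp_neq[OF japanese_pos, symmetric])
    then show "((\<lambda>s. ?m s \<xi>) \<longlongrightarrow> 0) (at t within S)"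
      using less_imp_neq[OF japanese_pos[of \<xi>]] by simp
  qed
  moreover have "?m s \<xi> * (complex_of_real (japanese \<xi>) * \<psi> \<xi>) =
      (rot \<omega> s \<psi> \<xi> - rot \<omega> t \<psi> \<xi>) / of_real (s - t) - (- (\<i> * of_real \<omega>) * rot \<omega> t (\<lambda>\<xi>. complex_of_real (japanese \<xi>) * \<psi> \<xi>) \<xi>)" for s \<xi>
  proof -
    have alg: "((a - b) / (d * k) + \<i> * w * b) * (k * p) = (a * p - b * p) / d - (- (\<i> * w) * (b * (k * p)))"
      if "k \<noteq> 0" for a b d k p w :: complex
    proof -
      have "(a - b) / (d * k) * (k * p) = (a - b) * p / d" using that by simp
      then show ?thesis unfolding distrib_right left_diff_distrib by (simp add: mult.assoc)
    qed
    show ?thesis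
      unfolding rot_def by (rule alg) (use less_imp_neq[OF japanese_pos[of \<xi>]] in simp)
  qed
  moreover have "(\<lambda>\<xi>. (rot \<omega> s \<psi> \<xi> - rot \<omega> t \<psi> \<xi>) / of_real (s - t)) \<in> L2" for s
    using L2_scale[OF L2_diff[OF rot_L2[OF \<psi>, of \<omega> s] rot_L2[OF \<psi>, of \<omega> t]], of "1 / of_real (s - t)"] by simp
  ultimately show ?thesis
    unfolding L2_tendsto_def using L2_scale[OF rot_L2[OF J], of "- (\<i> * of_real \<omega>)" \<omega> t] by simp
qed

section \<open>Orbits on the Fourier side\<close>

text \<open>Here \<open>U\<close> stands for <xi> u^, \<open>V\<close> for v^ and
  \<open>\<Gamma>\<close> for (N u)^. The quotient in \<open>U_deriv\<close> is that of u^, hence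
  the division by <xi>. About the time dependence of \<open>\<Gamma>\<close> nothing is assumed
  beyond the uniform bound and the integrated weak equation.\<close>

locale wave_orbit =
  fixes U V \<Gamma> :: "real \<Rightarrow> 'a::euclidean_space \<Rightarrow> complex" and E :: real
  assumes U_cont: "\<And>t. t \<ge> 0 \<Longrightarrow> L2_tendsto U (U t) (at t within {0..})"
    and V_cont: "\<And>t. t \<ge> 0 \<Longrightarrow> L2_tendsto V (V t) (at t within {0..})"
    and U_deriv: "\<And>t. t \<ge> 0 \<Longrightarrow> L2_tendsto
        (\<lambda>s \<xi>. (U s \<xi> - U t \<xi>) / (of_real (s - t) * of_real (japanese \<xi>))) (V t) (at t within {0..})"
    and \<Gamma>_L2: "\<And>t. t \<ge> 0 \<Longrightarrow> \<Gamma> t \<in> L2" and \<Gamma>_bound: "\<And>t. t \<ge> 0 \<Longrightarrow> L2_norm (\<Gamma> t) \<le> E"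
    and weak: "\<And>\<psi> t. \<psi> \<in> L2 \<Longrightarrow> (\<lambda>\<xi>. complex_of_real (japanese \<xi>) * \<psi> \<xi>) \<in> L2 \<Longrightarrow> t \<ge> 0 \<Longrightarrow>
        set_integrable lborel {0..t} (\<lambda>s. L2_inner (\<Gamma> s) \<psi> - L2_inner (U s) (\<lambda>\<xi>. complex_of_real (japanese \<xi>) * \<psi> \<xi>)) \<and>
        L2_inner (V t) \<psi> - L2_inner (V 0) \<psi> =
          (LINT s:{0..t}|lborel. L2_inner (\<Gamma> s) \<psi> - L2_inner (U s) (\<lambda>\<xi>. complex_of_real (japanese \<xi>) * \<psi> \<xi>))"
begin

lemma U_L2: "t \<ge> 0 \<Longrightarrow> U t \<in> L2" and V_L2: "t \<ge> 0 \<Longrightarrow> V t \<in> L2"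
  using L2_tendstoD(1)[OF U_cont] L2_tendstoD(1)[OF V_cont] by auto

text \<open>A half wave pulled back by the free flow. Formally U' = <xi> V and V' = \<Gamma> - <xi>
  U, so for \<omega>^2 = 1 the free motion cancels and the time derivative is i \<omega> exp(i
  \<omega> t <xi>) \<Gamma>.\<close>

definition profile :: "real \<Rightarrow> real \<Rightarrow> 'a \<Rightarrow> complex" where
  "profile \<omega> t \<xi> = exp (\<i> * of_real (\<omega> * t * japanese \<xi>)) * (U t \<xi> + \<i> * of_real \<omega> * V t \<xi>)"

lemma profile_inner: "L2_inner (profile \<omega> t) \<psi> = L2_inner (\<lambda>\<xi>. U t \<xi> + \<i> * of_real \<omega> * V t \<xi>) (rot \<omega> t \<psi>)"
proof -
  have "cnj (exp (\<i> * of_real (\<omega> * t * japanese \<xi>))) * \<psi> \<xi> = rot \<omega> t \<psi> \<xi>" for \<xi> by (simp add: rot_def exp_cnj)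
  then show ?thesis unfolding profile_def[abs_def] L2_inner_move by simp
qed

context
  fixes \<psi> :: "'a \<Rightarrow> complex" and \<omega> T :: real
  assumes \<psi>: "\<psi> \<in> L2" and J\<psi>: "(\<lambda>\<xi>. complex_of_real (japanese \<xi>) * \<psi> \<xi>) \<in> L2" and T: "T \<ge> 0"
begin

abbreviation (input) "R t \<equiv> rot \<omega> t \<psi>"
abbreviation (input) "RJ t \<equiv> rot \<omega> t (\<lambda>\<xi>. complex_of_real (japanese \<xi>) * \<psi> \<xi>)"

lemma R_L2: "R t \<in> L2" and RJ_L2: "RJ t \<in> L2"
  using rot_L2[OF \<psi>] rot_L2[OF J\<psi>] by auto

lemma weak_rot:
  assumes "t \<ge> 0"
  shows "set_integrable lborel {0..t} (\<lambda>s. L2_inner (\<Gamma> s) (R r) - L2_inner (U s) (RJ r))"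
    "L2_inner (V t) (R r) - L2_inner (V 0) (R r) = (LINT s:{0..t}|lborel. L2_inner (\<Gamma> s) (R r) - L2_inner (U s) (RJ r))"
  using weak[OF R_L2, of r t] RJ_L2[of r] assms unfolding rot_japanese by auto

lemma U_inner_continuous: "\<phi> \<in> L2 \<Longrightarrow> continuous_on {0..} (\<lambda>s. L2_inner (U s) \<phi>)"
  unfolding continuous_on_def by (auto intro!: L2_inner_tendsto U_cont simp: L2_tendsto_def)

text \<open>The weak equation gives integrability of a difference only; its \<open>U\<close> term is
  continuous in time and can be added back.\<close>

lemma \<Gamma>_inner_set_integrable: "set_integrable lborel {0..T} (\<lambda>s. L2_inner (\<Gamma> s) (R r))"
proof -
  have "set_integrable lborel {0..T} (\<lambda>s. L2_inner (U s) (RJ r))"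
    by (rule borel_integrable_atLeastAtMost') (rule continuous_on_subset[OF U_inner_continuous[OF RJ_L2]], auto)
  from set_integral_add(1)[OF weak_rot(1)[OF T, of r] this] show ?thesis by simp
qed

text \<open>Measurability in time is known for a fixed test function, whereas here the test function
  moves with s. Rounding the rotation time down to multiples of 1/(k+1) leaves countably many test
  functions, and strong continuity of the rotation removes the rounding as k grows.\<close>

lemma \<Gamma>_rot_measurable: "(\<lambda>s. indicator {0..T} s *\<^sub>R L2_inner (\<Gamma> s) (R s)) \<in> borel_measurable lborel"
proof (rule borel_measurable_LIMSEQ_metric)
  fix k :: nat
  have "(\<lambda>s. indicator {0..T} s *\<^sub>R L2_inner (\<Gamma> s) (R (real_of_int i / real (Suc k)))) \<in> borel_measurable lborel" for i :: int
    using \<Gamma>_inner_set_integrable unfolding set_integrable_def by (rule borel_measurable_integrable)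
  then show "(\<lambda>s. indicator {0..T} s *\<^sub>R L2_inner (\<Gamma> s) (R (real_of_int \<lfloor>real (Suc k) * s\<rfloor> / real (Suc k)))) \<in> borel_measurable lborel"
    by (rule measurable_compose_countable) measurable
next
  fix s :: real
  show "(\<lambda>k. indicator {0..T} s *\<^sub>R L2_inner (\<Gamma> s) (R (real_of_int \<lfloor>real (Suc k) * s\<rfloor> / real (Suc k)))) \<longlonglongrightarrow> indicator {0..T} s *\<^sub>R L2_inner (\<Gamma> s) (R s)"
  proof (cases "s \<in> {0..T}")
    case True
    have lim: "(\<lambda>k. real_of_int \<lfloor>real (Suc k) * s\<rfloor> / real (Suc k)) \<longlonglongrightarrow> s"
    proof (rule tendsto_sandwich[OF always_eventually always_eventually _ tendsto_const])
      show "\<forall>k. s - 1 / real (Suc k) \<le> real_of_int \<lfloor>real (Suc k) * s\<rfloor> / real (Suc k)"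
      proof
        fix k
        have "real (Suc k) * s - 1 \<le> real_of_int \<lfloor>real (Suc k) * s\<rfloor>" by linarith
        then have "(real (Suc k) * s - 1) / real (Suc k) \<le> real_of_int \<lfloor>real (Suc k) * s\<rfloor> / real (Suc k)"
          by (rule divide_right_mono) simp
        moreover have "(real (Suc k) * s - 1) / real (Suc k) = s - 1 / real (Suc k)"
          by (simp add: diff_divide_distrib del: of_nat_Suc)
        ultimately show "s - 1 / real (Suc k) \<le> real_of_int \<lfloor>real (Suc k) * s\<rfloor> / real (Suc k)" by (simp only:)
      qed
      show "\<forall>k. real_of_int \<lfloor>real (Suc k) * s\<rfloor> / real (Suc k) \<le> s"
      proof
        fix k
        have "real_of_int \<lfloor>real (Suc k) * s\<rfloor> / real (Suc k) \<le> real (Suc k) * s / real (Suc k)"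
          by (rule divide_right_mono) auto
        then show "real_of_int \<lfloor>real (Suc k) * s\<rfloor> / real (Suc k) \<le> s" by (simp del: of_nat_Suc)
      qed
      have "(\<lambda>k. s - inverse (real (Suc k))) \<longlonglongrightarrow> s - 0"
        by (intro tendsto_intros LIMSEQ_inverse_real_of_nat)
      then show "(\<lambda>k. s - 1 / real (Suc k)) \<longlonglongrightarrow> s" by (simp add: inverse_eq_divide)
    qed
    have "((\<lambda>r. L2_inner (\<Gamma> s) (R r)) \<longlongrightarrow> L2_inner (\<Gamma> s) (R s)) (at s)"
      by (rule L2_inner_tendsto[OF _ rot_tendsto[OF \<psi>]]) (use True \<Gamma>_L2 in \<open>auto simp: L2_tendsto_def\<close>)
    then have "isCont (\<lambda>r. L2_inner (\<Gamma> s) (R r)) s" by (simp add: isCont_def)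
    from isCont_tendsto_compose[OF this lim] show ?thesis using True by simp
  qed simp
qed

lemma \<Gamma>_rot_integrable: "(\<lambda>s. L2_inner (\<Gamma> s) (R s)) integrable_on {0..T}"
proof (rule set_borel_integral_eq_integral(1))
  show "set_integrable lborel {0..T} (\<lambda>s. L2_inner (\<Gamma> s) (R s))"
    unfolding set_integrable_def
  proof (rule Bochner_Integration.integrable_bound[OF _ \<Gamma>_rot_measurable])
    show "integrable lborel (\<lambda>s. indicator {0..T} s * (E * L2_norm \<psi>))"
      by (intro integrable_mult_left integrable_real_indicator) (auto simp: emeasure_lborel_Icc_eq)
    have "cmod (L2_inner (\<Gamma> s) (R s)) \<le> E * L2_norm \<psi>" if "s \<in> {0..T}" for s
    proof -
      have "L2_norm (R s) \<le> 1 * L2_norm \<psi>"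
        by (rule L2_norm_mono[OF \<psi> L2_measurable[OF R_L2]]) (auto simp: rot_def norm_mult)
      then have "cmod (L2_inner (\<Gamma> s) (R s)) \<le> L2_norm (\<Gamma> s) * L2_norm \<psi>"
        using that by (intro order_trans[OF L2_Cauchy_Schwarz[OF \<Gamma>_L2 R_L2]] mult_left_mono) auto
      also have "\<dots> \<le> E * L2_norm \<psi>" using that by (intro mult_right_mono \<Gamma>_bound) auto
      finally show ?thesis .
    qed
    then show "AE s in lborel. norm (indicator {0..T} s *\<^sub>R L2_inner (\<Gamma> s) (R s)) \<le> norm (indicator {0..T} s * (E * L2_norm \<psi>))"
      by (intro AE_I2) (auto simp: indicator_def abs_mult intro: order_trans[OF _ mult_right_mono[OF abs_ge_self]])
  qed
qed

text \<open>Neither \<open>V\<close> nor the source term has a usable derivative by itself, so the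
  source integral is subtracted before differentiating. For the \<open>V\<close> term the test
  function is frozen at x: the increment \<open>R y - R x\<close> is differentiated strongly, and
  \<open>V y\<close> against \<open>R x\<close> is governed by the weak equation.\<close>

lemma profile_derivative:
  assumes x: "x \<in> {0..T}" and \<omega>: "\<omega> * \<omega> = 1"
  shows "((\<lambda>y. L2_inner (profile \<omega> y) \<psi> - \<i> * of_real \<omega> * integral {0..y} (\<lambda>s. L2_inner (\<Gamma> s) (R s)))
    has_vector_derivative 0) (at x within {0..T})"
proof -
  let ?F = "at x within {0..T}"
  have sub: "L2_tendsto X f (at x within {0..}) \<Longrightarrow> L2_tendsto X f ?F" for X and f :: "'a \<Rightarrow> complex"
    unfolding L2_tendsto_def using x
    by (auto intro: tendsto_within_subset[where S="{0..}"] elim: filter_leD[OF at_le, rotated])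
  have x0: "x \<ge> 0" using x by simp
  let ?D = "\<lambda>y \<xi>. (R y \<xi> - R x \<xi>) / of_real (y - x)"
  have D: "L2_tendsto ?D (\<lambda>\<xi>. - (\<i> * of_real \<omega>) * RJ x \<xi>) ?F"
    by (rule rot_derivative[OF \<psi> J\<psi>])
  have Dq: "L2_inner f (?D y) = L2_inner f (\<lambda>\<xi>. R y \<xi> - R x \<xi>) / of_real (y - x)" for f y
    using L2_inner_scale_right[of f "1 / of_real (y - x)" "\<lambda>\<xi>. R y \<xi> - R x \<xi>"] by simp
  have cst: "f \<in> L2 \<Longrightarrow> L2_tendsto (\<lambda>_. f) f ?F" for f :: "'a \<Rightarrow> complex" by (simp add: L2_tendsto_def)
  have A: "((\<lambda>y. L2_inner (U y) (R y)) has_vector_derivative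
      L2_inner (V x) (RJ x) + L2_inner (U x) (\<lambda>\<xi>. - (\<i> * of_real \<omega>) * RJ x \<xi>)) ?F"
  proof (rule has_vector_derivative_quotient)
    let ?u = "\<lambda>y \<xi>. (U y \<xi> - U x \<xi>) / (of_real (y - x) * of_real (japanese \<xi>))"
    have lim: "((\<lambda>y. L2_inner (?u y) (RJ y) + L2_inner (U x) (?D y)) \<longlongrightarrow>
        L2_inner (V x) (RJ x) + L2_inner (U x) (\<lambda>\<xi>. - (\<i> * of_real \<omega>) * RJ x \<xi>)) ?F"
      by (intro tendsto_add L2_inner_tendsto sub[OF U_deriv[OF x0]] rot_tendsto J\<psi> D cst U_L2 x0)
    have eq: "L2_inner (?u y) (RJ y) + L2_inner (U x) (?D y) = (L2_inner (U y) (R y) - L2_inner (U x) (R x)) / of_real (y - x)"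
      if "y \<in> {0..T}" for y
    proof -
      have y0: "y \<ge> 0" using that by simp
      have "L2_inner (?u y) (RJ y) = L2_inner (\<lambda>\<xi>. 1 / of_real (y - x) * (U y \<xi> - U x \<xi>)) (R y)"
        unfolding rot_japanese[symmetric] L2_inner_def
        by (intro Bochner_Integration.integral_cong refl) simp
      also have "\<dots> = L2_inner (\<lambda>\<xi>. U y \<xi> - U x \<xi>) (R y) / of_real (y - x)"
        unfolding L2_inner_scale_left by simp
      finally show ?thesis
        unfolding Dq L2_inner_diff_left[OF U_L2[OF y0] U_L2[OF x0] R_L2] L2_inner_diff_right[OF R_L2 R_L2 U_L2[OF x0]]
        by (simp add: add_divide_distrib[symmetric])
    qed
    have "\<forall>\<^sub>F y in ?F. L2_inner (?u y) (RJ y) + L2_inner (U x) (?D y) = (L2_inner (U y) (R y) - L2_inner (U x) (R x)) / of_real (y - x)"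
      unfolding eventually_at_filter using eq by (intro always_eventually allI impI)
    from Lim_transform_eventually[OF lim this]
    show "((\<lambda>y. (L2_inner (U y) (R y) - L2_inner (U x) (R x)) / of_real (y - x)) \<longlongrightarrow>
        L2_inner (V x) (RJ x) + L2_inner (U x) (\<lambda>\<xi>. - (\<i> * of_real \<omega>) * RJ x \<xi>)) ?F" .
  qed
  \<comment> \<open>The pairing vanishes at y = x, so its difference quotient puts all the
    differentiation on the rotation, and continuity of \<open>V\<close> is enough.\<close>
  have B2: "((\<lambda>y. L2_inner (V y) (\<lambda>\<xi>. R y \<xi> - R x \<xi>)) has_vector_derivative
      L2_inner (V x) (\<lambda>\<xi>. - (\<i> * of_real \<omega>) * RJ x \<xi>)) ?F"
  proof (rule has_vector_derivative_quotient)
    have "((\<lambda>y. L2_inner (V y) (?D y)) \<longlongrightarrow> L2_inner (V x) (\<lambda>\<xi>. - (\<i> * of_real \<omega>) * RJ x \<xi>)) ?F"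
      by (intro L2_inner_tendsto sub[OF V_cont[OF x0]] D)
    then show "((\<lambda>y. (L2_inner (V y) (\<lambda>\<xi>. R y \<xi> - R x \<xi>) - L2_inner (V x) (\<lambda>\<xi>. R x \<xi> - R x \<xi>)) / of_real (y - x)) \<longlongrightarrow>
        L2_inner (V x) (\<lambda>\<xi>. - (\<i> * of_real \<omega>) * RJ x \<xi>)) ?F"
      unfolding Dq by (simp add: L2_inner_def)
  qed
  \<comment> \<open>Both source terms are gathered in one integrand. It is continuous at x although
    \<open>\<Gamma>\<close> need not be: \<open>\<Gamma>\<close> is bounded and multiplies
    \<open>R x - R s\<close>, which tends to 0. At s = x only the \<open>U\<close> term
    remains.\<close>
  define p where "p s = (L2_inner (\<Gamma> s) (R x) - L2_inner (U s) (RJ x)) - L2_inner (\<Gamma> s) (R s)" for s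
  note wi = set_borel_integral_eq_integral[OF weak_rot(1), of _ x]
  have p_int: "p integrable_on {0..T}"
    unfolding p_def by (intro integrable_diff wi(1) T \<Gamma>_rot_integrable)
  have "((\<lambda>u. integral {0..u} p) has_vector_derivative p x) (at x within ({0..T} - {}))"
  proof (rule integral_has_vector_derivative_continuous_at[OF p_int])
    have "((\<lambda>s. L2_inner (U s) (RJ x)) \<longlongrightarrow> L2_inner (U x) (RJ x)) ?F"
      by (intro L2_inner_tendsto sub[OF U_cont[OF x0]] cst RJ_L2)
    moreover have "((\<lambda>s. L2_inner (\<Gamma> s) (R x) - L2_inner (\<Gamma> s) (R s)) \<longlongrightarrow> 0) ?F"
    proof (rule Lim_null_comparison)
      show "\<forall>\<^sub>F s in ?F. norm (L2_inner (\<Gamma> s) (R x) - L2_inner (\<Gamma> s) (R s)) \<le> E * L2_norm (\<lambda>\<xi>. R s \<xi> - R x \<xi>)"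
        unfolding eventually_at_filter
      proof (intro always_eventually allI impI)
        fix s assume "s \<in> {0..T}"
        then have s0: "s \<ge> 0" by simp
        have "L2_inner (\<Gamma> s) (R x) - L2_inner (\<Gamma> s) (R s) = L2_inner (\<Gamma> s) (\<lambda>\<xi>. R x \<xi> - R s \<xi>)"
          by (rule L2_inner_diff_right[symmetric, OF R_L2 R_L2 \<Gamma>_L2[OF s0]])
        then show "norm (L2_inner (\<Gamma> s) (R x) - L2_inner (\<Gamma> s) (R s)) \<le> E * L2_norm (\<lambda>\<xi>. R s \<xi> - R x \<xi>)"
          unfolding L2_norm_minus_commute[of "R s" "R x"]
          using order_trans[OF L2_Cauchy_Schwarz[OF \<Gamma>_L2[OF s0] L2_diff[OF R_L2 R_L2]] mult_right_mono[OF \<Gamma>_bound[OF s0] L2_norm_nonneg]] by simp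
      qed
      show "((\<lambda>s. E * L2_norm (\<lambda>\<xi>. R s \<xi> - R x \<xi>)) \<longlongrightarrow> 0) ?F"
        by (rule tendsto_mult_right_zero[OF L2_tendstoD(3)[OF rot_tendsto[OF \<psi>]]])
    qed
    ultimately have "((\<lambda>s. (L2_inner (\<Gamma> s) (R x) - L2_inner (\<Gamma> s) (R s)) - L2_inner (U s) (RJ x)) \<longlongrightarrow> 0 - L2_inner (U x) (RJ x)) ?F"
      by (intro tendsto_diff)
    moreover have "(\<lambda>s. (L2_inner (\<Gamma> s) (R x) - L2_inner (\<Gamma> s) (R s)) - L2_inner (U s) (RJ x)) = p"
      by (intro ext) (simp add: p_def)
    moreover have "0 - L2_inner (U x) (RJ x) = p x" by (simp add: p_def)
    ultimately have "(p \<longlongrightarrow> p x) ?F" by (simp only:)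
    then show "continuous (at x within ({0..T} - {})) p" by (simp add: continuous_within)
  qed (use x in auto)
  then have I: "((\<lambda>u. integral {0..u} p) has_vector_derivative - L2_inner (U x) (RJ x)) ?F"
    by (simp add: p_def)
  have der: "((\<lambda>y. L2_inner (U y) (R y) + \<i> * of_real \<omega> * (L2_inner (V y) (\<lambda>\<xi>. R y \<xi> - R x \<xi>) + (L2_inner (V 0) (R x) + integral {0..y} p)))
      has_vector_derivative (L2_inner (V x) (RJ x) + L2_inner (U x) (\<lambda>\<xi>. - (\<i> * of_real \<omega>) * RJ x \<xi>)) +
        \<i> * of_real \<omega> * (L2_inner (V x) (\<lambda>\<xi>. - (\<i> * of_real \<omega>) * RJ x \<xi>) + (0 + - L2_inner (U x) (RJ x)))) ?F"
    by (intro has_vector_derivative_add has_vector_derivative_mult_right has_vector_derivative_const A B2 I)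
  \<comment> \<open>The two \<open>V\<close> terms cancel by \<omega>^2 = 1, the two
    \<open>U\<close> terms because the second slot of the inner product is conjugate linear.\<close>
  have zero: "(L2_inner (V x) (RJ x) + L2_inner (U x) (\<lambda>\<xi>. - (\<i> * of_real \<omega>) * RJ x \<xi>)) +
        \<i> * of_real \<omega> * (L2_inner (V x) (\<lambda>\<xi>. - (\<i> * of_real \<omega>) * RJ x \<xi>) + (0 + - L2_inner (U x) (RJ x))) = 0"
  proof -
    have "complex_of_real \<omega> * of_real \<omega> = 1" unfolding of_real_mult[symmetric] \<omega> by simp
    then have "\<i> * of_real \<omega> * (\<i> * of_real \<omega> * z) = - z" for z :: complex
    proof -
      have "\<i> * of_real \<omega> * (\<i> * of_real \<omega> * z) = (\<i> * \<i>) * ((complex_of_real \<omega> * of_real \<omega>) * z)"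
        by (simp only: mult_ac)
      then show ?thesis using \<open>complex_of_real \<omega> * of_real \<omega> = 1\<close> by simp
    qed
    then show ?thesis unfolding L2_inner_scale_right by (simp add: distrib_left right_diff_distrib)
  qed
  have eq: "L2_inner (U y) (R y) + \<i> * of_real \<omega> * (L2_inner (V y) (\<lambda>\<xi>. R y \<xi> - R x \<xi>) + (L2_inner (V 0) (R x) + integral {0..y} p))
      = L2_inner (profile \<omega> y) \<psi> - \<i> * of_real \<omega> * integral {0..y} (\<lambda>s. L2_inner (\<Gamma> s) (R s))" if y: "y \<in> {0..T}" for y
  proof -
    have y0: "y \<ge> 0" using y by simp
    have "(\<lambda>s. L2_inner (\<Gamma> s) (R s)) integrable_on {0..y}"
      by (rule integrable_on_subinterval[OF \<Gamma>_rot_integrable]) (use y in auto)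
    then have "integral {0..y} p = integral {0..y} (\<lambda>s. L2_inner (\<Gamma> s) (R x) - L2_inner (U s) (RJ x)) - integral {0..y} (\<lambda>s. L2_inner (\<Gamma> s) (R s))"
      unfolding p_def by (intro integral_diff wi(1) y0)
    also have "integral {0..y} (\<lambda>s. L2_inner (\<Gamma> s) (R x) - L2_inner (U s) (RJ x)) = L2_inner (V y) (R x) - L2_inner (V 0) (R x)"
      unfolding weak_rot(2)[OF y0] wi(2)[OF y0] ..
    finally have P: "integral {0..y} p = L2_inner (V y) (R x) - L2_inner (V 0) (R x) - integral {0..y} (\<lambda>s. L2_inner (\<Gamma> s) (R s))" .
    then show ?thesis
      unfolding profile_inner L2_inner_add_left[OF U_L2[OF y0] L2_scale[OF V_L2[OF y0]] R_L2] L2_inner_scale_left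
        L2_inner_diff_right[OF R_L2 R_L2 V_L2[OF y0]] P
      by (simp add: algebra_simps)
  qed
  show ?thesis
    by (rule has_vector_derivative_transform[OF x _ der[unfolded zero]]) (rule eq[symmetric])
qed

end

lemma profile_duhamel:
  assumes \<psi>: "\<psi> \<in> L2" and J\<psi>: "(\<lambda>\<xi>. complex_of_real (japanese \<xi>) * \<psi> \<xi>) \<in> L2"
    and \<omega>: "\<omega> * \<omega> = 1" and t: "0 \<le> t" "t \<le> t'"
  shows "(\<lambda>s. L2_inner (\<Gamma> s) (rot \<omega> s \<psi>)) integrable_on {t..t'}"
    and "L2_inner (profile \<omega> t') \<psi> - L2_inner (profile \<omega> t) \<psi> =
      \<i> * of_real \<omega> * integral {t..t'} (\<lambda>s. L2_inner (\<Gamma> s) (rot \<omega> s \<psi>))"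
proof -
  have t': "0 \<le> t'" using t by simp
  note i = \<Gamma>_rot_integrable[OF \<psi> J\<psi> t', of \<omega>]
  show "(\<lambda>s. L2_inner (\<Gamma> s) (rot \<omega> s \<psi>)) integrable_on {t..t'}"
    by (rule integrable_on_subinterval[OF i]) (use t in auto)
  obtain c where c: "\<And>y. y \<in> {0..t'} \<Longrightarrow> L2_inner (profile \<omega> y) \<psi> - \<i> * of_real \<omega> * integral {0..y} (\<lambda>s. L2_inner (\<Gamma> s) (rot \<omega> s \<psi>)) = c"
    by (rule has_vector_derivative_zero_constant[OF convex_real_interval(5) profile_derivative[OF \<psi> J\<psi> t' _ \<omega>]]) (assumption, rule that)
  have comb: "integral {0..t} (\<lambda>s. L2_inner (\<Gamma> s) (rot \<omega> s \<psi>)) + integral {t..t'} (\<lambda>s. L2_inner (\<Gamma> s) (rot \<omega> s \<psi>)) =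
      integral {0..t'} (\<lambda>s. L2_inner (\<Gamma> s) (rot \<omega> s \<psi>))"
    by (rule Henstock_Kurzweil_Integration.integral_combine[OF t i])
  have c': "L2_inner (profile \<omega> y) \<psi> = c + \<i> * of_real \<omega> * integral {0..y} (\<lambda>s. L2_inner (\<Gamma> s) (rot \<omega> s \<psi>))"
    if "y \<in> {0..t'}" for y
    using c[OF that] by (simp add: diff_eq_eq)
  have "t \<in> {0..t'}" "t' \<in> {0..t'}" using t by auto
  note ct = c'[OF this(1)] c'[OF this(2)]
  show "L2_inner (profile \<omega> t') \<psi> - L2_inner (profile \<omega> t) \<psi> =
      \<i> * of_real \<omega> * integral {t..t'} (\<lambda>s. L2_inner (\<Gamma> s) (rot \<omega> s \<psi>))"
    unfolding ct comb[symmetric] by (simp add: distrib_left)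
qed

end

section \<open>Weak limits\<close>

lemma Cauchy_at_top_convergent:
  fixes f :: "real \<Rightarrow> 'a::complete_space"
  assumes cau: "\<And>e. e > 0 \<Longrightarrow> \<exists>T. \<forall>s t. s \<ge> T \<longrightarrow> t \<ge> T \<longrightarrow> dist (f s) (f t) < e"
  shows "\<exists>z. (f \<longlongrightarrow> z) at_top"
proof -
  have "Cauchy (\<lambda>n. f (real n))"
    unfolding Cauchy_def
  proof (intro allI impI)
    fix e :: real assume "e > 0"
    then obtain T where T: "\<And>s t. s \<ge> T \<Longrightarrow> t \<ge> T \<Longrightarrow> dist (f s) (f t) < e" using cau by blast
    obtain N :: nat where "T \<le> real N" using real_arch_simple by blast
    then show "\<exists>M. \<forall>m\<ge>M. \<forall>n\<ge>M. dist (f (real m)) (f (real n)) < e" by (intro exI[of _ N]) (auto intro!: T)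
  qed
  then obtain z where z: "(\<lambda>n. f (real n)) \<longlonglongrightarrow> z" using Cauchy_convergent convergent_def by blast
  have "(f \<longlongrightarrow> z) at_top"
  proof (rule tendstoI)
    fix e :: real assume e: "e > 0"
    then obtain T where T: "\<And>s t. s \<ge> T \<Longrightarrow> t \<ge> T \<Longrightarrow> dist (f s) (f t) < e/2" using cau[of "e/2"] by auto
    have "\<forall>\<^sub>F n in sequentially. dist (f (real n)) z < e/2" using tendstoD[OF z, of "e/2"] e by simp
    moreover have "\<forall>\<^sub>F n in sequentially. T \<le> real n"
      using filterlim_real_sequentially unfolding filterlim_at_top by blast
    ultimately have "\<forall>\<^sub>F n in sequentially. dist (f (real n)) z < e/2 \<and> T \<le> real n" by eventually_elim simp
    then obtain n :: nat where n: "dist (f (real n)) z < e/2" "T \<le> real n"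
      by (auto simp: eventually_sequentially)
    show "\<forall>\<^sub>F t in at_top. dist (f t) z < e"
      using eventually_ge_at_top[of T]
    proof eventually_elim
      case (elim t)
      then show ?case using T[OF elim n(2)] n(1) dist_triangle[of "f t" z "f (real n)"] by linarith
    qed
  qed
  then show ?thesis by blast
qed

section \<open>Riesz representation and weak limits\<close>

text \<open>The representing vector minimizes |f|^2 - 2 Re (l f). Its first variation identifies
  real parts, and testing with i g identifies imaginary parts. The functional is conjugate linear to
  match the second slot of the inner product.\<close>

lemma L2_Riesz:
  fixes l :: "('a::euclidean_space \<Rightarrow> complex) \<Rightarrow> complex"
  assumes add: "\<And>f g. f \<in> L2 \<Longrightarrow> g \<in> L2 \<Longrightarrow> l (\<lambda>x. f x + g x) = l f + l g"
    and scale: "\<And>f c. f \<in> L2 \<Longrightarrow> l (\<lambda>x. c * f x) = cnj c * l f"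
    and bound: "\<And>f. f \<in> L2 \<Longrightarrow> cmod (l f) \<le> E * L2_norm f"
  shows "\<exists>c\<in>L2. \<forall>f\<in>L2. l f = L2_inner c f"
proof -
  define J where "J f = (L2_norm f)\<^sup>2 - 2 * Re (l f)" for f
  have Jlow: "J f \<ge> - E\<^sup>2" if "f \<in> L2" for f
  proof -
    have "Re (l f) \<le> E * L2_norm f" using complex_Re_le_cmod bound[OF that] by (rule order_trans)
    moreover have "0 \<le> (L2_norm f - E)\<^sup>2" by simp
    then have "2 * (E * L2_norm f) \<le> (L2_norm f)\<^sup>2 + E\<^sup>2" by (simp add: power2_diff algebra_simps)
    ultimately show ?thesis unfolding J_def by linarith
  qed
  define d where "d = Inf (J ` L2)"
  have bdd: "bdd_below (J ` L2)" using Jlow by (auto intro!: bdd_belowI2)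
  have d: "d \<le> J f" if "f \<in> L2" for f unfolding d_def by (rule cINF_lower[OF bdd that])
  have "\<exists>f\<in>L2. J f < d + 1 / real (Suc n)" for n
  proof -
    have "Inf (J ` L2) < d + 1 / real (Suc n)" by (simp add: d_def)
    then show ?thesis using cInf_lessD[of "J ` L2"] L2_zero by blast
  qed
  then obtain f where f: "\<And>n. f n \<in> L2" "\<And>n. J (f n) < d + 1 / real (Suc n)" by metis
  \<comment> \<open>The parallelogram identity at the midpoint of g and h, where the functional is
    at least d; it makes minimizing sequences Cauchy.\<close>
  have par: "(L2_norm (\<lambda>x. g x - h x))\<^sup>2 \<le> 2 * (J g - d) + 2 * (J h - d)" if g: "g \<in> L2" and h: "h \<in> L2" for g h
  proof -
    have gh: "(\<lambda>x. g x + h x) \<in> L2" by (rule L2_add[OF g h])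
    have "J (\<lambda>x. (1/2) * (g x + h x)) = (L2_norm (\<lambda>x. g x + h x))\<^sup>2 / 4 - Re (l g) - Re (l h)"
      unfolding J_def L2_norm_scale scale[OF gh] add[OF g h] by (simp add: power_divide add_divide_distrib)
    moreover have "d \<le> J (\<lambda>x. (1/2) * (g x + h x))" by (rule d[OF L2_scale[OF gh]])
    ultimately have "d \<le> (L2_norm (\<lambda>x. g x + h x))\<^sup>2 / 4 - Re (l g) - Re (l h)" by simp
    then show ?thesis
      unfolding J_def L2_norm_diff_sq[OF g h] L2_norm_add_sq[OF g h] by (simp add: field_simps)
  qed
  have "\<exists>c\<in>L2. (\<lambda>n. L2_norm (\<lambda>x. f n x - c x)) \<longlonglongrightarrow> 0"
  proof (rule L2_complete[OF f(1)])
    fix e :: real assume e: "e > 0"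
    then obtain N where N: "inverse (real (Suc N)) < e\<^sup>2 / 4" using reals_Archimedean[of "e\<^sup>2 / 4"] by auto
    show "\<exists>N. \<forall>m\<ge>N. \<forall>n\<ge>N. L2_norm (\<lambda>x. f m x - f n x) < e"
    proof (intro exI allI impI)
      fix m n assume mn: "m \<ge> N" "n \<ge> N"
      have small: "J (f k) - d < e\<^sup>2 / 4" if "k \<ge> N" for k
      proof -
        have "1 / real (Suc k) \<le> inverse (real (Suc N))" using that by (simp add: inverse_eq_divide frac_le)
        then show ?thesis using f(2)[of k] N by linarith
      qed
      have "(L2_norm (\<lambda>x. f m x - f n x))\<^sup>2 < e\<^sup>2"
      proof (rule le_less_trans[OF par[OF f(1) f(1)]])
        have "2 * a + 2 * b < k" if "a < k / 4" "b < k / 4" for a b k :: real using that by simp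
        then show "2 * (J (f m) - d) + 2 * (J (f n) - d) < e\<^sup>2" using small[OF mn(1)] small[OF mn(2)] by blast
      qed
      then show "L2_norm (\<lambda>x. f m x - f n x) < e" by (rule power_less_imp_less_base) (use e in simp)
    qed
  qed
  then obtain c where c: "c \<in> L2" "(\<lambda>n. L2_norm (\<lambda>x. f n x - c x)) \<longlonglongrightarrow> 0" by blast
  have fc: "L2_tendsto f c sequentially" using c f(1) by (simp add: L2_tendsto_def)
  have "(\<lambda>n. L2_inner (f n) (f n)) \<longlonglongrightarrow> L2_inner c c" by (rule L2_inner_tendsto[OF fc fc])
  then have n2: "(\<lambda>n. (L2_norm (f n))\<^sup>2) \<longlonglongrightarrow> (L2_norm c)\<^sup>2" unfolding L2_inner_self tendsto_of_real_iff .
  have "(\<lambda>n. l (f n) - l c) \<longlonglongrightarrow> 0"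
  proof (rule Lim_null_comparison)
    have "l (f n) - l c = l (\<lambda>x. f n x - c x)" for n
      using add[OF f(1)[of n] L2_scale[OF c(1), of "-1"]] scale[OF c(1), of "-1"] by simp
    then show "\<forall>\<^sub>F n in sequentially. norm (l (f n) - l c) \<le> E * L2_norm (\<lambda>x. f n x - c x)"
      using bound[OF L2_diff[OF f(1) c(1)]] by simp
    show "(\<lambda>n. E * L2_norm (\<lambda>x. f n x - c x)) \<longlonglongrightarrow> 0" by (rule tendsto_mult_right_zero[OF c(2)])
  qed
  then have "(\<lambda>n. l (f n)) \<longlonglongrightarrow> l c" by (rule LIM_zero_cancel)
  then have "(\<lambda>n. J (f n)) \<longlonglongrightarrow> J c" unfolding J_def by (intro tendsto_intros n2)
  moreover have "(\<lambda>n. d + 1 / real (Suc n)) \<longlonglongrightarrow> d + 0"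
    by (intro tendsto_intros LIMSEQ_inverse_real_of_nat[unfolded inverse_eq_divide])
  ultimately have Jc: "J c \<le> d + 0"
    using f(2) by (intro LIMSEQ_le[where X="\<lambda>n. J (f n)"]) (auto intro: less_imp_le)
  have Re_eq: "Re (L2_inner c g) = Re (l g)" if g: "g \<in> L2" for g
  proof (rule ccontr)
    define b where "b = Re (L2_inner c g) - Re (l g)"
    assume "Re (L2_inner c g) \<noteq> Re (l g)"
    then have b: "b \<noteq> 0" by (simp add: b_def)
    have pos: "0 \<le> 2 * s * b + s\<^sup>2 * (L2_norm g)\<^sup>2" for s :: real
    proof -
      note sg = L2_scale[OF g, of "of_real s"]
      have "J c \<le> J (\<lambda>x. c x + of_real s * g x)" using Jc d[OF L2_add[OF c(1) sg]] by simp
      then show ?thesis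
        unfolding J_def L2_norm_add_sq[OF c(1) sg] add[OF c(1) sg] scale[OF g] L2_norm_scale L2_inner_scale_right b_def
        by (simp add: power_mult_distrib algebra_simps)
    qed
    define M where "M = (L2_norm g)\<^sup>2 + 1"
    have M: "M > 0" by (simp add: M_def add_nonneg_pos)
    \<comment> \<open>The step length -b/M makes the quadratic at most -b^2/M, contradicting
      minimality; the 1 added in M keeps it positive.\<close>
    have "0 \<le> 2 * (- b / M) * b + (- b / M)\<^sup>2 * (L2_norm g)\<^sup>2" by (rule pos)
    also have "\<dots> \<le> 2 * (- b / M) * b + (- b / M)\<^sup>2 * M" by (intro add_left_mono mult_left_mono) (auto simp: M_def)
    also have "\<dots> = - (b\<^sup>2 / M)" using M by (simp add: power2_eq_square field_simps)
    finally show False using b M by (simp add: field_simps)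
  qed
  have "l g = L2_inner c g" if g: "g \<in> L2" for g
  proof (rule complex_eqI)
    show "Re (l g) = Re (L2_inner c g)" using Re_eq[OF g] by simp
    show "Im (l g) = Im (L2_inner c g)"
      using Re_eq[OF L2_scale[OF g, of \<i>]] unfolding scale[OF g] L2_inner_scale_right by simp
  qed
  with c(1) show ?thesis by blast
qed

lemma L2_weak_limit:
  fixes P :: "real \<Rightarrow> 'a::euclidean_space \<Rightarrow> complex"
  assumes P: "\<And>t. t \<ge> 0 \<Longrightarrow> P t \<in> L2" "\<And>t. t \<ge> 0 \<Longrightarrow> L2_norm (P t) \<le> E"
    and conv: "\<And>\<phi>. \<phi> \<in> L2 \<Longrightarrow> \<exists>z. ((\<lambda>t. L2_inner (P t) \<phi>) \<longlongrightarrow> z) at_top"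
  shows "\<exists>c\<in>L2. \<forall>\<phi>\<in>L2. ((\<lambda>t. L2_inner (P t) \<phi>) \<longlongrightarrow> L2_inner c \<phi>) at_top"
proof -
  define l where "l \<phi> = Lim at_top (\<lambda>t. L2_inner (P t) \<phi>)" for \<phi>
  have l: "((\<lambda>t. L2_inner (P t) \<phi>) \<longlongrightarrow> l \<phi>) at_top" if "\<phi> \<in> L2" for \<phi>
    using conv[OF that] tendsto_Lim[OF trivial_limit_at_top_linorder] unfolding l_def by metis
  have ev: "\<forall>\<^sub>F t in at_top. (t::real) \<ge> 0" by (rule eventually_ge_at_top)
  have "\<exists>c\<in>L2. \<forall>\<phi>\<in>L2. l \<phi> = L2_inner c \<phi>"
  proof (rule L2_Riesz)
    fix f g :: "'a \<Rightarrow> complex" assume f: "f \<in> L2" and g: "g \<in> L2"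
    have "\<forall>\<^sub>F t in at_top. L2_inner (P t) f + L2_inner (P t) g = L2_inner (P t) (\<lambda>x. f x + g x)"
      using ev by eventually_elim (simp add: L2_inner_add_right P f g)
    with tendsto_add[OF l[OF f] l[OF g]] have "((\<lambda>t. L2_inner (P t) (\<lambda>x. f x + g x)) \<longlongrightarrow> l f + l g) at_top"
      by (rule Lim_transform_eventually)
    then show "l (\<lambda>x. f x + g x) = l f + l g"
      by (rule tendsto_unique[OF trivial_limit_at_top_linorder l[OF L2_add[OF f g]]])
  next
    fix f :: "'a \<Rightarrow> complex" and k assume f: "f \<in> L2"
    have "((\<lambda>t. L2_inner (P t) (\<lambda>x. k * f x)) \<longlongrightarrow> cnj k * l f) at_top"
      unfolding L2_inner_scale_right by (intro tendsto_intros l f)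
    then show "l (\<lambda>x. k * f x) = cnj k * l f"
      by (rule tendsto_unique[OF trivial_limit_at_top_linorder l[OF L2_scale[OF f]]])
  next
    fix f :: "'a \<Rightarrow> complex" assume f: "f \<in> L2"
    have "\<forall>\<^sub>F t in at_top. cmod (L2_inner (P t) f) \<le> E * L2_norm f"
      using ev
    proof eventually_elim
      case (elim t)
      then show ?case
        using L2_Cauchy_Schwarz[OF P(1)[OF elim] f] mult_right_mono[OF P(2)[OF elim] L2_norm_nonneg[of f]] by linarith
    qed
    then show "cmod (l f) \<le> E * L2_norm f"
      by (rule tendsto_upperbound[OF tendsto_norm[OF l[OF f]]]) simp
  qed
  then obtain c where c: "c \<in> L2" "\<And>\<phi>. \<phi> \<in> L2 \<Longrightarrow> l \<phi> = L2_inner c \<phi>" by blast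
  show ?thesis using l unfolding c(2)[symmetric, of _] by (intro bexI[OF _ c(1)]) (simp add: c(2)[symmetric])
qed

lemma L2_weak_limit_unique:
  assumes "c \<in> L2" "c' \<in> L2"
    and "\<And>\<phi>. \<phi> \<in> L2 \<Longrightarrow> ((\<lambda>t::real. L2_inner (P t) \<phi>) \<longlongrightarrow> L2_inner c \<phi>) at_top"
    and "\<And>\<phi>. \<phi> \<in> L2 \<Longrightarrow> ((\<lambda>t::real. L2_inner (P t) \<phi>) \<longlongrightarrow> L2_inner c' \<phi>) at_top"
  shows "AE x in lborel. c x = c' x"
  by (rule L2_eq_AE_dual[OF assms(1,2)]) (rule tendsto_unique[OF trivial_limit_at_top_linorder assms(3,4)])

text \<open>The maps \<open>\<tau> t\<close> play the role of the adjoints of the localizations. Smallness of the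
  increments after localization upgrades to weak convergence because \<open>\<tau> t\<close> tends strongly to an
  operator with dense range, here an isomorphism.\<close>

lemma localized_weak_limit:
  fixes P :: "real \<Rightarrow> 'a::euclidean_space \<Rightarrow> complex" and \<tau> :: "real \<Rightarrow> ('a \<Rightarrow> complex) \<Rightarrow> 'a \<Rightarrow> complex"
  assumes P: "\<And>t. t \<ge> 0 \<Longrightarrow> P t \<in> L2" "\<And>t. t \<ge> 0 \<Longrightarrow> L2_norm (P t) \<le> E"
    and \<tau>: "\<And>t h. t \<ge> 1 \<Longrightarrow> h \<in> L2 \<Longrightarrow> \<tau> t h \<in> L2"
      "\<And>h. h \<in> L2 \<Longrightarrow> ((\<lambda>t. L2_norm (\<lambda>\<xi>. \<tau> t h \<xi> - fourier h \<xi>)) \<longlongrightarrow> 0) at_top"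
    and small: "\<And>\<eta>. \<eta> > 0 \<Longrightarrow> \<exists>T\<ge>1. \<forall>t\<ge>T. \<forall>t'\<ge>t. \<forall>h\<in>L2. cmod (L2_inner (\<lambda>\<xi>. P t' \<xi> - P t \<xi>) (\<tau> t h)) \<le> \<eta> * L2_norm h"
  shows "\<exists>c\<in>L2. (\<forall>\<phi>\<in>L2. ((\<lambda>t. L2_inner (P t) \<phi>) \<longlongrightarrow> L2_inner c \<phi>) at_top) \<and>
    (\<forall>\<eta>>0. \<exists>T\<ge>1. \<forall>t\<ge>T. \<forall>h\<in>L2. cmod (L2_inner (\<lambda>\<xi>. c \<xi> - P t \<xi>) (\<tau> t h)) \<le> \<eta> * L2_norm h)"
proof -
  have E0: "E \<ge> 0" using order_trans[OF L2_norm_nonneg P(2)[of 0]] by simp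
  have "\<exists>z. ((\<lambda>t. L2_inner (P t) \<phi>) \<longlongrightarrow> z) at_top" if \<phi>: "\<phi> \<in> L2" for \<phi>
  proof -
    define h where "h = inv_fourier \<phi>"
    have h: "h \<in> L2" unfolding h_def by (rule inv_fourier_L2[OF \<phi>])
    have "\<exists>T. \<forall>s t. s \<ge> T \<longrightarrow> t \<ge> T \<longrightarrow> dist (L2_inner (P s) \<phi>) (L2_inner (P t) \<phi>) < e" if e: "e > 0" for e
    proof -
      \<comment> \<open>The choice gives at most e/8 from the localized increment. The error of
        \<tau>_T h, at most e/(16 (E+1)), against |P t - P T| <= 2 (E+1) gives another e/8. Two
        comparisons with time T then total e/2 < e.\<close>
      define \<eta> where "\<eta> = e / (8 * (L2_norm h + 1))"
      have \<eta>: "\<eta> > 0" using e by (simp add: \<eta>_def add_nonneg_pos)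
      have \<eta>h: "\<eta> * L2_norm h \<le> e / 8"
      proof -
        have "\<eta> * L2_norm h \<le> \<eta> * (L2_norm h + 1)" using \<eta> by (intro mult_left_mono) auto
        also have "\<dots> = e / 8"
        proof -
          have "e / (8 * k) * k = e / 8" if "k > 0" for k using that by simp
          from this[of "L2_norm h + 1"] show ?thesis by (simp add: \<eta>_def add_nonneg_pos)
        qed
        finally show ?thesis .
      qed
      obtain T1 where T1: "T1 \<ge> 1" "\<And>t t' h. t \<ge> T1 \<Longrightarrow> t' \<ge> t \<Longrightarrow> h \<in> L2 \<Longrightarrow> cmod (L2_inner (\<lambda>\<xi>. P t' \<xi> - P t \<xi>) (\<tau> t h)) \<le> \<eta> * L2_norm h"
        using small[OF \<eta>] by blast
      have "\<forall>\<^sub>F t in at_top. L2_norm (\<lambda>\<xi>. \<tau> t h \<xi> - fourier h \<xi>) < e / (16 * (E + 1))"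
        using order_tendstoD(2)[OF \<tau>(2)[OF h]] e E0 by simp
      then obtain T2 where T2: "\<And>t. t \<ge> T2 \<Longrightarrow> L2_norm (\<lambda>\<xi>. \<tau> t h \<xi> - fourier h \<xi>) < e / (16 * (E + 1))"
        by (auto simp: eventually_at_top_linorder)
      define T where "T = max T1 T2"
      have T: "T \<ge> 1" using T1 by (simp add: T_def)
      have key: "dist (L2_inner (P t) \<phi>) (L2_inner (P T) \<phi>) \<le> e / 4" if t: "t \<ge> T" for t
      proof -
        have t0: "t \<ge> 0" "T \<ge> 0" using t T by auto
        note d = L2_diff[OF P(1)[OF t0(1)] P(1)[OF t0(2)]]
        have hT: "\<tau> T h \<in> L2" by (rule \<tau>(1)[OF T h])
        have eq: "L2_inner (P t) \<phi> - L2_inner (P T) \<phi> =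
            L2_inner (\<lambda>\<xi>. P t \<xi> - P T \<xi>) (\<tau> T h) - L2_inner (\<lambda>\<xi>. P t \<xi> - P T \<xi>) (\<lambda>\<xi>. \<tau> T h \<xi> - fourier h \<xi>)"
        proof -
          have "L2_inner (P t) \<phi> - L2_inner (P T) \<phi> = L2_inner (\<lambda>\<xi>. P t \<xi> - P T \<xi>) \<phi>"
            by (rule L2_inner_diff_left[symmetric, OF P(1)[OF t0(1)] P(1)[OF t0(2)] \<phi>])
          also have "\<dots> = L2_inner (\<lambda>\<xi>. P t \<xi> - P T \<xi>) (fourier h)"
            by (rule L2_inner_cong_AE)
              (use fourier_inv_fourier[OF \<phi>] L2_measurable[OF d] L2_measurable[OF \<phi>] L2_measurable[OF fourier_L2[OF h]] in \<open>auto simp: h_def\<close>)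
          finally show ?thesis unfolding L2_inner_diff_right[OF hT fourier_L2[OF h] d] by simp
        qed
        have "cmod (L2_inner (\<lambda>\<xi>. P t \<xi> - P T \<xi>) (\<tau> T h)) \<le> e / 8"
          using T1(2)[OF _ t h] \<eta>h by (simp add: T_def)
        moreover have "cmod (L2_inner (\<lambda>\<xi>. P t \<xi> - P T \<xi>) (\<lambda>\<xi>. \<tau> T h \<xi> - fourier h \<xi>)) \<le> e / 8"
        proof -
          have "L2_norm (\<lambda>\<xi>. P t \<xi> - P T \<xi>) \<le> 2 * (E + 1)"
            by (rule order_trans[OF L2_norm_triangle_diff[OF P(1)[OF t0(1)] P(1)[OF t0(2)]]]) (use P(2)[OF t0(1)] P(2)[OF t0(2)] in simp)
          moreover have "L2_norm (\<lambda>\<xi>. \<tau> T h \<xi> - fourier h \<xi>) \<le> e / (16 * (E + 1))"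
            using T2[of T] by (simp add: T_def)
          ultimately have "L2_norm (\<lambda>\<xi>. P t \<xi> - P T \<xi>) * L2_norm (\<lambda>\<xi>. \<tau> T h \<xi> - fourier h \<xi>) \<le> (2 * (E + 1)) * (e / (16 * (E + 1)))"
            using E0 by (intro mult_mono) auto
          also have "\<dots> = e / 8"
          proof -
            have "(2 * k) * (e / (16 * k)) = e / 8" if "k > 0" for k :: real using that by simp
            from this[of "E + 1"] show ?thesis using E0 by simp
          qed
          finally show ?thesis using L2_Cauchy_Schwarz[OF d L2_diff[OF hT fourier_L2[OF h]]] by linarith
        qed
        ultimately show ?thesis unfolding dist_norm eq by (intro order_trans[OF norm_triangle_ineq4]) simp
      qed
      have "dist (L2_inner (P s) \<phi>) (L2_inner (P t) \<phi>) < e" if "s \<ge> T" "t \<ge> T" for s t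
        using key[OF that(1)] key[OF that(2)] e dist_triangle2[of "L2_inner (P s) \<phi>" "L2_inner (P t) \<phi>" "L2_inner (P T) \<phi>"] by linarith
      then show ?thesis by blast
    qed
    then show ?thesis by (rule Cauchy_at_top_convergent)
  qed
  from L2_weak_limit[OF P this]
  obtain c where c: "c \<in> L2" "\<And>\<phi>. \<phi> \<in> L2 \<Longrightarrow> ((\<lambda>t. L2_inner (P t) \<phi>) \<longlongrightarrow> L2_inner c \<phi>) at_top" by blast
  have "\<exists>T\<ge>1. \<forall>t\<ge>T. \<forall>h\<in>L2. cmod (L2_inner (\<lambda>\<xi>. c \<xi> - P t \<xi>) (\<tau> t h)) \<le> \<eta> * L2_norm h" if \<eta>: "\<eta> > 0" for \<eta>
  proof -
    obtain T where T: "T \<ge> 1" "\<And>t t' h. t \<ge> T \<Longrightarrow> t' \<ge> t \<Longrightarrow> h \<in> L2 \<Longrightarrow> cmod (L2_inner (\<lambda>\<xi>. P t' \<xi> - P t \<xi>) (\<tau> t h)) \<le> \<eta> * L2_norm h"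
      using small[OF \<eta>] by blast
    have "cmod (L2_inner (\<lambda>\<xi>. c \<xi> - P t \<xi>) (\<tau> t h)) \<le> \<eta> * L2_norm h" if t: "t \<ge> T" and h: "h \<in> L2" for t h
    proof -
      have t0: "t \<ge> 0" and \<tau>L: "\<tau> t h \<in> L2" using t T(1) h by (auto intro: \<tau>(1))
      \<comment> \<open>With t and h fixed, \<tau>_t h is a fixed test function, so weak convergence
        lets t' tend to infinity in a bound that is uniform in t'.\<close>
      have "((\<lambda>t'. L2_inner (P t') (\<tau> t h) - L2_inner (P t) (\<tau> t h)) \<longlongrightarrow> L2_inner c (\<tau> t h) - L2_inner (P t) (\<tau> t h)) at_top"
        by (intro tendsto_intros c(2) \<tau>L)
      from tendsto_norm[OF this]
      have "cmod (L2_inner c (\<tau> t h) - L2_inner (P t) (\<tau> t h)) \<le> \<eta> * L2_norm h"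
      proof (rule tendsto_upperbound)
        show "\<forall>\<^sub>F t' in at_top. cmod (L2_inner (P t') (\<tau> t h) - L2_inner (P t) (\<tau> t h)) \<le> \<eta> * L2_norm h"
          using eventually_ge_at_top[of t]
        proof eventually_elim
          case (elim t')
          then have "t' \<ge> 0" using t0 by simp
          then show ?case using T(2)[OF t elim h] L2_inner_diff_left[OF P(1) P(1)[OF t0] \<tau>L] by simp
        qed
      qed simp
      then show ?thesis unfolding L2_inner_diff_left[OF c(1) P(1)[OF t0] \<tau>L] .
    qed
    with T(1) show ?thesis by blast
  qed
  with c show ?thesis by blast
qed

section \<open>Approximation of the cutoffs\<close>

lemma smooth_cutoffD:
  assumes "smooth_cutoff F"
  shows "continuous_on UNIV F" "r \<ge> 1 \<Longrightarrow> F r = 1" "r < 1/2 \<Longrightarrow> F r = 0" "\<exists>C\<ge>1. \<forall>r. \<bar>F r\<bar> \<le> C"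
proof -
  have "(deriv ^^ 0) F differentiable_on UNIV" using assms unfolding smooth_cutoff_def by blast
  then show c: "continuous_on UNIV F" by (simp add: differentiable_imp_continuous_on)
  have F: "\<And>r. r \<ge> 1 \<Longrightarrow> F r = 1" "\<And>r. r < 1/2 \<Longrightarrow> F r = 0" using assms by (auto simp: smooth_cutoff_def)
  then show "r \<ge> 1 \<Longrightarrow> F r = 1" "r < 1/2 \<Longrightarrow> F r = 0" by auto
  have "compact (F ` {1/2..1})" by (intro compact_continuous_image continuous_on_subset[OF c]) auto
  then have "bounded (F ` {1/2..1})" by (rule compact_imp_bounded)
  then obtain B where "\<forall>x\<in>F ` {1/2..1}. norm x \<le> B" unfolding bounded_iff by blast
  then have B: "\<bar>F r\<bar> \<le> B" if "r \<in> {1/2..1}" for r using that by simp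
  have "\<bar>F r\<bar> \<le> max 1 B" for r
    using B[of r] F[of r] by (cases "r < 1/2"; cases "r \<ge> 1") auto
  then show "\<exists>C\<ge>1. \<forall>r. \<bar>F r\<bar> \<le> C" by (intro exI[of _ "max 1 B"]) auto
qed

lemma gaussian_polynomial_approximation:
  assumes \<phi>: "continuous_on {0..1} \<phi>" and e: "(e::real) > 0"
  shows "\<exists>a n. \<forall>r\<ge>0. \<bar>\<phi> (exp (- r\<^sup>2)) - (\<Sum>i\<le>n. a i * exp (- r\<^sup>2) ^ i)\<bar> \<le> (e::real)"
proof -
  obtain g where g: "real_polynomial_function g" "\<And>x. x \<in> {0..1} \<Longrightarrow> \<bar>\<phi> x - g x\<bar> < e"
    using Stone_Weierstrass_real_polynomial_function[OF _ \<phi> e] by auto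
  obtain a n where "g = (\<lambda>x. \<Sum>i\<le>n. a i * x ^ i)" using g(1) unfolding real_polynomial_function_iff_sum by blast
  then show ?thesis using g(2)[of "exp (- r\<^sup>2)" for r] by (intro exI[of _ a] exI[of _ n]) (auto intro: less_imp_le)
qed

text \<open>In the variable \<open>y = exp (- r\<^sup>2)\<close> a cutoff vanishes near \<open>y = 1\<close> and is constant near
  \<open>y = 0\<close>, so the quotients approximated below extend continuously to \<open>[0, 1]\<close>; truncating the argument
  by \<open>max\<close> and \<open>min\<close> realises the extension.\<close>

lemma cutoff_approximation:
  assumes "smooth_cutoff F" and e: "e > 0"
  shows "\<exists>a n. \<forall>r\<ge>0. \<bar>F r - (1 - exp (- r\<^sup>2)) ^ K * (\<Sum>i\<le>n. a i * exp (- r\<^sup>2) ^ i)\<bar> \<le> e"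
    and "\<exists>a n. \<forall>r\<ge>0. \<bar>(1 - F r) - exp (- r\<^sup>2) * (\<Sum>i\<le>n. a i * exp (- r\<^sup>2) ^ i)\<bar> \<le> e"
proof -
  note F = smooth_cutoffD[OF assms(1)]
  \<comment> \<open>The inverse of r -> exp(-r^2), stopped at r = 1, beyond which F is constantly
    1.\<close>
  define R where "R y = sqrt (- ln (max y (exp (- 1))))" for y :: real
  have R: "continuous_on {0..1} R" unfolding R_def by (intro continuous_intros) (auto simp: max_def)
  have FR: "continuous_on {0..1} (\<lambda>y. F (R y))"
    by (rule continuous_on_compose2[OF F(1) R]) auto
  have Rr: "F (R (exp (- r\<^sup>2))) = F r" if "r \<ge> 0" for r
  proof (cases "r \<le> 1")
    case True
    then have "r\<^sup>2 \<le> 1" using that power_mono[of r 1 2] by simp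
    then have "max (exp (- r\<^sup>2)) (exp (- 1)) = exp (- r\<^sup>2)" by (intro max_absorb1) simp
    then show ?thesis using that by (simp add: R_def)
  next
    case False
    then have "1 \<le> r\<^sup>2" by (simp add: one_le_power)
    then have "max (exp (- r\<^sup>2)) (exp (- 1)) = exp (- 1)" by (intro max_absorb2) simp
    then show ?thesis using F(2)[of r] F(2)[of 1] False by (simp add: R_def)
  qed
  show "\<exists>a n. \<forall>r\<ge>0. \<bar>F r - (1 - exp (- r\<^sup>2)) ^ K * (\<Sum>i\<le>n. a i * exp (- r\<^sup>2) ^ i)\<bar> \<le> e"
  proof -
    \<comment> \<open>The value exp(-1/4) belongs to r = 1/2. For larger y the numerator is 0, so
      freezing the denominator there changes no value but removes its zero at y = 1.\<close>
    define \<phi> where "\<phi> y = F (R y) / (1 - min y (exp (- (1/4)))) ^ K" for y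
    have l1: "exp (- (1/4)) < (1::real)" by simp
    have "continuous_on {0..1} \<phi>"
      unfolding \<phi>_def by (intro continuous_intros FR) (use l1 in \<open>auto simp: min_def\<close>)
    from gaussian_polynomial_approximation[OF this e]
    obtain a n where an: "\<And>r. r \<ge> 0 \<Longrightarrow> \<bar>\<phi> (exp (- r\<^sup>2)) - (\<Sum>i\<le>n. a i * exp (- r\<^sup>2) ^ i)\<bar> \<le> e" by blast
    have "\<bar>F r - (1 - exp (- r\<^sup>2)) ^ K * (\<Sum>i\<le>n. a i * exp (- r\<^sup>2) ^ i)\<bar> \<le> e" if r: "r \<ge> 0" for r
    proof -
      let ?y = "exp (- r\<^sup>2)"
      have y: "0 \<le> 1 - ?y" "1 - ?y \<le> 1" by auto
      have eq: "F r = (1 - ?y) ^ K * \<phi> ?y"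
      proof (cases "r < 1/2")
        case True
        then show ?thesis using F(3)[OF True] Rr[OF r] by (simp add: \<phi>_def)
      next
        case False
        then have "1/4 \<le> r\<^sup>2" using power_mono[of "1/2" r 2] by (simp add: power_divide)
        then have "min ?y (exp (- (1/4))) = ?y" by (intro min_absorb1) simp
        moreover have "?y < 1" using False by simp
        ultimately show ?thesis using Rr[OF r] by (simp add: \<phi>_def)
      qed
      have "\<bar>F r - (1 - ?y) ^ K * (\<Sum>i\<le>n. a i * ?y ^ i)\<bar> = (1 - ?y) ^ K * \<bar>\<phi> ?y - (\<Sum>i\<le>n. a i * ?y ^ i)\<bar>"
        unfolding eq right_diff_distrib[symmetric] abs_mult using y by simp
      also have "\<dots> \<le> 1 * e" using y an[OF r] by (intro mult_mono power_le_one) auto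
      finally show ?thesis by simp
    qed
    then show ?thesis by blast
  qed
  show "\<exists>a n. \<forall>r\<ge>0. \<bar>(1 - F r) - exp (- r\<^sup>2) * (\<Sum>i\<le>n. a i * exp (- r\<^sup>2) ^ i)\<bar> \<le> e"
  proof -
    \<comment> \<open>For y below exp(-1), that is r > 1, the numerator is 0, so freezing the
      denominator there removes its zero at y = 0.\<close>
    define \<phi> where "\<phi> y = (1 - F (R y)) / max y (exp (- 1))" for y
    have "continuous_on {0..1} \<phi>"
      unfolding \<phi>_def by (intro continuous_intros FR) (auto simp: max_def)
    from gaussian_polynomial_approximation[OF this e]
    obtain a n where an: "\<And>r. r \<ge> 0 \<Longrightarrow> \<bar>\<phi> (exp (- r\<^sup>2)) - (\<Sum>i\<le>n. a i * exp (- r\<^sup>2) ^ i)\<bar> \<le> e" by blast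
    have "\<bar>(1 - F r) - exp (- r\<^sup>2) * (\<Sum>i\<le>n. a i * exp (- r\<^sup>2) ^ i)\<bar> \<le> e" if r: "r \<ge> 0" for r
    proof -
      let ?y = "exp (- r\<^sup>2)"
      have eq: "1 - F r = ?y * \<phi> ?y"
      proof (cases "r \<ge> 1")
        case True
        then show ?thesis using F(2)[OF True] Rr[OF r] by (simp add: \<phi>_def)
      next
        case False
        then have "r\<^sup>2 \<le> 1" using r power_mono[of r 1 2] by simp
        then have "max ?y (exp (- 1)) = ?y" by (intro max_absorb1) simp
        then show ?thesis using Rr[OF r] by (simp add: \<phi>_def)
      qed
      have "\<bar>(1 - F r) - ?y * (\<Sum>i\<le>n. a i * ?y ^ i)\<bar> = ?y * \<bar>\<phi> ?y - (\<Sum>i\<le>n. a i * ?y ^ i)\<bar>"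
        unfolding eq right_diff_distrib[symmetric] abs_mult by simp
      also have "\<dots> \<le> 1 * e" using an[OF r] by (intro mult_mono) auto
      finally show ?thesis by simp
    qed
    then show ?thesis by blast
  qed
qed

lemma norm_one_minus_exp_le:
  assumes "Re w \<ge> 0" shows "cmod (1 - exp (- w)) \<le> cmod w"
proof -
  have "cmod (exp (- w) - exp (- 0)) \<le> 1 * cmod (w - 0)"
  proof (rule field_differentiable_bound[where S="{w. Re w \<ge> 0}" and f'="\<lambda>w. - exp (- w)"])
    show "convex {w. Re w \<ge> 0}" by (rule convex_halfspace_Re_ge)
    show "((\<lambda>w. exp (- w)) has_field_derivative - exp (- z)) (at z within {w. Re w \<ge> 0})" for z
      by (auto intro!: derivative_eq_intros)
  qed (use assms in auto)
  then show ?thesis by (simp add: norm_minus_commute)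
qed

text \<open>For Re w >= 0 one has |exp(-w)| <= 1, so the polynomials are bounded by the sums of
  their coefficients. Each factor 1 - exp(-w) is at most 2 and at most |w|, giving boundedness and
  vanishing of order K; the factor exp(-w) in the second cutoff gives its decay.\<close>

lemma analytic_cutoffs_gaussian_polynomials:
  fixes a b :: "nat \<Rightarrow> real"
  shows "analytic_cutoffs (\<lambda>w. (1 - exp (- w)) ^ K * (\<Sum>i\<le>n. of_real (a i) * exp (- w) ^ i))
    (\<lambda>w. exp (- w) * (\<Sum>i\<le>m. of_real (b i) * exp (- w) ^ i)) K (2 ^ K * (\<Sum>i\<le>n. \<bar>a i\<bar>)) (\<Sum>i\<le>m. \<bar>b i\<bar>)"
proof
  have e1: "cmod (exp (- w)) \<le> 1" if "Re w \<ge> 0" for w using that by (simp add: norm_exp_eq_Re)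
  have poly: "cmod (\<Sum>i\<le>n. of_real (a i) * exp (- w) ^ i) \<le> (\<Sum>i\<le>n. \<bar>a i\<bar>)" if "Re w \<ge> 0" for w and a :: "nat \<Rightarrow> real" and n
  proof (rule order_trans[OF norm_sum], rule sum_mono)
    fix i
    have "\<bar>a i\<bar> * cmod (exp (- w)) ^ i \<le> \<bar>a i\<bar> * 1" using e1[OF that] by (intro mult_left_mono power_le_one) auto
    then show "cmod (of_real (a i) * exp (- w) ^ i) \<le> \<bar>a i\<bar>" by (simp add: norm_mult norm_power)
  qed
  have S: "(\<Sum>i\<le>n. \<bar>a i\<bar>) \<ge> 0" "(\<Sum>i\<le>m. \<bar>b i\<bar>) \<ge> 0" by (auto intro: sum_nonneg)
  show "(\<lambda>w. (1 - exp (- w)) ^ K * (\<Sum>i\<le>n. of_real (a i) * exp (- w) ^ i)) holomorphic_on UNIV"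
    "(\<lambda>w. exp (- w) * (\<Sum>i\<le>m. of_real (b i) * exp (- w) ^ i)) holomorphic_on UNIV"
    by (intro holomorphic_intros)+
  fix w :: complex assume w: "Re w \<ge> 0"
  have "cmod (1 - exp (- w)) \<le> 2" using norm_triangle_ineq4[of 1 "exp (- w)"] e1[OF w] unfolding norm_one by linarith
  then show "cmod ((1 - exp (- w)) ^ K * (\<Sum>i\<le>n. of_real (a i) * exp (- w) ^ i)) \<le> 2 ^ K * (\<Sum>i\<le>n. \<bar>a i\<bar>)"
    unfolding norm_mult norm_power by (intro mult_mono power_mono poly w) auto
  have "cmod ((1 - exp (- w)) ^ K * (\<Sum>i\<le>n. of_real (a i) * exp (- w) ^ i)) \<le> cmod w ^ K * (\<Sum>i\<le>n. \<bar>a i\<bar>)"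
    unfolding norm_mult norm_power by (intro mult_mono power_mono poly norm_one_minus_exp_le w) auto
  also have "\<dots> \<le> 2 ^ K * (\<Sum>i\<le>n. \<bar>a i\<bar>) * cmod w ^ K"
  proof -
    have "1 * ((\<Sum>i\<le>n. \<bar>a i\<bar>) * cmod w ^ K) \<le> 2 ^ K * ((\<Sum>i\<le>n. \<bar>a i\<bar>) * cmod w ^ K)"
      using S by (intro mult_right_mono) auto
    then show ?thesis by (simp add: mult_ac)
  qed
  finally show "cmod ((1 - exp (- w)) ^ K * (\<Sum>i\<le>n. of_real (a i) * exp (- w) ^ i)) \<le> 2 ^ K * (\<Sum>i\<le>n. \<bar>a i\<bar>) * cmod w ^ K" .
  show "cmod (exp (- w) * (\<Sum>i\<le>m. of_real (b i) * exp (- w) ^ i)) \<le> (\<Sum>i\<le>m. \<bar>b i\<bar>) * exp (- Re w)"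
    using mult_right_mono[OF poly[OF w, where a=b and n=m], of "exp (- Re w)"]
    by (simp add: norm_mult norm_exp_eq_Re mult.commute)
qed

text \<open>Localization to \<open>|x| \<le> R\<close> and \<open>|p| \<le> \<rho>\<close> is Hilbert--Schmidt with norm of order
  $(R \rho)^{n/2}$.\<close>

lemma low_frequency_bound:
  fixes h :: "'a::euclidean_space \<Rightarrow> complex" and q :: "'a \<Rightarrow> real"
  assumes h: "h \<in> L2" "\<And>x. norm x > R \<Longrightarrow> h x = 0" and R: "R \<ge> 0" and \<rho>: "\<rho> \<ge> 0"
    and q: "q \<in> borel_measurable borel" "\<And>\<xi>. \<bar>q \<xi>\<bar> \<le> C" "\<And>\<xi>. norm \<xi> > \<rho> \<Longrightarrow> q \<xi> = 0"
  shows "L2_norm (\<lambda>\<xi>. of_real (q \<xi>) * fourier h \<xi>) \<le>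
    C * (2 * pi) powr (- real DIM('a) / 2) * unit_ball_vol (real DIM('a)) * sqrt ((R * \<rho>) ^ DIM('a)) * L2_norm h"
proof -
  let ?n = "DIM('a)" and ?V = "unit_ball_vol (real DIM('a))" and ?c = "(2 * pi) powr (- real DIM('a) / 2)"
  have [measurable]: "q \<in> borel_measurable borel" "h \<in> borel_measurable borel" using q(1) L2_measurable[OF h(1)] by auto
  have C: "C \<ge> 0" using order_trans[OF abs_ge_zero q(2)] .
  define N where "N = ?c * (sqrt (?V * R ^ ?n) * L2_norm h)"
  have N: "N \<ge> 0" using R by (simp add: N_def)
  have ftN: "cmod (ft h \<xi>) \<le> N" for \<xi>
  proof -
    have "(LINT x|lborel. cmod (h x)) \<le> sqrt (?V * R ^ ?n) * L2_norm h"
      by (rule L2_ball_L1_bound[OF h R order_refl])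
    then have "?c * (LINT x|lborel. cmod (h x)) \<le> N" unfolding N_def by (rule mult_left_mono) simp
    then show ?thesis using ft_bound[of h \<xi>] by linarith
  qed
  have fm: "emeasure lborel (cball (0::'a) \<rho>) < \<infinity>" using emeasure_bounded_finite[OF bounded_cball] by simp
  have ind: "integrable lborel (\<lambda>\<xi>. (C * N)\<^sup>2 * indicator (cball 0 \<rho>) (\<xi>::'a))"
    by (intro integrable_mult_right integrable_real_indicator) (use fm in auto)
  have pt: "(cmod (of_real (q \<xi>) * ft h \<xi>))\<^sup>2 \<le> (C * N)\<^sup>2 * indicator (cball 0 \<rho>) \<xi>" for \<xi>
  proof (cases "norm \<xi> \<le> \<rho>")
    case True
    have b: "cmod (of_real (q \<xi>) * ft h \<xi>) \<le> C * N"
      unfolding norm_mult norm_of_real by (intro mult_mono q ftN C) auto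
    then show ?thesis using True power_mono[OF b norm_ge_zero, of 2] by simp
  qed (use q(3) in \<open>simp add: not_le\<close>)
  have AE: "AE \<xi> in lborel. of_real (q \<xi>) * fourier h \<xi> = of_real (q \<xi>) * ft h \<xi>"
  proof -
    have "AE \<xi> in lborel. fourier h \<xi> = ft h \<xi>"
      by (rule fourier_bounded_support[OF h(1)]) (rule h(2))
    then show ?thesis by eventually_elim simp
  qed
  have fM [measurable]: "fourier h \<in> borel_measurable borel" by (rule L2_measurable[OF fourier_L2[OF h(1)]])
  have "L2_norm (\<lambda>\<xi>. of_real (q \<xi>) * fourier h \<xi>) = L2_norm (\<lambda>\<xi>. of_real (q \<xi>) * ft h \<xi>)"
    by (rule L2_norm_cong_AE[OF _ _ AE]) measurable
  also have "\<dots> \<le> C * N * sqrt (?V * \<rho> ^ ?n)"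
  proof (rule power2_le_imp_le)
    have "(L2_norm (\<lambda>\<xi>. of_real (q \<xi>) * ft h \<xi>))\<^sup>2 \<le> (LINT \<xi>::'a|lborel. (C * N)\<^sup>2 * indicator (cball 0 \<rho>) \<xi>)"
      unfolding L2_norm_sq by (rule integral_mono'[OF ind pt]) simp
    also have "\<dots> = (C * N)\<^sup>2 * measure lborel (cball (0::'a) \<rho>)" by simp
    also have "measure lborel (cball (0::'a) \<rho>) = ?V * \<rho> ^ ?n" by (rule content_cball[OF \<rho>])
    also have "(C * N)\<^sup>2 * (?V * \<rho> ^ ?n) = (C * N * sqrt (?V * \<rho> ^ ?n))\<^sup>2"
      using \<rho> by (simp add: power_mult_distrib)
    finally show "(L2_norm (\<lambda>\<xi>. of_real (q \<xi>) * ft h \<xi>))\<^sup>2 \<le> (C * N * sqrt (?V * \<rho> ^ ?n))\<^sup>2" .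
  qed (use C N \<rho> in simp)
  also have "\<dots> = C * ?c * ?V * sqrt ((R * \<rho>) ^ ?n) * L2_norm h"
  proof -
    have "sqrt ?V * sqrt ?V = ?V" by simp
    then show ?thesis
      unfolding N_def real_sqrt_mult power_mult_distrib by (simp add: mult_ac)
  qed
  finally show ?thesis .
qed

lemma integral_powr_tail:
  fixes \<kappa> t t' :: real
  assumes "\<kappa> > 1" "0 < t" "t \<le> t'"
  shows "(\<lambda>s. s powr (- \<kappa>)) integrable_on {t..t'}" "integral {t..t'} (\<lambda>s. s powr (- \<kappa>)) \<le> t powr (1 - \<kappa>) / (\<kappa> - 1)"
proof -
  have hi: "((\<lambda>s. s powr (- \<kappa>)) has_integral - (t powr (- \<kappa> + 1)) / (- \<kappa> + 1)) {t..}"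
    using has_integral_powr_to_inf[of "- \<kappa>" t] assms by simp
  show i: "(\<lambda>s. s powr (- \<kappa>)) integrable_on {t..t'}"
    by (rule integrable_continuous_real) (use assms in \<open>auto intro!: continuous_intros\<close>)
  have "integral {t..t'} (\<lambda>s. s powr (- \<kappa>)) \<le> integral {t..} (\<lambda>s. s powr (- \<kappa>))"
    by (rule integral_subset_le[OF _ i has_integral_integrable[OF hi]]) auto
  also have "\<dots> = t powr (1 - \<kappa>) / (\<kappa> - 1)"
    using integral_unique[OF hi] assms(1) by (simp add: minus_divide_left[symmetric] minus_divide_right add.commute)
  finally show "integral {t..t'} (\<lambda>s. s powr (- \<kappa>)) \<le> t powr (1 - \<kappa>) / (\<kappa> - 1)" .
qed

section \<open>Smallness of localized increments\<close>

text \<open>A \<beta> below 1/2 serves as its own threshold. Otherwise \<alpha> < 1 - \<beta> <=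
  1/2, and the midpoint of \<alpha> and 1/2 works: it lies below \<beta>, so \<sigma> (1 - \<gamma>)
  > 1 is inherited, and it exceeds \<alpha>, so that the discarded frequencies contribute only a
  positive power of t^{\<alpha>-\<gamma>}.\<close>

lemma I_loc_threshold:
  assumes I: "(\<alpha>, \<beta>) \<in> I_loc \<sigma>" and \<sigma>: "\<sigma> > 1"
  shows "\<exists>\<gamma>. 0 < \<gamma> \<and> \<gamma> \<le> \<beta> \<and> \<gamma> < 1/2 \<and> \<alpha> + \<gamma> < 1 \<and> 1 < \<sigma> * (1 - \<gamma>) \<and> (\<gamma> = \<beta> \<or> \<alpha> < \<gamma>)"
proof -
  have a: "0 < \<alpha>" "\<alpha> < 1" "0 < \<beta>" "\<beta> < 1" "\<beta> < 1 - \<alpha>" "\<beta> < (\<sigma> - 1) / \<sigma>" using I by (auto simp: I_loc_def)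
  have s: "1 < \<sigma> * (1 - \<beta>)" using a(6) \<sigma> by (simp add: field_simps)
  show ?thesis
  proof (cases "\<beta> < 1/2")
    case True
    then show ?thesis using a s by (intro exI[of _ \<beta>]) auto
  next
    case False
    define \<gamma> where "\<gamma> = (\<alpha> + 1/2) / 2"
    have g: "\<alpha> < \<gamma>" "\<gamma> < 1/2" using a False by (auto simp: \<gamma>_def)
    have "\<sigma> * (1 - \<beta>) \<le> \<sigma> * (1 - \<gamma>)" using g False \<sigma> by (intro mult_left_mono) auto
    then show ?thesis using a s g False by (intro exI[of _ \<gamma>]) auto
  qed
qed

context wave_orbit
begin

lemma profile_L2: "t \<ge> 0 \<Longrightarrow> profile \<omega> t \<in> L2"
proof -
  assume t: "t \<ge> 0"
  have "(\<lambda>\<xi>::'a. exp (\<i> * of_real (\<omega> * t * japanese \<xi>))) \<in> borel_measurable borel"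
    unfolding japanese_def by (intro borel_measurable_continuous_onI continuous_intros)
  from L2_mult_bounded[OF L2_add[OF U_L2[OF t] L2_scale[OF V_L2[OF t], of "\<i> * of_real \<omega>"]] this, of 1]
  show ?thesis unfolding profile_def[abs_def] by simp
qed

text \<open>The localized test function is fixed at time t, so Duhamel's formula writes the pairing
  as an integral over [t, t'] of terms of size s^{-\<kappa>}. As \<kappa> > 1, the whole tail
  integral bounds it, independently of t'.\<close>

lemma analytic_increment:
  fixes g :: "real \<Rightarrow> 'a \<Rightarrow> complex" and m :: "'a \<Rightarrow> real"
  assumes ac: "analytic_cutoffs G H K CG CH"
    and \<epsilon>: "\<epsilon> > 0" "\<alpha> + \<gamma> + \<epsilon> \<le> 1" "2 * \<gamma> + 2 * \<epsilon> \<le> 1" and \<gamma>: "\<gamma> \<ge> 0" and \<beta>: "\<beta> \<le> 1" and \<alpha>: "\<alpha> \<ge> 0"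
    and K: "2 * real DIM('a) + 2 \<le> 2 * \<epsilon> * real K" and \<sigma>: "\<sigma> \<ge> 0"
    and \<kappa>: "\<kappa> = min 2 (\<sigma> * (1 - \<epsilon> - \<gamma>))" "\<kappa> > 1"
    and t: "t \<ge> 1" "t powr \<epsilon> \<ge> 16" "t \<le> t'"
    and g: "\<And>s. s \<ge> 0 \<Longrightarrow> g s \<in> borel_measurable borel"
      "\<And>s. s \<ge> 0 \<Longrightarrow> (\<lambda>x. complex_of_real (japanese x powr \<sigma>) * g s x) \<in> L2"
      "\<And>s. s \<ge> 0 \<Longrightarrow> L2_norm (\<lambda>x. complex_of_real (japanese x powr \<sigma>) * g s x) \<le> Eu"
      "\<And>s. s \<ge> 0 \<Longrightarrow> \<Gamma> s = fourier (g s)"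
    and h: "h \<in> L2" "\<And>x. norm x > t powr \<alpha> \<Longrightarrow> h x = 0"
    and m: "\<And>\<xi>. complex_of_real (m \<xi>) = G (of_real (t powr (2 * \<gamma>) * (norm \<xi>)\<^sup>2)) * H (of_real (t powr (- 2 * \<beta>) * (norm \<xi>)\<^sup>2))"
    and mm [measurable]: "m \<in> borel_measurable borel"
    and \<omega>: "\<omega> = 1 \<or> \<omega> = - 1"
  shows "cmod (L2_inner (\<lambda>\<xi>. profile \<omega> t' \<xi> - profile \<omega> t \<xi>) (\<lambda>\<xi>. of_real (m \<xi>) * fourier h \<xi>)) \<le>
     analytic_cutoffs.propagation_const K CG CH DIM('a) * Eu * (t powr (1 - \<kappa>) / (\<kappa> - 1)) * L2_norm h"
proof -
  interpret analytic_cutoffs G H K CG CH by (rule ac)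
  let ?C = "propagation_const DIM('a)"
  define B where "B = t powr (- 2 * \<beta>)"
  have B: "B > 0" using t by (simp add: B_def)
  have mb: "\<bar>m \<xi>\<bar> \<le> CG * CH * exp (- (B * (norm \<xi>)\<^sup>2))" for \<xi>
  proof -
    have "cmod (complex_of_real (m \<xi>)) \<le> CG * (CH * exp (- (B * (norm \<xi>)\<^sup>2)))"
      unfolding m norm_mult
      using G_bound[of "of_real (t powr (2 * \<gamma>) * (norm \<xi>)\<^sup>2)"] H_bound[of "of_real (B * (norm \<xi>)\<^sup>2)"] B C_nonneg
      by (intro mult_mono) (auto simp: B_def)
    then show ?thesis by simp
  qed
  have "\<bar>m \<xi>\<bar> \<le> CG * CH" for \<xi>
  proof -
    have "CG * CH * exp (- (B * (norm \<xi>)\<^sup>2)) \<le> CG * CH * 1" using C_nonneg B by (intro mult_left_mono) auto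
    then show ?thesis using mb[of \<xi>] by simp
  qed
  then have \<psi>: "(\<lambda>\<xi>. of_real (m \<xi>) * fourier h \<xi>) \<in> L2"
    by (intro L2_mult_bounded[OF fourier_L2[OF h(1)], where C="CG * CH"]) auto
  \<comment> \<open>Duhamel's formula needs <xi> times the test function in L^2. This holds because
    <xi> <= 1 + |xi|^2 and the Gaussian decay of \<open>H\<close> pays for |xi|^2 at the price
    1/B.\<close>
  have "japanese \<xi> * \<bar>m \<xi>\<bar> \<le> CG * CH * (1 + 1 / B)" for \<xi>
  proof -
    let ?q = "(norm \<xi>)\<^sup>2"
    have "japanese \<xi> \<le> 1 + ?q"
      unfolding japanese_def by (rule real_le_lsqrt) (auto simp: power2_sum)
    then have "japanese \<xi> * \<bar>m \<xi>\<bar> \<le> (1 + ?q) * (CG * CH * exp (- (B * ?q)))"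
      using mb[of \<xi>] by (intro mult_mono) auto
    also have "\<dots> = CG * CH * (exp (- (B * ?q)) + (B * ?q) * exp (- (B * ?q)) / B)" using B by (simp add: field_simps)
    also have "\<dots> \<le> CG * CH * (1 + 1 / B)"
      using B C_nonneg power_exp_minus_le_fact[of "B * ?q" 1]
      by (intro mult_left_mono add_mono divide_right_mono) auto
    finally show ?thesis .
  qed
  then have J\<psi>: "(\<lambda>\<xi>. complex_of_real (japanese \<xi>) * (of_real (m \<xi>) * fourier h \<xi>)) \<in> L2"
    unfolding mult.assoc[symmetric]
    by (intro L2_mult_bounded[OF fourier_L2[OF h(1)], where C="CG * CH * (1 + 1 / B)"]) (auto simp: norm_mult less_imp_le)
  have t0: "0 \<le> t" "0 \<le> t'" and t'1: "t > 0" using t by auto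
  have \<omega>2: "\<omega> * \<omega> = 1" using \<omega> by auto
  let ?\<psi> = "\<lambda>\<xi>. of_real (m \<xi>) * fourier h \<xi>"
  have Eu0: "Eu \<ge> 0" using order_trans[OF L2_norm_nonneg g(3)[OF t0(1)]] .
  have "L2_inner (\<lambda>\<xi>. profile \<omega> t' \<xi> - profile \<omega> t \<xi>) ?\<psi> = \<i> * of_real \<omega> * integral {t..t'} (\<lambda>s. L2_inner (\<Gamma> s) (rot \<omega> s ?\<psi>))"
    unfolding L2_inner_diff_left[OF profile_L2[OF t0(2)] profile_L2[OF t0(1)] \<psi>]
    by (rule profile_duhamel(2)[OF \<psi> J\<psi> \<omega>2 t0(1) t(3)])
  then have "cmod (L2_inner (\<lambda>\<xi>. profile \<omega> t' \<xi> - profile \<omega> t \<xi>) ?\<psi>) = cmod (integral {t..t'} (\<lambda>s. L2_inner (\<Gamma> s) (rot \<omega> s ?\<psi>)))"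
    using \<omega> by (auto simp: norm_mult)
  also have "\<dots> \<le> integral {t..t'} (\<lambda>s. (?C * Eu * L2_norm h) * s powr (- \<kappa>))"
  proof (rule integral_norm_bound_integral[OF profile_duhamel(1)[OF \<psi> J\<psi> \<omega>2 t0(1) t(3)]])
    show "(\<lambda>s. (?C * Eu * L2_norm h) * s powr (- \<kappa>)) integrable_on {t..t'}"
      using integral_powr_tail(1)[OF \<kappa>(2) t'1 t(3)] by (rule integrable_on_mult_right)
    fix s assume s: "s \<in> {t..t'}"
    then have s0: "s \<ge> 0" and st: "s \<ge> t" using t by auto
    have s16: "s powr \<epsilon> \<ge> 16" using t \<epsilon>(1) st powr_mono2[of \<epsilon> t s] by simp
    have "L2_inner (\<Gamma> s) (rot \<omega> s ?\<psi>) = L2_inner (\<lambda>\<xi>. (exp (\<i> * of_real (\<omega> * s * japanese \<xi>)) * of_real (m \<xi>)) * fourier (g s) \<xi>) (fourier h)"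
      unfolding L2_inner_move g(4)[OF s0] rot_def[abs_def] by (simp add: exp_cnj mult.assoc)
    also have "cmod \<dots> \<le> ?C * s powr (- \<kappa>) * Eu * L2_norm h"
      unfolding \<kappa>(1)
      by (rule propagation_estimate[OF \<epsilon> \<gamma> \<beta> \<alpha> K \<sigma> t(1) st s16 g(1)[OF s0] g(2)[OF s0] g(3)[OF s0] h m mm \<omega>])
    finally show "norm (L2_inner (\<Gamma> s) (rot \<omega> s ?\<psi>)) \<le> (?C * Eu * L2_norm h) * s powr (- \<kappa>)" by (simp add: mult_ac)
  qed
  also have "\<dots> = (?C * Eu * L2_norm h) * integral {t..t'} (\<lambda>s. s powr (- \<kappa>))" by simp
  also have "\<dots> \<le> (?C * Eu * L2_norm h) * (t powr (1 - \<kappa>) / (\<kappa> - 1))"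
    using propagation_const_nonneg Eu0 integral_powr_tail(2)[OF \<kappa>(2) t'1 t(3)] by (intro mult_left_mono) auto
  finally show ?thesis by (simp add: mult_ac)
qed

end

text \<open>The two thresholds have separate exponents. The given localization has \<gamma> =
  \<beta>; a smaller \<gamma> arises when low frequencies are discarded.\<close>

definition loc_symbol :: "(real \<Rightarrow> real) \<Rightarrow> real \<Rightarrow> real \<Rightarrow> real \<Rightarrow> 'a::euclidean_space \<Rightarrow> real" where
  "loc_symbol F \<gamma> \<beta> t \<xi> = F (t powr \<gamma> * norm \<xi>) * (1 - F (norm \<xi> / t powr \<beta>))"

text \<open>The Fourier side of the adjoint of \<open>F_loc\<close>: the cutoffs are real and hence
  self-adjoint, so only their order is reversed and the spatial cutoff acts before the frequency
  cutoffs.\<close>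

definition loc_adjoint :: "(real \<Rightarrow> real) \<Rightarrow> (real \<Rightarrow> real) \<Rightarrow> real \<Rightarrow> real \<Rightarrow> real \<Rightarrow>
    ('a::euclidean_space \<Rightarrow> complex) \<Rightarrow> 'a \<Rightarrow> complex" where
  "loc_adjoint Fc F1 \<alpha> \<beta> t h \<xi> = of_real (loc_symbol F1 \<beta> \<beta> t \<xi>) *
     fourier (\<lambda>x. of_real (1 - Fc (norm x / t powr \<alpha>)) * h x) \<xi>"

lemma loc_symbol_measurable [measurable]:
  assumes "smooth_cutoff F"
  shows "loc_symbol F \<gamma> \<beta> t \<in> borel_measurable borel"
proof -
  have [measurable]: "F \<in> borel_measurable borel"
    by (rule borel_measurable_continuous_onI[OF smooth_cutoffD(1)[OF assms]])
  show ?thesis unfolding loc_symbol_def by measurable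
qed

lemma loc_space_cutoff:
  assumes "smooth_cutoff Fc"
  shows "(\<lambda>x::'a::euclidean_space. complex_of_real (1 - Fc (norm x / s))) \<in> borel_measurable borel"
proof -
  have [measurable]: "Fc \<in> borel_measurable borel"
    by (rule borel_measurable_continuous_onI[OF smooth_cutoffD(1)[OF assms]])
  show ?thesis by measurable
qed

lemma loc_symbol_bound:
  assumes "\<And>r. \<bar>F r\<bar> \<le> C"
  shows "\<bar>loc_symbol F \<gamma> \<beta> t \<xi>\<bar> \<le> C * (1 + C)"
proof -
  have "\<bar>1 - F (norm \<xi> / t powr \<beta>)\<bar> \<le> 1 + C" using assms[of "norm \<xi> / t powr \<beta>"] by linarith
  then show ?thesis
    unfolding loc_symbol_def abs_mult using assms[of "t powr \<gamma> * norm \<xi>"] by (intro mult_mono) auto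
qed

context wave_orbit
begin

text \<open>The symbol is written as q + r + m: q is the change from exponent \<beta> to \<gamma>
  and lives on |xi| <= t^{-\<gamma>}, r is the error of the holomorphic approximation, and m is the
  approximant. Low-frequency bound, uniform closeness and Duhamel estimate each contribute at most
  \<eta>/3.\<close>

lemma localized_increment_small:
  fixes g :: "real \<Rightarrow> 'a \<Rightarrow> complex"
  assumes cut: "smooth_cutoff Fc" "smooth_cutoff F1"
    and \<sigma>: "\<sigma> > 1" and I: "(\<alpha>, \<beta>) \<in> I_loc \<sigma>"
    and g: "\<And>s. s \<ge> 0 \<Longrightarrow> g s \<in> borel_measurable borel"
      "\<And>s. s \<ge> 0 \<Longrightarrow> (\<lambda>x. complex_of_real (japanese x powr \<sigma>) * g s x) \<in> L2"
      "\<And>s. s \<ge> 0 \<Longrightarrow> L2_norm (\<lambda>x. complex_of_real (japanese x powr \<sigma>) * g s x) \<le> Eu"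
      "\<And>s. s \<ge> 0 \<Longrightarrow> \<Gamma> s = fourier (g s)"
    and P: "\<And>t. t \<ge> 0 \<Longrightarrow> L2_norm (profile \<omega> t) \<le> M"
    and \<omega>: "\<omega> = 1 \<or> \<omega> = - 1" and \<eta>: "\<eta> > 0"
  shows "\<exists>T\<ge>1. \<forall>t\<ge>T. \<forall>t'\<ge>t. \<forall>h\<in>L2.
    cmod (L2_inner (\<lambda>\<xi>. profile \<omega> t' \<xi> - profile \<omega> t \<xi>) (loc_adjoint Fc F1 \<alpha> \<beta> t h)) \<le> \<eta> * L2_norm h"
proof -
  have ab: "0 < \<alpha>" "0 < \<beta>" "\<beta> < 1" using I by (auto simp: I_loc_def)
  obtain \<gamma> where \<gamma>: "0 < \<gamma>" "\<gamma> \<le> \<beta>" "\<gamma> < 1/2" "\<alpha> + \<gamma> < 1" "1 < \<sigma> * (1 - \<gamma>)" "\<gamma> = \<beta> \<or> \<alpha> < \<gamma>"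
    using I_loc_threshold[OF I \<sigma>] by blast
  \<comment> \<open>The entries secure \<alpha> + \<gamma> + \<epsilon> <= 1, 2\<gamma> +
    2\<epsilon> <= 1 and \<sigma> (1 - \<epsilon> - \<gamma>) > 1; the last one spends half of the
    room in \<sigma> (1 - \<gamma>) - 1.\<close>
  define \<epsilon> where "\<epsilon> = min (1 - \<alpha> - \<gamma>) (min ((1 - 2 * \<gamma>) / 2) ((\<sigma> * (1 - \<gamma>) - 1) / (2 * \<sigma>)))"
  have \<epsilon>: "\<epsilon> > 0" "\<alpha> + \<gamma> + \<epsilon> \<le> 1" "2 * \<gamma> + 2 * \<epsilon> \<le> 1"
  proof -
    have "\<epsilon> \<le> 1 - \<alpha> - \<gamma>" "\<epsilon> \<le> (1 - 2 * \<gamma>) / 2" unfolding \<epsilon>_def by linarith+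
    then show "\<alpha> + \<gamma> + \<epsilon> \<le> 1" "2 * \<gamma> + 2 * \<epsilon> \<le> 1" by simp_all
    show "\<epsilon> > 0" unfolding \<epsilon>_def using \<gamma> \<sigma> by simp
  qed
  have "\<sigma> * \<epsilon> \<le> \<sigma> * ((\<sigma> * (1 - \<gamma>) - 1) / (2 * \<sigma>))" using \<sigma> by (intro mult_left_mono) (auto simp: \<epsilon>_def)
  also have "\<dots> = (\<sigma> * (1 - \<gamma>) - 1) / 2" using \<sigma> by simp
  finally have half: "\<sigma> * \<epsilon> \<le> (\<sigma> * (1 - \<gamma>) - 1) / 2" .
  have "1 < X - y" if "y \<le> (X - 1) / 2" "1 < X" for X y :: real using that by (simp add: field_simps)
  from this[OF half \<gamma>(5)] have "1 < \<sigma> * (1 - \<gamma>) - \<sigma> * \<epsilon>" .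
  then have \<sigma>1: "1 < \<sigma> * (1 - \<epsilon> - \<gamma>)" by (simp add: algebra_simps)
  define \<kappa> where "\<kappa> = min 2 (\<sigma> * (1 - \<epsilon> - \<gamma>))"
  have \<kappa>: "\<kappa> > 1" using \<sigma>1 by (simp add: \<kappa>_def)
  \<comment> \<open>With this order of vanishing, s^{-2\<epsilon>K} outweighs the volume factor
    s^{2n} by s^{-2}.\<close>
  define K where "K = nat \<lceil>(real DIM('a) + 1) / \<epsilon>\<rceil>"
  have "(real DIM('a) + 1) / \<epsilon> \<le> real K" unfolding K_def by linarith
  then have K: "2 * real DIM('a) + 2 \<le> 2 * \<epsilon> * real K" using \<epsilon>(1) by (simp add: field_simps)
  obtain C where C: "C \<ge> 1" "\<And>r. \<bar>F1 r\<bar> \<le> C" using smooth_cutoffD(4)[OF cut(2)] by blast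
  obtain C' where C': "C' \<ge> 1" "\<And>r. \<bar>Fc r\<bar> \<le> C'" using smooth_cutoffD(4)[OF cut(1)] by blast
  define Cc where "Cc = 1 + C'"
  have Cc: "Cc \<ge> 1" "\<bar>1 - Fc r\<bar> \<le> Cc" for r using C'(1) C'(2)[of r] by (auto simp: Cc_def abs_le_iff)
  have ccb: "cmod (complex_of_real (1 - Fc r)) \<le> Cc" for r using Cc(2)[of r] by (simp only: norm_of_real)
  have M0: "M \<ge> 0" using order_trans[OF L2_norm_nonneg P[of 0]] by simp
  \<comment> \<open>Sized so that the remainder r, paired with a profile difference of norm at most
    2M, stays below \<eta>/3; the cap 1 bounds the approximant itself. It is fixed before any time
    is chosen, because the propagation constant depends on the approximating polynomials.\<close>
  define \<eta>1 where "\<eta>1 = min 1 (\<eta> / (3 * (2 * (M + 1) * (2 * (C + 1)) * Cc)))"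
  have \<eta>1: "\<eta>1 > 0" "\<eta>1 \<le> 1" "2 * (M + 1) * (2 * (C + 1)) * Cc * \<eta>1 \<le> \<eta> / 3"
  proof -
    have D: "2 * (M + 1) * (2 * (C + 1)) * Cc > 0" using M0 C Cc(1) by (intro mult_pos_pos) auto
    then show "\<eta>1 > 0" "\<eta>1 \<le> 1" using \<eta> by (auto simp: \<eta>1_def)
    have "D * min 1 (\<eta> / (3 * D)) \<le> \<eta> / 3" if "D > 0" for D :: real
    proof -
      have "D * min 1 (\<eta> / (3 * D)) \<le> D * (\<eta> / (3 * D))" using that by (intro mult_left_mono) auto
      then show ?thesis using that by simp
    qed
    from this[OF D] show "2 * (M + 1) * (2 * (C + 1)) * Cc * \<eta>1 \<le> \<eta> / 3" unfolding \<eta>1_def .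
  qed
  obtain a n where a: "\<And>r. r \<ge> 0 \<Longrightarrow> \<bar>F1 r - (1 - exp (- r\<^sup>2)) ^ K * (\<Sum>i\<le>n. a i * exp (- r\<^sup>2) ^ i)\<bar> \<le> \<eta>1"
    using cutoff_approximation(1)[OF cut(2) \<eta>1(1)] by blast
  obtain b k where b: "\<And>r. r \<ge> 0 \<Longrightarrow> \<bar>(1 - F1 r) - exp (- r\<^sup>2) * (\<Sum>i\<le>k. b i * exp (- r\<^sup>2) ^ i)\<bar> \<le> \<eta>1"
    using cutoff_approximation(2)[OF cut(2) \<eta>1(1)] by blast
  define Gr where "Gr q = (1 - exp (- q)) ^ K * (\<Sum>i\<le>n. a i * exp (- q) ^ i)" for q :: real
  define Hr where "Hr q = exp (- q) * (\<Sum>i\<le>k. b i * exp (- q) ^ i)" for q :: real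
  define G where "G w = (1 - exp (- w)) ^ K * (\<Sum>i\<le>n. of_real (a i) * exp (- w) ^ i)" for w :: complex
  define H where "H w = exp (- w) * (\<Sum>i\<le>k. of_real (b i) * exp (- w) ^ i)" for w :: complex
  define CG where "CG = 2 ^ K * (\<Sum>i\<le>n. \<bar>a i\<bar>)"
  define CH where "CH = (\<Sum>i\<le>k. \<bar>b i\<bar>)"
  have ac: "analytic_cutoffs G H K CG CH"
    unfolding G_def H_def CG_def CH_def by (rule analytic_cutoffs_gaussian_polynomials)
  have GHr: "complex_of_real (Gr q) = G (of_real q)" "complex_of_real (Hr q) = H (of_real q)" for q
    by (simp_all add: Gr_def Hr_def G_def H_def exp_of_real[symmetric])
  define m where "m t \<xi> = Gr (t powr (2 * \<gamma>) * (norm \<xi>)\<^sup>2) * Hr (t powr (- 2 * \<beta>) * (norm \<xi>)\<^sup>2)" for t and \<xi> :: 'a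
  have mG: "complex_of_real (m t \<xi>) = G (of_real (t powr (2 * \<gamma>) * (norm \<xi>)\<^sup>2)) * H (of_real (t powr (- 2 * \<beta>) * (norm \<xi>)\<^sup>2))" for t \<xi>
    unfolding m_def of_real_mult[of "Gr _"] GHr ..
  have mm [measurable]: "m t \<in> borel_measurable borel" for t unfolding m_def Gr_def Hr_def by measurable
  have close: "\<bar>loc_symbol F1 \<gamma> \<beta> t \<xi> - m t \<xi>\<bar> \<le> 2 * (C + 1) * \<eta>1" if t: "t \<ge> 1" for t and \<xi> :: 'a
  proof -
    let ?x = "t powr \<gamma> * norm \<xi>" and ?y = "norm \<xi> / t powr \<beta>"
    have e1: "t powr (2 * \<gamma>) * (norm \<xi>)\<^sup>2 = ?x\<^sup>2" using t by (simp add: power_mult_distrib powr_realpow[symmetric] powr_powr mult.commute)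
    have e2: "t powr (- 2 * \<beta>) * (norm \<xi>)\<^sup>2 = ?y\<^sup>2"
    proof -
      have "?y = t powr (- \<beta>) * norm \<xi>" by (simp add: powr_minus divide_inverse mult.commute)
      moreover have "(t powr (- \<beta>))\<^sup>2 = t powr (- 2 * \<beta>)" by (simp add: power2_eq_square powr_add[symmetric])
      ultimately show ?thesis by (simp only: power_mult_distrib)
    qed
    have A: "\<bar>F1 ?x - Gr (?x\<^sup>2)\<bar> \<le> \<eta>1" unfolding Gr_def by (rule a) simp
    have B: "\<bar>(1 - F1 ?y) - Hr (?y\<^sup>2)\<bar> \<le> \<eta>1" unfolding Hr_def by (rule b) (use t in simp)
    have "\<bar>1 - F1 ?y\<bar> \<le> 1 + C" using C(2)[of ?y] by linarith
    then have Hb: "\<bar>Hr (?y\<^sup>2)\<bar> \<le> C + 2" using B \<eta>1(2) by linarith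
    have "loc_symbol F1 \<gamma> \<beta> t \<xi> - m t \<xi> = F1 ?x * ((1 - F1 ?y) - Hr (?y\<^sup>2)) + (F1 ?x - Gr (?x\<^sup>2)) * Hr (?y\<^sup>2)"
      unfolding loc_symbol_def m_def e1 e2 by (simp add: algebra_simps)
    also have "\<bar>\<dots>\<bar> \<le> C * \<eta>1 + \<eta>1 * (C + 2)"
      by (rule order_trans[OF abs_triangle_ineq], unfold abs_mult, intro add_mono mult_mono) (use A B Hb C \<eta>1 in auto)
    finally show ?thesis by (simp add: algebra_simps)
  qed
  let ?n = "DIM('a)"
  define CL where "CL = 2 * (C * (1 + C)) * (2 * pi) powr (- real ?n / 2) * unit_ball_vol (real ?n)"
  have CL: "CL \<ge> 0" using C(1) by (simp add: CL_def)
  define C0 where "C0 = analytic_cutoffs.propagation_const K CG CH ?n"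
  have C0: "C0 \<ge> 0" unfolding C0_def by (rule analytic_cutoffs.propagation_const_nonneg[OF ac])
  have Eu0: "Eu \<ge> 0" using order_trans[OF L2_norm_nonneg g(3)[of 0]] by simp
  \<comment> \<open>The bound for the discarded frequencies. It is 0 when nothing is discarded, and
    otherwise tends to 0 because \<alpha> < \<gamma>.\<close>
  define low where "low t = (if \<gamma> = \<beta> then 0 else 2 * M * (CL * sqrt ((t powr (\<alpha> - \<gamma>)) ^ ?n)) * Cc)" for t :: real
  have "(low \<longlongrightarrow> 0) at_top"
  proof (cases "\<gamma> = \<beta>")
    case False
    then have "\<alpha> - \<gamma> < 0" using \<gamma>(6) by simp
    then have "((\<lambda>t. t powr (\<alpha> - \<gamma>)) \<longlongrightarrow> 0) at_top" by (intro tendsto_neg_powr filterlim_ident)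
    then have "((\<lambda>t. 2 * M * (CL * sqrt ((t powr (\<alpha> - \<gamma>)) ^ ?n)) * Cc) \<longlongrightarrow> 2 * M * (CL * sqrt (0 ^ ?n)) * Cc) at_top"
      by (intro tendsto_intros)
    then show ?thesis using False unfolding low_def[abs_def] by (simp add: zero_power)
  qed (simp add: low_def[abs_def])
  then have ev1: "\<forall>\<^sub>F t in at_top. low t < \<eta> / 3" using \<eta> by (intro order_tendstoD) auto
  have "((\<lambda>t. t powr (1 - \<kappa>)) \<longlongrightarrow> 0) at_top" using \<kappa> by (intro tendsto_neg_powr filterlim_ident) auto
  then have "((\<lambda>t. C0 * Eu * (t powr (1 - \<kappa>) / (\<kappa> - 1)) * Cc) \<longlongrightarrow> C0 * Eu * (0 / (\<kappa> - 1)) * Cc) at_top"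
    using \<kappa> by (intro tendsto_intros) auto
  then have ev2: "\<forall>\<^sub>F t in at_top. C0 * Eu * (t powr (1 - \<kappa>) / (\<kappa> - 1)) * Cc < \<eta> / 3"
    using \<eta> by (intro order_tendstoD) auto
  have ev3: "\<forall>\<^sub>F t in at_top. 16 \<le> t powr \<epsilon>"
    using eventually_ge_at_top[of "16 powr (1 / \<epsilon>)"]
  proof eventually_elim
    case (elim t)
    then have "(16 powr (1 / \<epsilon>)) powr \<epsilon> \<le> t powr \<epsilon>" using \<epsilon>(1) by (intro powr_mono2) auto
    then show ?case using \<epsilon>(1) by (simp add: powr_powr)
  qed
  obtain T where T: "\<And>t. t \<ge> T \<Longrightarrow> low t < \<eta> / 3 \<and> C0 * Eu * (t powr (1 - \<kappa>) / (\<kappa> - 1)) * Cc < \<eta> / 3 \<and> 16 \<le> t powr \<epsilon>"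
    using eventually_conj[OF ev1 eventually_conj[OF ev2 ev3]] unfolding eventually_at_top_linorder by blast
  have "cmod (L2_inner (\<lambda>\<xi>. profile \<omega> t' \<xi> - profile \<omega> t \<xi>) (loc_adjoint Fc F1 \<alpha> \<beta> t h)) \<le> \<eta> * L2_norm h"
    if tT: "t \<ge> max 1 T" and tt': "t' \<ge> t" and h: "h \<in> L2" for t t' h
  proof -
    have t: "t \<ge> 1" "t > 0" "t \<ge> 0" "t' \<ge> 0" using tT tt' by auto
    have Tt: "low t < \<eta> / 3" "C0 * Eu * (t powr (1 - \<kappa>) / (\<kappa> - 1)) * Cc < \<eta> / 3" "16 \<le> t powr \<epsilon>"
      using T[of t] tT by auto
    define ht where "ht x = of_real (1 - Fc (norm x / t powr \<alpha>)) * h x" for x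
    have htL: "ht \<in> L2" unfolding ht_def
      by (rule L2_mult_bounded[OF h loc_space_cutoff[OF cut(1)], where C=Cc]) (rule ccb)
    have htn: "L2_norm ht \<le> Cc * L2_norm h" unfolding ht_def
      by (rule L2_norm_mult_bounded[OF h loc_space_cutoff[OF cut(1)]]) (rule ccb)
    have hts: "ht x = 0" if "norm x > t powr \<alpha>" for x
    proof -
      have "norm x / t powr \<alpha> \<ge> 1" using that t by simp
      then show ?thesis using smooth_cutoffD(2)[OF cut(1)] by (simp add: ht_def)
    qed
    define D where "D \<xi> = profile \<omega> t' \<xi> - profile \<omega> t \<xi>" for \<xi>
    have DL: "D \<in> L2" unfolding D_def by (intro L2_diff profile_L2 t)
    have DM: "L2_norm D \<le> 2 * M"
      unfolding D_def by (rule order_trans[OF L2_norm_triangle_diff[OF profile_L2[OF t(4)] profile_L2[OF t(3)]]])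
        (use P[OF t(4)] P[OF t(3)] in simp)
    define q where "q \<xi> = loc_symbol F1 \<beta> \<beta> t \<xi> - loc_symbol F1 \<gamma> \<beta> t \<xi>" for \<xi> :: 'a
    define r where "r \<xi> = loc_symbol F1 \<gamma> \<beta> t \<xi> - m t \<xi>" for \<xi> :: 'a
    note [measurable] = loc_symbol_measurable[OF cut(2)]
    have [measurable]: "q \<in> borel_measurable borel" "r \<in> borel_measurable borel" unfolding q_def r_def by measurable
    have qb: "\<bar>q \<xi>\<bar> \<le> 2 * (C * (1 + C))" for \<xi>
      using loc_symbol_bound[of F1, OF C(2), of \<beta> \<beta> t \<xi>] loc_symbol_bound[of F1, OF C(2), of \<gamma> \<beta> t \<xi>] unfolding q_def by linarith
    have rb: "\<bar>r \<xi>\<bar> \<le> 2 * (C + 1) * \<eta>1" for \<xi> unfolding r_def by (rule close[OF t(1)])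
    have mb: "\<bar>m t \<xi>\<bar> \<le> C * (1 + C) + 2 * (C + 1) * \<eta>1" for \<xi>
      using rb[of \<xi>] loc_symbol_bound[of F1, OF C(2), of \<gamma> \<beta> t \<xi>] unfolding r_def by linarith
    have fm: "fourier ht \<in> L2" by (rule fourier_L2[OF htL])
    have qL: "(\<lambda>\<xi>. of_real (q \<xi>) * fourier ht \<xi>) \<in> L2" by (rule bounded_multiplier_fourier_L2[OF htL _ qb]) measurable
    have rL: "(\<lambda>\<xi>. of_real (r \<xi>) * fourier ht \<xi>) \<in> L2" by (rule bounded_multiplier_fourier_L2[OF htL _ rb]) measurable
    have mL: "(\<lambda>\<xi>. of_real (m t \<xi>) * fourier ht \<xi>) \<in> L2" by (rule bounded_multiplier_fourier_L2[OF htL _ mb]) measurable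
    have split: "loc_adjoint Fc F1 \<alpha> \<beta> t h = (\<lambda>\<xi>. (of_real (q \<xi>) * fourier ht \<xi> + of_real (r \<xi>) * fourier ht \<xi>) + of_real (m t \<xi>) * fourier ht \<xi>)"
      unfolding loc_adjoint_def ht_def[symmetric] q_def r_def by (intro ext) (simp add: algebra_simps)
    have 1: "cmod (L2_inner D (\<lambda>\<xi>. of_real (q \<xi>) * fourier ht \<xi>)) \<le> low t * L2_norm h"
    proof (cases "\<gamma> = \<beta>")
      case True
      then show ?thesis by (simp add: q_def low_def L2_inner_def)
    next
      case False
      \<comment> \<open>For |xi| > t^{-\<gamma>} and \<gamma> <= \<beta> both low-frequency cutoffs
        are at their constant value 1, so the two symbols agree.\<close>
      have q0: "q \<xi> = 0" if "norm \<xi> > t powr (- \<gamma>)" for \<xi>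
      proof -
        have "t powr \<gamma> * norm \<xi> \<ge> t powr \<gamma> * t powr (- \<gamma>)" using that by (intro mult_left_mono) auto
        then have x: "t powr \<gamma> * norm \<xi> \<ge> 1" using t by (simp add: powr_add[symmetric])
        have "t powr \<beta> * norm \<xi> \<ge> t powr \<gamma> * norm \<xi>" using t \<gamma>(2) by (intro mult_right_mono powr_mono) auto
        with x have "t powr \<beta> * norm \<xi> \<ge> 1" by linarith
        with x show ?thesis using smooth_cutoffD(2)[OF cut(2)] by (simp add: q_def loc_symbol_def)
      qed
      have "L2_norm (\<lambda>\<xi>. of_real (q \<xi>) * fourier ht \<xi>) \<le> CL * sqrt ((t powr \<alpha> * t powr (- \<gamma>)) ^ ?n) * L2_norm ht"
        unfolding CL_def by (rule low_frequency_bound[OF htL hts _ _ _ qb q0]) auto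
      also have "t powr \<alpha> * t powr (- \<gamma>) = t powr (\<alpha> - \<gamma>)" by (simp add: powr_add[symmetric])
      finally have qn: "L2_norm (\<lambda>\<xi>. of_real (q \<xi>) * fourier ht \<xi>) \<le> CL * sqrt ((t powr (\<alpha> - \<gamma>)) ^ ?n) * L2_norm ht" .
      have "cmod (L2_inner D (\<lambda>\<xi>. of_real (q \<xi>) * fourier ht \<xi>)) \<le> L2_norm D * L2_norm (\<lambda>\<xi>. of_real (q \<xi>) * fourier ht \<xi>)"
        by (rule L2_Cauchy_Schwarz[OF DL qL])
      also have "\<dots> \<le> (2 * M) * (CL * sqrt ((t powr (\<alpha> - \<gamma>)) ^ ?n) * (Cc * L2_norm h))"
        using M0 CL by (intro mult_mono DM order_trans[OF qn] mult_left_mono htn) auto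
      finally show ?thesis using False by (simp add: low_def mult_ac)
    qed
    have 2: "cmod (L2_inner D (\<lambda>\<xi>. of_real (r \<xi>) * fourier ht \<xi>)) \<le> (\<eta> / 3) * L2_norm h"
    proof -
      have rn: "L2_norm (\<lambda>\<xi>. of_real (r \<xi>) * fourier ht \<xi>) \<le> 2 * (C + 1) * \<eta>1 * (Cc * L2_norm h)"
      proof -
        have "L2_norm (\<lambda>\<xi>. of_real (r \<xi>) * fourier ht \<xi>) \<le> 2 * (C + 1) * \<eta>1 * L2_norm (fourier ht)"
          by (rule L2_norm_mult_bounded[OF fm]) (use rb in auto)
        also have "\<dots> \<le> 2 * (C + 1) * \<eta>1 * (Cc * L2_norm h)"
          unfolding fourier_norm[OF htL] using C(1) \<eta>1 htn by (intro mult_left_mono) auto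
        finally show ?thesis .
      qed
      have "cmod (L2_inner D (\<lambda>\<xi>. of_real (r \<xi>) * fourier ht \<xi>)) \<le> L2_norm D * L2_norm (\<lambda>\<xi>. of_real (r \<xi>) * fourier ht \<xi>)"
        by (rule L2_Cauchy_Schwarz[OF DL rL])
      also have "\<dots> \<le> (2 * (M + 1)) * (2 * (C + 1) * \<eta>1 * (Cc * L2_norm h))"
        using M0 DM by (intro mult_mono rn) auto
      also have "\<dots> = (2 * (M + 1) * (2 * (C + 1)) * Cc * \<eta>1) * L2_norm h" by (simp add: mult_ac)
      also have "\<dots> \<le> (\<eta> / 3) * L2_norm h" by (rule mult_right_mono[OF \<eta>1(3) L2_norm_nonneg])
      finally show ?thesis .
    qed
    have 3: "cmod (L2_inner D (\<lambda>\<xi>. of_real (m t \<xi>) * fourier ht \<xi>)) \<le> (\<eta> / 3) * L2_norm h"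
    proof -
      have "cmod (L2_inner D (\<lambda>\<xi>. of_real (m t \<xi>) * fourier ht \<xi>)) \<le> C0 * Eu * (t powr (1 - \<kappa>) / (\<kappa> - 1)) * L2_norm ht"
        unfolding D_def C0_def
        by (rule analytic_increment[OF ac \<epsilon> _ _ _ K _ \<kappa>_def \<kappa> t(1) Tt(3) tt' g htL hts mG mm \<omega>])
          (use \<gamma> ab \<sigma> in auto)
      also have "\<dots> \<le> C0 * Eu * (t powr (1 - \<kappa>) / (\<kappa> - 1)) * (Cc * L2_norm h)"
        using C0 Eu0 \<kappa> by (intro mult_left_mono htn) auto
      also have "\<dots> = (C0 * Eu * (t powr (1 - \<kappa>) / (\<kappa> - 1)) * Cc) * L2_norm h" by (simp add: mult_ac)
      also have "\<dots> \<le> (\<eta> / 3) * L2_norm h" using Tt(2) by (intro mult_right_mono) auto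
      finally show ?thesis .
    qed
    have "low t * L2_norm h \<le> (\<eta> / 3) * L2_norm h" using Tt(1) by (intro mult_right_mono) auto
    then have "cmod (L2_inner D (\<lambda>\<xi>. of_real (q \<xi>) * fourier ht \<xi>) + L2_inner D (\<lambda>\<xi>. of_real (r \<xi>) * fourier ht \<xi>)
        + L2_inner D (\<lambda>\<xi>. of_real (m t \<xi>) * fourier ht \<xi>)) \<le> (\<eta> / 3) * L2_norm h + (\<eta> / 3) * L2_norm h + (\<eta> / 3) * L2_norm h"
      by (intro norm_triangle_le add_mono order_trans[OF 1] 2 3)
    then show ?thesis
      unfolding D_def[symmetric] split L2_inner_add_right[OF L2_add[OF qL rL] mL DL] L2_inner_add_right[OF qL rL DL] by simp
  qed
  then show ?thesis by (intro exI[of _ "max 1 T"]) auto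
qed

end

section \<open>Klein--Gordon orbits and localizations\<close>

abbreviation jfourier :: "('a::euclidean_space \<Rightarrow> complex) \<Rightarrow> 'a \<Rightarrow> complex" where
  "jfourier f \<equiv> (\<lambda>\<xi>. complex_of_real (japanese \<xi>) * fourier f \<xi>)"

lemma H1_D: "f \<in> H1 \<Longrightarrow> f \<in> L2" "f \<in> H1 \<Longrightarrow> jfourier f \<in> L2"
  by (auto simp: H1_def)

lemma energy_norm_eq: "energy_norm w = sqrt ((L2_norm (multiplier japanese (fst w)))\<^sup>2 + (L2_norm (snd w))\<^sup>2)"
  unfolding energy_norm_def energy_inner_def L2_inner_self by simp

lemma energy_norm_ge:
  "L2_norm (snd w) \<le> energy_norm w"
  "fst w \<in> H1 \<Longrightarrow> L2_norm (jfourier (fst w)) \<le> energy_norm w"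
  unfolding energy_norm_eq using multiplier_norm[OF H1_D(2), of "fst w"] by (auto intro!: real_le_rsqrt)

lemma H1_diff:
  assumes f: "f \<in> H1" and g: "g \<in> H1"
  shows "(\<lambda>x. f x - g x) \<in> H1" "AE \<xi> in lborel. jfourier (\<lambda>x. f x - g x) \<xi> = jfourier f \<xi> - jfourier g \<xi>"
proof -
  note d = L2_diff[OF H1_D(1)[OF f] H1_D(1)[OF g]]
  show AE: "AE \<xi> in lborel. jfourier (\<lambda>x. f x - g x) \<xi> = jfourier f \<xi> - jfourier g \<xi>"
    using fourier_diff[OF H1_D(1)[OF f] H1_D(1)[OF g]] by eventually_elim (simp add: right_diff_distrib)
  have "jfourier (\<lambda>x. f x - g x) \<in> L2"
    by (rule L2_cong_AE[OF L2_diff[OF H1_D(2)[OF f] H1_D(2)[OF g]]])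
      (use AE L2_measurable[OF fourier_L2[OF d]] in auto)
  with d show "(\<lambda>x. f x - g x) \<in> H1" by (simp add: H1_def)
qed

lemma L2_norm_le_jfourier:
  assumes "f \<in> H1" shows "L2_norm f \<le> L2_norm (jfourier f)"
proof -
  have "cmod (fourier f x) \<le> 1 * cmod (jfourier f x)" for x
    using mult_right_mono[OF japanese_ge_1[of x] norm_ge_zero[of "fourier f x"]] by (simp add: norm_mult abs_of_pos)
  from L2_norm_mono[OF H1_D(2)[OF assms] L2_measurable[OF fourier_L2[OF H1_D(1)[OF assms]]] this]
  show ?thesis unfolding fourier_norm[OF H1_D(1)[OF assms]] by simp
qed

lemma energy_tendsto_components:
  assumes "energy_tendsto X w F"
  shows "L2_tendsto (\<lambda>s. fst (X s)) (fst w) F" "L2_tendsto (\<lambda>s. snd (X s)) (snd w) F"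
    and "L2_tendsto (\<lambda>s. jfourier (fst (X s))) (jfourier (fst w)) F"
proof -
  have w: "fst w \<in> H1" "snd w \<in> L2" and ev: "\<forall>\<^sub>F s in F. fst (X s) \<in> H1 \<and> snd (X s) \<in> L2"
    using assms by (auto simp: energy_tendsto_def energy_space_def mem_Times_iff)
  let ?d = "\<lambda>s. (\<lambda>x. fst (X s) x - fst w x, \<lambda>x. snd (X s) x - snd w x)"
  have lim: "((\<lambda>s. energy_norm (?d s)) \<longlongrightarrow> 0) F" using assms by (simp add: energy_tendsto_def)
  have "\<forall>\<^sub>F s in F. norm (L2_norm (\<lambda>x. fst (X s) x - fst w x)) \<le> energy_norm (?d s)"
    using ev
  proof eventually_elim
    case (elim s)
    then show ?case
      using order_trans[OF L2_norm_le_jfourier energy_norm_ge(2)[of "?d s"]] H1_diff(1)[OF _ w(1)] by simp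
  qed
  from Lim_null_comparison[OF this lim] show "L2_tendsto (\<lambda>s. fst (X s)) (fst w) F"
    unfolding L2_tendsto_def using w ev by (auto elim: eventually_mono simp: H1_D)
  have "\<forall>\<^sub>F s in F. norm (L2_norm (\<lambda>x. snd (X s) x - snd w x)) \<le> energy_norm (?d s)"
    using energy_norm_ge(1)[of "?d _"] by (intro always_eventually) simp
  from Lim_null_comparison[OF this lim] show "L2_tendsto (\<lambda>s. snd (X s)) (snd w) F"
    unfolding L2_tendsto_def using w ev by (auto elim: eventually_mono)
  have "\<forall>\<^sub>F s in F. norm (L2_norm (\<lambda>\<xi>. jfourier (fst (X s)) \<xi> - jfourier (fst w) \<xi>)) \<le> energy_norm (?d s)"
    using ev
  proof eventually_elim
    case (elim s)
    then have X: "fst (X s) \<in> H1" by simp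
    note d = H1_diff[OF X w(1)]
    have "L2_norm (\<lambda>\<xi>. jfourier (fst (X s)) \<xi> - jfourier (fst w) \<xi>) = L2_norm (jfourier (\<lambda>x. fst (X s) x - fst w x))"
      by (rule L2_norm_cong_AE) (use d(2) L2_measurable[OF H1_D(2)[OF d(1)]]
        L2_measurable[OF L2_diff[OF H1_D(2)[OF X] H1_D(2)[OF w(1)]]] in auto)
    then show ?case using energy_norm_ge(2)[of "?d s"] d(1) by simp
  qed
  from Lim_null_comparison[OF this lim] show "L2_tendsto (\<lambda>s. jfourier (fst (X s))) (jfourier (fst w)) F"
    unfolding L2_tendsto_def using w ev by (auto elim: eventually_mono simp: H1_D)
qed

lemma energy_tendsto_unique:
  assumes "energy_tendsto X w F" "energy_tendsto X w' F" "F \<noteq> bot"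
  shows "energy_eq w w'"
  unfolding energy_eq_def
  using L2_tendsto_unique[OF energy_tendsto_components(1)[OF assms(1)] energy_tendsto_components(1)[OF assms(2)] assms(3)]
    L2_tendsto_unique[OF energy_tendsto_components(2)[OF assms(1)] energy_tendsto_components(2)[OF assms(2)] assms(3)] by simp

lemma L2_tendsto_fourier:
  assumes "L2_tendsto X f F"
  shows "L2_tendsto (\<lambda>s. fourier (X s)) (fourier f) F"
proof -
  note f = L2_tendstoD[OF assms]
  have "\<forall>\<^sub>F s in F. L2_norm (\<lambda>x. X s x - f x) = L2_norm (\<lambda>\<xi>. fourier (X s) \<xi> - fourier f \<xi>)"
    using f(2)
  proof eventually_elim
    case (elim s)
    note d = L2_diff[OF elim f(1)]
    have "L2_norm (\<lambda>x. X s x - f x) = L2_norm (fourier (\<lambda>x. X s x - f x))" by (rule fourier_norm[OF d, symmetric])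
    also have "\<dots> = L2_norm (\<lambda>\<xi>. fourier (X s) \<xi> - fourier f \<xi>)"
      by (rule L2_norm_cong_AE[OF L2_measurable[OF fourier_L2[OF d]] _ fourier_diff[OF elim f(1)]])
        (rule L2_measurable[OF L2_diff[OF fourier_L2[OF elim] fourier_L2[OF f(1)]]])
    finally show ?case .
  qed
  with f(3) have "((\<lambda>s. L2_norm (\<lambda>\<xi>. fourier (X s) \<xi> - fourier f \<xi>)) \<longlongrightarrow> 0) F" by (rule Lim_transform_eventually)
  then show ?thesis unfolding L2_tendsto_def using f fourier_L2 by (auto elim: eventually_mono)
qed

lemma L2_tendsto_cong_AE:
  assumes X: "L2_tendsto X f F"
    and Y: "\<forall>\<^sub>F s in F. Y s \<in> borel_measurable borel \<and> (AE x in lborel. X s x = Y s x)"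
  shows "L2_tendsto Y f F"
proof -
  note f = L2_tendstoD[OF X]
  have "\<forall>\<^sub>F s in F. L2_norm (\<lambda>x. X s x - f x) = L2_norm (\<lambda>x. Y s x - f x)"
    using Y f(2)
  proof eventually_elim
    case (elim s)
    note [measurable] = L2_measurable[OF f(1)] L2_measurable[OF elim(2)] conjunct1[OF elim(1)]
    show ?case by (rule L2_norm_cong_AE) (measurable, use elim(1) in auto)
  qed
  with f(3) have "((\<lambda>s. L2_norm (\<lambda>x. Y s x - f x)) \<longlongrightarrow> 0) F" by (rule Lim_transform_eventually)
  moreover have "\<forall>\<^sub>F s in F. Y s \<in> L2"
    using Y f(2) by eventually_elim (auto intro: L2_cong_AE)
  ultimately show ?thesis using f(1) by (simp add: L2_tendsto_def)
qed

section \<open>From the Klein-Gordon solution to the Fourier-side orbit\<close>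

text \<open>Plancherel transports every condition. The L^2 derivative of u becomes the quotient
  condition on \<open>U\<close> because dividing <xi> u^ by <xi> recovers u^, and the weak equation
  is carried over by inverse transforming the test function.\<close>

lemma KG_wave_orbit:
  fixes u v :: "real \<Rightarrow> 'a::euclidean_space \<Rightarrow> complex"
  assumes KG: "KG_global_solution N data u v"
    and bd: "\<And>t. t \<ge> 0 \<Longrightarrow> L2_norm (\<lambda>x. N (u t) x t * u t x) \<le> E"
  shows "wave_orbit (\<lambda>t. jfourier (u t)) (\<lambda>t. fourier (v t)) (\<lambda>t. fourier (\<lambda>x. N (u t) x t * u t x)) E"
proof -
  have uv: "u t \<in> H1" "v t \<in> L2" if "t \<ge> 0" for t
    using KG that by (auto simp: KG_global_solution_def energy_space_def)
  have et: "energy_tendsto (\<lambda>s. (u s, v s)) (u t, v t) (at t within {0..})" if "t \<ge> 0" for t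
    using KG that by (auto simp: KG_global_solution_def)
  have dq: "L2_tendsto (\<lambda>s x. (u s x - u t x) / complex_of_real (s - t)) (v t) (at t within {0..})" if "t \<ge> 0" for t
    using KG that by (auto simp: KG_global_solution_def)
  have gL: "(\<lambda>x. N (u t) x t * u t x) \<in> L2" if "t \<ge> 0" for t
    using KG that by (auto simp: KG_global_solution_def)
  show ?thesis
  proof
    fix t :: real assume t: "t \<ge> 0"
    show "L2_tendsto (\<lambda>t. jfourier (u t)) (jfourier (u t)) (at t within {0..})"
      using energy_tendsto_components(3)[OF et[OF t]] by simp
    show "L2_tendsto (\<lambda>t. fourier (v t)) (fourier (v t)) (at t within {0..})"
      using L2_tendsto_fourier[OF energy_tendsto_components(2)[OF et[OF t]]] by simp
    show "fourier (\<lambda>x. N (u t) x t * u t x) \<in> L2" by (rule fourier_L2[OF gL[OF t]])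
    show "L2_norm (fourier (\<lambda>x. N (u t) x t * u t x)) \<le> E" unfolding fourier_norm[OF gL[OF t]] by (rule bd[OF t])
    show "L2_tendsto (\<lambda>s \<xi>. (jfourier (u s) \<xi> - jfourier (u t) \<xi>) / (complex_of_real (s - t) * complex_of_real (japanese \<xi>)))
        (fourier (v t)) (at t within {0..})"
    proof (rule L2_tendsto_cong_AE[OF L2_tendsto_fourier[OF dq[OF t]]])
      have "(\<lambda>\<xi>. (jfourier (u s) \<xi> - jfourier (u t) \<xi>) / (complex_of_real (s - t) * complex_of_real (japanese \<xi>))) \<in> borel_measurable borel \<and>
        (AE \<xi> in lborel. fourier (\<lambda>x. (u s x - u t x) / complex_of_real (s - t)) \<xi> =
          (jfourier (u s) \<xi> - jfourier (u t) \<xi>) / (complex_of_real (s - t) * complex_of_real (japanese \<xi>)))" if s: "s \<ge> 0" for s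
      proof
        note us = H1_D(1)[OF uv(1)[OF s]] and ut = H1_D(1)[OF uv(1)[OF t]]
        note [measurable] = L2_measurable[OF fourier_L2[OF us]] L2_measurable[OF fourier_L2[OF ut]]
        show "(\<lambda>\<xi>. (jfourier (u s) \<xi> - jfourier (u t) \<xi>) / (complex_of_real (s - t) * complex_of_real (japanese \<xi>))) \<in> borel_measurable borel"
          by measurable
        have "AE \<xi> in lborel. fourier (\<lambda>x. (u s x - u t x) / complex_of_real (s - t)) \<xi> = 1 / complex_of_real (s - t) * fourier (\<lambda>x. u s x - u t x) \<xi>"
          using fourier_scale[OF L2_diff[OF us ut], of "1 / complex_of_real (s - t)"] by simp
        with fourier_diff[OF us ut]
        show "AE \<xi> in lborel. fourier (\<lambda>x. (u s x - u t x) / complex_of_real (s - t)) \<xi> =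
          (jfourier (u s) \<xi> - jfourier (u t) \<xi>) / (complex_of_real (s - t) * complex_of_real (japanese \<xi>))"
        proof eventually_elim
          case (elim \<xi>)
          have "(k * a - k * b) / (d * k) = 1 / d * (a - b)" if "k \<noteq> 0" for a b d k :: complex
            using that by (simp add: right_diff_distrib[symmetric])
          then show ?case using elim by simp
        qed
      qed
      then show "\<forall>\<^sub>F s in at t within {0..}. (\<lambda>\<xi>. (jfourier (u s) \<xi> - jfourier (u t) \<xi>) / (complex_of_real (s - t) * complex_of_real (japanese \<xi>))) \<in> borel_measurable borel \<and>
        (AE \<xi> in lborel. fourier (\<lambda>x. (u s x - u t x) / complex_of_real (s - t)) \<xi> =
          (jfourier (u s) \<xi> - jfourier (u t) \<xi>) / (complex_of_real (s - t) * complex_of_real (japanese \<xi>)))"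
        unfolding eventually_at_filter by (intro always_eventually) simp
    qed
  next
    fix \<psi> :: "'a \<Rightarrow> complex" and t :: real
    assume \<psi>: "\<psi> \<in> L2" and J\<psi>: "(\<lambda>\<xi>. complex_of_real (japanese \<xi>) * \<psi> \<xi>) \<in> L2" and t: "t \<ge> 0"
    \<comment> \<open>The weight condition on \<psi> says that this inverse transform lies in
      \<open>H1\<close>, so it is an admissible test function for the original equation.\<close>
    define \<phi> where "\<phi> = inv_fourier \<psi>"
    have \<phi>L: "\<phi> \<in> L2" unfolding \<phi>_def by (rule inv_fourier_L2[OF \<psi>])
    have F\<phi>: "AE \<xi> in lborel. fourier \<phi> \<xi> = \<psi> \<xi>" unfolding \<phi>_def by (rule fourier_inv_fourier[OF \<psi>])
    then have J: "AE \<xi> in lborel. complex_of_real (japanese \<xi>) * \<psi> \<xi> = jfourier \<phi> \<xi>" by eventually_elim simp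
    have "jfourier \<phi> \<in> L2"
      by (rule L2_cong_AE[OF J\<psi> _ J]) (use L2_measurable[OF fourier_L2[OF \<phi>L]] in measurable)
    then have \<phi>: "\<phi> \<in> H1" using \<phi>L by (simp add: H1_def)
    note [measurable] = L2_measurable[OF \<psi>] L2_measurable[OF J\<psi>] L2_measurable[OF fourier_L2[OF \<phi>L]]
    have Vin: "L2_inner f \<phi> = L2_inner (fourier f) \<psi>" if f: "f \<in> L2" for f
    proof -
      have "L2_inner f \<phi> = L2_inner (fourier f) (fourier \<phi>)" by (rule fourier_inner[OF f \<phi>L, symmetric])
      also have "\<dots> = L2_inner (fourier f) \<psi>"
        by (rule L2_inner_cong_AE) (use F\<phi> L2_measurable[OF fourier_L2[OF f]] in auto)
      finally show ?thesis .
    qed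
    have Uin: "L2_inner (multiplier japanese f) (multiplier japanese \<phi>) = L2_inner (jfourier f) (\<lambda>\<xi>. complex_of_real (japanese \<xi>) * \<psi> \<xi>)"
      if f: "f \<in> H1" for f
    proof -
      have "L2_inner (multiplier japanese f) (multiplier japanese \<phi>) = L2_inner (jfourier f) (jfourier \<phi>)"
        unfolding multiplier_def by (rule inv_fourier_inner[OF H1_D(2)[OF f] H1_D(2)[OF \<phi>]])
      also have "\<dots> = L2_inner (jfourier f) (\<lambda>\<xi>. complex_of_real (japanese \<xi>) * \<psi> \<xi>)"
        by (rule L2_inner_cong_AE) (use J L2_measurable[OF H1_D(2)[OF f]] in auto)
      finally show ?thesis .
    qed
    let ?r = "\<lambda>s. L2_inner (\<lambda>x. N (u s) x s * u s x) \<phi> - L2_inner (multiplier japanese (u s)) (multiplier japanese \<phi>)"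
    let ?q = "\<lambda>s. L2_inner (fourier (\<lambda>x. N (u s) x s * u s x)) \<psi> - L2_inner (jfourier (u s)) (\<lambda>\<xi>. complex_of_real (japanese \<xi>) * \<psi> \<xi>)"
    have eq: "indicator {0..t} s *\<^sub>R ?r s = indicator {0..t} s *\<^sub>R ?q s" for s
      using Vin[OF gL] Uin[OF uv(1)] by (simp add: indicator_def)
    have "set_integrable lborel {0..t} ?r \<and> L2_inner (v t) \<phi> - L2_inner (v 0) \<phi> = (LINT s:{0..t}|lborel. ?r s)"
      using KG \<phi> t unfolding KG_global_solution_def Let_def by blast
    then show "set_integrable lborel {0..t} ?q \<and> L2_inner (fourier (v t)) \<psi> - L2_inner (fourier (v 0)) \<psi> = (LINT s:{0..t}|lborel. ?q s)"
      unfolding set_integrable_def set_lebesgue_integral_def eq Vin[OF uv(2)[OF t]] Vin[OF uv(2)[OF order_refl]] .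
  qed
qed

section \<open>Localizations, their adjoints and their strong limits\<close>

lemma F_loc_properties:
  fixes f :: "'a::euclidean_space \<Rightarrow> complex"
  assumes cut: "smooth_cutoff Fc" "smooth_cutoff F1" and f: "f \<in> L2"
  shows "F_loc Fc F1 \<alpha> \<beta> t f \<in> L2"
    and "h \<in> L2 \<Longrightarrow> L2_inner (F_loc Fc F1 \<alpha> \<beta> t f) h = L2_inner (fourier f) (loc_adjoint Fc F1 \<alpha> \<beta> t h)"
proof -
  obtain C where C: "\<And>r. \<bar>F1 r\<bar> \<le> C" using smooth_cutoffD(4)[OF cut(2)] by blast
  obtain C' where C': "\<And>r. \<bar>Fc r\<bar> \<le> C'" using smooth_cutoffD(4)[OF cut(1)] by blast
  have [measurable]: "F1 \<in> borel_measurable borel" by (rule borel_measurable_continuous_onI[OF smooth_cutoffD(1)[OF cut(2)]])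
  let ?m1 = "\<lambda>\<xi>::'a. F1 (t powr \<beta> * norm \<xi>)" and ?m2 = "\<lambda>\<xi>::'a. 1 - F1 (norm \<xi> / t powr \<beta>)"
  have m2: "\<bar>?m2 \<xi>\<bar> \<le> 1 + C" for \<xi> using C[of "norm \<xi> / t powr \<beta>"] by linarith
  have L2m: "(\<lambda>\<xi>. of_real (?m2 \<xi>) * fourier f \<xi>) \<in> L2" by (rule bounded_multiplier_fourier_L2[OF f _ m2]) measurable
  have X2: "multiplier ?m2 f \<in> L2" by (rule multiplier_L2[OF L2m])
  have L1m: "(\<lambda>\<xi>. of_real (?m1 \<xi>) * fourier (multiplier ?m2 f) \<xi>) \<in> L2" by (rule bounded_multiplier_fourier_L2[OF X2 _ C]) measurable
  define X where "X = multiplier ?m1 (multiplier ?m2 f)"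
  have XL: "X \<in> L2" unfolding X_def by (rule multiplier_L2[OF L1m])
  have FX: "AE \<xi> in lborel. fourier X \<xi> = of_real (loc_symbol F1 \<beta> \<beta> t \<xi>) * fourier f \<xi>"
    using fourier_multiplier[OF L1m] fourier_multiplier[OF L2m] unfolding X_def loc_symbol_def
    by eventually_elim simp
  have ccb: "cmod (complex_of_real (1 - Fc r)) \<le> 1 + C'" for r using C'[of r] unfolding norm_of_real by linarith
  have eq: "F_loc Fc F1 \<alpha> \<beta> t f = (\<lambda>x. complex_of_real (1 - Fc (norm x / t powr \<alpha>)) * X x)"
    unfolding F_loc_def X_def ..
  show "F_loc Fc F1 \<alpha> \<beta> t f \<in> L2"
    unfolding eq by (rule L2_mult_bounded[OF XL loc_space_cutoff[OF cut(1)] ccb])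
  assume h: "h \<in> L2"
  define ht where "ht x = complex_of_real (1 - Fc (norm x / t powr \<alpha>)) * h x" for x
  have htL: "ht \<in> L2" unfolding ht_def by (rule L2_mult_bounded[OF h loc_space_cutoff[OF cut(1)] ccb])
  note [measurable] = loc_symbol_measurable[OF cut(2)] L2_measurable[OF fourier_L2[OF f]]
  have "L2_inner (F_loc Fc F1 \<alpha> \<beta> t f) h = L2_inner X ht"
    unfolding eq L2_inner_move ht_def by simp
  also have "\<dots> = L2_inner (fourier X) (fourier ht)" by (rule fourier_inner[OF XL htL, symmetric])
  also have "\<dots> = L2_inner (\<lambda>\<xi>. of_real (loc_symbol F1 \<beta> \<beta> t \<xi>) * fourier f \<xi>) (fourier ht)"
    by (rule L2_inner_cong_AE) (use FX L2_measurable[OF fourier_L2[OF XL]] L2_measurable[OF fourier_L2[OF htL]] in auto)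
  also have "\<dots> = L2_inner (fourier f) (loc_adjoint Fc F1 \<alpha> \<beta> t h)"
    unfolding L2_inner_move loc_adjoint_def[abs_def] ht_def by simp
  finally show "L2_inner (F_loc Fc F1 \<alpha> \<beta> t f) h = L2_inner (fourier f) (loc_adjoint Fc F1 \<alpha> \<beta> t h)" .
qed

lemma eventually_powr_ge:
  assumes "\<beta> > 0" shows "\<forall>\<^sub>F t::real in at_top. c \<le> t powr \<beta>"
proof -
  have "\<forall>\<^sub>F t::real in at_top. max c 1 powr (1 / \<beta>) \<le> t" by (rule eventually_ge_at_top)
  then show ?thesis
  proof eventually_elim
    case (elim t)
    then have "(max c 1 powr (1 / \<beta>)) powr \<beta> \<le> t powr \<beta>" using assms by (intro powr_mono2) auto
    then show ?case using assms by (simp add: powr_powr)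
  qed
qed

text \<open>At a fixed nonzero frequency both cutoffs eventually take their constant values exactly.
  Zero frequency, where the low-frequency cutoff vanishes at all times, is a null set. Waiting until
  t^\<beta> >= 3|xi| gives the strict inequality |xi|/t^\<beta> < 1/2 that the cutoff asks
  for.\<close>

lemma loc_symbol_error:
  fixes f :: "'a::euclidean_space \<Rightarrow> complex"
  assumes cut: "smooth_cutoff F" and \<beta>: "\<beta> > 0" and f: "f \<in> L2"
  shows "((\<lambda>t. L2_norm (\<lambda>\<xi>. (complex_of_real (loc_symbol F \<beta> \<beta> t \<xi>) - 1) * f \<xi>)) \<longlongrightarrow> 0) at_top"
proof -
  obtain C where C: "\<And>r. \<bar>F r\<bar> \<le> C" using smooth_cutoffD(4)[OF cut] by blast
  note [measurable] = loc_symbol_measurable[OF cut]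
  have lim: "((\<lambda>t. complex_of_real (loc_symbol F \<beta> \<beta> t \<xi>) - 1) \<longlongrightarrow> 0) at_top" if \<xi>: "\<xi> \<noteq> 0" for \<xi> :: 'a
  proof (rule tendsto_eventually)
    show "\<forall>\<^sub>F t in at_top. complex_of_real (loc_symbol F \<beta> \<beta> t \<xi>) - 1 = 0"
      using eventually_powr_ge[OF \<beta>, of "1 / norm \<xi>"] eventually_powr_ge[OF \<beta>, of "3 * norm \<xi>"]
    proof eventually_elim
      case (elim t)
      have p: "t powr \<beta> > 0" by (rule less_le_trans[OF _ elim(2)]) (use \<xi> in simp)
      have "1 \<le> t powr \<beta> * norm \<xi>" using elim(1) \<xi> by (simp add: field_simps)
      moreover have "norm \<xi> < t powr \<beta> / 2" using elim(2) p by linarith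
      then have "norm \<xi> / t powr \<beta> < 1/2" using p by (simp add: field_simps)
      ultimately show ?case using smooth_cutoffD(2,3)[OF cut] by (simp add: loc_symbol_def)
    qed
  qed
  have "AE \<xi> in lborel. \<xi> \<noteq> (0::'a)" by (rule AE_lborel_singleton)
  then have AE: "AE \<xi> in lborel. ((\<lambda>t. complex_of_real (loc_symbol F \<beta> \<beta> t (\<xi>::'a)) - 1) \<longlongrightarrow> 0) at_top"
    by eventually_elim (rule lim)
  have bd: "cmod (complex_of_real (loc_symbol F \<beta> \<beta> t \<xi>) - 1) \<le> C * (1 + C) + 1" for t and \<xi> :: 'a
    by (rule order_trans[OF norm_triangle_ineq4])
      (use loc_symbol_bound[of F C \<beta> \<beta> t \<xi>] C in simp)
  have m: "(\<lambda>\<xi>::'a. complex_of_real (loc_symbol F \<beta> \<beta> t \<xi>) - 1) \<in> borel_measurable borel" for t by measurable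
  show ?thesis by (rule L2_tendsto_dominated_at_top[OF f m bd AE])
qed

lemma space_cutoff_error:
  fixes f :: "'a::euclidean_space \<Rightarrow> complex"
  assumes cut: "smooth_cutoff F" and \<alpha>: "\<alpha> > 0" and f: "f \<in> L2"
  shows "((\<lambda>t. L2_norm (\<lambda>x. (complex_of_real (1 - F (norm x / t powr \<alpha>)) - 1) * f x)) \<longlongrightarrow> 0) at_top"
proof -
  obtain C where C: "\<And>r. \<bar>F r\<bar> \<le> C" using smooth_cutoffD(4)[OF cut] by blast
  have [measurable]: "(\<lambda>x::'a. complex_of_real (1 - F (norm x / s))) \<in> borel_measurable borel" for s
    by (rule loc_space_cutoff[OF cut])
  have "((\<lambda>t. complex_of_real (1 - F (norm x / t powr \<alpha>)) - 1) \<longlongrightarrow> 0) at_top" for x :: 'a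
  proof (rule tendsto_eventually)
    show "\<forall>\<^sub>F t in at_top. complex_of_real (1 - F (norm x / t powr \<alpha>)) - 1 = 0"
      using eventually_powr_ge[OF \<alpha>, of "3 * norm x + 1"]
    proof eventually_elim
      case (elim t)
      have p: "t powr \<alpha> > 0" and "norm x < t powr \<alpha> / 2" using elim norm_ge_zero[of x] by linarith+
      then have "norm x / t powr \<alpha> < 1/2" by (simp add: field_simps)
      then show ?case using smooth_cutoffD(3)[OF cut] by simp
    qed
  qed
  then have AE: "AE x::'a in lborel. ((\<lambda>t. complex_of_real (1 - F (norm x / t powr \<alpha>)) - 1) \<longlongrightarrow> 0) at_top" by simp
  have bd: "cmod (complex_of_real (1 - F (norm x / t powr \<alpha>)) - 1) \<le> C" for t and x :: 'a
    using C[of "norm x / t powr \<alpha>"] by (simp add: norm_minus_commute)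
  have m: "(\<lambda>x::'a. complex_of_real (1 - F (norm x / t powr \<alpha>)) - 1) \<in> borel_measurable borel" for t by measurable
  show ?thesis by (rule L2_tendsto_dominated_at_top[OF f m bd AE])
qed

text \<open>The error is the bounded symbol applied to the transform of the spatial truncation
  error, plus the frequency truncation error of h^. Both tend to 0 by dominated convergence.\<close>

lemma loc_adjoint_tendsto:
  fixes h :: "'a::euclidean_space \<Rightarrow> complex"
  assumes cut: "smooth_cutoff Fc" "smooth_cutoff F1" and ab: "\<alpha> > 0" "\<beta> > 0" and h: "h \<in> L2"
  shows "loc_adjoint Fc F1 \<alpha> \<beta> t h \<in> L2"
    and "((\<lambda>t. L2_norm (\<lambda>\<xi>. loc_adjoint Fc F1 \<alpha> \<beta> t h \<xi> - fourier h \<xi>)) \<longlongrightarrow> 0) at_top"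
proof -
  obtain C where C: "\<And>r. \<bar>F1 r\<bar> \<le> C" using smooth_cutoffD(4)[OF cut(2)] by blast
  obtain C' where C': "\<And>r. \<bar>Fc r\<bar> \<le> C'" using smooth_cutoffD(4)[OF cut(1)] by blast
  note [measurable] = loc_symbol_measurable[OF cut(2)]
  have ccb: "cmod (complex_of_real (1 - Fc r)) \<le> 1 + C'" for r using C'[of r] unfolding norm_of_real by linarith
  define ht where "ht t x = complex_of_real (1 - Fc (norm x / t powr \<alpha>)) * h x" for t x
  have htL: "ht t \<in> L2" for t unfolding ht_def by (rule L2_mult_bounded[OF h loc_space_cutoff[OF cut(1)] ccb])
  have Cb: "\<bar>loc_symbol F1 \<beta> \<beta> t \<xi>\<bar> \<le> C * (1 + C)" for t and \<xi> :: 'a by (rule loc_symbol_bound[OF C])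
  have mL: "(\<lambda>\<xi>. of_real (loc_symbol F1 \<beta> \<beta> t \<xi>) * fourier f \<xi>) \<in> L2" if "f \<in> L2" for t and f :: "'a \<Rightarrow> complex"
    by (rule bounded_multiplier_fourier_L2[OF that _ Cb]) measurable
  have eq: "loc_adjoint Fc F1 \<alpha> \<beta> t h = (\<lambda>\<xi>. of_real (loc_symbol F1 \<beta> \<beta> t \<xi>) * fourier (ht t) \<xi>)" for t
    unfolding loc_adjoint_def[abs_def] ht_def ..
  show L: "loc_adjoint Fc F1 \<alpha> \<beta> t h \<in> L2" for t unfolding eq by (rule mL[OF htL])
  let ?e1 = "\<lambda>t. L2_norm (\<lambda>x. (complex_of_real (1 - Fc (norm x / t powr \<alpha>)) - 1) * h x)"
  let ?e2 = "\<lambda>t. L2_norm (\<lambda>\<xi>. (complex_of_real (loc_symbol F1 \<beta> \<beta> t \<xi>) - 1) * fourier h \<xi>)"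
  have "L2_norm (\<lambda>\<xi>. loc_adjoint Fc F1 \<alpha> \<beta> t h \<xi> - fourier h \<xi>) \<le> C * (1 + C) * ?e1 t + ?e2 t" for t
  proof -
    have d: "(\<lambda>x. ht t x - h x) = (\<lambda>x. (complex_of_real (1 - Fc (norm x / t powr \<alpha>)) - 1) * h x)"
      unfolding ht_def by (simp add: left_diff_distrib)
    have "L2_norm (\<lambda>\<xi>. loc_adjoint Fc F1 \<alpha> \<beta> t h \<xi> - fourier h \<xi>) \<le>
        L2_norm (\<lambda>\<xi>. loc_adjoint Fc F1 \<alpha> \<beta> t h \<xi> - of_real (loc_symbol F1 \<beta> \<beta> t \<xi>) * fourier h \<xi>) +
        L2_norm (\<lambda>\<xi>. of_real (loc_symbol F1 \<beta> \<beta> t \<xi>) * fourier h \<xi> - fourier h \<xi>)"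
      by (rule L2_norm_triangle3[OF L mL[OF h] fourier_L2[OF h]])
    also have "(\<lambda>\<xi>. loc_adjoint Fc F1 \<alpha> \<beta> t h \<xi> - of_real (loc_symbol F1 \<beta> \<beta> t \<xi>) * fourier h \<xi>) =
        (\<lambda>\<xi>. of_real (loc_symbol F1 \<beta> \<beta> t \<xi>) * (fourier (ht t) \<xi> - fourier h \<xi>))"
      unfolding eq by (simp add: right_diff_distrib)
    also have "L2_norm \<dots> \<le> C * (1 + C) * L2_norm (\<lambda>\<xi>. fourier (ht t) \<xi> - fourier h \<xi>)"
      by (rule L2_norm_mult_bounded[OF L2_diff[OF fourier_L2[OF htL] fourier_L2[OF h]]]) (use Cb in simp_all)
    also have "L2_norm (\<lambda>\<xi>. fourier (ht t) \<xi> - fourier h \<xi>) = L2_norm (fourier (\<lambda>x. ht t x - h x))"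
      by (rule L2_norm_cong_AE[symmetric]) (rule fourier_diff[OF htL h] L2_measurable[OF fourier_L2[OF L2_diff[OF htL h]]]
        L2_measurable[OF L2_diff[OF fourier_L2[OF htL] fourier_L2[OF h]]])+
    also have "\<dots> = ?e1 t" unfolding d[symmetric] by (rule fourier_norm[OF L2_diff[OF htL h]])
    also have "(\<lambda>\<xi>. of_real (loc_symbol F1 \<beta> \<beta> t \<xi>) * fourier h \<xi> - fourier h \<xi>) =
        (\<lambda>\<xi>. (complex_of_real (loc_symbol F1 \<beta> \<beta> t \<xi>) - 1) * fourier h \<xi>)"
      by (simp add: left_diff_distrib)
    finally show ?thesis by simp
  qed
  then have ev: "\<forall>\<^sub>F t in at_top. norm (L2_norm (\<lambda>\<xi>. loc_adjoint Fc F1 \<alpha> \<beta> t h \<xi> - fourier h \<xi>)) \<le> C * (1 + C) * ?e1 t + ?e2 t"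
    by (intro always_eventually) (simp only: real_norm_def abs_of_nonneg L2_norm_nonneg simp_thms)
  have "((\<lambda>t. C * (1 + C) * ?e1 t + ?e2 t) \<longlongrightarrow> C * (1 + C) * 0 + 0) at_top"
    by (rule tendsto_add[OF tendsto_mult[OF tendsto_const space_cutoff_error[OF cut(1) ab(1) h]]
      loc_symbol_error[OF cut(2) ab(2) fourier_L2[OF h]]])
  then have lim: "((\<lambda>t. C * (1 + C) * ?e1 t + ?e2 t) \<longlongrightarrow> 0) at_top" by (simp only: mult_zero_right add_0)
  show "((\<lambda>t. L2_norm (\<lambda>\<xi>. loc_adjoint Fc F1 \<alpha> \<beta> t h \<xi> - fourier h \<xi>)) \<longlongrightarrow> 0) at_top"
    by (rule Lim_null_comparison[OF ev lim])
qed

text \<open>By duality, the error against h splits into (\<chi> - 1) a paired with h and the symbol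
  error on a^ paired with the transform of \<chi> h, where \<chi> is the spatial cutoff. Taking the
  supremum over h gives the norm.\<close>

lemma F_loc_tendsto:
  fixes a :: "'a::euclidean_space \<Rightarrow> complex"
  assumes cut: "smooth_cutoff Fc" "smooth_cutoff F1" and ab: "\<alpha> > 0" "\<beta> > 0" and a: "a \<in> L2"
  shows "((\<lambda>t. L2_norm (\<lambda>x. F_loc Fc F1 \<alpha> \<beta> t a x - a x)) \<longlongrightarrow> 0) at_top"
proof -
  obtain C' where C': "C' \<ge> 1" "\<And>r. \<bar>Fc r\<bar> \<le> C'" using smooth_cutoffD(4)[OF cut(1)] by blast
  obtain C where C: "\<And>r. \<bar>F1 r\<bar> \<le> C" using smooth_cutoffD(4)[OF cut(2)] by blast
  note [measurable] = loc_symbol_measurable[OF cut(2)]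
  have ccb: "cmod (complex_of_real (1 - Fc r)) \<le> 1 + C'" for r using C'(2)[of r] unfolding norm_of_real by linarith
  let ?e1 = "\<lambda>t. L2_norm (\<lambda>x. (complex_of_real (1 - Fc (norm x / t powr \<alpha>)) - 1) * a x)"
  let ?e2 = "\<lambda>t. L2_norm (\<lambda>\<xi>. (complex_of_real (loc_symbol F1 \<beta> \<beta> t \<xi>) - 1) * fourier a \<xi>)"
  have bound: "L2_norm (\<lambda>x. F_loc Fc F1 \<alpha> \<beta> t a x - a x) \<le> ?e1 t + (1 + C') * ?e2 t" for t
  proof (rule L2_norm_le_dual)
    let ?\<chi> = "\<lambda>x::'a. complex_of_real (1 - Fc (norm x / t powr \<alpha>))"
    let ?m = "\<lambda>\<xi>::'a. complex_of_real (loc_symbol F1 \<beta> \<beta> t \<xi>)"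
    note FL = F_loc_properties[OF cut a, where \<alpha>=\<alpha> and \<beta>=\<beta> and t=t]
    show "(\<lambda>x. F_loc Fc F1 \<alpha> \<beta> t a x - a x) \<in> L2" by (rule L2_diff[OF FL(1) a])
    show "0 \<le> ?e1 t + (1 + C') * ?e2 t" using C'(1) by simp
    have alg: "y * (c * n) + x * n = (x + c * y) * n" for c n x y :: real by (simp add: algebra_simps)
    fix h :: "'a \<Rightarrow> complex" assume h: "h \<in> L2"
    have \<chi>h: "(\<lambda>x. ?\<chi> x * h x) \<in> L2" by (rule L2_mult_bounded[OF h loc_space_cutoff[OF cut(1)] ccb])
    have \<chi>n: "L2_norm (\<lambda>x. ?\<chi> x * h x) \<le> (1 + C') * L2_norm h"
      by (rule L2_norm_mult_bounded[OF h loc_space_cutoff[OF cut(1)] ccb])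
    have \<chi>a: "(\<lambda>x. ?\<chi> x * a x) \<in> L2" by (rule L2_mult_bounded[OF a loc_space_cutoff[OF cut(1)] ccb])
    have ma: "(\<lambda>\<xi>. ?m \<xi> * fourier a \<xi>) \<in> L2"
      by (rule bounded_multiplier_fourier_L2[OF a _ loc_symbol_bound[OF C]]) measurable
    note Fa = fourier_L2[OF a] and F\<chi> = fourier_L2[OF \<chi>h]
    have d1: "(\<lambda>x. (?\<chi> x - 1) * a x) = (\<lambda>x. ?\<chi> x * a x - a x)" by (simp add: left_diff_distrib)
    have d2: "(\<lambda>\<xi>. (?m \<xi> - 1) * fourier a \<xi>) = (\<lambda>\<xi>. ?m \<xi> * fourier a \<xi> - fourier a \<xi>)" by (simp add: left_diff_distrib)
    have L1: "(\<lambda>x. (?\<chi> x - 1) * a x) \<in> L2" unfolding d1 by (rule L2_diff[OF \<chi>a a])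
    have L2': "(\<lambda>\<xi>. (?m \<xi> - 1) * fourier a \<xi>) \<in> L2" unfolding d2 by (rule L2_diff[OF ma Fa])
    have 1: "L2_inner (F_loc Fc F1 \<alpha> \<beta> t a) h = L2_inner (\<lambda>\<xi>. ?m \<xi> * fourier a \<xi>) (fourier (\<lambda>x. ?\<chi> x * h x))"
      unfolding FL(2)[OF h] loc_adjoint_def[abs_def] L2_inner_move by simp
    have 2: "L2_inner (\<lambda>x. ?\<chi> x * a x) h = L2_inner (fourier a) (fourier (\<lambda>x. ?\<chi> x * h x))"
      unfolding fourier_inner[OF a \<chi>h] L2_inner_move by simp
    have "L2_inner (\<lambda>x. F_loc Fc F1 \<alpha> \<beta> t a x - a x) h =
        L2_inner (\<lambda>\<xi>. (?m \<xi> - 1) * fourier a \<xi>) (fourier (\<lambda>x. ?\<chi> x * h x)) + L2_inner (\<lambda>x. (?\<chi> x - 1) * a x) h"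
      unfolding d1 d2 L2_inner_diff_left[OF FL(1) a h] L2_inner_diff_left[OF ma Fa F\<chi>] L2_inner_diff_left[OF \<chi>a a h] 1 2
      by simp
    then have "cmod (L2_inner (\<lambda>x. F_loc Fc F1 \<alpha> \<beta> t a x - a x) h) \<le>
        ?e2 t * L2_norm (\<lambda>x. ?\<chi> x * h x) + ?e1 t * L2_norm h"
      using order_trans[OF norm_triangle_ineq add_mono[OF L2_Cauchy_Schwarz[OF L2' F\<chi>, unfolded fourier_norm[OF \<chi>h]]
        L2_Cauchy_Schwarz[OF L1 h]]] by (simp only:)
    from order_trans[OF this add_right_mono[OF mult_left_mono[OF \<chi>n L2_norm_nonneg]]]
    show "cmod (L2_inner (\<lambda>x. F_loc Fc F1 \<alpha> \<beta> t a x - a x) h) \<le> (?e1 t + (1 + C') * ?e2 t) * L2_norm h"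
      unfolding alg .
  qed
  have "((\<lambda>t. ?e1 t + (1 + C') * ?e2 t) \<longlongrightarrow> 0 + (1 + C') * 0) at_top"
    by (rule tendsto_add[OF space_cutoff_error[OF cut(1) ab(1) a]
      tendsto_mult[OF tendsto_const loc_symbol_error[OF cut(2) ab(2) fourier_L2[OF a]]]])
  then have lim: "((\<lambda>t. ?e1 t + (1 + C') * ?e2 t) \<longlongrightarrow> 0) at_top" by (simp only: mult_zero_right add_0)
  have ev: "\<forall>\<^sub>F t in at_top. norm (L2_norm (\<lambda>x. F_loc Fc F1 \<alpha> \<beta> t a x - a x)) \<le> ?e1 t + (1 + C') * ?e2 t"
    using bound by (intro always_eventually) (simp only: real_norm_def abs_of_nonneg L2_norm_nonneg simp_thms)
  show ?thesis by (rule Lim_null_comparison[OF ev lim])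
qed

text \<open>The hypothesis \<open>small\<close> is uniform over h, so by duality the localization of
  A t minus the limit is small in norm and not just weakly. What remains is the localization of the
  fixed limit, which converges strongly to it.\<close>

lemma localized_strong_limit:
  fixes c :: "'a::euclidean_space \<Rightarrow> complex" and A :: "real \<Rightarrow> 'a \<Rightarrow> complex"
  assumes cut: "smooth_cutoff Fc" "smooth_cutoff F1" and ab: "\<alpha> > 0" "\<beta> > 0"
    and c: "c \<in> L2" and A: "\<And>t. t \<ge> 0 \<Longrightarrow> A t \<in> L2"
    and small: "\<And>\<eta>. \<eta> > 0 \<Longrightarrow> \<exists>T\<ge>1. \<forall>t\<ge>T. \<forall>h\<in>L2.
      cmod (L2_inner (\<lambda>\<xi>. c \<xi> - fourier (A t) \<xi>) (loc_adjoint Fc F1 \<alpha> \<beta> t h)) \<le> \<eta> * L2_norm h"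
  shows "L2_tendsto (\<lambda>t. F_loc Fc F1 \<alpha> \<beta> t (A t)) (inv_fourier c) at_top"
proof -
  define a where "a = inv_fourier c"
  have a: "a \<in> L2" unfolding a_def by (rule inv_fourier_L2[OF c])
  have Fa: "AE \<xi> in lborel. fourier a \<xi> = c \<xi>" unfolding a_def by (rule fourier_inv_fourier[OF c])
  note La = F_loc_properties[OF cut a, where \<alpha>=\<alpha> and \<beta>=\<beta>]
  have "((\<lambda>t. L2_norm (\<lambda>x. F_loc Fc F1 \<alpha> \<beta> t a x - F_loc Fc F1 \<alpha> \<beta> t (A t) x)) \<longlongrightarrow> 0) at_top"
  proof (rule tendstoI)
    fix e :: real assume e: "e > 0"
    obtain T where T: "T \<ge> 1" "\<And>t h. t \<ge> T \<Longrightarrow> h \<in> L2 \<Longrightarrow>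
        cmod (L2_inner (\<lambda>\<xi>. c \<xi> - fourier (A t) \<xi>) (loc_adjoint Fc F1 \<alpha> \<beta> t h)) \<le> e / 2 * L2_norm h"
      using small[of "e / 2"] e by auto
    have half: "L2_norm (\<lambda>x. F_loc Fc F1 \<alpha> \<beta> t a x - F_loc Fc F1 \<alpha> \<beta> t (A t) x) \<le> e / 2" if t: "t \<ge> T" for t
    proof (rule L2_norm_le_dual)
      have At: "A t \<in> L2" using A[of t] t T(1) by simp
      note LA = F_loc_properties[OF cut At, where \<alpha>=\<alpha> and \<beta>=\<beta> and t=t]
      show "(\<lambda>x. F_loc Fc F1 \<alpha> \<beta> t a x - F_loc Fc F1 \<alpha> \<beta> t (A t) x) \<in> L2" by (rule L2_diff[OF La(1) LA(1)])
      show "0 \<le> e / 2" using e by simp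
      fix h :: "'a \<Rightarrow> complex" assume h: "h \<in> L2"
      note \<tau> = loc_adjoint_tendsto(1)[OF cut ab h, of t]
      have "L2_inner (\<lambda>x. F_loc Fc F1 \<alpha> \<beta> t a x - F_loc Fc F1 \<alpha> \<beta> t (A t) x) h =
          L2_inner (fourier a) (loc_adjoint Fc F1 \<alpha> \<beta> t h) - L2_inner (fourier (A t)) (loc_adjoint Fc F1 \<alpha> \<beta> t h)"
        unfolding L2_inner_diff_left[OF La(1) LA(1) h] La(2)[OF h] LA(2)[OF h] ..
      also have "L2_inner (fourier a) (loc_adjoint Fc F1 \<alpha> \<beta> t h) = L2_inner c (loc_adjoint Fc F1 \<alpha> \<beta> t h)"
        by (rule L2_inner_cong_AE) (use Fa L2_measurable[OF fourier_L2[OF a]] L2_measurable[OF c] L2_measurable[OF \<tau>] in auto)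
      finally have "L2_inner (\<lambda>x. F_loc Fc F1 \<alpha> \<beta> t a x - F_loc Fc F1 \<alpha> \<beta> t (A t) x) h =
          L2_inner (\<lambda>\<xi>. c \<xi> - fourier (A t) \<xi>) (loc_adjoint Fc F1 \<alpha> \<beta> t h)"
        unfolding L2_inner_diff_left[OF c fourier_L2[OF At] \<tau>] .
      with T(2)[OF t h] show "cmod (L2_inner (\<lambda>x. F_loc Fc F1 \<alpha> \<beta> t a x - F_loc Fc F1 \<alpha> \<beta> t (A t) x) h) \<le> e / 2 * L2_norm h"
        by simp
    qed
    have "dist (L2_norm (\<lambda>x. F_loc Fc F1 \<alpha> \<beta> t a x - F_loc Fc F1 \<alpha> \<beta> t (A t) x)) 0 < e" if "t \<ge> T" for t
      using le_less_trans[OF half[OF that], of e] e by (simp add: dist_real_def)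
    then show "\<forall>\<^sub>F t in at_top. dist (L2_norm (\<lambda>x. F_loc Fc F1 \<alpha> \<beta> t a x - F_loc Fc F1 \<alpha> \<beta> t (A t) x)) 0 < e"
      unfolding eventually_at_top_linorder by blast
  qed
  from tendsto_add[OF this F_loc_tendsto[OF cut ab a]]
  have lim: "((\<lambda>t. L2_norm (\<lambda>x. F_loc Fc F1 \<alpha> \<beta> t a x - F_loc Fc F1 \<alpha> \<beta> t (A t) x) +
      L2_norm (\<lambda>x. F_loc Fc F1 \<alpha> \<beta> t a x - a x)) \<longlongrightarrow> 0) at_top" by (simp only: mult_zero_right add_0)
  have ev0: "\<forall>\<^sub>F t in at_top. F_loc Fc F1 \<alpha> \<beta> t (A t) \<in> L2"
    using eventually_ge_at_top[of 0] by eventually_elim (rule F_loc_properties(1)[OF cut A])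
  then have ev: "\<forall>\<^sub>F t in at_top. norm (L2_norm (\<lambda>x. F_loc Fc F1 \<alpha> \<beta> t (A t) x - a x)) \<le>
      L2_norm (\<lambda>x. F_loc Fc F1 \<alpha> \<beta> t a x - F_loc Fc F1 \<alpha> \<beta> t (A t) x) + L2_norm (\<lambda>x. F_loc Fc F1 \<alpha> \<beta> t a x - a x)"
  proof eventually_elim
    case (elim t)
    then show ?case
      using L2_norm_triangle3[OF elim La(1) a, of t] by (simp add: L2_norm_minus_commute[of "F_loc Fc F1 \<alpha> \<beta> t (A t)"])
  qed
  from Lim_null_comparison[OF ev lim] show ?thesis
    unfolding L2_tendsto_def a_def[symmetric] using ev0 a by simp
qed

section \<open>Energy convergence and the free flow\<close>

lemma bessel_multiplier:
  fixes f :: "'a::euclidean_space \<Rightarrow> complex"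
  assumes f: "f \<in> L2"
  shows "multiplier (\<lambda>\<xi>. 1 / japanese \<xi>) f \<in> H1"
    and "AE \<xi> in lborel. jfourier (multiplier (\<lambda>\<xi>. 1 / japanese \<xi>) f) \<xi> = fourier f \<xi>"
proof -
  have bd: "\<bar>1 / japanese \<xi>\<bar> \<le> 1" for \<xi> :: 'a using japanese_ge_1[of \<xi>] by simp
  have m: "(\<lambda>\<xi>. of_real (1 / japanese \<xi>) * fourier f \<xi>) \<in> L2"
    by (rule bounded_multiplier_fourier_L2[OF f _ bd]) measurable
  let ?g = "multiplier (\<lambda>\<xi>. 1 / japanese \<xi>) f"
  have g: "?g \<in> L2" by (rule multiplier_L2[OF m])
  show AE: "AE \<xi> in lborel. jfourier ?g \<xi> = fourier f \<xi>"
    using fourier_multiplier[OF m] by eventually_elim simp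
  note [measurable] = L2_measurable[OF fourier_L2[OF g]]
  have "jfourier ?g \<in> L2"
    by (rule L2_cong_AE[OF fourier_L2[OF f]]) (measurable, use AE in auto)
  with g show "?g \<in> H1" by (simp add: H1_def)
qed

text \<open>The weight <p> of the energy norm undoes the outer <p>^{-1} of the localization matrix.
  Convergence in the energy space thereby reduces to L^2 convergence of two scalar
  localizations.\<close>

lemma energy_norm_bessel_diff:
  assumes f: "f \<in> L2" and g: "g \<in> L2"
  shows "energy_norm (\<lambda>x. multiplier (\<lambda>\<xi>. 1 / japanese \<xi>) f x - multiplier (\<lambda>\<xi>. 1 / japanese \<xi>) g x, h) =
    sqrt ((L2_norm (\<lambda>x. f x - g x))\<^sup>2 + (L2_norm h)\<^sup>2)"
proof -
  let ?d = "\<lambda>x. multiplier (\<lambda>\<xi>. 1 / japanese \<xi>) f x - multiplier (\<lambda>\<xi>. 1 / japanese \<xi>) g x"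
  note d = H1_diff[OF bessel_multiplier(1)[OF f] bessel_multiplier(1)[OF g]]
  have "L2_norm (multiplier japanese ?d) = L2_norm (jfourier ?d)" by (rule multiplier_norm[OF H1_D(2)[OF d(1)]])
  also have "\<dots> = L2_norm (fourier (\<lambda>x. f x - g x))"
  proof (rule L2_norm_cong_AE)
    show "AE \<xi> in lborel. jfourier ?d \<xi> = fourier (\<lambda>x. f x - g x) \<xi>"
      using d(2) bessel_multiplier(2)[OF f] bessel_multiplier(2)[OF g] fourier_diff[OF f g]
      by eventually_elim simp
  qed (rule L2_measurable[OF H1_D(2)[OF d(1)]] L2_measurable[OF fourier_L2[OF L2_diff[OF f g]]])+
  also have "\<dots> = L2_norm (\<lambda>x. f x - g x)" by (rule fourier_norm[OF L2_diff[OF f g]])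
  finally show ?thesis unfolding energy_norm_eq by simp
qed

lemma energy_tendsto_bessel:
  assumes X: "L2_tendsto X f F" and Y: "L2_tendsto Y g F"
  shows "energy_tendsto (\<lambda>s. (multiplier (\<lambda>\<xi>. 1 / japanese \<xi>) (X s), Y s)) (multiplier (\<lambda>\<xi>. 1 / japanese \<xi>) f, g) F"
proof -
  note f = L2_tendstoD[OF X] and g = L2_tendstoD[OF Y]
  have "((\<lambda>s. sqrt ((L2_norm (\<lambda>x. X s x - f x))\<^sup>2 + (L2_norm (\<lambda>x. Y s x - g x))\<^sup>2)) \<longlongrightarrow> sqrt (0\<^sup>2 + 0\<^sup>2)) F"
    by (intro tendsto_real_sqrt tendsto_add tendsto_power f g)
  moreover have "\<forall>\<^sub>F s in F. sqrt ((L2_norm (\<lambda>x. X s x - f x))\<^sup>2 + (L2_norm (\<lambda>x. Y s x - g x))\<^sup>2) =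
      energy_norm (\<lambda>x. multiplier (\<lambda>\<xi>. 1 / japanese \<xi>) (X s) x - multiplier (\<lambda>\<xi>. 1 / japanese \<xi>) f x, \<lambda>x. Y s x - g x)"
    using f(2) by eventually_elim (rule energy_norm_bessel_diff[OF _ f(1), symmetric])
  ultimately have "((\<lambda>s. energy_norm (\<lambda>x. multiplier (\<lambda>\<xi>. 1 / japanese \<xi>) (X s) x -
      multiplier (\<lambda>\<xi>. 1 / japanese \<xi>) f x, \<lambda>x. Y s x - g x)) \<longlongrightarrow> sqrt (0\<^sup>2 + 0\<^sup>2)) F"
    by (rule Lim_transform_eventually)
  moreover have "\<forall>\<^sub>F s in F. (multiplier (\<lambda>\<xi>. 1 / japanese \<xi>) (X s), Y s) \<in> energy_space"
    using f(2) g(2) by eventually_elim (simp add: energy_space_def bessel_multiplier(1))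
  ultimately show ?thesis
    unfolding energy_tendsto_def using bessel_multiplier(1)[OF f(1)] g(1) by (simp add: energy_space_def)
qed

text \<open>In the variables (<xi> f^, g^) the free flow is a rotation by the angle t <xi>. All
  coefficients become bounded, although one multiplier acting on f is not.\<close>

lemma free_evol_fourier:
  fixes f g :: "'a::euclidean_space \<Rightarrow> complex" and t :: real
  assumes f: "f \<in> H1" and g: "g \<in> L2"
  defines "w \<equiv> free_evol (- t) (f, g)"
  shows "fst w \<in> H1" "snd w \<in> L2"
    and "AE \<xi> in lborel. jfourier (fst w) \<xi> = of_real (cos (t * japanese \<xi>)) * jfourier f \<xi> - of_real (sin (t * japanese \<xi>)) * fourier g \<xi>"
    and "AE \<xi> in lborel. fourier (snd w) \<xi> = of_real (sin (t * japanese \<xi>)) * jfourier f \<xi> + of_real (cos (t * japanese \<xi>)) * fourier g \<xi>"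
proof -
  note fL = H1_D(1)[OF f] and Jf = H1_D(2)[OF f] and Fg = fourier_L2[OF g]
  let ?c = "\<lambda>\<xi>::'a. cos (- t * japanese \<xi>)" and ?s = "\<lambda>\<xi>::'a. sin (- t * japanese \<xi>) / japanese \<xi>"
    and ?r = "\<lambda>\<xi>::'a. - (sin (- t * japanese \<xi>) * japanese \<xi>)"
  have bs: "\<bar>?s \<xi>\<bar> \<le> 1" for \<xi> :: 'a
    using abs_sin_le_one[of "- t * japanese \<xi>"] japanese_ge_1[of \<xi>] unfolding abs_divide
    by (simp add: divide_le_eq_1 del: abs_sin_le_one)
  have 1: "(\<lambda>\<xi>. of_real (?c \<xi>) * fourier f \<xi>) \<in> L2" by (rule bounded_multiplier_fourier_L2[OF fL _ abs_cos_le_one]) measurable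
  have 2: "(\<lambda>\<xi>. of_real (?s \<xi>) * fourier g \<xi>) \<in> L2" by (rule bounded_multiplier_fourier_L2[OF g _ bs]) measurable
  have 4: "(\<lambda>\<xi>. of_real (?c \<xi>) * fourier g \<xi>) \<in> L2" by (rule bounded_multiplier_fourier_L2[OF g _ abs_cos_le_one]) measurable
  have trig: "(\<lambda>\<xi>. of_real (sin (t * japanese \<xi>)) * h \<xi>) \<in> L2" "(\<lambda>\<xi>. of_real (cos (t * japanese \<xi>)) * h \<xi>) \<in> L2"
    if "h \<in> L2" for h :: "'a \<Rightarrow> complex"
    by (auto intro!: L2_mult_bounded[OF that, where C=1])
  have 3: "(\<lambda>\<xi>. of_real (?r \<xi>) * fourier f \<xi>) \<in> L2" using trig(1)[OF Jf] by (simp add: mult.assoc)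
  have w: "fst w = (\<lambda>x. multiplier ?c f x + multiplier ?s g x)" "snd w = (\<lambda>x. multiplier ?r f x + multiplier ?c g x)"
    by (simp_all add: w_def free_evol_def)
  have w1: "fst w \<in> L2" unfolding w by (rule L2_add[OF multiplier_L2[OF 1] multiplier_L2[OF 2]])
  show "snd w \<in> L2" unfolding w by (rule L2_add[OF multiplier_L2[OF 3] multiplier_L2[OF 4]])
  show AE: "AE \<xi> in lborel. jfourier (fst w) \<xi> = of_real (cos (t * japanese \<xi>)) * jfourier f \<xi> - of_real (sin (t * japanese \<xi>)) * fourier g \<xi>"
    using fourier_add[OF multiplier_L2[OF 1] multiplier_L2[OF 2]] fourier_multiplier[OF 1] fourier_multiplier[OF 2]
    unfolding w(1)[symmetric]
    by eventually_elim (simp only:, simp add: field_simps)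
  show "AE \<xi> in lborel. fourier (snd w) \<xi> = of_real (sin (t * japanese \<xi>)) * jfourier f \<xi> + of_real (cos (t * japanese \<xi>)) * fourier g \<xi>"
    using fourier_add[OF multiplier_L2[OF 3] multiplier_L2[OF 4]] fourier_multiplier[OF 3] fourier_multiplier[OF 4]
    unfolding w(2)[symmetric]
    by eventually_elim (simp add: algebra_simps)
  note [measurable] = L2_measurable[OF fourier_L2[OF w1]]
  have "jfourier (fst w) \<in> L2"
    by (rule L2_cong_AE[OF L2_diff[OF trig(2)[OF Jf] trig(1)[OF Fg]]]) (measurable, use AE in auto)
  with w1 show "fst w \<in> H1" by (simp add: H1_def)
qed

text \<open>Besides existence, this records that the limit is built from the weak limits of the two
  profiles. The profiles do not involve (\<alpha>, \<beta>), so limits for different parameters can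
  be compared through them.\<close>

lemma Omega_star_representation:
  fixes u v :: "real \<Rightarrow> 'a::euclidean_space \<Rightarrow> complex"
  assumes cut: "smooth_cutoff Fc" "smooth_cutoff F1"
    and KG: "KG_global_solution N data u v"
    and M: "\<And>t. t \<ge> 0 \<Longrightarrow> energy_norm (u t, v t) \<le> M"
    and \<sigma>: "\<sigma> > 1" and I: "(\<alpha>, \<beta>) \<in> I_loc \<sigma>"
    and g: "\<And>t. t \<ge> 0 \<Longrightarrow> (\<lambda>x. complex_of_real (japanese x powr \<sigma>) * (N (u t) x t * u t x)) \<in> L2"
      "\<And>t. t \<ge> 0 \<Longrightarrow> L2_norm (\<lambda>x. complex_of_real (japanese x powr \<sigma>) * (N (u t) x t * u t x)) \<le> Eu"
  defines "P \<equiv> wave_orbit.profile (\<lambda>t. jfourier (u t)) (\<lambda>t. fourier (v t))"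
  shows "\<exists>c\<in>L2. \<exists>d\<in>L2.
    (\<forall>\<phi>\<in>L2. ((\<lambda>t. L2_inner (P 1 t) \<phi>) \<longlongrightarrow> L2_inner c \<phi>) at_top) \<and>
    (\<forall>\<phi>\<in>L2. ((\<lambda>t. L2_inner (P (- 1) t) \<phi>) \<longlongrightarrow> L2_inner d \<phi>) at_top) \<and>
    is_Omega_star Fc F1 \<alpha> \<beta> u v (multiplier (\<lambda>\<xi>. 1 / japanese \<xi>) (inv_fourier (\<lambda>\<xi>. 1 / 2 * c \<xi> + 1 / 2 * d \<xi>)),
      inv_fourier (\<lambda>\<xi>. - \<i> / 2 * c \<xi> + \<i> / 2 * d \<xi>))"
proof -
  have ab: "0 < \<alpha>" "0 < \<beta>" using I by (auto simp: I_loc_def)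
  have uv: "u t \<in> H1" "v t \<in> L2" if "t \<ge> 0" for t
    using KG that by (auto simp: KG_global_solution_def energy_space_def)
  have gL: "(\<lambda>x. N (u t) x t * u t x) \<in> L2" if "t \<ge> 0" for t
    using KG that by (auto simp: KG_global_solution_def)
  have gn: "L2_norm (\<lambda>x. N (u t) x t * u t x) \<le> Eu" if t: "t \<ge> 0" for t
  proof -
    have one: "1 \<le> japanese x powr \<sigma>" for x :: 'a using japanese_ge_1[of x] \<sigma> by (intro ge_one_powr_ge_zero) auto
    have "cmod (N (u t) x t * u t x) \<le> 1 * cmod (complex_of_real (japanese x powr \<sigma>) * (N (u t) x t * u t x))" for x
      using mult_right_mono[OF one[of x] norm_ge_zero[of "N (u t) x t * u t x"]] by (simp only: norm_mult norm_of_real mult_1_left) simp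
    from L2_norm_mono[OF g(1)[OF t] L2_measurable[OF gL[OF t]] this] g(2)[OF t] show ?thesis by simp
  qed
  interpret wave_orbit "\<lambda>t. jfourier (u t)" "\<lambda>t. fourier (v t)" "\<lambda>t. fourier (\<lambda>x. N (u t) x t * u t x)" Eu
    by (rule KG_wave_orbit[OF KG gn])
  have Pn: "L2_norm (profile \<omega> t) \<le> 2 * M" if t: "t \<ge> 0" and \<omega>: "\<omega> = 1 \<or> \<omega> = - 1" for \<omega> t
  proof -
    have em: "(\<lambda>\<xi>::'a. exp (\<i> * of_real (\<omega> * t * japanese \<xi>))) \<in> borel_measurable borel"
      using exp_japanese_measurable[of "- (\<omega> * t)"] by simp
    have c: "cmod (\<i> * of_real \<omega>) = 1" using \<omega> by (auto simp: norm_mult)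
    note iV = L2_scale[OF V_L2[OF t], of "\<i> * of_real \<omega>"]
    have "L2_norm (profile \<omega> t) \<le> 1 * L2_norm (\<lambda>\<xi>. jfourier (u t) \<xi> + \<i> * of_real \<omega> * fourier (v t) \<xi>)"
      unfolding profile_def[abs_def]
      by (rule L2_norm_mult_bounded[OF L2_add[OF U_L2[OF t] iV] em]) simp
    also have "\<dots> \<le> L2_norm (jfourier (u t)) + L2_norm (fourier (v t))"
      using L2_norm_triangle[OF U_L2[OF t] iV] unfolding L2_norm_scale c by simp
    also have "\<dots> \<le> M + M"
      using energy_norm_ge[of "(u t, v t)"] uv[OF t] M[OF t] fourier_norm[OF uv(2)[OF t]] by fastforce
    finally show ?thesis by simp
  qed
  have lim: "\<exists>c\<in>L2. (\<forall>\<phi>\<in>L2. ((\<lambda>t. L2_inner (profile \<omega> t) \<phi>) \<longlongrightarrow> L2_inner c \<phi>) at_top) \<and>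
    (\<forall>\<eta>>0. \<exists>T\<ge>1. \<forall>t\<ge>T. \<forall>h\<in>L2. cmod (L2_inner (\<lambda>\<xi>. c \<xi> - profile \<omega> t \<xi>) (loc_adjoint Fc F1 \<alpha> \<beta> t h)) \<le> \<eta> * L2_norm h)"
    if \<omega>: "\<omega> = 1 \<or> \<omega> = - 1" for \<omega>
  proof (rule localized_weak_limit)
    show "profile \<omega> t \<in> L2" if "t \<ge> 0" for t by (rule profile_L2[OF that])
    show "L2_norm (profile \<omega> t) \<le> 2 * M" if "t \<ge> 0" for t by (rule Pn[OF that \<omega>])
    show "loc_adjoint Fc F1 \<alpha> \<beta> t h \<in> L2" if "h \<in> L2" for t and h :: "'a \<Rightarrow> complex"
      by (rule loc_adjoint_tendsto(1)[OF cut ab that])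
    show "((\<lambda>t. L2_norm (\<lambda>\<xi>. loc_adjoint Fc F1 \<alpha> \<beta> t h \<xi> - fourier h \<xi>)) \<longlongrightarrow> 0) at_top" if "h \<in> L2" for h :: "'a \<Rightarrow> complex"
      by (rule loc_adjoint_tendsto(2)[OF cut ab that])
    show "\<exists>T\<ge>1. \<forall>t\<ge>T. \<forall>t'\<ge>t. \<forall>h\<in>L2. cmod (L2_inner (\<lambda>\<xi>. profile \<omega> t' \<xi> - profile \<omega> t \<xi>) (loc_adjoint Fc F1 \<alpha> \<beta> t h)) \<le> \<eta> * L2_norm h"
      if "\<eta> > 0" for \<eta>
      by (rule localized_increment_small[OF cut \<sigma> I L2_measurable[OF gL] g refl Pn[OF _ \<omega>] \<omega> that])
  qed
  obtain c where c: "c \<in> L2" "\<And>\<phi>. \<phi> \<in> L2 \<Longrightarrow> ((\<lambda>t. L2_inner (profile 1 t) \<phi>) \<longlongrightarrow> L2_inner c \<phi>) at_top"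
    and cs: "\<And>\<eta>. \<eta> > 0 \<Longrightarrow> \<exists>T\<ge>1. \<forall>t\<ge>T. \<forall>h\<in>L2. cmod (L2_inner (\<lambda>\<xi>. c \<xi> - profile 1 t \<xi>) (loc_adjoint Fc F1 \<alpha> \<beta> t h)) \<le> \<eta> * L2_norm h"
    using lim[of 1] by blast
  obtain d where d: "d \<in> L2" "\<And>\<phi>. \<phi> \<in> L2 \<Longrightarrow> ((\<lambda>t. L2_inner (profile (- 1) t) \<phi>) \<longlongrightarrow> L2_inner d \<phi>) at_top"
    and ds: "\<And>\<eta>. \<eta> > 0 \<Longrightarrow> \<exists>T\<ge>1. \<forall>t\<ge>T. \<forall>h\<in>L2. cmod (L2_inner (\<lambda>\<xi>. d \<xi> - profile (- 1) t \<xi>) (loc_adjoint Fc F1 \<alpha> \<beta> t h)) \<le> \<eta> * L2_norm h"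
    using lim[of "- 1"] by blast
  \<comment> \<open>Both energy components are combinations of the two half waves with coefficients
    of modulus at most 1, so half of \<eta> for each half wave suffices.\<close>
  have comb: "L2_tendsto (\<lambda>t. F_loc Fc F1 \<alpha> \<beta> t (A t)) (inv_fourier (\<lambda>\<xi>. a * c \<xi> + b * d \<xi>)) at_top"
    if A: "\<And>t. t \<ge> 0 \<Longrightarrow> A t \<in> L2"
      and FA: "\<And>t. t \<ge> 0 \<Longrightarrow> AE \<xi> in lborel. fourier (A t) \<xi> = a * profile 1 t \<xi> + b * profile (- 1) t \<xi>"
      and ab1: "cmod a \<le> 1" "cmod b \<le> 1" for A a b
  proof (rule localized_strong_limit[OF cut ab L2_add[OF L2_scale[OF c(1)] L2_scale[OF d(1)]] A])
    fix \<eta> :: real assume \<eta>: "\<eta> > 0"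
    obtain T where T: "T \<ge> 1" "\<And>t h. t \<ge> T \<Longrightarrow> h \<in> L2 \<Longrightarrow>
        cmod (L2_inner (\<lambda>\<xi>. c \<xi> - profile 1 t \<xi>) (loc_adjoint Fc F1 \<alpha> \<beta> t h)) \<le> \<eta> / 2 * L2_norm h"
      using cs[of "\<eta> / 2"] \<eta> by auto
    obtain T' where T': "T' \<ge> 1" "\<And>t h. t \<ge> T' \<Longrightarrow> h \<in> L2 \<Longrightarrow>
        cmod (L2_inner (\<lambda>\<xi>. d \<xi> - profile (- 1) t \<xi>) (loc_adjoint Fc F1 \<alpha> \<beta> t h)) \<le> \<eta> / 2 * L2_norm h"
      using ds[of "\<eta> / 2"] \<eta> by auto
    have "cmod (L2_inner (\<lambda>\<xi>. (a * c \<xi> + b * d \<xi>) - fourier (A t) \<xi>) (loc_adjoint Fc F1 \<alpha> \<beta> t h)) \<le> \<eta> * L2_norm h"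
      if t: "t \<ge> max T T'" and h: "h \<in> L2" for t h
    proof -
      have t0: "t \<ge> 0" "t \<ge> T" "t \<ge> T'" using t T(1) by auto
      note \<tau> = loc_adjoint_tendsto(1)[OF cut ab h, of t]
      note D1 = L2_diff[OF c(1) profile_L2[OF t0(1), of 1]] and D2 = L2_diff[OF d(1) profile_L2[OF t0(1), of "- 1"]]
      have "L2_inner (\<lambda>\<xi>. (a * c \<xi> + b * d \<xi>) - fourier (A t) \<xi>) (loc_adjoint Fc F1 \<alpha> \<beta> t h) =
          L2_inner (\<lambda>\<xi>. a * (c \<xi> - profile 1 t \<xi>) + b * (d \<xi> - profile (- 1) t \<xi>)) (loc_adjoint Fc F1 \<alpha> \<beta> t h)"
      proof (rule L2_inner_cong_AE)
        show "AE \<xi> in lborel. (a * c \<xi> + b * d \<xi>) - fourier (A t) \<xi> = a * (c \<xi> - profile 1 t \<xi>) + b * (d \<xi> - profile (- 1) t \<xi>)"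
          using FA[OF t0(1)] by eventually_elim (simp add: algebra_simps)
      qed (rule L2_measurable[OF L2_diff[OF L2_add[OF L2_scale[OF c(1)] L2_scale[OF d(1)]] fourier_L2[OF A[OF t0(1)]]]]
        L2_measurable[OF L2_add[OF L2_scale[OF D1] L2_scale[OF D2]]] L2_measurable[OF \<tau>] AE_I2 refl)+
      also have "\<dots> = a * L2_inner (\<lambda>\<xi>. c \<xi> - profile 1 t \<xi>) (loc_adjoint Fc F1 \<alpha> \<beta> t h) +
          b * L2_inner (\<lambda>\<xi>. d \<xi> - profile (- 1) t \<xi>) (loc_adjoint Fc F1 \<alpha> \<beta> t h)"
        unfolding L2_inner_add_left[OF L2_scale[OF D1] L2_scale[OF D2] \<tau>] L2_inner_scale_left ..
      finally have eq: "cmod (L2_inner (\<lambda>\<xi>. (a * c \<xi> + b * d \<xi>) - fourier (A t) \<xi>) (loc_adjoint Fc F1 \<alpha> \<beta> t h)) =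
        cmod (a * L2_inner (\<lambda>\<xi>. c \<xi> - profile 1 t \<xi>) (loc_adjoint Fc F1 \<alpha> \<beta> t h) +
          b * L2_inner (\<lambda>\<xi>. d \<xi> - profile (- 1) t \<xi>) (loc_adjoint Fc F1 \<alpha> \<beta> t h))" by (rule arg_cong)
      have gen: "cmod (a * x + b * y) \<le> 2 * r" if "cmod x \<le> r" "cmod y \<le> r" for x y r
      proof -
        have "cmod (a * x) \<le> 1 * r" "cmod (b * y) \<le> 1 * r"
          unfolding norm_mult using ab1 that by (intro mult_mono; simp)+
        then show ?thesis using norm_triangle_ineq[of "a * x" "b * y"] by simp
      qed
      have "2 * (\<eta> / 2 * L2_norm h) = \<eta> * L2_norm h" by simp
      with gen[OF T(2)[OF t0(2) h] T'(2)[OF t0(3) h]] show ?thesis unfolding eq by simp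
    qed
    then show "\<exists>T\<ge>1. \<forall>t\<ge>T. \<forall>h\<in>L2. cmod (L2_inner (\<lambda>\<xi>. a * c \<xi> + b * d \<xi> - fourier (A t) \<xi>) (loc_adjoint Fc F1 \<alpha> \<beta> t h)) \<le> \<eta> * L2_norm h"
      using T(1) by (intro exI[of _ "max T T'"]) auto
  qed
  let ?w = "\<lambda>t. free_evol (- t) (u t, v t)"
  have pr: "profile 1 t \<xi> = (of_real (cos (t * japanese \<xi>)) + \<i> * of_real (sin (t * japanese \<xi>))) * (jfourier (u t) \<xi> + \<i> * fourier (v t) \<xi>)"
    "profile (- 1) t \<xi> = (of_real (cos (t * japanese \<xi>)) - \<i> * of_real (sin (t * japanese \<xi>))) * (jfourier (u t) \<xi> - \<i> * fourier (v t) \<xi>)" for t \<xi>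
  proof -
    have ex: "exp (\<i> * of_real r) = of_real (cos r) + \<i> * of_real (sin r)" for r :: real
      by (simp add: exp_Euler cos_of_real sin_of_real)
    have "1 * t * japanese \<xi> = t * japanese \<xi>" "- 1 * t * japanese \<xi> = - (t * japanese \<xi>)" by simp_all
    then show "profile 1 t \<xi> = (of_real (cos (t * japanese \<xi>)) + \<i> * of_real (sin (t * japanese \<xi>))) * (jfourier (u t) \<xi> + \<i> * fourier (v t) \<xi>)"
      "profile (- 1) t \<xi> = (of_real (cos (t * japanese \<xi>)) - \<i> * of_real (sin (t * japanese \<xi>))) * (jfourier (u t) \<xi> - \<i> * fourier (v t) \<xi>)"
      unfolding profile_def by (simp_all only: ex) simp_all
  qed
  \<comment> \<open>Expanding (C + iS)(x + iy) gives (C x - S y) + i (S x + C y). As x and y are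
    complex, the companion (C - iS)(x - iy) plays the part of the conjugate in recovering the two
    entries of the rotation.\<close>
  have alg: "C * x - S * y = 1 / 2 * ((C + \<i> * S) * (x + \<i> * y)) + 1 / 2 * ((C - \<i> * S) * (x - \<i> * y))"
    "S * x + C * y = - \<i> / 2 * ((C + \<i> * S) * (x + \<i> * y)) + \<i> / 2 * ((C - \<i> * S) * (x - \<i> * y))" for C S x y :: complex
    by (simp_all add: field_simps)
  have X: "L2_tendsto (\<lambda>t. F_loc Fc F1 \<alpha> \<beta> t (multiplier japanese (fst (?w t)))) (inv_fourier (\<lambda>\<xi>. 1 / 2 * c \<xi> + 1 / 2 * d \<xi>)) at_top"
  proof (rule comb)
    fix t :: real assume t: "t \<ge> 0"
    note J = H1_D(2)[OF free_evol_fourier(1)[OF uv[OF t], of t]]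
    show "multiplier japanese (fst (?w t)) \<in> L2" by (rule multiplier_L2[OF J])
    show "AE \<xi> in lborel. fourier (multiplier japanese (fst (?w t))) \<xi> = 1 / 2 * profile 1 t \<xi> + 1 / 2 * profile (- 1) t \<xi>"
      using fourier_multiplier[OF J] free_evol_fourier(3)[OF uv[OF t], of t] by eventually_elim (simp only: pr, rule alg(1))
  qed auto
  have Y: "L2_tendsto (\<lambda>t. F_loc Fc F1 \<alpha> \<beta> t (snd (?w t))) (inv_fourier (\<lambda>\<xi>. - \<i> / 2 * c \<xi> + \<i> / 2 * d \<xi>)) at_top"
  proof (rule comb)
    fix t :: real assume t: "t \<ge> 0"
    show "snd (?w t) \<in> L2" by (rule free_evol_fourier(2)[OF uv[OF t]])
    show "AE \<xi> in lborel. fourier (snd (?w t)) \<xi> = - \<i> / 2 * profile 1 t \<xi> + \<i> / 2 * profile (- 1) t \<xi>"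
      using free_evol_fourier(4)[OF uv[OF t], of t] by eventually_elim (simp only: pr, rule alg(2))
  qed auto
  have "is_Omega_star Fc F1 \<alpha> \<beta> u v (multiplier (\<lambda>\<xi>. 1 / japanese \<xi>) (inv_fourier (\<lambda>\<xi>. 1 / 2 * c \<xi> + 1 / 2 * d \<xi>)),
      inv_fourier (\<lambda>\<xi>. - \<i> / 2 * c \<xi> + \<i> / 2 * d \<xi>))"
    unfolding is_Omega_star_def F_loc_mat_def by (rule energy_tendsto_bessel[OF X Y])
  then show ?thesis unfolding P_def using c d by blast
qed

theorem theorem1p6:
  fixes N :: "(real ^ 'n \<Rightarrow> complex) \<Rightarrow> real ^ 'n \<Rightarrow> real \<Rightarrow> complex"
    and u v :: "real \<Rightarrow> real ^ 'n \<Rightarrow> complex"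
    and u0 v0 :: "real ^ 'n \<Rightarrow> complex"
    and Fc F1 :: "real \<Rightarrow> real"
    and \<sigma> :: real
  assumes "smooth_cutoff Fc" and "smooth_cutoff F1"
    and "(u0, v0) \<in> energy_space"
    and "KG_global_solution N (u0, v0) u v"
    and "bdd_above ((\<lambda>t. energy_norm (u t, v t)) ` {0..})"
    and "\<sigma> > 1"
    and "\<And>t. t \<ge> 0 \<Longrightarrow>
           (\<lambda>x. complex_of_real (japanese x powr \<sigma>) * (N (u t) x t * u t x)) \<in> L2"
    and "bdd_above ((\<lambda>t. L2_norm (\<lambda>x. complex_of_real (japanese x powr \<sigma>) *
           (N (u t) x t * u t x))) ` {0..})"
  shows "(\<forall>(\<alpha>, \<beta>) \<in> I_loc \<sigma>. \<exists>w. is_Omega_star Fc F1 \<alpha> \<beta> u v w) \<and>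
         (\<forall>(\<alpha>, \<beta>) \<in> I_loc \<sigma>. \<forall>(\<alpha>', \<beta>') \<in> I_loc \<sigma>. \<forall>w w'.
            is_Omega_star Fc F1 \<alpha> \<beta> u v w \<longrightarrow> is_Omega_star Fc F1 \<alpha>' \<beta>' u v w' \<longrightarrow>
            energy_eq w w')"
proof -
  let ?P = "wave_orbit.profile (\<lambda>t. jfourier (u t)) (\<lambda>t. fourier (v t))"
  obtain M where M: "\<And>t. t \<ge> 0 \<Longrightarrow> energy_norm (u t, v t) \<le> M"
    using assms(5) by (auto simp: bdd_above_def)
  obtain Eu where Eu: "\<And>t. t \<ge> 0 \<Longrightarrow> L2_norm (\<lambda>x. complex_of_real (japanese x powr \<sigma>) * (N (u t) x t * u t x)) \<le> Eu"
    using assms(8) by (auto simp: bdd_above_def)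
  have rep: "\<exists>c\<in>L2. \<exists>d\<in>L2.
      (\<forall>\<phi>\<in>L2. ((\<lambda>t. L2_inner (?P 1 t) \<phi>) \<longlongrightarrow> L2_inner c \<phi>) at_top) \<and>
      (\<forall>\<phi>\<in>L2. ((\<lambda>t. L2_inner (?P (- 1) t) \<phi>) \<longlongrightarrow> L2_inner d \<phi>) at_top) \<and>
      is_Omega_star Fc F1 \<alpha> \<beta> u v (multiplier (\<lambda>\<xi>. 1 / japanese \<xi>) (inv_fourier (\<lambda>\<xi>. 1 / 2 * c \<xi> + 1 / 2 * d \<xi>)),
        inv_fourier (\<lambda>\<xi>. - \<i> / 2 * c \<xi> + \<i> / 2 * d \<xi>))"
    if I: "(\<alpha>, \<beta>) \<in> I_loc \<sigma>" for \<alpha> \<beta>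
    by (rule Omega_star_representation[OF assms(1,2,4) M assms(6) I assms(7) Eu])
  have "energy_eq w w'"
    if I: "(\<alpha>, \<beta>) \<in> I_loc \<sigma>" and I': "(\<alpha>', \<beta>') \<in> I_loc \<sigma>"
      and w: "is_Omega_star Fc F1 \<alpha> \<beta> u v w" and w': "is_Omega_star Fc F1 \<alpha>' \<beta>' u v w'" for \<alpha> \<beta> \<alpha>' \<beta>' w w'
  proof -
    obtain c d where L: "c \<in> L2" "d \<in> L2"
      and P: "\<forall>\<phi>\<in>L2. ((\<lambda>t. L2_inner (?P 1 t) \<phi>) \<longlongrightarrow> L2_inner c \<phi>) at_top"
        "\<forall>\<phi>\<in>L2. ((\<lambda>t. L2_inner (?P (- 1) t) \<phi>) \<longlongrightarrow> L2_inner d \<phi>) at_top"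
      and \<Omega>: "is_Omega_star Fc F1 \<alpha> \<beta> u v (multiplier (\<lambda>\<xi>. 1 / japanese \<xi>) (inv_fourier (\<lambda>\<xi>. 1 / 2 * c \<xi> + 1 / 2 * d \<xi>)),
        inv_fourier (\<lambda>\<xi>. - \<i> / 2 * c \<xi> + \<i> / 2 * d \<xi>))"
      using rep[OF I] by blast
    obtain c' d' where L': "c' \<in> L2" "d' \<in> L2"
      and P': "\<forall>\<phi>\<in>L2. ((\<lambda>t. L2_inner (?P 1 t) \<phi>) \<longlongrightarrow> L2_inner c' \<phi>) at_top"
        "\<forall>\<phi>\<in>L2. ((\<lambda>t. L2_inner (?P (- 1) t) \<phi>) \<longlongrightarrow> L2_inner d' \<phi>) at_top"
      and \<Omega>': "is_Omega_star Fc F1 \<alpha>' \<beta>' u v (multiplier (\<lambda>\<xi>. 1 / japanese \<xi>) (inv_fourier (\<lambda>\<xi>. 1 / 2 * c' \<xi> + 1 / 2 * d' \<xi>)),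
        inv_fourier (\<lambda>\<xi>. - \<i> / 2 * c' \<xi> + \<i> / 2 * d' \<xi>))"
      using rep[OF I'] by blast
    \<comment> \<open>Weak limits are unique, and both parameter pairs see the same
      profiles.\<close>
    have AE: "AE \<xi> in lborel. c \<xi> = c' \<xi>" "AE \<xi> in lborel. d \<xi> = d' \<xi>"
      using L2_weak_limit_unique[OF L(1) L'(1)] L2_weak_limit_unique[OF L(2) L'(2)] P P' by blast+
    \<comment> \<open>Equality of functions and not just almost everywhere, because the transform
      ignores null sets; this permits rewriting inside the second limit statement.\<close>
    have eq: "inv_fourier (\<lambda>\<xi>. a * c \<xi> + b * d \<xi>) = inv_fourier (\<lambda>\<xi>. a * c' \<xi> + b * d' \<xi>)" for a b
    proof (rule inv_fourier_cong_AE)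
      show "AE \<xi> in lborel. a * c \<xi> + b * d \<xi> = a * c' \<xi> + b * d' \<xi>" using AE by eventually_elim simp
    qed (intro L2_measurable L2_add L2_scale L L')+
    note \<Omega>' = \<Omega>'[folded eq]
    have "energy_eq w (multiplier (\<lambda>\<xi>. 1 / japanese \<xi>) (inv_fourier (\<lambda>\<xi>. 1 / 2 * c \<xi> + 1 / 2 * d \<xi>)),
        inv_fourier (\<lambda>\<xi>. - \<i> / 2 * c \<xi> + \<i> / 2 * d \<xi>))"
      by (rule energy_tendsto_unique[OF w[unfolded is_Omega_star_def] \<Omega>[unfolded is_Omega_star_def]]) simp
    moreover have "energy_eq w' (multiplier (\<lambda>\<xi>. 1 / japanese \<xi>) (inv_fourier (\<lambda>\<xi>. 1 / 2 * c \<xi> + 1 / 2 * d \<xi>)),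
        inv_fourier (\<lambda>\<xi>. - \<i> / 2 * c \<xi> + \<i> / 2 * d \<xi>))"
      by (rule energy_tendsto_unique[OF w'[unfolded is_Omega_star_def] \<Omega>'[unfolded is_Omega_star_def]]) simp
    ultimately show ?thesis unfolding energy_eq_def by auto
  qed
  moreover have "\<exists>w. is_Omega_star Fc F1 \<alpha> \<beta> u v w" if "(\<alpha>, \<beta>) \<in> I_loc \<sigma>" for \<alpha> \<beta>
    using rep[OF that] by blast
  ultimately show ?thesis by blast
qed

end
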